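(* Let $G=(V,E)$ be a finite connected graph with minimal degree $\ge2$ which is not a cycle, let $d$ be its maximal degree, let $\widetilde{G}$ be its universal cover, and let $\mathrm{sp}(A(\widetilde{G}))$ be the spectrum of the adjacency operator of $\widetilde{G}$. Put $c=\frac{1}{8\log(d-1)}$. There exists a family of sets $(I_{c_1,c_2})_{0<c_1\le c_2<+\infty}$ having the following properties: (1) For any $0<c_1<c_2<+\infty$ there exist $C,C'>0$ such that for any integer $n\ge3$, any $\Lambda>0$, any interval $I\subset\mathrm{sp}(A(\widetilde{G}))\setminus I_{c_1,c_2}$ of length at least $C\frac{\log\log n}{\log n}$, and any $n$-lift $G_n$ of $G$ satisfying $$d_{\mathrm{TV}}\bigl(\overline{\mathbb{P}}^{(h)}_{G_n},\overline{\mathbb{P}}^{(h)}\bigr)\le\frac{2}{\sqrt n}\qquad\text{with }h=\lfloor c\log n\rfloor,$$ there holds $$\mathbb{P}_I\left(\|u\|_{L^\infty}\ge\Lambda C'(\log n)^2n^{-\frac12}\right)\le\Lambda^{-\frac{\log n}{2\log\log n}},$$ where $u\sim\mathbb{P}_I$ is a random approximate eigenvector of the adjacency matrix of $G_n$. (2) For any $0<c_1\le c_2<+\infty$, $I_{c_1,c_2}$ is a finite union of open intervals, and $I_{c_1,c_2}$ shrinks to a finite set when $c_1\to0$ and $c_2\to+\infty$. In particular, $\mathrm{sp}(A(\widetilde{G}))\setminus I_{c_1,c_2}$ is non-empty when $c_1$ is sufficiently close to $0$ and $c_2$ is sufficiently large.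
   Context: An $n$-lift of $G=(V,E)$: orient the edges of $G$ arbitrarily, choose a permutation $\sigma_e\in\mathfrak{S}_n$ for each edge $e$; the lift $G_n$ has vertex set $V_n=V\times[n]$ and edges $((u,i),(v,\sigma_e(i)))$ for each oriented edge $e=(u,v)$ and $i\in[n]$. "Shrinks to a finite set when $c_1\to0$, $c_2\to+\infty$" means: there is a finite set $F\subset\mathbb{R}$ such that for every $\varepsilon>0$, $I_{c_1,c_2}$ is contained in the $\varepsilon$-neighbourhood of $F$ for $c_1$ small enough and $c_2$ large enough. For a rooted graph $(\Gamma;x)$ and $h\in\mathbb{N}$, $(\Gamma;x)_h$ is the rooted graph obtained by cutting $\Gamma$ at distance $h$ from $x$. $\overline{\mathbb{P}}^{(h)}_{G_n}=\frac1{|V_n|}\sum_{x\in V_n}\delta_{(G_n;x)_h}$, a probability measure on isomorphism classes of rooted graphs of depth $\le h$. $\overline{\mathbb{P}}=\frac1{|V|}\sum_{x\in V}\delta_{[\widetilde{G},x]}$, where $[\widetilde{G},x]$ is the isomorphism class of $\widetilde{G}$ rooted at any vertex above $x$, and $\overline{\mathbb{P}}^{(h)}(H;o)=\overline{\mathbb{P}}(\{(T;x):(T;x)_h\simeq(H;o)\})$. $d_{\mathrm{TV}}$ is the total variation distance. For $I\subset\mathbb{R}$, $E_I\subset\mathbb{R}^{V_n}$ is the real span of the eigenvectors of the adjacency matrix of $G_n$ with eigenvalue in $I$, and $\mathbb{P}_I$ is the uniform probability measure on its Euclidean unit sphere. $\|u\|_{L^\infty}=\max_x|u(x)|$. *)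

theory Defs
  imports
    "HOL-Probability.Probability"
    "Graph_Theory.Digraph_Component"
    "Graph_Theory.Vertex_Walk"
begin

text \<open>
  Undirected simple graphs are symmetric loop-free digraphs without parallel arcs
  (locale \<^locale>\<open>pair_graph\<close> in the finite case), so the degree of a vertex is its out-degree.
\<close>

definition max_degree :: "'v pair_pre_digraph \<Rightarrow> nat" where
  "max_degree G = Max (out_degree (with_proj G) ` pverts G)"

definition is_cycle_graph :: "'v pair_pre_digraph \<Rightarrow> bool" where
  "is_cycle_graph G \<longleftrightarrow>
     (\<exists>vs. distinct vs \<and> 3 \<le> length vs \<and> pverts G = set vs \<and>
        (let A = {(vs ! i, vs ! (Suc i mod length vs)) | i. i < length vs}
         in parcs G = A \<union> A\<inverse>))"


subsection \<open>Universal cover\<close>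

text \<open>
  The universal cover, realised as the tree of non-backtracking walks of \<open>G\<close> issued from \<open>r\<close>;
  two walks are adjacent if one extends the other by one step. The covering map is \<^const>\<open>last\<close>.
  For connected \<open>G\<close>, different base points \<open>r\<close> give isomorphic trees.
\<close>

definition nonbacktracking :: "'v list \<Rightarrow> bool" where
  "nonbacktracking p \<longleftrightarrow> (\<forall>i. i + 2 < length p \<longrightarrow> p ! (i + 2) \<noteq> p ! i)"

definition universal_cover :: "'v pair_pre_digraph \<Rightarrow> 'v \<Rightarrow> 'v list pair_pre_digraph" where
  "universal_cover G r =
     (let X = {p. vwalk p (with_proj G) \<and> hd p = r \<and> nonbacktracking p}
      in \<lparr> pverts = X,
           parcs = {(p, q) \<in> X \<times> X. (\<exists>v. q = p @ [v]) \<or> (\<exists>v. p = q @ [v])} \<rparr>)"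


subsection \<open>Adjacency operator and its spectrum\<close>

text \<open>
  Functions on the vertex set \<open>X\<close> are represented by functions that are \<^const>\<open>undefined\<close>
  outside \<open>X\<close>, as in the product measure spaces \<^const>\<open>PiM\<close>.
\<close>

definition adjacency :: "'v pair_pre_digraph \<Rightarrow> ('v \<Rightarrow> 'k::comm_monoid_add) \<Rightarrow> 'v \<Rightarrow> 'k" where
  "adjacency G f = (\<lambda>x\<in>pverts G. \<Sum>y | (x, y) \<in> parcs G. f y)"

definition ell2 :: "'v set \<Rightarrow> ('v \<Rightarrow> complex) set" where
  "ell2 X = {f \<in> extensional X. (\<lambda>x. (cmod (f x))\<^sup>2) summable_on X}"

definition ell2_norm :: "'v set \<Rightarrow> ('v \<Rightarrow> complex) \<Rightarrow> real" where
  "ell2_norm X f = sqrt (\<Sum>\<^sub>\<infinity>x\<in>X. (cmod (f x))\<^sup>2)"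

text \<open>
  \<open>z\<close> is in the resolvent set if \<open>A - z\<close> is a bijection of \<open>\<ell>\<^sup>2\<close> with bounded inverse.
\<close>

definition resolvent_set :: "'v pair_pre_digraph \<Rightarrow> complex set" where
  "resolvent_set G = {z.
     let X = pverts G; S = (\<lambda>f. \<lambda>x\<in>X. adjacency G f x - z * f x)
     in bij_betw S (ell2 X) (ell2 X) \<and>
        (\<exists>B. \<forall>f\<in>ell2 X. ell2_norm X f \<le> B * ell2_norm X (S f))}"

text \<open>
  For graphs of bounded degree the adjacency operator is self-adjoint, so the whole spectrum is real.
\<close>

definition adj_spectrum :: "'v pair_pre_digraph \<Rightarrow> real set" where
  "adj_spectrum G = {t. complex_of_real t \<notin> resolvent_set G}"


subsection \<open>Lifts\<close>

definition is_orientation :: "'v pair_pre_digraph \<Rightarrow> ('v \<times> 'v) set \<Rightarrow> bool" where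
  "is_orientation G R \<longleftrightarrow> R \<subseteq> parcs G \<and>
     (\<forall>(u, v) \<in> parcs G. (u, v) \<in> R \<longleftrightarrow> (v, u) \<notin> R)"

definition is_lift :: "nat \<Rightarrow> 'v pair_pre_digraph \<Rightarrow> ('v \<times> nat) pair_pre_digraph \<Rightarrow> bool" where
  "is_lift n G H \<longleftrightarrow>
     (\<exists>R \<sigma>. is_orientation G R \<and> (\<forall>e\<in>R. \<sigma> e permutes {1..n}) \<and>
        pverts H = pverts G \<times> {1..n} \<and>
        (let A = {((u, i), (v, \<sigma> (u, v) i)) | u v i. (u, v) \<in> R \<and> i \<in> {1..n}}
         in parcs H = A \<union> A\<inverse>))"


subsection \<open>Local statistics\<close>

definition ball_at :: "'v pair_pre_digraph \<Rightarrow> 'v \<Rightarrow> nat \<Rightarrow> 'v pair_pre_digraph" where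
  "ball_at G x h =
     (let B = {y. \<exists>k\<le>h. (x, y) \<in> parcs G ^^ k}
      in \<lparr> pverts = B, parcs = parcs G \<inter> B \<times> B \<rparr>)"

definition rooted_iso :: "'v pair_pre_digraph \<Rightarrow> 'v \<Rightarrow> 'w pair_pre_digraph \<Rightarrow> 'w \<Rightarrow> bool" where
  "rooted_iso G x H y \<longleftrightarrow>
     (\<exists>f. bij_betw f (pverts G) (pverts H) \<and> f x = y \<and>
        (\<forall>u\<in>pverts G. \<forall>v\<in>pverts G. (u, v) \<in> parcs G \<longleftrightarrow> (f u, f v) \<in> parcs H))"

text \<open>
  The isomorphism class of a countable rooted graph, as the set of its copies with vertices in
  \<^typ>\<open>nat\<close>; this makes classes of graphs over different vertex types comparable.
\<close>

definition iso_class :: "'v pair_pre_digraph \<Rightarrow> 'v \<Rightarrow> (nat pair_pre_digraph \<times> nat) set" where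
  "iso_class G x = {(H, y). pair_wf_digraph H \<and> y \<in> pverts H \<and> rooted_iso G x H y}"

definition empirical_law ::
    "'v pair_pre_digraph \<Rightarrow> nat \<Rightarrow> (nat pair_pre_digraph \<times> nat) set pmf" where
  "empirical_law G h = map_pmf (\<lambda>x. iso_class (ball_at G x h) x) (pmf_of_set (pverts G))"

text \<open>
  Any two vertices of the universal cover above \<open>x\<close> give isomorphic rooted trees, so the choice of
  \<open>p\<close> is irrelevant.
\<close>

definition cover_law ::
    "'v pair_pre_digraph \<Rightarrow> 'v \<Rightarrow> nat \<Rightarrow> (nat pair_pre_digraph \<times> nat) set pmf" where
  "cover_law G r h =
     (let T = universal_cover G r
      in map_pmf (\<lambda>x. let p = (SOME p. p \<in> pverts T \<and> last p = x) in iso_class (ball_at T p h) p)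
           (pmf_of_set (pverts G)))"

definition tv_dist :: "'b pmf \<Rightarrow> 'b pmf \<Rightarrow> real" where
  "tv_dist p q = (SUP A. \<bar>measure_pmf.prob p A - measure_pmf.prob q A\<bar>)"


subsection \<open>Random approximate eigenvectors\<close>

definition is_eigenvector :: "'v pair_pre_digraph \<Rightarrow> real \<Rightarrow> ('v \<Rightarrow> real) \<Rightarrow> bool" where
  "is_eigenvector G l f \<longleftrightarrow> f \<in> extensional (pverts G) \<and> (\<exists>x\<in>pverts G. f x \<noteq> 0) \<and>
     (\<forall>x\<in>pverts G. adjacency G f x = l * f x)"

text \<open>The real span of the eigenvectors with eigenvalue in \<open>J\<close>.\<close>

definition eigen_span :: "'v pair_pre_digraph \<Rightarrow> real set \<Rightarrow> ('v \<Rightarrow> real) set" where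
  "eigen_span G J = {(\<lambda>x\<in>pverts G. \<Sum>f\<in>S. a f * f x) | S a.
     finite S \<and> S \<subseteq> {f. \<exists>l\<in>J. is_eigenvector G l f}}"

definition is_orthonormal_basis ::
    "'v set \<Rightarrow> ('v \<Rightarrow> real) set \<Rightarrow> nat \<Rightarrow> (nat \<Rightarrow> 'v \<Rightarrow> real) \<Rightarrow> bool" where
  "is_orthonormal_basis X E N b \<longleftrightarrow>
     (\<forall>i<N. b i \<in> E) \<and>
     (\<forall>i<N. \<forall>j<N. (\<Sum>x\<in>X. b i x * b j x) = of_bool (i = j)) \<and>
     (\<forall>f\<in>E. \<exists>a. f = (\<lambda>x\<in>X. \<Sum>i<N. a i * b i x))"

text \<open>
  The uniform probability measure on the unit sphere of the subspace \<open>E\<close> of \<open>\<real>\<^sup>X\<close>, \<open>X\<close> finite: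
  in coordinates \<open>z\<close> with respect to an orthonormal basis of \<open>E\<close>, the normalised surface measure
  is the image of the normalised Lebesgue measure on the unit ball under \<open>z \<mapsto> z / \<parallel>z\<parallel>\<close>.
  By rotation invariance it does not depend on the basis. Meaningful only for nonzero \<open>E\<close>.
\<close>

definition uniform_sphere :: "'v set \<Rightarrow> ('v \<Rightarrow> real) set \<Rightarrow> ('v \<Rightarrow> real) measure" where
  "uniform_sphere X E =
     (let (N, b) = (SOME (N, b). is_orthonormal_basis X E N b);
          D = {z \<in> {..<N} \<rightarrow>\<^sub>E UNIV. L2_set z {..<N} \<le> 1}
      in distr (uniform_measure (PiM {..<N} (\<lambda>_. lborel)) D) (PiM X (\<lambda>_. borel))
           (\<lambda>z. \<lambda>x\<in>X. (\<Sum>i<N. z i * b i x) / L2_set z {..<N}))"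

definition random_eigenvector :: "'v pair_pre_digraph \<Rightarrow> real set \<Rightarrow> ('v \<Rightarrow> real) measure" where
  "random_eigenvector G J = uniform_sphere (pverts G) (eigen_span G J)"

definition sup_norm :: "'v set \<Rightarrow> ('v \<Rightarrow> real) \<Rightarrow> real" where
  "sup_norm X u = (MAX x\<in>X. \<bar>u x\<bar>)"

end

theory Submission
  imports Defs
    "HOL-Complex_Analysis.Complex_Analysis"
    "Jordan_Normal_Form.Char_Poly"
    "HOL-Computational_Algebra.Fundamental_Theorem_Algebra"
    "HOL-Real_Asymp.Real_Asymp"
begin

text \<open>A uniform unit vector of an N-dimensional space of functions has sup norm at least s
  with probability at most 2 |X| exp (-s^2 N / 4), because a spherical cap is contained in a cone
  over a smaller ball (\<open>cap_measure\<close>, \<open>sphere_tail\<close>). So it is enough that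
  an interval of length C log log n / log n in the good part of the spectrum contains at least
  \<kappa> n / log n eigenvalues of the lift (\<open>eigenvalue_count\<close>): for s of order
  \<Lambda> (log n)^2 / sqrt n, the union bound over the vertices then leaves room for the claimed
  decay (\<open>tail_estimate\<close>).

  To count eigenvalues, the normalised trace of the resolvent of the lift is compared with its
  analogue \<open>trace\<close> on the universal cover, at height y = Im z. With z = D0 (w + 1/w) /
  2 the resolvent is a series of Chebyshev polynomials of A / D0 in powers of 1/w. Cutting it after
  m terms costs a factor (1 + y / D0)^(-m), and the diagonal entries of the truncation depend only
  on balls of radius m, so the total variation bound controls the difference of their averages
  (\<open>resolvent_cheb\<close>, \<open>class_res_ball\<close>, \<open>trace_compare\<close>). With
  m of order log n, the height may go down to a multiple of log log n / log n. If near t the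
  quantity -Im \<open>trace\<close> is bounded below and |\<open>trace\<close>| above, comparing
  Poisson kernels at two heights produces the eigenvalues close to t (\<open>count_near\<close>).

  It remains to find where these bounds hold. The Green function of the tree is built from finitely
  many functions g_i, one for each vertex and each directed edge of G, with g_i (z - sum of g_j) =
  1. For Im z > 0 they are obtained by an iteration that contracts a hyperbolic distance
  (\<open>hyperbolic_contraction\<close>). They are algebraic in z: a small cubic term makes the
  ring of unknowns a finite module, a characteristic polynomial then eliminates all unknowns but
  one, and the cubic term is sent to 0 (\<open>eliminant\<close>, \<open>leading_part\<close>,
  \<open>green_algebraic\<close>). Hence outside a finite set F of reals every g_i continues
  holomorphically across the real axis, and its continuation is either real on the axis or has
  imaginary part bounded away from 0 (\<open>local_branch\<close>). If all are real near t, the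
  kernel of the tree continues to a bounded inverse and t is not in the spectrum
  (\<open>real_type_resolvent\<close>); otherwise -Im \<open>trace\<close> is bounded below near t
  (\<open>spectral_dichotomy\<close>). Compactness makes the constants uniform off the
  c1-neighbourhood of F (\<open>spectrum_local_law\<close>), and this neighbourhood is the
  exceptional set. Something is left after its removal because the spectrum is infinite: no nonzero
  polynomial of the adjacency operator kills the delta function at the root
  (\<open>opoly_root_nonzero\<close>, \<open>spectrum_not_subset_finite\<close>).\<close>

section \<open>Evaluation of nested polynomials with real coefficients\<close>

definition eval_rpoly :: "real poly \<Rightarrow> complex \<Rightarrow> complex" where
  "eval_rpoly p z = poly (map_poly complex_of_real p) z"

text \<open>Elements of R[z][x]: the outer variable is \<open>x\<close>, the coefficients are
  polynomials in \<open>z\<close>. In the elimination below the outer slot holds the parameter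
  \<open>u\<close>. Real base coefficients keep the symmetry under complex conjugation
  available.\<close>

definition eval2 :: "real poly poly \<Rightarrow> complex \<Rightarrow> complex \<Rightarrow> complex" where
  "eval2 P z x = poly (map_poly (\<lambda>c. eval_rpoly c z) P) x"

lemma comm_ring_hom_eval:
  assumes "comm_ring_hom h"
  shows "comm_ring_hom (\<lambda>p. poly (map_poly h p) (x :: 'b :: comm_ring_1))"
proof -
  interpret h: comm_ring_hom h by fact
  interpret map_poly_comm_ring_hom h ..
  show ?thesis by unfold_locales (auto simp: hom_distribs)
qed

lemma comm_ring_hom_eval_rpoly: "comm_ring_hom (\<lambda>p. eval_rpoly p z)"
  unfolding eval_rpoly_def by (rule comm_ring_hom_eval) (unfold_locales, auto)

lemma comm_ring_hom_eval2: "comm_ring_hom (\<lambda>P. eval2 P z x)"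
  unfolding eval2_def by (rule comm_ring_hom_eval) (rule comm_ring_hom_eval_rpoly)

interpretation eval_rpoly: comm_ring_hom "\<lambda>p. eval_rpoly p z" for z
  by (rule comm_ring_hom_eval_rpoly)

interpretation eval2: comm_ring_hom "\<lambda>P. eval2 P z x" for z x
  by (rule comm_ring_hom_eval2)

lemma poly_eq_sum_le:
  fixes p :: "'b :: comm_semiring_1 poly"
  assumes "degree p \<le> n" shows "poly p x = (\<Sum>i\<le>n. coeff p i * x ^ i)"
  unfolding poly_altdef using assms by (intro sum.mono_neutral_left) (auto simp: coeff_eq_0)

lemma eval2_sum_coeffs: 
  "degree P \<le> n \<Longrightarrow> eval2 P z x = (\<Sum>i\<le>n. eval_rpoly (coeff P i) z * x ^ i)"
  unfolding eval2_def
  by (subst poly_eq_sum_le, rule order.trans[OF degree_map_poly_le]) (simp_all add: coeff_map_poly)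

lemma eval2_const: "eval2 [:c:] z x = eval_rpoly c z"
  by (cases "c = 0") (simp_all add: eval2_def map_poly_pCons)

lemma eval2_X: "eval2 [:0, 1:] z x = x"
  by (simp add: eval2_def map_poly_pCons)

lemma eval_rpoly_const: "eval_rpoly [:c:] z = of_real c"
  by (cases "c = 0") (simp_all add: eval_rpoly_def map_poly_pCons)

lemma eval_rpoly_X: "eval_rpoly [:0, 1:] z = z"
  by (simp add: eval_rpoly_def map_poly_pCons)

lemma eval2_Xz: "eval2 [:[:0, 1:]:] z x = z"
  by (simp add: eval2_const eval_rpoly_X)

section \<open>Elimination of unknowns through a finite module of monomials\<close>

context
  fixes I :: "'i set" and N :: "'i \<Rightarrow> 'i set"
  assumes fin: "finite I" and N: "\<And>i. i \<in> I \<Longrightarrow> N i \<subseteq> I"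
begin

text \<open>For \<open>u = 1 / s\<close> this says 1 - z X_i + X_i (sum of X_j) = s X_i^3, a
  perturbation of the Green function equation X_i (z - sum of X_j) = 1. Its purpose is the pure cube
  on the left: it dominates the quadratic right-hand side, so high powers can always be
  rewritten.\<close>

definition cubic_sol :: "complex \<Rightarrow> complex \<Rightarrow> ('i \<Rightarrow> complex) \<Rightarrow> bool" where
  "cubic_sol z u X \<longleftrightarrow> (\<forall>i\<in>I. X i ^ 3 = u * (1 - z * X i + (\<Sum>j\<in>N i. X i * X j)))"

definition mono :: "('i \<Rightarrow> complex) \<Rightarrow> ('i \<Rightarrow> nat) \<Rightarrow> complex" where
  "mono X a = (\<Prod>i\<in>I. X i ^ a i)"

definition basis :: "('i \<Rightarrow> nat) set" where
  "basis = PiE I (\<lambda>_. {..2})"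

text \<open>\<open>F\<close> lies in the span of the monomials with exponents at most 2 over
  R[z][u], with coefficients that are the same for all solutions. Working with functions of
  solutions takes the place of a quotient ring.\<close>

definition reducible :: "(('i \<Rightarrow> complex) \<Rightarrow> complex \<Rightarrow> complex \<Rightarrow> complex) \<Rightarrow> bool" where
  "reducible F \<longleftrightarrow> (\<exists>r. \<forall>X z u. cubic_sol z u X \<longrightarrow>
     F X z u = (\<Sum>b\<in>basis. eval2 (r b) z u * mono X b))"

lemma finite_basis: "finite basis"
  unfolding basis_def using fin by (intro finite_PiE) auto

lemma reducible_cong:
  assumes "\<And>X z u. cubic_sol z u X \<Longrightarrow> F X z u = G X z u" "reducible G"
  shows "reducible F"
  using assms unfolding reducible_def by simp

lemma reducible_add:
  assumes "reducible F" "reducible G"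
  shows "reducible (\<lambda>X z u. F X z u + G X z u)"
proof -
  obtain r s where r: "\<And>X z u. cubic_sol z u X \<Longrightarrow> F X z u = (\<Sum>b\<in>basis. eval2 (r b) z u * mono X b)"
    and s: "\<And>X z u. cubic_sol z u X \<Longrightarrow> G X z u = (\<Sum>b\<in>basis. eval2 (s b) z u * mono X b)"
    using assms unfolding reducible_def by blast
  show ?thesis unfolding reducible_def
    by (rule exI[of _ "\<lambda>b. r b + s b"]) (simp add: r s eval2.hom_add sum.distrib algebra_simps)
qed

lemma reducible_scale:
  assumes "reducible F"
  shows "reducible (\<lambda>X z u. eval2 q z u * F X z u)"
proof -
  obtain r where r: "\<And>X z u. cubic_sol z u X \<Longrightarrow> F X z u = (\<Sum>b\<in>basis. eval2 (r b) z u * mono X b)"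
    using assms unfolding reducible_def by blast
  show ?thesis unfolding reducible_def
    by (rule exI[of _ "\<lambda>b. q * r b"]) (simp add: r eval2.hom_mult sum_distrib_left algebra_simps)
qed

lemma reducible_zero: "reducible (\<lambda>X z u. 0)"
  unfolding reducible_def by (rule exI[of _ "\<lambda>_. 0"]) simp

lemma reducible_sum:
  assumes "finite J" "\<And>j. j \<in> J \<Longrightarrow> reducible (F j)"
  shows "reducible (\<lambda>X z u. \<Sum>j\<in>J. F j X z u)"
  using assms
proof (induction J rule: finite_induct)
  case empty
  then show ?case using reducible_zero by simp
next
  case (insert j J)
  have "reducible (\<lambda>X z u. F j X z u + (\<Sum>j\<in>J. F j X z u))"
    using insert by (intro reducible_add) auto
  then show ?case using insert by simp
qed

lemma mono_upd: 
  assumes "i \<in> I" shows "mono X (a(i := a i + k)) = X i ^ k * mono X a"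
  using assms fin unfolding mono_def
  by (simp add: prod.remove[of I i] power_add)

lemma mono_upd1: 
  assumes "i \<in> I" shows "mono X (a(i := Suc (a i))) = X i * mono X a"
  using mono_upd[OF assms, of X a 1] by simp

text \<open>Rewriting one cube turns total degree k + 3 into terms of degree at most k + 2, so
  induction on the total degree ends in \<open>basis\<close>.\<close>

lemma reducible_mono: "reducible (\<lambda>X z u. mono X a)"
proof (induction "sum a I" arbitrary: a rule: less_induct)
  case less
  show ?case
  proof (cases "\<forall>i\<in>I. a i \<le> 2")
    case True
    let ?b = "restrict a I"
    have b: "?b \<in> basis" using True by (auto simp: basis_def)
    have m: "mono X a = mono X ?b" for X by (simp add: mono_def)
    have "(\<Sum>b\<in>basis. eval2 (if b = ?b then 1 else 0) z u * mono X b) = mono X ?b" for X z u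
    proof -
      have "(\<Sum>b\<in>basis. eval2 (if b = ?b then 1 else 0) z u * mono X b) 
          = (\<Sum>b\<in>basis. if b = ?b then mono X b else 0)"
        by (rule sum.cong) auto
      then show ?thesis using b finite_basis by simp
    qed
    then show ?thesis unfolding reducible_def
      by (intro exI[of _ "\<lambda>b. if b = ?b then 1 else 0"]) (simp add: m)
  next
    case False
    then obtain i where i: "i \<in> I" "3 \<le> a i" by force
    \<comment> \<open>\<open>a'\<close> is \<open>a\<close> with the cube of X_i removed, and
      \<open>b\<close> puts one factor X_i back; the three kinds of terms have degrees smaller than
      that of \<open>a\<close> by 3, 2 and 1.\<close>
    define a' where "a' = a(i := a i - 3)"
    define b where "b = a'(i := Suc (a' i))"
    have a: "a = a'(i := a' i + 3)" using i by (auto simp: a'_def)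
    have s3: "sum a I = sum a' I + 3"
      unfolding a using i fin by (simp add: sum.remove[of I i] cong: if_cong)
    have sb: "sum b I = sum a' I + 1"
      unfolding b_def using i fin by (simp add: sum.remove[of I i] cong: if_cong)
    have sj: "sum (b(j := Suc (b j))) I = sum a' I + 2" if "j \<in> I" for j
      using that fin sb by (simp add: sum.remove[of I j] cong: if_cong)
    have Ni: "j \<in> N i \<Longrightarrow> j \<in> I" for j using N i by blast
    have finN: "finite (N i)" using N[OF i(1)] fin by (rule finite_subset)
    let ?U = "[:0, 1:] :: real poly poly" and ?Z = "[:[:0, 1:]:] :: real poly poly"
    show ?thesis
    proof (rule reducible_cong)
      fix X z u assume sol: "cubic_sol z u X"
      have "mono X a = X i ^ 3 * mono X a'"
        using mono_upd[OF i(1), of X a' 3] a by simp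
      also have "X i ^ 3 = u * (1 - z * X i + (\<Sum>j\<in>N i. X i * X j))"
        using sol i by (auto simp: cubic_sol_def)
      also have "\<dots> * mono X a' = u * (mono X a' + (- z) * mono X b 
            + (\<Sum>j\<in>N i. mono X (b(j := Suc (b j)))))"
      proof -
        have mb: "mono X b = X i * mono X a'" unfolding b_def by (rule mono_upd1[OF i(1)])
        have "(\<Sum>j\<in>N i. mono X (b(j := Suc (b j)))) = (\<Sum>j\<in>N i. X j * mono X b)"
          by (rule sum.cong) (auto simp: mono_upd1 Ni simp del: fun_upd_apply)
        then show ?thesis by (simp add: mb algebra_simps sum_distrib_left sum_distrib_right)
      qed
      finally show "mono X a = eval2 ?U z u * (mono X a' + eval2 (- ?Z) z u * mono X b 
            + (\<Sum>j\<in>N i. mono X (b(j := Suc (b j)))))"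
        unfolding eval2_X eval2.hom_uminus eval2_Xz by simp
    next
      show "reducible (\<lambda>X z u. eval2 ?U z u * (mono X a' + eval2 (- ?Z) z u * mono X b 
            + (\<Sum>j\<in>N i. mono X (b(j := Suc (b j))))))"
        using finN s3 sb sj Ni
        by (intro reducible_scale reducible_add reducible_sum less) (auto simp del: fun_upd_apply)
    qed
  qed
qed

text \<open>Multiplication by X_i on the span of \<open>basis\<close> is given by a matrix
  \<open>M\<close> over R[z][u]. The vector of monomials at a solution is an eigenvector of the
  evaluated matrix with eigenvalue X_i, so the characteristic polynomial, which is monic and hence
  nonzero, vanishes there.\<close>

lemma eliminant:
  assumes i: "i \<in> I"
  shows "\<exists>Q :: real poly poly poly. Q \<noteq> 0 \<and> 
    (\<forall>X z u. cubic_sol z u X \<longrightarrow> poly (map_poly (\<lambda>c. eval2 c z u) Q) (X i) = 0)"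
proof -
  have "\<forall>b. \<exists>r. \<forall>X z u. cubic_sol z u X \<longrightarrow>
     mono X (b(i := Suc (b i))) = (\<Sum>b'\<in>basis. eval2 (r b') z u * mono X b')"
    using reducible_mono unfolding reducible_def by blast
  then obtain r where r: "\<And>b X z u. cubic_sol z u X \<Longrightarrow>
     X i * mono X b = (\<Sum>b'\<in>basis. eval2 (r b b') z u * mono X b')"
    unfolding mono_upd1[OF i] by metis
  obtain bs where bs: "set bs = basis" "distinct bs"
    using finite_distinct_list[OF finite_basis] by blast
  define m where "m = length bs"
  define M where "M = mat m m (\<lambda>(k,l). r (bs ! k) (bs ! l))"
  have M: "M \<in> carrier_mat m m" by (simp add: M_def)
  have z0: "restrict (\<lambda>_. 0) I \<in> basis" by (auto simp: basis_def)
  have chi: "degree (char_poly M) = m \<and> coeff (char_poly M) m = 1"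
    using degree_monic_char_poly[OF M] .
  show ?thesis
  proof (intro exI[of _ "char_poly M"] conjI allI impI)
    show "char_poly M \<noteq> 0" using chi by auto
  next
    fix X z u assume sol: "cubic_sol z u X"
    let ?h = "\<lambda>c. eval2 c z u"
    define v where "v = vec m (\<lambda>k. mono X (bs ! k))"
    have vM: "map_mat ?h M *\<^sub>v v = X i \<cdot>\<^sub>v v"
    proof (rule eq_vecI)
      fix k assume k: "k < dim_vec (X i \<cdot>\<^sub>v v)"
      then have k: "k < m" by (simp add: v_def)
      have "(map_mat ?h M *\<^sub>v v) $ k = (\<Sum>l<m. eval2 (r (bs ! k) (bs ! l)) z u * mono X (bs ! l))"
        using k by (simp add: M_def v_def scalar_prod_def atLeast0LessThan)
      also have "\<dots> = (\<Sum>b'\<in>basis. eval2 (r (bs ! k) b') z u * mono X b')"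
        by (rule sum.reindex_bij_betw) (use bs bij_betw_nth[of bs "{..<m}"] in \<open>auto simp: m_def\<close>)
      also have "\<dots> = X i * mono X (bs ! k)" using r[OF sol] by simp
      finally show "(map_mat ?h M *\<^sub>v v) $ k = (X i \<cdot>\<^sub>v v) $ k" using k by (simp add: v_def)
    qed (simp add: v_def M_def)
    have vc: "v \<in> carrier_vec m" by (simp add: v_def)
    obtain k0 where k0: "k0 < m" "bs ! k0 = restrict (\<lambda>_. 0) I"
      using z0 bs by (metis in_set_conv_nth m_def)
    \<comment> \<open>The empty monomial has value 1, which keeps the eigenvector nonzero at every
      solution.\<close>
    have "v $ k0 = 1" using k0 by (simp add: v_def mono_def)
    then have "v \<noteq> 0\<^sub>v m" using k0(1) by (metis index_zero_vec(1) zero_neq_one)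
    then have "eigenvector (map_mat ?h M) v (X i)"
      unfolding eigenvector_def using vM vc M by simp
    then have "eigenvalue (map_mat ?h M) (X i)" unfolding eigenvalue_def by blast
    then have "poly (char_poly (map_mat ?h M)) (X i) = 0"
      using eigenvalue_root_char_poly[of "map_mat ?h M" m] M by simp
    then show "poly (map_poly ?h (char_poly M)) (X i) = 0"
      using eval2.char_poly_hom[OF M] by simp
  qed
qed

end

text \<open>The coefficient of the highest power of the outer variable survives as that variable tends to infinity.\<close>

lemma leading_part:
  fixes Q :: "real poly poly poly"
  assumes "Q \<noteq> 0"
  shows "\<exists>P::real poly poly. P \<noteq> 0 \<and> (\<forall>(z::complex) (x::complex) (X::nat \<Rightarrow> complex) (s::nat \<Rightarrow> complex).
     (\<forall>n. s n \<noteq> 0 \<and> poly (map_poly (\<lambda>c. eval2 c z (1 / s n)) Q) (X n) = 0) \<longrightarrow>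
     s \<longlonglongrightarrow> 0 \<longrightarrow> X \<longlonglongrightarrow> x \<longrightarrow> eval2 P z x = 0)"
proof -
  \<comment> \<open>The largest power of \<open>u\<close> in any coefficient of \<open>Q\<close>;
    \<open>P\<close> collects the coefficients of exactly that power.\<close>
  define J where "J = Max ((\<lambda>i. degree (coeff Q i)) ` {..degree Q})"
  have J: "degree (coeff Q i) \<le> J" if "i \<le> degree Q" for i
    unfolding J_def using that by (intro Max_ge) auto
  have J': "degree (coeff Q i) \<le> J" for i
    using J[of i] by (cases "i \<le> degree Q") (auto simp: coeff_eq_0)
  define P where "P = map_poly (\<lambda>c. coeff c J) Q"
  have cP: "coeff P i = coeff (coeff Q i) J" for i
    by (simp add: P_def coeff_map_poly)
  have "P \<noteq> 0"
  proof -
    have "J \<in> (\<lambda>i. degree (coeff Q i)) ` {..degree Q}"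
      unfolding J_def by (intro Max_in) auto
    then obtain i where i: "i \<le> degree Q" "degree (coeff Q i) = J" by auto
    show ?thesis
    proof (cases "J = 0")
      case True
      have "degree (coeff Q (degree Q)) = 0" using J'[of "degree Q"] True by simp
      moreover have "coeff (coeff Q (degree Q)) (degree (coeff Q (degree Q))) \<noteq> 0"
        using assms by simp
      ultimately have "coeff P (degree Q) \<noteq> 0" using True by (simp add: cP)
      then show ?thesis by auto
    next
      case False
      then have "coeff Q i \<noteq> 0" using i by auto
      then have "coeff (coeff Q i) (degree (coeff Q i)) \<noteq> 0" by simp
      then have "coeff P i \<noteq> 0" using i by (simp add: cP)
      then show ?thesis by auto
    qed
  qed
  moreover have "eval2 P z x = 0" 
    if A: "\<forall>n::nat. s n \<noteq> 0 \<and> poly (map_poly (\<lambda>c. eval2 c z (1 / s n)) Q) (X n) = 0"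
    and s: "s \<longlonglongrightarrow> 0" and X: "X \<longlonglongrightarrow> x" for z x X s
  proof -
    let ?c = "\<lambda>i j. eval_rpoly (coeff (coeff Q i) j) z"
    \<comment> \<open>\<open>s ^ J\<close> times \<open>Q\<close> at \<open>u = 1 / s\<close>,
      written as a polynomial in \<open>s\<close>: it is continuous at \<open>s = 0\<close>, where
      only the terms with u^J survive.\<close>
    define G where "G s x = (\<Sum>i\<le>degree Q. (\<Sum>j\<le>J. ?c i j * s ^ (J - j)) * x ^ i)" for s x
    have G0: "G (s n) (X n) = 0" for n
    proof -
      have sn: "s n \<noteq> 0" using A by blast
      have "0 = s n ^ J * poly (map_poly (\<lambda>c. eval2 c z (1 / s n)) Q) (X n)" using A by simp
      also have "poly (map_poly (\<lambda>c. eval2 c z (1 / s n)) Q) (X n)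
         = (\<Sum>i\<le>degree Q. eval2 (coeff Q i) z (1 / s n) * X n ^ i)"
        by (subst poly_eq_sum_le, rule degree_map_poly_le) (simp add: coeff_map_poly)
      also have "s n ^ J * \<dots> = G (s n) (X n)"
        unfolding G_def sum_distrib_left
      proof (rule sum.cong[OF refl])
        fix i assume "i \<in> {..degree Q}"
        have "s n ^ J * eval2 (coeff Q i) z (1 / s n) = (\<Sum>j\<le>J. ?c i j * s n ^ (J - j))"
          unfolding eval2_sum_coeffs[OF J'] sum_distrib_left
          by (rule sum.cong) (use sn in \<open>simp_all add: power_diff power_one_over field_simps\<close>)
        then show "s n ^ J * (eval2 (coeff Q i) z (1 / s n) * X n ^ i)
           = (\<Sum>j\<le>J. ?c i j * s n ^ (J - j)) * X n ^ i"
          by (simp add: mult.assoc[symmetric])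
      qed
      finally show ?thesis by simp
    qed
    have "(\<lambda>n. G (s n) (X n)) \<longlonglongrightarrow> G 0 x"
      unfolding G_def by (intro tendsto_intros s X)
    moreover have "(\<lambda>n. G (s n) (X n)) \<longlonglongrightarrow> 0" by (simp add: G0)
    ultimately have "G 0 x = 0" by (rule LIMSEQ_unique)
    moreover have "G 0 x = (\<Sum>i\<le>degree Q. ?c i J * x ^ i)"
      unfolding G_def
    proof (rule sum.cong[OF refl])
      fix i
      have "(\<Sum>j\<le>J. ?c i j * 0 ^ (J - j)) = (\<Sum>j\<le>J. if j = J then ?c i j else 0)"
        by (rule sum.cong) (simp_all add: power_0_left)
      then show "(\<Sum>j\<le>J. ?c i j * 0 ^ (J - j)) * x ^ i = ?c i J * x ^ i" by simp
    qed
    moreover have "\<dots> = eval2 P z x"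
      using eval2_sum_coeffs[of P "degree Q" z x] cP degree_map_poly_le[of "\<lambda>c. coeff c J" Q]
      by (simp add: P_def)
    ultimately show ?thesis by simp
  qed
  ultimately show ?thesis by blast
qed

section \<open>The continued-fraction system in the upper half-plane\<close>

abbreviation uhp :: "complex set" where "uhp \<equiv> {z. 0 < Im z}"

lemma open_uhp: "open uhp" by (rule open_halfspace_Im_gt)
lemma connected_uhp: "topological_space_class.connected uhp"
  by (intro convex_connected convex_halfspace_Im_gt)

lemma Im_inverse_neg:
  assumes "0 < y" "y \<le> Im w"
  shows "w \<noteq> 0" "Im (1 / w) = - Im w / (cmod w)\<^sup>2" "Im (1 / w) < 0" "cmod (1 / w) \<le> 1 / y"
proof -
  show w: "w \<noteq> 0" using assms by auto
  show *: "Im (1 / w) = - Im w / (cmod w)\<^sup>2"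
    by (simp add: Im_divide cmod_power2)
  show "Im (1 / w) < 0" using w assms by (simp add: * divide_neg_pos)
  have "y \<le> cmod w" using assms abs_Im_le_cmod[of w] by simp
  then show "cmod (1 / w) \<le> 1 / y" using assms by (simp add: norm_divide frac_le)
qed

text \<open>The quantity \<open>\<bar>f - g\<bar>\<^sup>2 / (Im f \<cdot> Im g)\<close> is a function of the hyperbolic distance,
  and the map contracts it.\<close>

lemma hyperbolic_contraction:
  fixes f g :: "'j \<Rightarrow> complex"
  assumes J: "finite J" and y: "0 < y" "y \<le> Im z" and D: "0 < D" and Gam: "0 \<le> Gam"
    and f: "\<And>j. j \<in> J \<Longrightarrow> Im (f j) < 0" and g: "\<And>j. j \<in> J \<Longrightarrow> Im (g j) < 0"
    and fg: "\<And>j. j \<in> J \<Longrightarrow> (cmod (f j - g j))\<^sup>2 \<le> Gam * (Im (f j) * Im (g j))"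
    and S: "(\<Sum>j\<in>J. - Im (g j)) \<le> D / y"
  defines "F \<equiv> 1 / (z - sum f J)" and "G \<equiv> 1 / (z - sum g J)"
  shows "(cmod (F - G))\<^sup>2 \<le> D / (y\<^sup>2 + D) * Gam * (Im F * Im G)"
proof -
  define p where "p = z - sum f J"
  define r where "r = z - sum g J"
  define A where "A = (\<Sum>j\<in>J. - Im (f j))"
  define B where "B = (\<Sum>j\<in>J. - Im (g j))"
  have A0: "0 \<le> A" and B0: "0 \<le> B" unfolding A_def B_def
    using f g by (auto intro!: sum_nonneg simp: less_imp_le)
  have Ip: "Im p = Im z + A" and Ir: "Im r = Im z + B"
    by (simp_all add: p_def r_def A_def B_def sum_negf)
  have yp: "y \<le> Im p" "y \<le> Im r" using Ip Ir A0 B0 y by auto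
  note p = Im_inverse_neg[OF y(1) yp(1)] and r = Im_inverse_neg[OF y(1) yp(2)]
  have "cmod (sum f J - sum g J) \<le> (\<Sum>j\<in>J. cmod (f j - g j))"
    by (simp flip: sum_subtractf add: norm_sum)
  also have "\<dots> \<le> (\<Sum>j\<in>J. sqrt Gam * (sqrt (- Im (f j)) * sqrt (- Im (g j))))"
  proof (rule sum_mono)
    fix j assume j: "j \<in> J"
    have "cmod (f j - g j) \<le> sqrt (Gam * (Im (f j) * Im (g j)))"
      using fg[OF j] real_le_rsqrt by blast
    also have "\<dots> = sqrt Gam * (sqrt (- Im (f j)) * sqrt (- Im (g j)))"
      by (simp flip: real_sqrt_mult)
    finally show "cmod (f j - g j) \<le> sqrt Gam * (sqrt (- Im (f j)) * sqrt (- Im (g j)))" .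
  qed
  also have "\<dots> = sqrt Gam * (\<Sum>j\<in>J. sqrt (- Im (f j)) * sqrt (- Im (g j)))"
    by (simp add: sum_distrib_left)
  also have "\<dots> \<le> sqrt Gam * (L2_set (\<lambda>j. sqrt (- Im (f j))) J * L2_set (\<lambda>j. sqrt (- Im (g j))) J)"
  proof (rule mult_left_mono)
    have "(\<Sum>j\<in>J. sqrt (- Im (f j)) * sqrt (- Im (g j)))
       \<le> (\<Sum>j\<in>J. \<bar>sqrt (- Im (f j))\<bar> * \<bar>sqrt (- Im (g j))\<bar>)"
      by (intro sum_mono) (metis abs_ge_self abs_mult)
    also have "\<dots> \<le> L2_set (\<lambda>j. sqrt (- Im (f j))) J * L2_set (\<lambda>j. sqrt (- Im (g j))) J"
      by (rule L2_set_mult_ineq)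
    finally show "(\<Sum>j\<in>J. sqrt (- Im (f j)) * sqrt (- Im (g j))) \<le> \<dots>" .
  qed (use Gam in simp)
  also have "\<dots> = sqrt (Gam * (A * B))"
  proof -
    have "(\<Sum>j\<in>J. (sqrt (- Im (f j)))\<^sup>2) = A" "(\<Sum>j\<in>J. (sqrt (- Im (g j)))\<^sup>2) = B"
      unfolding A_def B_def by (rule sum.cong; use f g in \<open>force simp: less_imp_le\<close>)+
    then show ?thesis by (simp add: L2_set_def real_sqrt_mult)
  qed
  finally have "cmod (sum f J - sum g J) \<le> sqrt (Gam * (A * B))" .
  then have "(cmod (sum f J - sum g J))\<^sup>2 \<le> (sqrt (Gam * (A * B)))\<^sup>2" by (rule power_mono) simp
  then have AB: "(cmod (sum f J - sum g J))\<^sup>2 \<le> Gam * (A * B)" using Gam A0 B0 by simp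
  have FF: "F = 1 / p" "G = 1 / r" by (simp_all add: F_def G_def p_def r_def)
  have FG: "F - G = (sum f J - sum g J) / (p * r)"
    using p(1) r(1) by (simp add: F_def G_def p_def r_def field_simps)
  have "(cmod (F - G))\<^sup>2 = (cmod (sum f J - sum g J))\<^sup>2 / ((cmod p)\<^sup>2 * (cmod r)\<^sup>2)"
    by (simp add: FG norm_divide norm_mult power_divide power_mult_distrib)
  also have "\<dots> \<le> Gam * (A * B) / ((cmod p)\<^sup>2 * (cmod r)\<^sup>2)"
    using AB by (intro divide_right_mono) auto
  \<comment> \<open>The contraction is strict because \<open>Im r\<close> exceeds \<open>B\<close>
    by \<open>Im z\<close>: \<open>B \<le> D / y\<close> and \<open>y \<le> Im z\<close> bound the
    ratio of \<open>B\<close> to \<open>Im r\<close> by the factor below 1. On the other side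
    \<open>A \<le> Im p\<close> is enough.\<close>
  also have "\<dots> \<le> Gam * (Im p * (D / (y\<^sup>2 + D) * Im r)) / ((cmod p)\<^sup>2 * (cmod r)\<^sup>2)"
  proof (intro divide_right_mono mult_left_mono mult_mono)
    have "B * y \<le> D" using S y by (simp add: B_def pos_le_divide_eq)
    then have "B * y * y \<le> D * y" using y by (intro mult_right_mono) auto
    moreover have "D * y \<le> D * Im z" using D y by simp
    ultimately have "B * (y\<^sup>2 + D) \<le> D * (Im z + B)" by (simp add: power2_eq_square algebra_simps)
    then show "B \<le> D / (y\<^sup>2 + D) * Im r"
      using D y by (simp add: Ir pos_le_divide_eq add_pos_pos)
  qed (use A0 B0 y Gam Ip D in auto)
  also have "\<dots> = D / (y\<^sup>2 + D) * Gam * (Im F * Im G)"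
    unfolding FF p(2) r(2) by simp
  finally show ?thesis .
qed

locale cf_system =
  fixes I :: "'i set" and N :: "'i \<Rightarrow> 'i set"
  assumes fin: "finite I" and N: "\<And>i. i \<in> I \<Longrightarrow> N i \<subseteq> I"
begin

definition D :: real where "D = real (card I) + 1"

lemma D_pos: "0 < D" by (simp add: D_def add_nonneg_pos)

lemma finN: "i \<in> I \<Longrightarrow> finite (N i)" using N fin finite_subset by blast
lemma card_N: "i \<in> I \<Longrightarrow> real (card (N i)) \<le> D"
  using card_mono[OF fin N] by (fastforce simp: D_def)

text \<open>The start -i lies in the lower half-plane, which the map preserves when Im z > 0; there
  the denominators never vanish.\<close>

fun iter :: "nat \<Rightarrow> complex \<Rightarrow> 'i \<Rightarrow> complex" where
  "iter 0 z i = - \<i>"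
| "iter (Suc k) z i = 1 / (z - (\<Sum>j\<in>N i. iter k z j))"

lemma iter_neg:
  assumes z: "0 < Im z" shows "i \<in> I \<Longrightarrow> Im (iter k z i) < 0"
proof (induction k arbitrary: i)
  case (Suc k)
  have "(\<Sum>j\<in>N i. Im (iter k z j)) \<le> 0"
    using Suc.IH N[OF Suc.prems] by (intro sum_nonpos) (auto simp: less_imp_le)
  then have "Im z \<le> Im (z - (\<Sum>j\<in>N i. iter k z j))" by simp
  then show ?case using Im_inverse_neg(3)[OF z] by simp
qed simp

lemma iter_den:
  assumes z: "0 < Im z" and i: "i \<in> I"
  shows "Im z \<le> Im (z - (\<Sum>j\<in>N i. iter k z j))"
proof -
  have "(\<Sum>j\<in>N i. Im (iter k z j)) \<le> 0"
    using iter_neg[OF z] N[OF i] by (intro sum_nonpos) (auto simp: less_imp_le)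
  then show ?thesis by simp
qed

lemma iter_bound:
  assumes y: "0 < y" "y \<le> Im z" and i: "i \<in> I"
  shows "cmod (iter (Suc k) z i) \<le> 1 / y"
proof -
  have "y \<le> Im (z - (\<Sum>j\<in>N i. iter k z j))" using iter_den[of z i k] y i by simp
  then show ?thesis using Im_inverse_neg(4)[OF y(1)] by simp
qed

lemma sum_N_bound:
  assumes i: "i \<in> I" and b: "\<And>j. j \<in> I \<Longrightarrow> h j \<le> b" "0 \<le> b"
  shows "(\<Sum>j\<in>N i. h j) \<le> D * b"
proof -
  have "(\<Sum>j\<in>N i. h j) \<le> of_nat (card (N i)) * b" by (rule sum_bounded_above) (use b N[OF i] in auto)
  also have "\<dots> \<le> D * b" using card_N[OF i] b by (intro mult_right_mono) auto
  finally show ?thesis .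
qed

text \<open>Bounds the hyperbolic gap between the first two iterates: their distance is at most
  \<open>2 / y\<close>, and the other two factors are the reciprocal lower bounds of their imaginary
  parts supplied by \<open>iter_im_lower\<close>.\<close>

definition Gam :: "real \<Rightarrow> real \<Rightarrow> real" where
  "Gam y M = (2 / y)\<^sup>2 * ((M + D)\<^sup>2 / y) * ((M + D / y)\<^sup>2 / y)"

lemma Gam_nonneg: "0 < y \<Longrightarrow> 0 \<le> Gam y M"
  unfolding Gam_def by (intro mult_nonneg_nonneg divide_nonneg_pos zero_le_power2)

lemma iter_im_lower:
  assumes y: "0 < y" "y \<le> Im z" and i: "i \<in> I" 
    and b: "\<And>j. j \<in> I \<Longrightarrow> cmod (iter k z j) \<le> b" "0 \<le> b" and M: "cmod z \<le> M"
  shows "1 \<le> - Im (iter (Suc k) z i) * ((M + D * b)\<^sup>2 / y)"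
proof -
  let ?w = "z - (\<Sum>j\<in>N i. iter k z j)"
  have w: "y \<le> Im ?w" using iter_den[of z i k] y i by simp
  note r = Im_inverse_neg[OF y(1) w]
  have "cmod ?w \<le> cmod z + (\<Sum>j\<in>N i. cmod (iter k z j))"
    by (rule order.trans[OF norm_triangle_ineq4]) (simp add: norm_sum)
  also have "\<dots> \<le> M + D * b" using sum_N_bound[OF i b] M by (intro add_mono) auto
  finally have "(cmod ?w)\<^sup>2 \<le> (M + D * b)\<^sup>2" by (rule power_mono) simp
  then have "y * (cmod ?w)\<^sup>2 \<le> Im ?w * (M + D * b)\<^sup>2" using w y by (intro mult_mono) auto
  moreover have "0 < (cmod ?w)\<^sup>2" using r(1) by simp
  ultimately have "1 \<le> (Im ?w * (M + D * b)\<^sup>2) / (y * (cmod ?w)\<^sup>2)"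
    using y by (subst pos_le_divide_eq) auto
  also have "\<dots> = - (- Im ?w / (cmod ?w)\<^sup>2) * ((M + D * b)\<^sup>2 / y)"
    by (simp only: minus_divide_left minus_minus times_divide_times_eq mult.commute)
  finally show ?thesis unfolding iter.simps r(2) .
qed

text \<open>The initial gap \<open>Gam y M\<close> is multiplied by the contraction factor at every
  step, so the iterates converge geometrically, uniformly for \<open>y \<le> Im z\<close> and
  \<open>cmod z \<le> M\<close>.\<close>

lemma iter_diff:
  assumes y: "0 < y" "y \<le> Im z" and M: "cmod z \<le> M" and i: "i \<in> I"
  shows "(cmod (iter (Suc (Suc k)) z i - iter (Suc k) z i))\<^sup>2 
     \<le> (D / (y\<^sup>2 + D)) ^ k * Gam y M * (Im (iter (Suc (Suc k)) z i) * Im (iter (Suc k) z i))"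
  using i
proof (induction k arbitrary: i)
  case 0
  let ?a = "- Im (iter (Suc (Suc 0)) z i)" and ?b = "- Im (iter (Suc 0) z i)"
  let ?A = "(M + D * (1 / y))\<^sup>2 / y" and ?B = "(M + D)\<^sup>2 / y"
  have a: "1 \<le> ?a * ?A" using y D_pos
    by (intro iter_im_lower[OF y 0(1) _ _ M]) (simp_all only: iter_bound[OF y], simp)
  have b: "1 \<le> ?b * ?B" using iter_im_lower[OF y 0(1) _ _ M, of 0 1] by simp
  have "cmod (iter (Suc (Suc 0)) z i - iter (Suc 0) z i) \<le> 2 / y"
    using norm_triangle_ineq4[of "iter (Suc (Suc 0)) z i" "iter (Suc 0) z i"]
      iter_bound[OF y 0(1), of 0] iter_bound[OF y 0(1), of 1] by simp
  then have "(cmod (iter (Suc (Suc 0)) z i - iter (Suc 0) z i))\<^sup>2 \<le> (2 / y)\<^sup>2 * 1"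
    by (simp add: power_mono del: iter.simps)
  also have "\<dots> \<le> (2 / y)\<^sup>2 * ((?a * ?A) * (?b * ?B))"
    using mult_mono[OF a b] a by (intro mult_left_mono) (auto simp del: iter.simps)
  also have "\<dots> = (D / (y\<^sup>2 + D)) ^ 0 * Gam y M * (Im (iter (Suc (Suc 0)) z i) * Im (iter (Suc 0) z i))"
    unfolding Gam_def by (simp add: algebra_simps del: iter.simps)
  finally show ?case .
next
  case (Suc k)
  have z: "0 < Im z" using y by simp
  have G: "0 \<le> (D / (y\<^sup>2 + D)) ^ k * Gam y M"
    using D_pos y by (intro mult_nonneg_nonneg zero_le_power divide_nonneg_pos Gam_nonneg) (auto intro: add_pos_pos)
  have Nj: "j \<in> I" if "j \<in> N i" for j using that N[OF Suc.prems] by blast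
  have "(\<Sum>j\<in>N i. - Im (iter (Suc k) z j)) \<le> D * (1 / y)"
  proof (rule sum_N_bound[OF Suc.prems])
    fix j assume "j \<in> I"
    then show "- Im (iter (Suc k) z j) \<le> 1 / y"
      using iter_bound[OF y, of j k] abs_Im_le_cmod[of "iter (Suc k) z j"] by linarith
  qed (use y in auto)
  then have S: "(\<Sum>j\<in>N i. - Im (iter (Suc k) z j)) \<le> D / y" by simp
  have "(cmod (1 / (z - (\<Sum>j\<in>N i. iter (Suc (Suc k)) z j)) - 1 / (z - (\<Sum>j\<in>N i. iter (Suc k) z j))))\<^sup>2
    \<le> D / (y\<^sup>2 + D) * ((D / (y\<^sup>2 + D)) ^ k * Gam y M) * 
       (Im (1 / (z - (\<Sum>j\<in>N i. iter (Suc (Suc k)) z j))) * Im (1 / (z - (\<Sum>j\<in>N i. iter (Suc k) z j))))"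
    by (rule hyperbolic_contraction[OF finN[OF Suc.prems] y D_pos G _ _ Suc.IH S])
      (auto simp only: Nj iter_neg[OF z])
  then show ?case by (simp add: mult.assoc)
qed

lemma iter_diff':
  assumes y: "0 < y" "y \<le> Im z" and M: "cmod z \<le> M" and i: "i \<in> I"
  shows "cmod (iter (Suc (Suc k)) z i - iter (Suc k) z i)
     \<le> sqrt (Gam y M) / y * sqrt (D / (y\<^sup>2 + D)) ^ k"
proof -
  have im: "\<bar>Im (iter (Suc k) z i)\<bar> \<le> 1 / y" for k
    using iter_bound[OF y i, of k] abs_Im_le_cmod order.trans by blast
  have G0: "0 \<le> (D / (y\<^sup>2 + D)) ^ k * Gam y M"
    using D_pos y by (intro mult_nonneg_nonneg zero_le_power divide_nonneg_pos Gam_nonneg) (auto intro: add_pos_pos)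
  have "Im (iter (Suc (Suc k)) z i) * Im (iter (Suc k) z i) 
      \<le> \<bar>Im (iter (Suc (Suc k)) z i)\<bar> * \<bar>Im (iter (Suc k) z i)\<bar>"
    by (simp only: abs_ge_self flip: abs_mult)
  also have "\<dots> \<le> (1 / y) * (1 / y)"
    by (rule mult_mono[OF im im]) (use y in auto)
  finally have "Im (iter (Suc (Suc k)) z i) * Im (iter (Suc k) z i) \<le> (1 / y) * (1 / y)" .
  then have "(D / (y\<^sup>2 + D)) ^ k * Gam y M * (Im (iter (Suc (Suc k)) z i) * Im (iter (Suc k) z i)) 
    \<le> (D / (y\<^sup>2 + D)) ^ k * Gam y M * ((1 / y) * (1 / y))"
    by (rule mult_left_mono[OF _ G0])
  with iter_diff[OF y M i, of k] 
  have "(cmod (iter (Suc (Suc k)) z i - iter (Suc k) z i))\<^sup>2 \<le> (D / (y\<^sup>2 + D)) ^ k * Gam y M * ((1 / y) * (1 / y))"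
    by linarith
  then have "cmod (iter (Suc (Suc k)) z i - iter (Suc k) z i) \<le> sqrt ((D / (y\<^sup>2 + D)) ^ k * Gam y M * ((1 / y) * (1 / y)))"
    by (rule real_le_rsqrt)
  also have "\<dots> = sqrt (Gam y M) / y * sqrt (D / (y\<^sup>2 + D)) ^ k"
    using y by (simp add: real_sqrt_mult real_sqrt_power real_sqrt_divide)
  finally show ?thesis .
qed

text \<open>The limit of the iterates, written as a telescoping series so that the Weierstrass test
  gives locally uniform convergence and therefore holomorphy.\<close>

definition green :: "complex \<Rightarrow> 'i \<Rightarrow> complex" where
  "green z i = (\<Sum>k. iter (Suc (Suc k)) z i - iter (Suc k) z i) + iter 1 z i"

lemma uniform_limit_iter:
  assumes y: "0 < y" and A: "\<And>z. z \<in> A \<Longrightarrow> y \<le> Im z" "\<And>z. z \<in> A \<Longrightarrow> cmod z \<le> M" and i: "i \<in> I"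
  shows "uniform_limit A (\<lambda>k z. iter (Suc k) z i) (\<lambda>z. green z i) sequentially"
proof -
  let ?f = "\<lambda>k z. iter (Suc (Suc k)) z i - iter (Suc k) z i"
  have "norm (sqrt (D / (y\<^sup>2 + D))) < 1"
    using D_pos y by (simp add: real_sqrt_divide[symmetric] add_pos_pos)
  then have sm: "summable (\<lambda>k. sqrt (Gam y M) / y * sqrt (D / (y\<^sup>2 + D)) ^ k)"
    by (intro summable_mult summable_geometric)
  have "uniform_limit A (\<lambda>n z. \<Sum>k<n. ?f k z) (\<lambda>z. \<Sum>k. ?f k z) sequentially"
    by (rule Weierstrass_m_test[OF _ sm]) (simp only: iter_diff'[OF y A i])
  then have "uniform_limit A (\<lambda>n z. (\<Sum>k<n. ?f k z) + iter 1 z i) (\<lambda>z. (\<Sum>k. ?f k z) + iter 1 z i) sequentially"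
    by (intro uniform_limit_intros)
  moreover have "(\<lambda>n z. (\<Sum>k<n. ?f k z) + iter 1 z i) = (\<lambda>n z. iter (Suc n) z i)"
    unfolding sum_lessThan_telescope[of "\<lambda>k. iter (Suc k) z i" for z] by simp
  ultimately show ?thesis unfolding green_def by metis
qed

lemma tendsto_iter:
  assumes z: "0 < Im z" and i: "i \<in> I"
  shows "(\<lambda>k. iter (Suc k) z i) \<longlonglongrightarrow> green z i"
  by (rule tendsto_uniform_limitI[OF uniform_limit_iter[OF z, of "{z}" "cmod z" i]]) (use i in auto)

lemma green_eq:
  assumes z: "0 < Im z" and i: "i \<in> I"
  shows "green z i * (z - (\<Sum>j\<in>N i. green z j)) = 1"
proof -
  have Nj: "j \<in> I" if "j \<in> N i" for j using that N[OF i] by blast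
  have "(\<lambda>k. iter (Suc (Suc k)) z i * (z - (\<Sum>j\<in>N i. iter (Suc k) z j))) 
     \<longlonglongrightarrow> green z i * (z - (\<Sum>j\<in>N i. green z j))"
    by (intro tendsto_mult tendsto_diff tendsto_const tendsto_sum LIMSEQ_Suc[OF tendsto_iter[OF z i]]
        tendsto_iter[OF z] Nj)
  moreover have "iter (Suc (Suc k)) z i * (z - (\<Sum>j\<in>N i. iter (Suc k) z j)) = 1" for k
    using Im_inverse_neg(1)[OF z iter_den[OF z i, of "Suc k"]] 
    unfolding iter.simps(2)[of "Suc k"] by (simp del: iter.simps)
  ultimately show ?thesis by (simp only: LIMSEQ_const_iff)
qed

text \<open>The limit alone only gives a nonpositive imaginary part; strictness and the norm bound
  come from reading the fixed point equation once more.\<close>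

lemma green_props:
  assumes z: "0 < Im z" and i: "i \<in> I"
  shows "Im (green z i) < 0" "cmod (green z i) \<le> 1 / Im z"
proof -
  have le0: "Im (green z j) \<le> 0" if "j \<in> I" for j
    by (rule LIMSEQ_le_const2[OF tendsto_Im[OF tendsto_iter[OF z that]]])
      (use iter_neg[OF z that] in \<open>auto simp: less_imp_le simp del: iter.simps\<close>)
  then have "(\<Sum>j\<in>N i. Im (green z j)) \<le> 0" using N[OF i] by (intro sum_nonpos) auto
  then have w: "Im z \<le> Im (z - (\<Sum>j\<in>N i. green z j))" by simp
  have "green z i = 1 / (z - (\<Sum>j\<in>N i. green z j))"
    using green_eq[OF z i] by (metis mult_cancel_left1 mult_zero_right nonzero_eq_divide_eq)
  then show "Im (green z i) < 0" "cmod (green z i) \<le> 1 / Im z"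
    using Im_inverse_neg(3,4)[OF z w] by simp_all
qed

lemma iter_holomorphic: "i \<in> I \<Longrightarrow> (\<lambda>z. iter k z i) holomorphic_on uhp"
proof (induction k arbitrary: i)
  case (Suc k)
  show ?case unfolding iter.simps
    using Suc.prems N[OF Suc.prems] Im_inverse_neg(1)[OF _ iter_den]
    by (intro holomorphic_intros Suc.IH) auto
qed simp

lemma green_holomorphic:
  assumes i: "i \<in> I" shows "(\<lambda>z. green z i) holomorphic_on uhp"
proof (rule holomorphic_uniform_sequence[OF open_uhp])
  show "(\<lambda>z. iter (Suc k) z i) holomorphic_on uhp" for k by (rule iter_holomorphic[OF i])
next
  fix z assume "z \<in> uhp"
  then have z: "0 < Im z" by simp
  have le: "Im z / 2 \<le> Im w" if "w \<in> cball z (Im z / 2)" for w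
    using that abs_Im_le_cmod[of "z - w"] by (simp add: dist_norm)
  have "cmod w \<le> cmod z + Im z / 2" if "w \<in> cball z (Im z / 2)" for w
    using that norm_triangle_ineq[of z "w - z"] by (simp add: dist_norm norm_minus_commute)
  then have "uniform_limit (cball z (Im z / 2)) (\<lambda>k z. iter (Suc k) z i) (\<lambda>z. green z i) sequentially"
    using z le i by (intro uniform_limit_iter[of "Im z / 2"]) auto
  moreover have "cball z (Im z / 2) \<subseteq> uhp" using le z by force
  ultimately show "\<exists>d>0. cball z d \<subseteq> uhp \<and> 
      uniform_limit (cball z d) (\<lambda>k z. iter (Suc k) z i) (\<lambda>z. green z i) sequentially"
    using z by (intro exI[of _ "Im z / 2"]) auto
qed

end

section \<open>Continuation of an algebraic function across the real axis\<close>

lemma eval_rpoly_explicit: "eval_rpoly p z = (\<Sum>j\<le>degree p. of_real (coeff p j) * z ^ j)"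
  unfolding eval_rpoly_def by (subst poly_altdef) (simp add: coeff_map_poly)

lemma eval2_explicit: "eval2 P z x = 
    (\<Sum>i\<le>degree P. (\<Sum>j\<le>degree (coeff P i). of_real (coeff (coeff P i) j) * z ^ j) * x ^ i)"
  by (simp only: eval2_sum_coeffs[OF order_refl] eval_rpoly_explicit)

lemma holomorphic_eval2:
  assumes "f holomorphic_on S"
  shows "(\<lambda>z. eval2 P z (f z)) holomorphic_on S"
  unfolding eval2_explicit using assms
  by (intro holomorphic_on_sum holomorphic_on_mult holomorphic_on_power holomorphic_on_const holomorphic_on_ident)

lemma continuous_eval2: "continuous_on UNIV (\<lambda>w. eval2 P (fst w) (snd w))"
  unfolding eval2_explicit by (intro continuous_intros)

lemma tendsto_eval2:
  assumes "(f \<longlongrightarrow> z) F" "(g \<longlongrightarrow> x) F"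
  shows "((\<lambda>t. eval2 P (f t) (g t)) \<longlongrightarrow> eval2 P z x) F"
  unfolding eval2_explicit by (intro tendsto_sum tendsto_mult tendsto_power tendsto_const assms)

lemma DERIV_eval2: "((\<lambda>x. eval2 P z x) has_field_derivative eval2 (pderiv P) z x) (at x within S)"
proof -
  interpret idom_hom "\<lambda>p. eval_rpoly p z" ..
  show ?thesis unfolding eval2_def map_poly_pderiv 
    by (rule DERIV_subset[OF poly_DERIV]) simp
qed

lemma eval_rpoly_cnj: "eval_rpoly p (cnj z) = cnj (eval_rpoly p z)"
  by (simp add: eval_rpoly_def poly_altdef coeff_map_poly)

lemma eval2_cnj: "eval2 P (cnj z) (cnj x) = cnj (eval2 P z x)"
  by (simp add: eval2_sum_coeffs[OF order_refl] eval_rpoly_cnj)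

lemma eval_rpoly_of_real: "eval_rpoly p (of_real t) = of_real (poly p t)"
  by (simp add: eval_rpoly_def poly_altdef coeff_map_poly)

lemma eval_rpoly_eq_0:
  assumes "\<And>z. z \<in> uhp \<Longrightarrow> eval_rpoly p z = 0"
  shows "p = 0"
proof (rule ccontr)
  assume "p \<noteq> 0"
  then have "map_poly complex_of_real p \<noteq> 0" by simp
  then have "finite {z. poly (map_poly complex_of_real p) z = 0}" by (rule poly_roots_finite)
  moreover have "(\<lambda>n::nat. Complex 0 (real n + 1)) ` UNIV \<subseteq> {z. poly (map_poly complex_of_real p) z = 0}"
    using assms by (auto simp: eval_rpoly_def)
  ultimately have "finite ((\<lambda>n::nat. Complex 0 (real n + 1)) ` UNIV)" by (rule finite_subset[rotated])
  then show False by (subst (asm) finite_image_iff) (auto intro!: inj_onI)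
qed

text \<open>Two steps of Newton's method with frozen derivative turn the implicit equation into a contraction.\<close>

lemma implicit_function_eval2:
  fixes z0 a :: complex and \<sigma> :: real
  assumes root: "eval2 P z0 a = 0" and simple: "eval2 (pderiv P) z0 a \<noteq> 0" and \<sigma>: "0 < \<sigma>"
  shows "\<exists>r>0. \<exists>\<rho>>0. \<exists>\<phi>. \<rho> \<le> \<sigma> \<and> \<phi> holomorphic_on ball z0 r \<and> 
     (\<forall>z\<in>ball z0 r. \<phi> z \<in> ball a \<rho> \<and> (\<forall>x\<in>ball a \<rho>. eval2 P z x = 0 \<longleftrightarrow> x = \<phi> z))"
proof -
  define p where "p = eval2 (pderiv P) z0 a"
  have p: "p \<noteq> 0" using simple p_def by simp
  define \<Psi> where "\<Psi> z x = x - eval2 P z x / p" for z x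
  have "continuous_on UNIV (\<lambda>w. 1 - eval2 (pderiv P) (fst w) (snd w) / p)"
    by (intro continuous_on_diff continuous_on_const continuous_on_divide continuous_eval2) (use p in auto)
  then have "isCont (\<lambda>w. 1 - eval2 (pderiv P) (fst w) (snd w) / p) (z0, a)"
    by (simp add: continuous_on_eq_continuous_at)
  then have "\<exists>\<delta>>0. \<forall>w. dist w (z0, a) < \<delta> \<longrightarrow> 
      dist (1 - eval2 (pderiv P) (fst w) (snd w) / p) (1 - eval2 (pderiv P) z0 a / p) < 1 / 2"
    unfolding continuous_at_eps_delta fst_conv snd_conv by (elim allE[of _ "1 / 2"]) simp
  then obtain \<delta> where \<delta>: "0 < \<delta>" and \<delta>': "\<And>w. dist w (z0, a) < \<delta> \<Longrightarrow> 
      dist (1 - eval2 (pderiv P) (fst w) (snd w) / p) (1 - eval2 (pderiv P) z0 a / p) < 1 / 2"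
    by blast
  have d2: "cmod (1 - eval2 (pderiv P) z x / p) \<le> 1 / 2" if "dist z z0 < \<delta> / 2" "dist x a < \<delta> / 2" for z x
  proof -
    have "dist (z, x) (z0, a) \<le> dist z z0 + dist x a"
      by (simp add: dist_Pair_Pair sqrt_sum_squares_le_sum)
    also have "\<dots> < \<delta>" using that by simp
    finally show ?thesis using \<delta>'[of "(z, x)"] p by (simp add: p_def[symmetric] less_imp_le)
  qed
  \<comment> \<open>Strictly below \<open>\<delta> / 2\<close>, because the derivative bound is used
    on the closed ball of radius \<open>\<rho>\<close>.\<close>
  define \<rho> where "\<rho> = min \<sigma> (\<delta> / 3)"
  have \<rho>: "0 < \<rho>" "\<rho> \<le> \<sigma>" "\<rho> < \<delta> / 2" using \<sigma> \<delta> by (auto simp: \<rho>_def min_def)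
  have "isCont (\<lambda>z. eval2 P z a / p) z0"
    using tendsto_eval2[of "\<lambda>z. z" z0 "at z0" "\<lambda>_. a" a P] p by (auto simp: isCont_def intro!: tendsto_intros)
  then obtain \<epsilon> where \<epsilon>: "0 < \<epsilon>" "\<And>z. dist z z0 < \<epsilon> \<Longrightarrow> dist (eval2 P z a / p) (eval2 P z0 a / p) < \<rho> / 4"
    unfolding continuous_at_eps_delta using \<rho> by (metis zero_less_divide_iff zero_less_numeral)
  define r where "r = min \<epsilon> (\<delta> / 2)"
  have r: "0 < r" using \<epsilon> \<delta> by (simp add: r_def)
  have lip: "cmod (\<Psi> z x - \<Psi> z y) \<le> 1 / 2 * cmod (x - y)" 
    if "z \<in> ball z0 r" "x \<in> cball a \<rho>" "y \<in> cball a \<rho>" for z x y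
  proof (rule field_differentiable_bound[OF convex_cball])
    fix w assume w: "w \<in> cball a \<rho>"
    show "(\<Psi> z has_field_derivative 1 - eval2 (pderiv P) z w / p) (at w within cball a \<rho>)"
      unfolding \<Psi>_def using p by (auto intro!: derivative_eq_intros DERIV_eval2)
    show "cmod (1 - eval2 (pderiv P) z w / p) \<le> 1 / 2"
      using w that \<rho> by (intro d2) (auto simp: r_def dist_commute)
  qed (use that in auto)
  have maps: "\<Psi> z x \<in> ball a \<rho>" if z: "z \<in> ball z0 r" and x: "x \<in> cball a \<rho>" for z x
  proof -
    have "cmod (\<Psi> z x - a) \<le> cmod (\<Psi> z x - \<Psi> z a) + cmod (\<Psi> z a - a)"
      using norm_triangle_ineq[of "\<Psi> z x - \<Psi> z a" "\<Psi> z a - a"] by simp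
    also have "cmod (\<Psi> z x - \<Psi> z a) \<le> 1 / 2 * \<rho>"
      using lip[OF z x, of a] x \<rho> by (simp add: dist_norm norm_minus_commute)
    also have "cmod (\<Psi> z a - a) < \<rho> / 4"
      using \<epsilon>(2)[of z] z root by (simp add: \<Psi>_def r_def dist_commute)
    finally show ?thesis using \<rho> by (simp add: dist_norm norm_minus_commute)
  qed
  have fixpt: "\<Psi> z x = x \<longleftrightarrow> eval2 P z x = 0" for z x using p by (simp add: \<Psi>_def)
  have ex1: "\<exists>!x\<in>cball a \<rho>. \<Psi> z x = x" if z: "z \<in> ball z0 r" for z
  proof (rule Banach_fix[of _ "1/2"])
    show "\<Psi> z ` cball a \<rho> \<subseteq> cball a \<rho>" using maps[OF z] ball_subset_cball by blast
    show "dist (\<Psi> z x) (\<Psi> z y) \<le> 1 / 2 * dist x y" if "x \<in> cball a \<rho>" "y \<in> cball a \<rho>" for x y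
      using lip[OF z that] by (simp add: dist_norm)
  qed (use \<rho> in \<open>auto simp: complete_eq_closed\<close>)
  define \<phi> where "\<phi> z = (THE x. x \<in> cball a \<rho> \<and> \<Psi> z x = x)" for z
  have \<phi>: "\<phi> z \<in> cball a \<rho>" "\<Psi> z (\<phi> z) = \<phi> z" if "z \<in> ball z0 r" for z
    using theI'[OF ex1[OF that]] unfolding \<phi>_def by auto
  have \<phi>u: "x = \<phi> z" if "z \<in> ball z0 r" "x \<in> cball a \<rho>" "\<Psi> z x = x" for z x
    using ex1[OF that(1)] that \<phi>[OF that(1)] by blast
  define \<psi> where "\<psi> k z = (\<Psi> z ^^ k) a" for k z
  have \<psi>S: "\<psi> (Suc k) z = \<psi> k z - eval2 P z (\<psi> k z) / p" for k z
    by (simp add: \<psi>_def \<Psi>_def)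
  have \<psi>hol: "\<psi> k holomorphic_on UNIV" for k
  proof (induction k)
    case 0
    have "\<psi> 0 = (\<lambda>z. a)" by (simp add: \<psi>_def fun_eq_iff)
    then show ?case by simp
  next
    case (Suc k)
    have "\<psi> (Suc k) = (\<lambda>z. \<psi> k z - eval2 P z (\<psi> k z) / p)" using \<psi>S by auto
    moreover have "(\<lambda>z. \<psi> k z - eval2 P z (\<psi> k z) / p) holomorphic_on UNIV"
      by (intro holomorphic_intros holomorphic_eval2 Suc p)
    ultimately show ?case by simp
  qed
  have conv: "\<psi> k z \<in> cball a \<rho> \<and> cmod (\<psi> k z - \<phi> z) \<le> (1 / 2) ^ k * \<rho>" if z: "z \<in> ball z0 r" for k z
  proof (induction k)
    case 0
    show ?case using \<phi>(1)[OF z] \<rho> by (simp add: \<psi>_def dist_norm)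
  next
    case (Suc k)
    have e: "\<psi> (Suc k) z = \<Psi> z (\<psi> k z)" by (simp add: \<psi>_def)
    have "cmod (\<psi> (Suc k) z - \<phi> z) = cmod (\<Psi> z (\<psi> k z) - \<Psi> z (\<phi> z))" using e \<phi>(2)[OF z] by simp
    also have "\<dots> \<le> 1 / 2 * cmod (\<psi> k z - \<phi> z)" using lip[OF z] Suc \<phi>(1)[OF z] by blast
    also have "\<dots> \<le> (1 / 2) ^ Suc k * \<rho>" using Suc by simp
    finally show ?case using e maps[OF z, of "\<psi> k z"] Suc ball_subset_cball by auto
  qed
  have lim0: "(\<lambda>k. (1 / 2) ^ k * \<rho>) \<longlonglongrightarrow> 0"
    by (intro tendsto_mult_left_zero LIMSEQ_power_zero) simp
  have ulim: "uniform_limit (ball z0 r) \<psi> \<phi> sequentially"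
    unfolding uniform_limit_iff
  proof (intro allI impI)
    fix e :: real assume "0 < e"
    then have "\<forall>\<^sub>F k in sequentially. (1 / 2) ^ k * \<rho> < e" using lim0 by (rule order_tendstoD(2)[rotated])
    then show "\<forall>\<^sub>F k in sequentially. \<forall>z\<in>ball z0 r. dist (\<psi> k z) (\<phi> z) < e"
      unfolding dist_norm by eventually_elim (blast intro: le_less_trans conv[THEN conjunct2])
  qed
  have "\<phi> holomorphic_on ball z0 r"
  proof (rule holomorphic_uniform_sequence[OF open_ball])
    show "\<psi> k holomorphic_on ball z0 r" for k using \<psi>hol holomorphic_on_subset by blast
    fix z assume "z \<in> ball z0 r"
    then obtain d where "d > 0" "cball z d \<subseteq> ball z0 r"
      using open_contains_cball_eq[OF open_ball] by blast
    then show "\<exists>d>0. cball z d \<subseteq> ball z0 r \<and> uniform_limit (cball z d) \<psi> \<phi> sequentially"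
      using ulim uniform_limit_on_subset by blast
  qed
  moreover have "\<phi> z \<in> ball a \<rho>" if "z \<in> ball z0 r" for z
    using maps[OF that \<phi>(1)[OF that]] \<phi>(2)[OF that] by simp
  moreover have "eval2 P z x = 0 \<longleftrightarrow> x = \<phi> z" if "z \<in> ball z0 r" "x \<in> ball a \<rho>" for z x
    using that \<phi>u[OF that(1)] \<phi>(2)[OF that(1)] fixpt ball_subset_cball by blast
  ultimately show ?thesis using r \<rho> by blast
qed

definition annihilates :: "real poly poly \<Rightarrow> (complex \<Rightarrow> complex) \<Rightarrow> bool" where
  "annihilates P f \<longleftrightarrow> (\<forall>z\<in>uhp. eval2 P z (f z) = 0)"

lemma holomorphic_mult_eq_0:
  assumes S: "open S" "topological_space_class.connected S" and h: "f holomorphic_on S" "g holomorphic_on S"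
    and fg: "\<And>z. z \<in> S \<Longrightarrow> f z * g z = 0"
  shows "(\<forall>z\<in>S. f z = 0) \<or> (\<forall>z\<in>S. g z = 0)"
proof (rule ccontr)
  assume "\<not> ?thesis"
  then obtain z w where z: "z \<in> S" "f z \<noteq> 0" and w: "w \<in> S" "g w \<noteq> 0" by blast
  have "continuous_on S f" using h holomorphic_on_imp_continuous_on by blast
  then have op: "open {u \<in> S. f u \<noteq> 0}"
    using continuous_open_preimage[OF _ S(1), of f "- {0}"] by (auto simp: vimage_def Int_def)
  have "g w = 0"
  proof (rule analytic_continuation[OF h(2) S])
    show "{u \<in> S. f u \<noteq> 0} \<subseteq> S" "z \<in> S" "w \<in> S" using z w by auto
    show "z islimpt {u \<in> S. f u \<noteq> 0}" using op z by (intro interior_limit_point) (simp add: interior_open)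
    show "g u = 0" if "u \<in> {u \<in> S. f u \<noteq> 0}" for u using fg that by auto
  qed
  with w show False by simp
qed

text \<open>Holomorphic functions on a connected open set have no zero divisors, so the polynomials
  annihilating \<open>f\<close> form a prime ideal.\<close>

lemma annihilates_mult:
  assumes f: "f holomorphic_on uhp" and "annihilates (P * Q) f"
  shows "annihilates P f \<or> annihilates Q f"
proof -
  have "eval2 P z (f z) * eval2 Q z (f z) = 0" if "z \<in> uhp" for z
    using assms(2) that unfolding annihilates_def eval2.hom_mult by blast
  then show ?thesis unfolding annihilates_def
    by (rule holomorphic_mult_eq_0[OF open_uhp connected_uhp holomorphic_eval2[OF f] holomorphic_eval2[OF f]])
qed

lemma annihilates_const: "annihilates [:c:] f \<Longrightarrow> c = 0"
  unfolding annihilates_def eval2_const by (rule eval_rpoly_eq_0) blast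

text \<open>Euclid's algorithm with pseudo-division. A remainder annihilating \<open>f\<close> would
  be 0 by minimality; then the quotient would annihilate \<open>f\<close> since \<open>Q\<close>
  does not, although its degree is smaller than that of \<open>P\<close>. So the algorithm only
  stops at a nonzero polynomial in z alone.\<close>

lemma coprime_to_minimal:
  assumes f: "f holomorphic_on uhp" and P: "P \<noteq> 0" "annihilates P f"
    and min: "\<And>Q. Q \<noteq> 0 \<Longrightarrow> annihilates Q f \<Longrightarrow> degree P \<le> degree Q"
    and Q: "\<not> annihilates Q f" "degree Q < degree P"
  shows "\<exists>a b R. R \<noteq> 0 \<and> a * P + b * Q = [:R:]"
  using Q
proof (induction "degree Q" arbitrary: Q rule: less_induct)
  case less
  show ?case
  proof (cases "degree Q = 0")
    case True
    then obtain c where c: "Q = [:c:]" by (metis degree_eq_zeroE)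
    have "c \<noteq> 0" using less.prems c by (auto simp: annihilates_def)
    then show ?thesis by (intro exI[of _ 0] exI[of _ 1] exI[of _ c]) (simp add: c)
  next
    case False
    have Q0: "Q \<noteq> 0" using False by auto
    obtain s t where st: "pseudo_divmod P Q = (s, t)" by fastforce
    define l where "l = coeff Q (degree Q) ^ (Suc (degree P) - degree Q)"
    have l: "l \<noteq> 0" using Q0 by (simp add: l_def)
    have eq: "Polynomial.smult l P = Q * s + t" and t: "t = 0 \<or> degree t < degree Q"
      using pseudo_divmod[OF Q0 st] by (auto simp: l_def)
    have "\<not> annihilates t f"
    proof
      assume a: "annihilates t f"
      have "t = 0" using t min[OF _ a] less.prems(2) by force
      then have eq': "Polynomial.smult l P = Q * s" using eq by simp
      have lP: "Polynomial.smult l P = [:l:] * P" by simp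
      have "annihilates (Q * s) f" 
        using P(2) unfolding annihilates_def eq'[symmetric] lP by (simp add: eval2.hom_mult del: mult_pCons_left)
      then have "annihilates s f" using annihilates_mult[OF f] less.prems by blast
      moreover have "s \<noteq> 0" using eq' l P(1) by auto
      ultimately have "degree P \<le> degree s" using min by blast
      moreover have "degree P = degree Q + degree s"
        using eq' l Q0 \<open>s \<noteq> 0\<close> by (metis degree_mult_eq degree_smult_eq)
      ultimately show False using False by simp
    qed
    note nt = this
    then have dt: "degree t < degree Q" using t by (auto simp: annihilates_def)
    obtain a b R where R: "R \<noteq> 0" "a * P + b * t = [:R:]"
      using less.hyps[OF dt nt] less_trans[OF dt less.prems(2)] by blast
    have "t = [:l:] * P - Q * s" using eq by simp
    have "(a + b * [:l:]) * P + (- (b * s)) * Q = a * P + b * ([:l:] * P - Q * s)"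
      by (simp only: algebra_simps)
    also have "\<dots> = [:R:]" using R(2) \<open>t = _\<close> by simp
    finally have "(a + b * [:l:]) * P + (- (b * s)) * Q = [:R:]" .
    then show ?thesis using R(1) by blast
  qed
qed

text \<open>A Cauchy bound. It keeps the values of an algebraic function bounded as long as the
  leading coefficient stays away from 0.\<close>

lemma root_bound:
  fixes c :: "nat \<Rightarrow> complex"
  assumes "(\<Sum>i\<le>k. c i * x ^ i) = 0" "\<And>i. i < k \<Longrightarrow> cmod (c i) \<le> C" "m \<le> cmod (c k)" "0 < m" "0 \<le> C"
  shows "cmod x \<le> 1 + real k * C / m"
proof (cases "cmod x \<le> 1")
  case True
  then show ?thesis using assms by (simp add: add_increasing2)
next
  case False
  show ?thesis
  proof (cases k)
    case 0
    then show ?thesis using assms by simp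
  next
    case (Suc n)
    have "c k * x ^ k = - (\<Sum>i<k. c i * x ^ i)"
      using assms(1) by (simp add: lessThan_Suc_atMost[symmetric] eq_neg_iff_add_eq_0 add.commute)
    then have "cmod (c k) * cmod x ^ k = cmod (\<Sum>i<k. c i * x ^ i)"
      by (metis norm_minus_cancel norm_mult norm_power)
    also have "\<dots> \<le> (\<Sum>i<k. C * cmod x ^ n)"
    proof (rule sum_norm_le)
      fix i assume "i \<in> {..<k}"
      then show "cmod (c i * x ^ i) \<le> C * cmod x ^ n"
        using assms False Suc by (auto simp: norm_mult norm_power intro!: mult_mono power_increasing)
    qed
    finally have "cmod (c k) * cmod x * cmod x ^ n \<le> real k * C * cmod x ^ n" by (simp add: Suc mult_ac)
    moreover have "0 < cmod x ^ n" using False by (intro zero_less_power) linarith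
    ultimately have "cmod (c k) * cmod x \<le> real k * C" by simp
    moreover have "m * cmod x \<le> cmod (c k) * cmod x" using assms by (intro mult_right_mono) auto
    ultimately have "cmod x \<le> real k * C / m" using assms by (simp add: pos_le_divide_eq mult.commute)
    then show ?thesis by simp
  qed
qed


text \<open>The conjugate of the root is again a root in the same ball, whose centre is real;
  uniqueness makes the two equal.\<close>

lemma implicit_real:
  assumes u: "\<And>x. x \<in> ball a \<rho> \<Longrightarrow> eval2 P z x = 0 \<longleftrightarrow> x = w" and w: "w \<in> ball a \<rho>"
    and a: "a \<in> \<real>" and z: "z \<in> \<real>"
  shows "w \<in> \<real>"
proof -
  have "eval2 P z (cnj w) = cnj (eval2 P z w)"
    using eval2_cnj[of P z w] z by (simp add: Reals_cnj_iff)
  moreover have "cnj w \<in> ball a \<rho>"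
  proof -
    have "dist a (cnj w) = dist (cnj a) (cnj w)" using a by (simp add: Reals_cnj_iff)
    then show ?thesis using w by (simp add: dist_norm flip: complex_cnj_diff)
  qed
  ultimately have "cnj w = w" using u[of "cnj w"] u[OF w] by simp
  then show ?thesis by (simp add: Reals_cnj_iff)
qed

text \<open>The last clause is the dichotomy that drives the spectral argument: a branch that is
  real on the axis contributes no spectral density, while one with imaginary part at most
  \<open>- c\<close> contributes a positive amount.\<close>

definition extends_locally :: "(complex \<Rightarrow> complex) \<Rightarrow> real \<Rightarrow> real \<Rightarrow> (complex \<Rightarrow> complex) \<Rightarrow> bool" where
  "extends_locally f t r \<phi> \<longleftrightarrow> \<phi> holomorphic_on ball (of_real t) r \<and> 
    (\<forall>z\<in>ball (of_real t) r \<inter> uhp. \<phi> z = f z) \<and>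
    (\<exists>b. \<forall>z\<in>ball (of_real t) r. cmod (\<phi> z) \<le> b) \<and>
    ((\<forall>z\<in>ball (of_real t) r. z \<in> \<real> \<longrightarrow> \<phi> z \<in> \<real>) \<or> 
     (\<exists>c>0. \<forall>z\<in>ball (of_real t) r. Im (\<phi> z) \<le> - c))"

lemma extends_locally_mono:
  assumes "extends_locally f t r \<phi>" "r' \<le> r"
  shows "extends_locally f t r' \<phi>"
proof -
  have "ball (complex_of_real t) r' \<subseteq> ball (complex_of_real t) r" using assms(2) by (rule subset_ball)
  then show ?thesis using assms(1) unfolding extends_locally_def
    by (meson IntE IntI subsetD holomorphic_on_subset)
qed

text \<open>As z tends to t vertically, f stays bounded by \<open>root_bound\<close>, so a
  subsequence converges to some \<open>a\<close>, a root of P(t, .). The Bezout identity shows that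
  the root is simple. The implicit function theorem gives a branch through it, and the identity
  theorem shows that f is this branch.\<close>

lemma local_branch:
  fixes t :: real
  assumes f: "f holomorphic_on uhp" and Im: "\<And>z. z \<in> uhp \<Longrightarrow> Im (f z) \<le> 0"
    and P: "annihilates P f" and lc: "eval_rpoly (lead_coeff P) t \<noteq> 0"
    and R: "A * P + B * pderiv P = [:R:]" "eval_rpoly R t \<noteq> 0"
  shows "\<exists>r>0. \<exists>\<phi>. extends_locally f t r \<phi>"
proof -
  define zn where "zn n = Complex t (1 / (real n + 1))" for n
  have zn_uhp: "zn n \<in> uhp" for n by (simp add: zn_def)
  have inv0: "(\<lambda>n. 1 / (real n + 1)) \<longlonglongrightarrow> 0"
    using LIMSEQ_inverse_real_of_nat by (simp add: inverse_eq_divide add.commute)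
  have zn_lim: "zn \<longlonglongrightarrow> of_real t"
    unfolding zn_def[abs_def] complex_of_real_def by (intro tendsto_Complex tendsto_const inv0)
  define c where "c i z = eval_rpoly (coeff P i) z" for i z
  have c_lim: "(\<lambda>n. c i (zn n)) \<longlonglongrightarrow> c i (of_real t)" for i
    unfolding c_def eval_rpoly_explicit by (intro tendsto_intros zn_lim)
  let ?k = "degree P"
  have ck: "c ?k (of_real t) \<noteq> 0" using lc by (simp add: c_def)
  have "\<exists>C. \<forall>n. cmod (c i (zn n)) \<le> C" for i
    using convergent_imp_Bseq[OF convergentI[OF c_lim[of i]]] unfolding Bseq_def by blast
  then obtain C where C: "\<And>i n. cmod (c i (zn n)) \<le> C i" by metis
  define C' where "C' = (\<Sum>i<?k. \<bar>C i\<bar>)"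
  have C': "cmod (c i (zn n)) \<le> C'" if "i < ?k" for i n
  proof -
    have "cmod (c i (zn n)) \<le> \<bar>C i\<bar>" using C[of i n] by linarith
    also have "\<dots> \<le> C'" unfolding C'_def using that by (intro member_le_sum) auto
    finally show ?thesis .
  qed
  have "\<forall>\<^sub>F n in sequentially. cmod (c ?k (of_real t)) / 2 < cmod (c ?k (zn n))"
    using ck by (intro order_tendstoD(1)[OF tendsto_norm[OF c_lim]]) simp
  then obtain n0 where n0: "\<And>n. n0 \<le> n \<Longrightarrow> cmod (c ?k (of_real t)) / 2 < cmod (c ?k (zn n))"
    unfolding eventually_sequentially by blast
  have Pz: "eval2 P z (f z) = 0" if "z \<in> uhp" for z using P that by (simp add: annihilates_def)
  have "cmod (f (zn (n + n0))) \<le> 1 + real ?k * C' / (cmod (c ?k (of_real t)) / 2)" for n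
  proof (rule root_bound)
    show "(\<Sum>i\<le>?k. c i (zn (n + n0)) * f (zn (n + n0)) ^ i) = 0"
      using Pz[OF zn_uhp] by (simp add: eval2_sum_coeffs[OF order_refl] c_def)
    show "0 \<le> C'" by (simp add: C'_def sum_nonneg)
  qed (use C' n0[of "n + n0"] ck in auto)
  then have "bounded (range (\<lambda>n. f (zn (n + n0))))" by (auto simp: bounded_iff)
  then obtain a s where s: "strict_mono s" and a: "((\<lambda>n. f (zn (n + n0))) \<circ> s) \<longlonglongrightarrow> a"
    using bounded_imp_convergent_subsequence by blast
  define y where "y m = zn (s m + n0)" for m
  have y_uhp: "y m \<in> uhp" for m using zn_uhp by (simp add: y_def)
  have fy: "(\<lambda>m. f (y m)) \<longlonglongrightarrow> a" using a by (simp add: y_def o_def)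
  have "((\<lambda>n. zn (n + n0)) \<circ> s) \<longlonglongrightarrow> of_real t"
    by (intro LIMSEQ_subseq_LIMSEQ[OF _ s] LIMSEQ_ignore_initial_segment zn_lim)
  then have ylim: "y \<longlonglongrightarrow> of_real t" by (simp add: y_def[abs_def] o_def)
  have "(\<lambda>m. eval2 P (y m) (f (y m))) \<longlonglongrightarrow> eval2 P t a" by (rule tendsto_eval2[OF ylim fy])
  then have root: "eval2 P t a = 0" using Pz[OF y_uhp] by (simp add: LIMSEQ_const_iff)
  have "eval2 A t a * eval2 P t a + eval2 B t a * eval2 (pderiv P) t a = eval_rpoly R t"
    by (simp only: eval2.hom_mult[symmetric] eval2.hom_add[symmetric] R(1) eval2_const)
  then have simple: "eval2 (pderiv P) t a \<noteq> 0" using root R(2) by auto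
  have Ima: "Im a \<le> 0" 
    by (rule LIMSEQ_le_const2[OF tendsto_Im[OF fy]]) (use Im[OF y_uhp] in auto)
  \<comment> \<open>For nonreal \<open>a\<close>, half its distance to the real axis: the branch
    then keeps imaginary part at most \<open>Im a / 2\<close>.\<close>
  define \<sigma> where "\<sigma> = (if a \<in> \<real> then 1 else - Im a / 2)"
  have \<sigma>: "0 < \<sigma>" using Ima by (auto simp: \<sigma>_def complex_is_Real_iff)
  obtain r \<rho> \<phi> where r: "0 < r" "0 < \<rho>" "\<rho> \<le> \<sigma>" and \<phi>: "\<phi> holomorphic_on ball (of_real t) r"
    and \<phi>1: "\<And>z. z \<in> ball (of_real t) r \<Longrightarrow> \<phi> z \<in> ball a \<rho>"
    and \<phi>2: "\<And>z x. z \<in> ball (of_real t) r \<Longrightarrow> x \<in> ball a \<rho> \<Longrightarrow> eval2 P z x = 0 \<longleftrightarrow> x = \<phi> z"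
    using implicit_function_eval2[OF root simple \<sigma>] by blast
  let ?S = "ball (of_real t) r \<inter> uhp"
  have S: "open ?S" "topological_space_class.connected ?S"
    using open_uhp by (auto intro!: convex_connected convex_Int convex_halfspace_Im_gt)
  have "\<forall>\<^sub>F m in sequentially. y m \<in> ball (of_real t) r" 
    using tendstoD[OF ylim r(1)] by (simp add: dist_commute)
  moreover have "\<forall>\<^sub>F m in sequentially. f (y m) \<in> ball a \<rho>" 
    using tendstoD[OF fy r(2)] by (simp add: dist_commute)
  ultimately have "\<forall>\<^sub>F m in sequentially. y m \<in> ball (of_real t) r \<and> f (y m) \<in> ball a \<rho>"
    by (rule eventually_conj)
  then have "\<exists>m. y m \<in> ball (of_real t) r \<and> f (y m) \<in> ball a \<rho>"
    by (rule eventually_happens'[OF sequentially_bot])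
  then obtain m where m: "y m \<in> ball (of_real t) r" "f (y m) \<in> ball a \<rho>" by blast
  \<comment> \<open>On this open set f is the only root in the ball around \<open>a\<close>, hence
    equal to \<open>\<phi>\<close>; it contains \<open>y m\<close>, from which the identity theorem
    spreads the equality over the half ball.\<close>
  let ?U = "{z \<in> ?S. f z \<in> ball a \<rho>}"
  have "continuous_on ?S f" by (intro holomorphic_on_imp_continuous_on holomorphic_on_subset[OF f]) auto
  then have U: "open ?U"
    using continuous_open_preimage[OF _ S(1), of f "ball a \<rho>"] by (simp add: vimage_def Int_def)
  have agree: "\<phi> z = f z" if z: "z \<in> ?S" for z
  proof -
    have "\<phi> z - f z = 0"
    proof (rule analytic_continuation[of "\<lambda>z. \<phi> z - f z" ?S ?U "y m"])
      show "(\<lambda>z. \<phi> z - f z) holomorphic_on ?S"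
        by (intro holomorphic_on_diff holomorphic_on_subset[OF \<phi>] holomorphic_on_subset[OF f]) auto
      show "y m islimpt ?U" using U m y_uhp[of m] by (intro interior_limit_point) (simp add: interior_open)
      show "\<phi> w - f w = 0" if "w \<in> ?U" for w using that \<phi>2[of w "f w"] Pz[of w] by auto
    qed (use S m y_uhp[of m] z in auto)
    then show ?thesis by simp
  qed
  have bd: "cmod (\<phi> z) \<le> cmod a + \<rho>" if "z \<in> ball (of_real t) r" for z
    using \<phi>1[OF that] norm_triangle_ineq[of a "\<phi> z - a"] by (simp add: dist_norm norm_minus_commute)
  have "(\<forall>z\<in>ball (of_real t) r. z \<in> \<real> \<longrightarrow> \<phi> z \<in> \<real>) \<or> (\<exists>c>0. \<forall>z\<in>ball (of_real t) r. Im (\<phi> z) \<le> - c)"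
  proof (cases "a \<in> \<real>")
    case True
    then show ?thesis using implicit_real[of a \<rho> P] \<phi>1 \<phi>2 by blast
  next
    case False
    have "Im (\<phi> z) \<le> - (- Im a / 2)" if "z \<in> ball (of_real t) r" for z
      using \<phi>1[OF that] r(3) False abs_Im_le_cmod[of "a - \<phi> z"] by (simp add: \<sigma>_def dist_norm)
    moreover have "0 < - Im a / 2" using \<sigma> False by (simp add: \<sigma>_def)
    ultimately show ?thesis by blast
  qed
  then have "extends_locally f t r \<phi>" unfolding extends_locally_def using \<phi> agree bd by blast
  then show ?thesis using r(1) by blast
qed

text \<open>An annihilator \<open>P\<close> of least degree is not annihilated together with its
  derivative, so the two are coprime up to some \<open>R\<close> in R[z]. The excluded points are
  the real zeros of the leading coefficient of \<open>P\<close> and of \<open>R\<close>.\<close>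

lemma algebraic_local_branches:
  assumes f: "f holomorphic_on uhp" and Im: "\<And>z. z \<in> uhp \<Longrightarrow> Im (f z) \<le> 0"
    and alg: "\<exists>P. P \<noteq> 0 \<and> annihilates P f"
  shows "\<exists>F::real set. finite F \<and> (\<forall>t. t \<notin> F \<longrightarrow> (\<exists>r>0. \<exists>\<phi>. extends_locally f t r \<phi>))"
proof -
  obtain P where P: "P \<noteq> 0 \<and> annihilates P f"
    and min: "\<And>Q. Q \<noteq> 0 \<and> annihilates Q f \<Longrightarrow> degree P \<le> degree Q"
    using ex_has_least_nat[of "\<lambda>P. P \<noteq> 0 \<and> annihilates P f" _ degree] alg by metis
  have deg: "degree P \<noteq> 0"
  proof
    assume "degree P = 0"
    then obtain c where "P = [:c:]" by (metis degree_eq_zeroE)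
    then show False using P annihilates_const by auto
  qed
  then have "pderiv P \<noteq> 0" by (simp add: pderiv_eq_0_iff)
  moreover have dlt: "degree (pderiv P) < degree P" using deg by (simp add: degree_pderiv)
  ultimately have "\<not> annihilates (pderiv P) f" using min by force
  then have "\<exists>a b R. R \<noteq> 0 \<and> a * P + b * pderiv P = [:R:]"
    using P min by (intro coprime_to_minimal[OF f _ _ _ _ dlt]) simp_all
  then obtain A B R where R: "R \<noteq> 0" "A * P + B * pderiv P = [:R:]" by blast
  let ?F = "{t. poly (lead_coeff P) t = 0} \<union> {t. poly R t = 0}"
  show ?thesis
  proof (intro exI[of _ ?F] conjI allI impI)
    show "finite ?F" using P R by (simp add: poly_roots_finite)
    fix t assume "t \<notin> ?F"
    then have "eval_rpoly (lead_coeff P) t \<noteq> 0" "eval_rpoly R t \<noteq> 0" by (simp_all add: eval_rpoly_of_real)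
    then show "\<exists>r>0. \<exists>\<phi>. extends_locally f t r \<phi>"
      by (intro local_branch[OF f Im _ _ R(2)]) (simp_all add: P)
  qed
qed

section \<open>Algebraicity of the Green functions by cubic perturbation\<close>

text \<open>Its fixed points are the solutions of the cubic system with \<open>u = 1 / s\<close>,
  solved for the term z X_i; at \<open>s = 0\<close> they are the Green function values. Dividing by
  a large z makes the map a contraction of the unit polydisc.\<close>

definition perturb :: "('i \<Rightarrow> 'i set) \<Rightarrow> complex \<Rightarrow> real \<Rightarrow> ('i \<Rightarrow> complex) \<Rightarrow> 'i \<Rightarrow> complex" where
  "perturb N z s f i = (1 + f i * sum f (N i) - of_real s * f i ^ 3) / z"

context cf_system
begin

lemma perturb_bound:
  assumes z: "4 * D + 8 \<le> cmod z" and s: "0 \<le> s" "s \<le> 1"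
    and f: "\<And>i. i \<in> I \<Longrightarrow> cmod (f i) \<le> 1" and i: "i \<in> I"
  shows "cmod (perturb N z s f i) \<le> 1"
proof -
  have z0: "0 < cmod z" using z D_pos by linarith
  have "cmod (sum f (N i)) \<le> D * 1"
    by (rule order.trans[OF norm_sum]) (rule sum_N_bound[OF i f], auto)
  then have "cmod (f i) * cmod (sum f (N i)) \<le> 1 * (D * 1)"
    using f[OF i] by (intro mult_mono) auto
  moreover have "s * cmod (f i) ^ 3 \<le> 1 * 1"
    using f[OF i] s by (intro mult_mono power_le_one) auto
  moreover have "cmod (1 + f i * sum f (N i) - of_real s * f i ^ 3) 
      \<le> 1 + cmod (f i) * cmod (sum f (N i)) + s * cmod (f i) ^ 3"
    using norm_triangle_ineq4[of "1 + f i * sum f (N i)" "of_real s * f i ^ 3"]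
      norm_triangle_ineq[of 1 "f i * sum f (N i)"] s by (simp add: norm_mult norm_power)
  ultimately have "cmod (1 + f i * sum f (N i) - of_real s * f i ^ 3) \<le> cmod z" using z D_pos by linarith
  then show ?thesis using z0 by (simp add: perturb_def norm_divide)
qed

lemma perturb_contraction:
  assumes z: "4 * D + 8 \<le> cmod z" and s: "0 \<le> s" "s \<le> 1"
    and f: "\<And>i. i \<in> I \<Longrightarrow> cmod (f i) \<le> 1" and g: "\<And>i. i \<in> I \<Longrightarrow> cmod (g i) \<le> 1"
    and fg: "\<And>i. i \<in> I \<Longrightarrow> cmod (f i - g i) \<le> e" and i: "i \<in> I"
  shows "cmod (perturb N z s f i - perturb N z s g i) \<le> e / 2"
proof -
  have z0: "0 < cmod z" using z D_pos by linarith
  have e: "0 \<le> e" using fg[OF i] norm_ge_zero order.trans by blast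
  have sf: "cmod (sum f (N i)) \<le> D * 1"
    by (rule order.trans[OF norm_sum]) (rule sum_N_bound[OF i f], auto)
  have sfg: "cmod (sum f (N i) - sum g (N i)) \<le> D * e"
    unfolding sum_subtractf[symmetric]
    by (rule order.trans[OF norm_sum]) (rule sum_N_bound[OF i fg e], auto)
  have 1: "cmod ((f i - g i) * sum f (N i)) \<le> e * (D * 1)"
    unfolding norm_mult using fg[OF i] sf e by (intro mult_mono) auto
  have 2: "cmod (g i * (sum f (N i) - sum g (N i))) \<le> 1 * (D * e)"
    unfolding norm_mult using g[OF i] sfg by (intro mult_mono) auto
  have c: "cmod (f i ^ 2 + f i * g i + g i ^ 2) \<le> 3"
  proof -
    have "cmod (f i ^ 2 + f i * g i + g i ^ 2) \<le> cmod (f i) ^ 2 + cmod (f i) * cmod (g i) + cmod (g i) ^ 2"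
      by (metis (no_types, lifting) add_right_mono norm_mult norm_power norm_triangle_ineq order.trans)
    moreover have "cmod (f i) ^ 2 \<le> 1" "cmod (g i) ^ 2 \<le> 1" "cmod (f i) * cmod (g i) \<le> 1"
      using f[OF i] g[OF i] by (auto intro: power_le_one mult_le_one)
    ultimately show ?thesis by linarith
  qed
  have 3: "cmod (of_real s * ((f i - g i) * (f i ^ 2 + f i * g i + g i ^ 2))) \<le> 1 * (e * 3)"
    unfolding norm_mult using s c fg[OF i] e by (intro mult_mono) auto
  have "perturb N z s f i - perturb N z s g i = ((f i - g i) * sum f (N i) + g i * (sum f (N i) - sum g (N i))
     - of_real s * ((f i - g i) * (f i ^ 2 + f i * g i + g i ^ 2))) / z"
    unfolding perturb_def diff_divide_distrib[symmetric] by (simp add: algebra_simps power2_eq_square power3_eq_cube)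
  then have "cmod (perturb N z s f i - perturb N z s g i) = cmod ((f i - g i) * sum f (N i) + g i * (sum f (N i) - sum g (N i))
     - of_real s * ((f i - g i) * (f i ^ 2 + f i * g i + g i ^ 2))) / cmod z"
    by (simp add: norm_divide)
  also have "\<dots> \<le> (e * (D * 1) + 1 * (D * e) + 1 * (e * 3)) / cmod z"
    using norm_triangle_ineq4[of "(f i - g i) * sum f (N i) + g i * (sum f (N i) - sum g (N i))"
        "of_real s * ((f i - g i) * (f i ^ 2 + f i * g i + g i ^ 2))"]
      norm_triangle_ineq[of "(f i - g i) * sum f (N i)" "g i * (sum f (N i) - sum g (N i))"] 1 2 3
    by (intro divide_right_mono) (linarith, simp)
  \<comment> \<open>The numerator is \<open>e\<close> times \<open>2 * D + 3\<close>, at most half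
    of \<open>cmod z\<close> by the assumption on \<open>z\<close>.\<close>
  also have "\<dots> \<le> e / 2"
  proof -
    have "e * (4 * D + 6) \<le> e * cmod z" using z e by (intro mult_left_mono) auto
    then show ?thesis using z0 by (simp add: field_simps)
  qed
  finally show ?thesis .
qed

text \<open>An exact solution \<open>x\<close> of the unperturbed system is moved by at most
  \<open>s\<close>, since its defect is s x_i^3 / z. Iterating a map that contracts by 1/2 from
  there moves it by at most \<open>2 * s\<close> in total.\<close>

lemma perturbed_solution:
  assumes z: "4 * D + 8 \<le> cmod z" and s: "0 \<le> s" "s \<le> 1"
    and x: "\<And>i. i \<in> I \<Longrightarrow> cmod (x i) \<le> 1" 
    and eq: "\<And>i. i \<in> I \<Longrightarrow> x i * (z - sum x (N i)) = 1"
  shows "\<exists>Y. \<forall>i\<in>I. perturb N z s Y i = Y i \<and> cmod (Y i - x i) \<le> 2 * s"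
proof -
  have z1: "1 \<le> cmod z" and z0: "z \<noteq> 0" using z D_pos by auto
  define h where "h k = ((perturb N z s) ^^ k) x" for k
  have hS: "h (Suc k) = perturb N z s (h k)" for k by (simp add: h_def)
  have hb: "i \<in> I \<Longrightarrow> cmod (h k i) \<le> 1" for k i
  proof (induction k arbitrary: i)
    case 0 then show ?case using x by (simp add: h_def)
  next
    case (Suc k) then show ?case unfolding hS by (intro perturb_bound[OF z s]) auto
  qed
  have hd: "i \<in> I \<Longrightarrow> cmod (h (Suc k) i - h k i) \<le> s * (1 / 2) ^ k" for k i
  proof (induction k arbitrary: i)
    case 0
    have "1 + x i * sum x (N i) = x i * z" using eq[OF 0] by (simp add: algebra_simps)
    then have "h (Suc 0) i - h 0 i = - (of_real s * x i ^ 3) / z"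
      using z0 by (simp add: h_def perturb_def field_simps)
    then have "cmod (h (Suc 0) i - h 0 i) = s * cmod (x i) ^ 3 / cmod z"
      using s by (simp add: norm_divide norm_mult norm_power)
    also have "\<dots> \<le> s * 1 / 1"
      using s x[OF 0] z1 by (intro frac_le mult_mono power_le_one) auto
    finally show ?case by simp
  next
    case (Suc k)
    have "cmod (perturb N z s (h (Suc k)) i - perturb N z s (h k) i) \<le> (s * (1 / 2) ^ k) / 2"
      by (rule perturb_contraction[OF z s]) (use hb Suc in auto)
    then show ?case by (simp add: hS)
  qed
  have g: "(\<lambda>k. s * (1 / 2) ^ k) sums (2 * s)" 
    using sums_mult[OF geometric_sums[of "1 / 2 :: real"], of s] by (simp add: mult.commute)
  define Y where "Y i = x i + (\<Sum>k. h (Suc k) i - h k i)" for i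
  have lim: "(\<lambda>k. h k i) \<longlonglongrightarrow> Y i" and close: "cmod (Y i - x i) \<le> 2 * s" if i: "i \<in> I" for i
  proof -
    have sm: "summable (\<lambda>k. h (Suc k) i - h k i)"
      by (rule summable_comparison_test'[OF sums_summable[OF g]]) (rule hd[OF i])
    have "(\<lambda>n. \<Sum>k<n. h (Suc k) i - h k i) \<longlonglongrightarrow> (\<Sum>k. h (Suc k) i - h k i)"
      using summable_LIMSEQ[OF sm] .
    then have "(\<lambda>n. x i + (\<Sum>k<n. h (Suc k) i - h k i)) \<longlonglongrightarrow> Y i"
      unfolding Y_def by (intro tendsto_intros)
    then show "(\<lambda>k. h k i) \<longlonglongrightarrow> Y i"
      unfolding sum_lessThan_telescope[of "\<lambda>k. h k i"] by (simp add: h_def)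
    have "cmod (\<Sum>k. h (Suc k) i - h k i) \<le> (\<Sum>k. s * (1 / 2) ^ k)"
      by (rule norm_suminf_le[OF hd[OF i] sums_summable[OF g]])
    then show "cmod (Y i - x i) \<le> 2 * s" using sums_unique[OF g] by (simp add: Y_def)
  qed
  have "perturb N z s Y i = Y i" if i: "i \<in> I" for i
  proof (rule LIMSEQ_unique)
    show "(\<lambda>k. h (Suc k) i) \<longlonglongrightarrow> Y i" by (rule LIMSEQ_Suc[OF lim[OF i]])
    have "j \<in> N i \<Longrightarrow> j \<in> I" for j using N[OF i] by blast
    then show "(\<lambda>k. h (Suc k) i) \<longlonglongrightarrow> perturb N z s Y i"
      unfolding hS perturb_def using z0
      by (intro tendsto_divide tendsto_diff tendsto_add tendsto_mult tendsto_sum tendsto_power tendsto_const lim i) auto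
  qed
  with close show ?thesis by blast
qed

text \<open>For Im z large, \<open>green z\<close> is the limit of solutions of the cubic systems
  with \<open>s = 1 / (n + 1)\<close>, so the part of the eliminant leading in u annihilates it. The
  identity theorem carries this to the whole half-plane.\<close>

lemma green_algebraic:
  assumes i: "i \<in> I"
  shows "\<exists>P. P \<noteq> 0 \<and> annihilates P (\<lambda>z. green z i)"
proof -
  from eliminant[OF fin N i] obtain Q :: "real poly poly poly" where Q: "Q \<noteq> 0 \<and> 
    (\<forall>X z u. cubic_sol I N z u X \<longrightarrow> poly (map_poly (\<lambda>c. eval2 c z u) Q) (X i) = 0)" by (rule exE)
  note Qs = Q[THEN conjunct2, rule_format]
  from leading_part[OF Q[THEN conjunct1]] obtain P where P: "P \<noteq> 0 \<and> (\<forall>(z::complex) (x::complex) 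
     (X::nat \<Rightarrow> complex) (s::nat \<Rightarrow> complex).
     (\<forall>n. s n \<noteq> 0 \<and> poly (map_poly (\<lambda>c. eval2 c z (1 / s n)) Q) (X n) = 0) \<longrightarrow>
     s \<longlonglongrightarrow> 0 \<longrightarrow> X \<longlonglongrightarrow> x \<longrightarrow> eval2 P z x = 0)" by (rule exE)
  note Pl = P[THEN conjunct2, rule_format]
  have csd: "cubic_sol I N z u X \<longleftrightarrow> (\<forall>i\<in>I. X i ^ 3 = u * (1 - z * X i + (\<Sum>j\<in>N i. X i * X j)))" 
    for z u X by (rule cubic_sol_def[OF fin N])
  have large: "eval2 P z (green z i) = 0" if z: "4 * D + 8 < Im z" for z
  proof -
    have z1: "0 < Im z" "1 \<le> Im z" "z \<noteq> 0" using z D_pos by auto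
    have cz: "4 * D + 8 \<le> cmod z" using z abs_Im_le_cmod[of z] by linarith
    have b: "cmod (green z j) \<le> 1" if "j \<in> I" for j
      using green_props(2)[OF z1(1) that] z1 by (auto intro: order.trans)
    define s where "s n = 1 / (real n + 1)" for n
    have s01: "0 < s n" "s n \<le> 1" for n by (auto simp: s_def)
    have "\<exists>Y. \<forall>j\<in>I. perturb N z (s n) Y j = Y j \<and> cmod (Y j - green z j) \<le> 2 * s n" for n
      using s01[of n] by (intro perturbed_solution[OF cz] b green_eq[OF z1(1)]) auto
    then obtain Y where Y: "\<And>n j. j \<in> I \<Longrightarrow> perturb N z (s n) (Y n) j = Y n j"
       "\<And>n j. j \<in> I \<Longrightarrow> cmod (Y n j - green z j) \<le> 2 * s n" by metis
    have slim: "s \<longlonglongrightarrow> 0" unfolding s_def[abs_def]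
      using LIMSEQ_inverse_real_of_nat by (simp add: inverse_eq_divide add.commute)
    show ?thesis
    proof (rule Pl[where X = "\<lambda>n. Y n i" and s = "\<lambda>n. complex_of_real (s n)"])
      fix n
      have "cubic_sol I N z (1 / of_real (s n)) (Y n)"
        unfolding csd
      proof
        fix j assume j: "j \<in> I"
        have "1 + Y n j * sum (Y n) (N j) - of_real (s n) * Y n j ^ 3 = Y n j * z"
          using Y(1)[OF j, of n] z1 by (simp add: perturb_def field_simps)
        then have "of_real (s n) * Y n j ^ 3 = 1 - z * Y n j + Y n j * sum (Y n) (N j)"
          by (simp add: algebra_simps)
        then show "Y n j ^ 3 = 1 / of_real (s n) * (1 - z * Y n j + (\<Sum>k\<in>N j. Y n j * Y n k))"
          using s01(1)[of n] by (simp add: sum_distrib_left field_simps)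
      qed
      then show "complex_of_real (s n) \<noteq> 0 \<and> poly (map_poly (\<lambda>c. eval2 c z (1 / complex_of_real (s n))) Q) (Y n i) = 0"
        using Qs s01(1)[of n] by simp
    next
      show "(\<lambda>n. complex_of_real (s n)) \<longlonglongrightarrow> 0" using tendsto_of_real[OF slim] by simp
      have "(\<lambda>n. Y n i - green z i) \<longlonglongrightarrow> 0"
      proof (rule Lim_null_comparison)
        show "(\<lambda>n. 2 * s n) \<longlonglongrightarrow> 0" using tendsto_mult_right_zero[OF slim] by simp
      qed (use Y(2)[OF i] in auto)
      then show "(\<lambda>n. Y n i) \<longlonglongrightarrow> green z i" by (simp add: LIM_zero_iff)
    qed
  qed
  have "eval2 P z (green z i) = 0" if z: "z \<in> uhp" for z
  proof (rule analytic_continuation[of "\<lambda>z. eval2 P z (green z i)" uhp "{z. 4 * D + 8 < Im z}" "Complex 0 (4 * D + 9)"])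
    show "(\<lambda>z. eval2 P z (green z i)) holomorphic_on uhp"
      by (intro holomorphic_eval2 green_holomorphic i)
    show "Complex 0 (4 * D + 9) islimpt {z. 4 * D + 8 < Im z}"
      using D_pos by (intro interior_limit_point) (simp add: interior_open open_halfspace_Im_gt)
    show "{z. 4 * D + 8 < Im z} \<subseteq> uhp" using D_pos by auto
  qed (use D_pos z large open_uhp connected_uhp in auto)
  then show ?thesis using P unfolding annihilates_def by blast
qed

lemma exceptional_set:
  "\<exists>F::real set. finite F \<and> (\<forall>t. t \<notin> F \<longrightarrow> (\<exists>r>0. \<forall>i\<in>I. \<exists>\<phi>. extends_locally (\<lambda>z. green z i) t r \<phi>))"
proof -
  have "\<exists>F::real set. finite F \<and> (\<forall>t. t \<notin> F \<longrightarrow> (\<exists>r>0. \<exists>\<phi>. extends_locally (\<lambda>z. green z i) t r \<phi>))" 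
    if i: "i \<in> I" for i
    by (rule algebraic_local_branches[OF green_holomorphic[OF i] _ green_algebraic[OF i]])
      (use green_props(1)[OF _ i] in \<open>simp add: less_imp_le\<close>)
  then obtain F where F: "\<And>i. i \<in> I \<Longrightarrow> finite (F i :: real set)"
    "\<And>i t. i \<in> I \<Longrightarrow> t \<notin> F i \<Longrightarrow> \<exists>r>0. \<exists>\<phi>. extends_locally (\<lambda>z. green z i) t r \<phi>" by metis
  have "\<exists>r>0. \<forall>i\<in>I. \<exists>\<phi>. extends_locally (\<lambda>z. green z i) t r \<phi>" if t: "t \<notin> \<Union>(F ` I)" for t
  proof -
    have "\<forall>i\<in>I. \<exists>r. 0 < r \<and> (\<exists>\<phi>. extends_locally (\<lambda>z. green z i) t r \<phi>)" using F(2) t by blast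
    then obtain r where r: "\<And>i. i \<in> I \<Longrightarrow> 0 < r i \<and> (\<exists>\<phi>. extends_locally (\<lambda>z. green z i) t (r i) \<phi>)"
      by metis
    define m where "m = Min (insert 1 (r ` I))"
    have m: "0 < m" unfolding m_def using fin r by (subst Min_gr_iff) auto
    have mr: "m \<le> r i" if "i \<in> I" for i unfolding m_def using fin that by (intro Min_le) auto
    have "\<exists>\<phi>. extends_locally (\<lambda>z. green z i) t m \<phi>" if i: "i \<in> I" for i
      using r[OF i] extends_locally_mono[OF _ mr[OF i]] by blast
    then show ?thesis using m by blast
  qed
  moreover have "finite (\<Union>(F ` I))" using fin F(1) by blast
  ultimately show ?thesis by blast
qed

end

section \<open>Square-summable functions and bounded-degree adjacency operators\<close>

definition sqsum :: "('v \<Rightarrow> complex) \<Rightarrow> bool" where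
  "sqsum f \<longleftrightarrow> (\<lambda>x. (cmod (f x))\<^sup>2) summable_on UNIV"

text \<open>Bilinear, without conjugation: Green kernels at nonreal z are symmetric and not
  Hermitian, and this is the form in which that symmetry is expressed.\<close>

definition pair :: "('v \<Rightarrow> complex) \<Rightarrow> ('v \<Rightarrow> complex) \<Rightarrow> complex" where
  "pair f g = (\<Sum>\<^sub>\<infinity>x. f x * g x)"

lemma norm_mult_le_squares: "norm (a * b) \<le> (cmod a)\<^sup>2 + (cmod b)\<^sup>2" for a b :: complex
  using sum_squares_bound[of "cmod a" "cmod b"] mult_nonneg_nonneg[OF norm_ge_zero[of a] norm_ge_zero[of b]]
  unfolding norm_mult by linarith

lemma sqsum_mult:
  assumes "sqsum f" "sqsum g"
  shows "(\<lambda>x. norm (f x * g x)) summable_on UNIV"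
proof (rule Infinite_Sum.abs_summable_on_comparison_test')
  show "(\<lambda>x. (cmod (f x))\<^sup>2 + (cmod (g x))\<^sup>2) summable_on UNIV"
    using assms unfolding sqsum_def by (rule summable_on_add)
  show "norm (f x * g x) \<le> (cmod (f x))\<^sup>2 + (cmod (g x))\<^sup>2" for x
    using norm_mult_le_squares .
qed

lemma sqsum_mult': "sqsum f \<Longrightarrow> sqsum g \<Longrightarrow> (\<lambda>x. f x * g x) summable_on UNIV"
  by (rule abs_summable_summable[OF sqsum_mult])

lemma sqsum_comparison:
  assumes "sqsum g" "\<And>x. (cmod (f x))\<^sup>2 \<le> c * (cmod (g x))\<^sup>2"
  shows "sqsum f"
  unfolding sqsum_def
  by (rule summable_on_comparison_test[where f = "\<lambda>x. c * (cmod (g x))\<^sup>2"])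
    (use assms in \<open>auto simp: sqsum_def intro: summable_on_cmult_right\<close>)

lemma sqsum_add:
  assumes "sqsum f" "sqsum g"
  shows "sqsum (\<lambda>x. f x + g x)"
  unfolding sqsum_def
proof (rule summable_on_comparison_test)
  show "(\<lambda>x. 2 * (cmod (f x))\<^sup>2 + 2 * (cmod (g x))\<^sup>2) summable_on UNIV"
    using assms unfolding sqsum_def by (intro summable_on_add summable_on_cmult_right)
  show "(cmod (f x + g x))\<^sup>2 \<le> 2 * (cmod (f x))\<^sup>2 + 2 * (cmod (g x))\<^sup>2" for x
  proof -
    have "(cmod (f x + g x))\<^sup>2 \<le> (cmod (f x) + cmod (g x))\<^sup>2"
      by (intro power_mono norm_triangle_ineq) simp
    also have "\<dots> \<le> 2 * (cmod (f x))\<^sup>2 + 2 * (cmod (g x))\<^sup>2"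
      using sum_squares_bound[of "cmod (f x)" "cmod (g x)"] by (simp add: power2_sum)
    finally show ?thesis .
  qed
qed simp

lemma sqsum_cmult: "sqsum f \<Longrightarrow> sqsum (\<lambda>x. c * f x)"
  by (rule sqsum_comparison[where c = "(cmod c)\<^sup>2"]) (auto simp: norm_mult power_mult_distrib)

lemma sqsum_zero: "sqsum (\<lambda>_. 0)"
  by (simp add: sqsum_def)

lemma sqsum_uminus: "sqsum f \<Longrightarrow> sqsum (\<lambda>x. - f x)"
  by (simp add: sqsum_def)

lemma sqsum_diff: "sqsum f \<Longrightarrow> sqsum g \<Longrightarrow> sqsum (\<lambda>x. f x - g x)"
  using sqsum_add[of f "\<lambda>x. - g x"] by (simp add: sqsum_uminus)

lemma sqsum_cnj: "sqsum f \<Longrightarrow> sqsum (\<lambda>x. cnj (f x))"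
  by (simp add: sqsum_def)

lemma sqsum_finite: 
  assumes "finite S" "\<And>x. x \<notin> S \<Longrightarrow> f x = 0" shows "sqsum f"
proof -
  have "(\<lambda>x. (cmod (f x))\<^sup>2) summable_on S" using assms(1) by simp
  then show ?thesis unfolding sqsum_def 
    by (rule summable_on_cong_neutral[THEN iffD1, rotated -1]) (use assms(2) in auto)
qed

lemma pair_commute: "pair f g = pair g f"
  by (simp add: pair_def mult.commute)

lemma pair_add_left: 
  "sqsum f \<Longrightarrow> sqsum f' \<Longrightarrow> sqsum g \<Longrightarrow> pair (\<lambda>x. f x + f' x) g = pair f g + pair f' g"
  unfolding pair_def distrib_right by (rule infsum_add) (auto intro: sqsum_mult')

lemma pair_cmult_left: "pair (\<lambda>x. c * f x) g = c * pair f g"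
  unfolding pair_def mult.assoc by (rule infsum_cmult_right')

lemma pair_cmult_right: "pair f (\<lambda>x. c * g x) = c * pair f g"
  using pair_cmult_left[of c g f] by (simp add: pair_commute)

lemma pair_minus_right: "pair f (\<lambda>x. - g x) = - pair f g"
  using pair_cmult_right[of f "-1" g] by simp

lemma pair_diff_right: 
  assumes "sqsum f" "sqsum f'" "sqsum g" shows "pair g (\<lambda>x. f x - f' x) = pair g f - pair g f'"
  using pair_add_left[OF assms(1) sqsum_uminus[OF assms(2)] assms(3)] 
  by (simp only: pair_commute[of _ g] pair_minus_right diff_conv_add_uminus)

lemma pair_diff_left: 
  assumes "sqsum f" "sqsum f'" "sqsum g" shows "pair (\<lambda>x. f x - f' x) g = pair f g - pair f' g"
  using pair_diff_right[OF assms] by (simp only: pair_commute[of _ g])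

lemma pair_cnj: "pair (\<lambda>x. cnj (f x)) (\<lambda>x. cnj (g x)) = cnj (pair f g)"
  unfolding pair_def by (simp flip: complex_cnj_mult infsum_cnj)

text \<open>Made a type so that the theory of real inner product spaces applies, with the real part
  of the Hermitian product as inner product. Complex multiples are kept apart, as
  \<open>cscale\<close>.\<close>

typedef 'v l2 = "{f :: 'v \<Rightarrow> complex. sqsum f}"
  using sqsum_zero by blast

setup_lifting type_definition_l2

lemma sqsum_Rep: "sqsum (Rep_l2 u)"
  using Rep_l2 by blast

instantiation l2 :: (type) real_vector
begin

lift_definition zero_l2 :: "'a l2" is "\<lambda>_. 0" by (rule sqsum_zero)
lift_definition plus_l2 :: "'a l2 \<Rightarrow> 'a l2 \<Rightarrow> 'a l2" is "\<lambda>f g x. f x + g x" by (rule sqsum_add)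
lift_definition minus_l2 :: "'a l2 \<Rightarrow> 'a l2 \<Rightarrow> 'a l2" is "\<lambda>f g x. f x - g x" by (rule sqsum_diff)
lift_definition uminus_l2 :: "'a l2 \<Rightarrow> 'a l2" is "\<lambda>f x. - f x" by (rule sqsum_uminus)
lift_definition scaleR_l2 :: "real \<Rightarrow> 'a l2 \<Rightarrow> 'a l2" is "\<lambda>c f x. of_real c * f x" by (rule sqsum_cmult)

instance
proof
  fix u v w :: "'a l2" and a b :: real
  show "u + v + w = u + (v + w)" by transfer (simp add: add.assoc)
  show "u + v = v + u" by transfer (simp add: add.commute)
  show "0 + u = u" by transfer simp
  show "- u + u = 0" by transfer simp
  show "u - v = u + - v" by transfer simp
  show "a *\<^sub>R (u + v) = a *\<^sub>R u + a *\<^sub>R v" by transfer (simp add: distrib_left)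
  show "(a + b) *\<^sub>R u = a *\<^sub>R u + b *\<^sub>R u" by transfer (simp add: distrib_right)
  show "a *\<^sub>R b *\<^sub>R u = (a * b) *\<^sub>R u" by transfer (simp add: mult.assoc)
  show "1 *\<^sub>R u = u" by transfer simp
qed

end

instantiation l2 :: (type) real_inner
begin

lift_definition inner_l2 :: "'a l2 \<Rightarrow> 'a l2 \<Rightarrow> real" is "\<lambda>f g. Re (pair f (\<lambda>x. cnj (g x)))" .
definition norm_l2 :: "'a l2 \<Rightarrow> real" where "norm_l2 u = sqrt (inner u u)"
definition dist_l2 :: "'a l2 \<Rightarrow> 'a l2 \<Rightarrow> real" where "dist_l2 u v = norm (u - v)"
definition sgn_l2 :: "'a l2 \<Rightarrow> 'a l2" where "sgn_l2 u = u /\<^sub>R norm u"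
definition uniformity_l2 :: "('a l2 \<times> 'a l2) filter" where
  "uniformity_l2 = (INF e\<in>{0 <..}. principal {(x, y). dist x y < e})"
definition open_l2 :: "'a l2 set \<Rightarrow> bool" where
  "open_l2 U = (\<forall>x\<in>U. eventually (\<lambda>(x', y). x' = x \<longrightarrow> y \<in> U) uniformity)"

lemma pair_self: "sqsum f \<Longrightarrow> pair f (\<lambda>x. cnj (f x)) = of_real (\<Sum>\<^sub>\<infinity>x. (cmod (f x))\<^sup>2)"
  unfolding pair_def complex_norm_square[symmetric] sqsum_def
  by (intro infsumI has_sum_of_real has_sum_infsum)

instance
proof
  fix u v w :: "'a l2" and a b :: real
  show "inner u v = inner v u"
  proof (transfer)
    fix f g :: "'a \<Rightarrow> complex"
    have "pair f (\<lambda>x. cnj (g x)) = cnj (pair g (\<lambda>x. cnj (f x)))"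
      using pair_cnj[of g "\<lambda>x. cnj (f x)"] by (simp add: pair_commute)
    then show "Re (pair f (\<lambda>x. cnj (g x))) = Re (pair g (\<lambda>x. cnj (f x)))" by simp
  qed
  show "inner (u + v) w = inner u w + inner v w"
    by transfer (simp add: pair_add_left sqsum_cnj)
  show "inner (a *\<^sub>R u) v = a * inner u v"
    by transfer (simp add: pair_cmult_left)
  show "0 \<le> inner u u"
    by transfer (simp add: pair_self infsum_nonneg)
  show "(inner u u = 0) = (u = 0)"
  proof (transfer)
    fix f :: "'a \<Rightarrow> complex" assume f: "sqsum f"
    show "(Re (pair f (\<lambda>x. cnj (f x))) = 0) = (f = (\<lambda>_. 0))"
    proof
      assume "Re (pair f (\<lambda>x. cnj (f x))) = 0"
      then have "(\<Sum>\<^sub>\<infinity>x. (cmod (f x))\<^sup>2) = 0" using pair_self[OF f] by simp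
      then have "(cmod (f x))\<^sup>2 = 0" for x
        using f unfolding sqsum_def by (intro nonneg_infsum_le_0D[of "\<lambda>x. (cmod (f x))\<^sup>2" UNIV x]) auto
      then show "f = (\<lambda>_. 0)" by (simp add: fun_eq_iff)
    qed (simp add: pair_def)
  qed
qed (simp_all add: norm_l2_def dist_l2_def sgn_l2_def uniformity_l2_def open_l2_def)

end

lemma l2_eqI: "(\<And>x. Rep_l2 u x = Rep_l2 v x) \<Longrightarrow> u = v" for u v :: "'v l2"
  by (metis Rep_l2_inject ext)

lemmas l2_simps = zero_l2.rep_eq plus_l2.rep_eq minus_l2.rep_eq uminus_l2.rep_eq scaleR_l2.rep_eq

lift_definition cscale :: "complex \<Rightarrow> 'v l2 \<Rightarrow> 'v l2" is "\<lambda>c f x. c * f x" by (rule sqsum_cmult)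

lift_definition delta :: "'v \<Rightarrow> 'v l2" is "\<lambda>v x. of_bool (x = v)"
  by (rule sqsum_finite[of "{_}"]) auto

lemma norm_l2_square: "(norm u)\<^sup>2 = (\<Sum>\<^sub>\<infinity>x. (cmod (Rep_l2 u x))\<^sup>2)"
  by (subst power2_norm_eq_inner) (transfer, simp add: pair_self)

lemma finite_sum_le_norm: "finite S \<Longrightarrow> (\<Sum>x\<in>S. (cmod (Rep_l2 u x))\<^sup>2) \<le> (norm u)\<^sup>2"
  unfolding norm_l2_square using sqsum_Rep[of u]
  by (intro finite_sum_le_infsum) (auto simp: sqsum_def)

lemma L2_set_le_norm: "finite S \<Longrightarrow> L2_set (\<lambda>x. cmod (Rep_l2 u x)) S \<le> norm u"
  unfolding L2_set_def by (rule real_le_lsqrt) (auto intro: sum_nonneg finite_sum_le_norm)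

lemma Rep_le_norm: "cmod (Rep_l2 u x) \<le> norm u"
  using L2_set_le_norm[of "{x}" u] by simp

lemma norm_l2_leI:
  assumes "\<And>S. finite S \<Longrightarrow> (\<Sum>x\<in>S. (cmod (f x))\<^sup>2) \<le> b\<^sup>2"
  shows "sqsum f" "0 \<le> b \<Longrightarrow> Rep_l2 u = f \<Longrightarrow> norm u \<le> b"
proof -
  show f: "sqsum f" unfolding sqsum_def
    by (rule nonneg_bdd_above_summable_on) (auto intro!: bdd_aboveI2[of _ _ "b\<^sup>2"] assms)
  assume "0 \<le> b" "Rep_l2 u = f"
  then have "(norm u)\<^sup>2 \<le> b\<^sup>2" unfolding norm_l2_square using f assms
    by (intro infsum_le_finite_sums) (auto simp: sqsum_def)
  then show "norm u \<le> b" using \<open>0 \<le> b\<close> by (rule power2_le_imp_le)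
qed

lemma norm_finite_support:
  assumes "finite S" "\<And>x. x \<notin> S \<Longrightarrow> Rep_l2 u x = 0"
  shows "norm u = L2_set (\<lambda>x. cmod (Rep_l2 u x)) S"
proof -
  have "(norm u)\<^sup>2 = (\<Sum>\<^sub>\<infinity>x\<in>S. (cmod (Rep_l2 u x))\<^sup>2)"
    unfolding norm_l2_square by (rule infsum_cong_neutral) (use assms in auto)
  also have "\<dots> = (\<Sum>x\<in>S. (cmod (Rep_l2 u x))\<^sup>2)" using assms(1) by simp
  finally show ?thesis unfolding L2_set_def by (metis norm_ge_zero real_sqrt_unique)
qed

lemma norm_delta: "norm (delta v) = 1"
  by (subst norm_finite_support[of "{v}"]) (auto simp: delta.rep_eq)

lemma norm_cscale: "norm (cscale c u) = cmod c * norm u"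
proof -
  have "(norm (cscale c u))\<^sup>2 = (cmod c * norm u)\<^sup>2"
    unfolding norm_l2_square power_mult_distrib cscale.rep_eq norm_mult
    by (rule infsum_cmult_right')
  then show ?thesis by (rule power2_eq_imp_eq) auto
qed

lemma cscale_of_real: "cscale (of_real c) u = c *\<^sub>R u"
  by transfer simp

lemma inner_cscale_i: "inner (cscale \<i> u) v = - inner u (cscale \<i> v)"
  by transfer (simp add: pair_cmult_left pair_cmult_right pair_minus_right)

lemma inner_i_self: "inner (cscale \<i> u) u = 0"
  using inner_cscale_i[of u u] by (simp add: inner_commute)

definition nbr_sum :: "('v \<times> 'v) set \<Rightarrow> ('v \<Rightarrow> complex) \<Rightarrow> 'v \<Rightarrow> complex" where
  "nbr_sum E f x = (\<Sum>y\<in>E `` {x}. f y)"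

locale bounded_graph =
  fixes E :: "('v \<times> 'v) set" and d :: real
  assumes sym: "sym E" and finite_nbrs: "\<And>x. finite (E `` {x})" 
    and card_nbrs: "\<And>x. real (card (E `` {x})) \<le> d" and d_pos: "0 < d"
begin

abbreviation adj :: "('v \<Rightarrow> complex) \<Rightarrow> 'v \<Rightarrow> complex" where
  "adj \<equiv> nbr_sum E"

lemma E_Sigma: "E = Sigma UNIV (\<lambda>x. E `` {x})" by auto

lemma swap_E: "prod.swap ` E = E"
proof (intro equalityI subsetI)
  fix e assume "e \<in> prod.swap ` E"
  then obtain a b where "(a, b) \<in> E" "e = (b, a)" by auto
  then show "e \<in> E" using symD[OF sym] by simp
next
  fix e assume "e \<in> E"
  then have "prod.swap e \<in> E" using symD[OF sym] by (cases e) simp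
  then have "prod.swap (prod.swap e) \<in> prod.swap ` E" by (rule imageI)
  then show "e \<in> prod.swap ` E" by simp
qed

lemma edge_sum:
  fixes h :: "'v \<Rightarrow> real"
  assumes h: "h summable_on UNIV" "\<And>x. 0 \<le> h x"
  shows "(\<lambda>(x, y). h x) summable_on E" "(\<lambda>(x, y). h y) summable_on E"
    "(\<Sum>\<^sub>\<infinity>(x, y)\<in>E. h y) \<le> d * (\<Sum>\<^sub>\<infinity>x. h x)"
proof -
  have fin: "(\<Sum>(x, y)\<in>P. h x) \<le> d * (\<Sum>\<^sub>\<infinity>x. h x)" if P: "finite P" "P \<subseteq> E" for P
  proof -
    have "(\<Sum>(x, y)\<in>P. h x) \<le> (\<Sum>(x, y)\<in>Sigma (fst ` P) (\<lambda>x. E `` {x}). h x)"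
      using P h(2) finite_nbrs by (intro sum_mono2) (auto intro: rev_image_eqI)
    also have "\<dots> = (\<Sum>x\<in>fst ` P. real (card (E `` {x})) * h x)"
      using P finite_nbrs by (subst sum.Sigma[symmetric]) auto
    also have "\<dots> \<le> (\<Sum>x\<in>fst ` P. d * h x)"
      using card_nbrs h(2) by (intro sum_mono mult_right_mono)
    also have "\<dots> \<le> d * (\<Sum>\<^sub>\<infinity>x. h x)"
      using P h d_pos unfolding sum_distrib_left[symmetric] 
      by (intro mult_left_mono finite_sum_le_infsum) auto
    finally show ?thesis .
  qed
  show s1: "(\<lambda>(x, y). h x) summable_on E"
    by (rule nonneg_bdd_above_summable_on) 
      (use h(2) fin in \<open>auto intro!: bdd_aboveI2[of _ _ "d * (\<Sum>\<^sub>\<infinity>x. h x)"]\<close>)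
  have inf1: "(\<Sum>\<^sub>\<infinity>(x, y)\<in>E. h x) \<le> d * (\<Sum>\<^sub>\<infinity>x. h x)"
    by (rule infsum_le_finite_sums[OF s1]) (use fin in auto)
  note sw = swap_E
  have *: "(\<lambda>(x, y). h x) \<circ> prod.swap = (\<lambda>(x, y). h y)" by (auto simp: fun_eq_iff)
  have "(\<lambda>(x, y). h x) summable_on (prod.swap ` E)" using s1 sw by simp
  then have "((\<lambda>(x, y). h x) \<circ> prod.swap) summable_on E"
    by (subst (asm) summable_on_reindex) auto
  then show "(\<lambda>(x, y). h y) summable_on E" unfolding * .
  have "(\<Sum>\<^sub>\<infinity>e\<in>prod.swap ` E. (\<lambda>(x, y). h x) e) = (\<Sum>\<^sub>\<infinity>e\<in>E. ((\<lambda>(x, y). h x) \<circ> prod.swap) e)"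
    by (rule infsum_reindex) auto
  then have "(\<Sum>\<^sub>\<infinity>(x, y)\<in>E. h y) = (\<Sum>\<^sub>\<infinity>(x, y)\<in>E. h x)" unfolding sw * by simp
  then show "(\<Sum>\<^sub>\<infinity>(x, y)\<in>E. h y) \<le> d * (\<Sum>\<^sub>\<infinity>x. h x)" using inf1 by simp
qed

text \<open>Cauchy-Schwarz at each vertex loses one factor \<open>d\<close>; then each value of f is
  counted at most \<open>d\<close> times, which loses the other. So the operator norm is at most
  \<open>d\<close>.\<close>

lemma adj_square_sum:
  assumes f: "sqsum f" and S: "finite S"
  shows "(\<Sum>x\<in>S. (cmod (adj f x))\<^sup>2) \<le> d\<^sup>2 * (\<Sum>\<^sub>\<infinity>x. (cmod (f x))\<^sup>2)"
proof -
  let ?h = "\<lambda>x. (cmod (f x))\<^sup>2"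
  have h: "?h summable_on UNIV" using f by (simp add: sqsum_def)
  note e = edge_sum[OF h]
  have "(\<Sum>x\<in>S. (cmod (adj f x))\<^sup>2) \<le> (\<Sum>x\<in>S. d * (\<Sum>y\<in>E `` {x}. ?h y))"
  proof (rule sum_mono)
    fix x
    have "cmod (adj f x) \<le> (\<Sum>y\<in>E `` {x}. \<bar>1\<bar> * \<bar>cmod (f y)\<bar>)" 
      unfolding nbr_sum_def by (rule order.trans[OF norm_sum]) simp
    also have "\<dots> \<le> L2_set (\<lambda>_. 1) (E `` {x}) * L2_set (\<lambda>y. cmod (f y)) (E `` {x})"
      by (rule L2_set_mult_ineq)
    finally have "(cmod (adj f x))\<^sup>2 \<le> (L2_set (\<lambda>_. 1) (E `` {x}) * L2_set (\<lambda>y. cmod (f y)) (E `` {x}))\<^sup>2"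
      by (rule power_mono) simp
    also have "\<dots> = real (card (E `` {x})) * (\<Sum>y\<in>E `` {x}. ?h y)"
      by (simp add: L2_set_def power_mult_distrib sum_nonneg)
    also have "\<dots> \<le> d * (\<Sum>y\<in>E `` {x}. ?h y)" 
      using card_nbrs by (intro mult_right_mono) (auto intro: sum_nonneg)
    finally show "(cmod (adj f x))\<^sup>2 \<le> d * (\<Sum>y\<in>E `` {x}. ?h y)" .
  qed
  also have "\<dots> = d * (\<Sum>(x, y)\<in>Sigma S (\<lambda>x. E `` {x}). ?h y)"
  proof -
    have "(\<Sum>(x, y)\<in>Sigma S (\<lambda>x. E `` {x}). ?h y) = (\<Sum>x\<in>S. \<Sum>y\<in>E `` {x}. ?h y)"
      by (rule sum.Sigma[symmetric]) (use S finite_nbrs in auto)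
    then show ?thesis by (simp add: sum_distrib_left)
  qed
  also have "\<dots> \<le> d * (\<Sum>\<^sub>\<infinity>(x, y)\<in>E. ?h y)"
    using S finite_nbrs d_pos e(2) by (intro mult_left_mono finite_sum_le_infsum) auto
  also have "\<dots> \<le> d * (d * (\<Sum>\<^sub>\<infinity>x. ?h x))"
    using e(3) d_pos by (intro mult_left_mono) auto
  finally show ?thesis by (simp add: power2_eq_square)
qed

lemma sqsum_adj: "sqsum f \<Longrightarrow> sqsum (adj f)"
  by (rule norm_l2_leI(1)[where b = "sqrt (d\<^sup>2 * (\<Sum>\<^sub>\<infinity>x. (cmod (f x))\<^sup>2))"]) 
    (simp add: adj_square_sum infsum_nonneg)

text \<open>Both sides are the same sum over edges read in the two orientations; absolute
  summability over the edges justifies the exchange.\<close>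

lemma pair_adj:
  assumes f: "sqsum f" and g: "sqsum g"
  shows "pair (adj f) g = pair f (adj g)"
proof -
  have sm: "(\<lambda>e. norm ((\<lambda>(x, y). f y * g x) e)) summable_on E" if f: "sqsum f" and g: "sqsum g" for f g :: "'v \<Rightarrow> complex"
  proof (rule Infinite_Sum.abs_summable_on_comparison_test')
    show "(\<lambda>e. (\<lambda>(x, y). (cmod (f y))\<^sup>2) e + (\<lambda>(x, y). (cmod (g x))\<^sup>2) e) summable_on E"
      using f g unfolding sqsum_def by (intro summable_on_add edge_sum) auto
    show "norm (case e of (x, y) \<Rightarrow> f y * g x) \<le> (\<lambda>(x, y). (cmod (f y))\<^sup>2) e + (\<lambda>(x, y). (cmod (g x))\<^sup>2) e" for e
      by (cases e) (simp add: norm_mult_le_squares)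
  qed
  have left: "pair (adj f) g = (\<Sum>\<^sub>\<infinity>(x, y)\<in>E. f y * g x)" if f: "sqsum f" and g: "sqsum g" for f g :: "'v \<Rightarrow> complex"
  proof -
    have "pair (adj f) g = (\<Sum>\<^sub>\<infinity>x. \<Sum>\<^sub>\<infinity>y\<in>E `` {x}. f y * g x)"
      unfolding pair_def nbr_sum_def using finite_nbrs by (simp add: sum_distrib_right)
    also have "\<dots> = (\<Sum>\<^sub>\<infinity>(x, y)\<in>Sigma UNIV (\<lambda>x. E `` {x}). f y * g x)"
      by (rule infsum_Sigma'_banach) 
        (use abs_summable_summable[OF sm[OF f g]] in \<open>simp flip: E_Sigma\<close>)
    finally show ?thesis by (simp flip: E_Sigma)
  qed
  note sw = swap_E
  have "pair f (adj g) = (\<Sum>\<^sub>\<infinity>(x, y)\<in>E. g y * f x)" using left[OF g f] by (simp add: pair_commute)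
  also have "\<dots> = (\<Sum>\<^sub>\<infinity>e\<in>prod.swap ` E. (\<lambda>(x, y). g y * f x) e)" unfolding sw ..
  also have "\<dots> = (\<Sum>\<^sub>\<infinity>e\<in>E. ((\<lambda>(x, y). g y * f x) \<circ> prod.swap) e)" by (rule infsum_reindex) auto
  also have "(\<lambda>(x, y). g y * f x) \<circ> prod.swap = (\<lambda>(x, y). f y * g x)" by (auto simp: fun_eq_iff mult.commute)
  finally show ?thesis using left[OF f g] by simp
qed

definition adjop :: "'v l2 \<Rightarrow> 'v l2" where "adjop u = Abs_l2 (adj (Rep_l2 u))"

lemma Rep_adjop: "Rep_l2 (adjop u) = adj (Rep_l2 u)"
  unfolding adjop_def by (rule Abs_l2_inverse) (simp add: sqsum_adj sqsum_Rep)

lemma adjop_add: "adjop (u + v) = adjop u + adjop v"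
  by (rule l2_eqI) (simp add: Rep_adjop nbr_sum_def l2_simps sum.distrib)

lemma adjop_diff: "adjop (u - v) = adjop u - adjop v"
  by (rule l2_eqI) (simp add: Rep_adjop nbr_sum_def l2_simps sum_subtractf)

lemma adjop_cscale: "adjop (cscale c u) = cscale c (adjop u)"
  by (rule l2_eqI) (simp add: Rep_adjop nbr_sum_def cscale.rep_eq sum_distrib_left)

lemma adjop_scaleR: "adjop (c *\<^sub>R u) = c *\<^sub>R adjop u"
  using adjop_cscale[of "of_real c" u] by (simp add: cscale_of_real)

lemma norm_adjop: "norm (adjop u) \<le> d * norm u"
proof (rule norm_l2_leI(2)[OF _ _ Rep_adjop])
  show "(\<Sum>x\<in>S. (cmod (adj (Rep_l2 u) x))\<^sup>2) \<le> (d * norm u)\<^sup>2" if "finite S" for S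
    using adj_square_sum[OF sqsum_Rep that] by (simp add: power_mult_distrib norm_l2_square)
qed (use d_pos in simp)

lemma inner_adjop: "inner (adjop u) v = inner u (adjop v)"
proof -
  have "adj (\<lambda>x. cnj (Rep_l2 v x)) = (\<lambda>x. cnj (adj (Rep_l2 v) x))" by (simp add: nbr_sum_def fun_eq_iff)
  then show ?thesis unfolding inner_l2.rep_eq Rep_adjop
    using pair_adj[OF sqsum_Rep[of u] sqsum_cnj[OF sqsum_Rep[of v]]] by simp
qed

text \<open>Multiplication by i is skew and commutes with the self-adjoint operator, so the operator
  and the real part of z drop out. This identity gives both the resolvent bound and the formula for
  the imaginary part of a diagonal entry.\<close>

lemma inner_resolvent:
  assumes "cscale z u - adjop u = f"
  shows "inner (cscale \<i> u) f = Im z * (norm u)\<^sup>2"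
proof -
  have "inner (cscale \<i> u) (adjop u) = inner (adjop (cscale \<i> u)) u" by (simp add: inner_adjop)
  also have "\<dots> = - inner (cscale \<i> u) (adjop u)"
    unfolding adjop_cscale inner_cscale_i[of "adjop u"] inner_commute[of "adjop u"] ..
  finally have 1: "inner (cscale \<i> u) (adjop u) = 0" by simp
  have z: "cscale z u = Re z *\<^sub>R u + Im z *\<^sub>R cscale \<i> u"
    by transfer (simp add: fun_eq_iff complex_eq_iff algebra_simps)
  have "inner (cscale \<i> u) (cscale \<i> u) = (norm u)\<^sup>2"
    by (simp add: norm_cscale flip: power2_norm_eq_inner)
  then show ?thesis
    unfolding assms[symmetric] z by (simp add: inner_diff_right inner_add_right inner_i_self 1)
qed

lemma resolvent_norm_bound:
  assumes "cscale z u - adjop u = f"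
  shows "\<bar>Im z\<bar> * norm u \<le> norm f" "(cmod z - d) * norm u \<le> norm f"
proof -
  have "\<bar>Im z\<bar> * (norm u)\<^sup>2 \<le> norm u * norm f"
    using inner_resolvent[OF assms] Cauchy_Schwarz_ineq2[of "cscale \<i> u" f] by (simp add: abs_mult norm_cscale)
  then show "\<bar>Im z\<bar> * norm u \<le> norm f"
    by (cases "norm u = 0") (auto simp: power2_eq_square mult.assoc mult_le_cancel_left)
  have "cmod z * norm u \<le> norm f + norm (adjop u)"
    using norm_triangle_ineq[of f "adjop u"] assms norm_cscale[of z u] by auto
  then show "(cmod z - d) * norm u \<le> norm f" using norm_adjop[of u] by (simp add: left_diff_distrib)
qed

end

section \<open>Chebyshev expansion of the resolvent\<close>

text \<open>T_k(A / d) applied to \<open>f\<close>. It is stated on bare functions over an edge set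
  so that its dependence on nearby edges alone can be read off and transported along
  isomorphisms.\<close>

fun cheb :: "('v \<times> 'v) set \<Rightarrow> real \<Rightarrow> ('v \<Rightarrow> complex) \<Rightarrow> nat \<Rightarrow> 'v \<Rightarrow> complex" where
  "cheb E d f 0 = f"
| "cheb E d f (Suc 0) = (\<lambda>x. nbr_sum E f x / of_real d)"
| "cheb E d f (Suc (Suc k)) = (\<lambda>x. 2 * (nbr_sum E (cheb E d f (Suc k)) x / of_real d) - cheb E d f k x)"

text \<open>Joukowski parametrisation \<open>z = d (w + 1/w) / 2\<close>; \<open>w\<close> is taken outside the unit disc.\<close>

lemma joukowski_exists:
  assumes d: "0 < d" and y: "0 < Im z"
  shows "\<exists>w. w \<noteq> 0 \<and> z = of_real d * (w + 1 / w) / 2 \<and> 2 * Im z / d \<le> cmod w - 1 / cmod w \<and> 1 + Im z / d \<le> cmod w"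
proof -
  define q where "q = [:1, - (2 * z / of_real d), 1:]"
  have "\<not> constant (poly q)" unfolding q_def constant_degree by simp
  then obtain w0 where "poly q w0 = 0" using fundamental_theorem_of_algebra by blast
  then have w0: "w0 * w0 + 1 = 2 * z / of_real d * w0" by (simp add: q_def algebra_simps)
  then have "w0 \<noteq> 0" by auto
  define w where "w = (if 1 \<le> cmod w0 then w0 else 1 / w0)"
  have w: "w \<noteq> 0" "1 \<le> cmod w" using \<open>w0 \<noteq> 0\<close> by (auto simp: w_def norm_divide)
  have "w + 1 / w = w0 + 1 / w0" by (simp add: w_def)
  also have "\<dots> = 2 * z / of_real d" using w0 \<open>w0 \<noteq> 0\<close> by (simp add: field_simps)
  finally have z: "z = of_real d * (w + 1 / w) / 2" using d by (simp add: field_simps)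
  have "Im (w + 1 / w) = Im w - Im w / (cmod w)\<^sup>2" by (simp add: Im_divide cmod_power2)
  then have "Im z = d / 2 * (Im w - Im w / (cmod w)\<^sup>2)" unfolding z by simp
  also have "\<dots> \<le> d / 2 * (cmod w - 1 / cmod w)"
  proof (rule mult_left_mono)
    have c: "0 < cmod w" using w by simp
    have "Im w - Im w / (cmod w)\<^sup>2 = Im w * (1 - 1 / (cmod w)\<^sup>2)" by (simp add: algebra_simps)
    also have "\<dots> \<le> cmod w * (1 - 1 / (cmod w)\<^sup>2)"
      using w abs_Im_le_cmod[of w] by (intro mult_right_mono) (auto simp: divide_le_eq_1)
    also have "\<dots> = cmod w - 1 / cmod w" using c by (simp add: field_simps power2_eq_square)
    finally show "Im w - Im w / (cmod w)\<^sup>2 \<le> cmod w - 1 / cmod w" .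
  qed (use d in simp)
  finally have 1: "2 * Im z / d \<le> cmod w - 1 / cmod w" using d by (simp add: field_simps)
  have "1 / cmod w \<ge> 2 - cmod w"
  proof -
    have "0 \<le> (cmod w - 1)\<^sup>2" by simp
    then show ?thesis using w by (simp add: field_simps power2_eq_square)
  qed
  moreover have "2 * Im z / d = 2 * (Im z / d)" by simp
  ultimately have "1 + Im z / d \<le> cmod w" using 1 by linarith
  then show ?thesis using w z 1 by blast
qed

context bounded_graph
begin

definition nop :: "'v l2 \<Rightarrow> 'v l2" where "nop u = (1 / d) *\<^sub>R adjop u"

lemma nop_linear: "nop (u + v) = nop u + nop v" "nop (u - v) = nop u - nop v" "nop (c *\<^sub>R u) = c *\<^sub>R nop u"
  by (simp_all add: nop_def adjop_add adjop_diff adjop_scaleR algebra_simps)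

lemma inner_nop: "inner (nop u) v = inner u (nop v)"
  by (simp add: nop_def inner_adjop)

lemma norm_nop: "norm (nop u) \<le> norm u"
  using norm_adjop[of u] d_pos by (simp add: nop_def field_simps)

text \<open>The components are T_m(A / d) u and U_{m-1}(A / d) u, by the joint recurrence T_{m+1} =
  X T_m - (1 - X^2) U_{m-1} and U_m = T_m + X U_{m-1}.\<close>

primrec cheb_pair :: "nat \<Rightarrow> 'v l2 \<Rightarrow> 'v l2 \<times> 'v l2" where
  "cheb_pair 0 u = (u, 0)"
| "cheb_pair (Suc m) u = (nop (fst (cheb_pair m u)) - (snd (cheb_pair m u) - nop (nop (snd (cheb_pair m u)))), 
     fst (cheb_pair m u) + nop (snd (cheb_pair m u)))"

text \<open>Pell's identity \<open>T\<^sub>m\<^sup>2 + (1 - X\<^sup>2) U\<^sub>m\<^sub>-\<^sub>1\<^sup>2 = 1\<close> for Chebyshev polynomials,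
  applied to a self-adjoint contraction.\<close>

lemma pell:
  "(norm (fst (cheb_pair m u)))\<^sup>2 + inner (snd (cheb_pair m u) - nop (nop (snd (cheb_pair m u)))) (snd (cheb_pair m u)) = (norm u)\<^sup>2"
proof (induction m)
  case (Suc m)
  define f where "f = fst (cheb_pair m u)"
  define g where "g = snd (cheb_pair m u)"
  have *: "inner f f + inner (g - nop (nop g)) g = (norm u)\<^sup>2"
    using Suc by (simp add: f_def g_def power2_norm_eq_inner)
  have "(norm (nop f - (g - nop (nop g))))\<^sup>2 + inner (f + nop g - nop (nop (f + nop g))) (f + nop g)
     = inner f f + inner (g - nop (nop g)) g"
    unfolding power2_norm_eq_inner nop_linear inner_diff_left inner_diff_right inner_add_left inner_add_right
    using inner_nop[of "nop f" "nop g"] inner_nop[of "nop (nop g)" f] inner_nop[of "nop (nop g)" "nop g"]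
      inner_nop[of "nop g" g] inner_nop[of f g] inner_nop[of "nop f" f]
      inner_commute[of g "nop (nop g)"] inner_commute[of "nop f" "nop (nop g)"]
      inner_commute[of "nop f" g] inner_commute[of f "nop g"]
    by linarith
  then show ?case using * by (simp add: f_def g_def)
qed simp

definition chebl :: "nat \<Rightarrow> 'v l2 \<Rightarrow> 'v l2" where "chebl m u = fst (cheb_pair m u)"

text \<open>In Pell's identity the term with U is nonnegative, because \<open>nop\<close> is a
  self-adjoint contraction. This replaces the spectral calculus for the bound |T_m| at most 1 on
  [-1, 1].\<close>

lemma norm_chebl: "norm (chebl m u) \<le> norm u"
proof -
  let ?g = "snd (cheb_pair m u)"
  have "inner (nop (nop ?g)) ?g = (norm (nop ?g))\<^sup>2"
    by (simp only: inner_nop[of "nop ?g" ?g] power2_norm_eq_inner)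
  then have "inner (nop (nop ?g)) ?g \<le> inner ?g ?g"
    using power_mono[OF norm_nop[of ?g], of 2] by (simp add: power2_norm_eq_inner)
  then have "(norm (chebl m u))\<^sup>2 \<le> (norm u)\<^sup>2" 
    using pell[of m u] unfolding chebl_def inner_diff_left by linarith
  then show ?thesis by (rule power2_le_imp_le) simp
qed

lemma chebl_rec: "chebl 0 u = u" "chebl (Suc 0) u = nop u" 
  "chebl (Suc (Suc m)) u = 2 *\<^sub>R nop (chebl (Suc m) u) - chebl m u"
proof -
  have "nop 0 = 0" using nop_linear(3)[of 0 0] by simp
  then show "chebl 0 u = u" "chebl (Suc 0) u = nop u" by (simp_all add: chebl_def)
  show "chebl (Suc (Suc m)) u = 2 *\<^sub>R nop (chebl (Suc m) u) - chebl m u"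
    by (rule l2_eqI) (simp add: chebl_def nop_linear l2_simps algebra_simps)
qed

lemma Rep_nop: "Rep_l2 (nop u) x = adj (Rep_l2 u) x / of_real d"
  by (simp add: nop_def l2_simps Rep_adjop)

lemma Rep_chebl: "Rep_l2 (chebl m u) = cheb E d (Rep_l2 u) m"
proof (induction m rule: induct_nat_012)
  case (ge2 m)
  show ?case by (rule ext) (simp add: chebl_rec l2_simps Rep_nop ge2)
qed (simp_all add: chebl_rec Rep_nop fun_eq_iff)

definition cheb_sum :: "complex \<Rightarrow> nat \<Rightarrow> 'v l2 \<Rightarrow> 'v l2" where
  "cheb_sum w m u = u + (\<Sum>k=1..m. cscale (2 / w ^ k) (chebl k u))"

lemma cscale_simps: "cscale a (u + v) = cscale a u + cscale a v" "cscale a (u - v) = cscale a u - cscale a v" 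
  "cscale a (cscale b u) = cscale (a * b) u" "cscale (a + b) u = cscale a u + cscale b u"
  "cscale (a - b) u = cscale a u - cscale b u" "cscale 1 u = u"
  by (rule l2_eqI; simp add: l2_simps cscale.rep_eq algebra_simps)+

text \<open>The generating function of the T_k, truncated: multiplication by w + 1/w - 2 X
  telescopes to w - 1/w up to a boundary term of size |w|^(-m).\<close>

lemma cheb_sum_eq:
  assumes w: "w \<noteq> 0"
  shows "cscale (w + 1 / w) (cheb_sum w m u) - 2 *\<^sub>R nop (cheb_sum w m u) 
    = cscale (w - 1 / w) u + cscale (2 / w ^ m) (cscale (1 / w) (chebl m u) - chebl (Suc m) u)"
proof (induction m)
  case 0
  show ?case
    by (rule l2_eqI) (simp add: cheb_sum_def chebl_rec l2_simps cscale.rep_eq algebra_simps)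
next
  case (Suc m)
  have nc: "nop (cscale a v) = cscale a (nop v)" for a v
    by (simp add: nop_def adjop_cscale flip: cscale_of_real) (simp add: cscale_simps mult.commute)
  have "2 *\<^sub>R nop (chebl (Suc m) u) = chebl (Suc (Suc m)) u + chebl m u" by (simp add: chebl_rec)
  then have c2: "2 *\<^sub>R nop (cscale (2 / w ^ Suc m) (chebl (Suc m) u)) = 
      cscale (2 / w ^ Suc m) (chebl (Suc (Suc m)) u + chebl m u)"
    unfolding nc by (metis cscale_of_real cscale_simps(3) mult.commute)
  have s: "cheb_sum w (Suc m) u = cheb_sum w m u + cscale (2 / w ^ Suc m) (chebl (Suc m) u)"
    by (simp add: cheb_sum_def)
  have "cscale (w + 1 / w) (cheb_sum w (Suc m) u) - 2 *\<^sub>R nop (cheb_sum w (Suc m) u) 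
    = (cscale (w + 1 / w) (cheb_sum w m u) - 2 *\<^sub>R nop (cheb_sum w m u))
     + (cscale (w + 1 / w) (cscale (2 / w ^ Suc m) (chebl (Suc m) u)) 
        - cscale (2 / w ^ Suc m) (chebl (Suc (Suc m)) u + chebl m u))"
    unfolding s nop_linear cscale_simps(1) scaleR_add_right c2 by (simp add: algebra_simps)
  also have "\<dots> = cscale (w - 1 / w) u + cscale (2 / w ^ Suc m) (cscale (1 / w) (chebl (Suc m) u) - chebl (Suc (Suc m)) u)"
    unfolding Suc.IH
    by (rule l2_eqI) (use w in \<open>simp add: l2_simps cscale.rep_eq field_simps\<close>)
  finally show ?case .
qed

text \<open>The difference of the true and the truncated resolvent solves the resolvent equation
  whose right side is the boundary term \<open>e\<close>, of norm at most 2 times the prefactor. The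
  bound 1 / Im z of the resolvent then gives the error.\<close>

lemma resolvent_cheb:
  assumes u: "cscale z u - adjop u = delta x" and y: "0 < Im z"
    and w: "w \<noteq> 0" "z = of_real d * (w + 1 / w) / 2" "2 * Im z / d \<le> cmod w - 1 / cmod w" "1 \<le> cmod w"
  shows "cmod (Rep_l2 u x - 2 / (of_real d * (w - 1 / w)) * 
     (1 + (\<Sum>k=1..m. 2 / w ^ k * cheb E d (\<lambda>y. of_bool (y = x)) k x))) \<le> 2 * d / (Im z)\<^sup>2 / cmod w ^ m"
proof -
  have wd: "2 * Im z / d \<le> cmod (w - 1 / w)"
    using w(3) norm_triangle_ineq2[of w "1 / w"] by (simp add: norm_divide)
  moreover have "0 < 2 * Im z / d" using y d_pos by simp
  ultimately have w0: "w - 1 / w \<noteq> 0" by auto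
  define c where "c = 2 / (of_real d * (w - 1 / w))"
  define v where "v = u - cscale c (cheb_sum w m (delta x))"
  define e where "e = cscale (1 / w) (chebl m (delta x)) - chebl (Suc m) (delta x)"
  have e: "norm e \<le> 2"
  proof -
    have "norm e \<le> norm (cscale (1 / w) (chebl m (delta x))) + norm (chebl (Suc m) (delta x))"
      unfolding e_def by (rule norm_triangle_ineq4)
    also have "\<dots> \<le> 1 * 1 + 1"
      unfolding norm_cscale using norm_chebl[of _ "delta x"] w(4)
      by (intro add_mono mult_mono) (auto simp: norm_delta norm_divide divide_le_eq_1)
    finally show ?thesis by simp
  qed
  have zc: "cscale z t - adjop t = cscale (of_real d / 2) (cscale (w + 1 / w) t - 2 *\<^sub>R nop t)" for t
  proof (rule l2_eqI)
    fix x
    have "of_real d / 2 * ((w + 1 / w) * a - 2 * (b / of_real d)) = (of_real d / 2 * (w + 1 / w)) * a - b"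
      for a b :: complex using d_pos by (simp add: right_diff_distrib)
    moreover have "of_real d / 2 * (w + 1 / w) = z" using w(2) by simp
    ultimately show "Rep_l2 (cscale z t - adjop t) x 
      = Rep_l2 (cscale (of_real d / 2) (cscale (w + 1 / w) t - 2 *\<^sub>R nop t)) x"
      by (simp add: l2_simps cscale.rep_eq Rep_nop Rep_adjop)
  qed
  have "cscale z v - adjop v = delta x - cscale c (cscale z (cheb_sum w m (delta x)) - adjop (cheb_sum w m (delta x)))"
    unfolding v_def adjop_diff adjop_cscale u[symmetric]
    by (rule l2_eqI) (simp add: l2_simps cscale.rep_eq algebra_simps)
  also have "\<dots> = cscale (- (c * of_real d / w ^ m)) e"
    unfolding zc cheb_sum_eq[OF w(1)] e_def[symmetric]
  proof (rule l2_eqI)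
    fix t
    have h: "c * (of_real d / 2 * (w - 1 / w)) = 1" using w0 d_pos by (simp add: c_def)
    have "a - c * (of_real d / 2 * (k * a + 2 / w ^ m * b)) 
        = a - c * (of_real d / 2 * k) * a - c * of_real d / w ^ m * b" for a b k
      by (simp add: algebra_simps)
    from this[of _ "w - 1 / w"] show "Rep_l2 (delta x - cscale c (cscale (complex_of_real d / 2) (cscale (w - 1 / w) (delta x) + cscale (2 / w ^ m) e))) t
      = Rep_l2 (cscale (- (c * complex_of_real d / w ^ m)) e) t"
      unfolding h by (simp add: l2_simps cscale.rep_eq)
  qed
  finally have "cscale z v - adjop v = cscale (- (c * of_real d / w ^ m)) e" .
  from resolvent_norm_bound(1)[OF this] have "Im z * norm v \<le> cmod (c * of_real d / w ^ m) * norm e"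
    using y by (simp add: norm_cscale)
  also have "\<dots> \<le> (d / Im z / cmod w ^ m) * 2"
  proof (intro mult_mono e)
    have "cmod (c * of_real d / w ^ m) = 2 / cmod (w - 1 / w) / cmod w ^ m"
      using d_pos by (simp add: c_def norm_mult norm_divide norm_power)
    also have "\<dots> \<le> 2 / (2 * Im z / d) / cmod w ^ m"
      using wd \<open>0 < 2 * Im z / d\<close> by (intro divide_right_mono frac_le) auto
    finally show "cmod (c * of_real d / w ^ m) \<le> d / Im z / cmod w ^ m" by simp
  qed (use y d_pos in auto)
  finally have "norm v * Im z \<le> d / Im z / cmod w ^ m * 2" by (simp only: mult.commute)
  then have "norm v \<le> d / Im z / cmod w ^ m * 2 / Im z" by (simp only: pos_le_divide_eq[OF y])
  also have "\<dots> = 2 * d / (Im z)\<^sup>2 / cmod w ^ m" by (simp add: power2_eq_square mult_ac)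
  finally have "norm v \<le> 2 * d / (Im z)\<^sup>2 / cmod w ^ m" .
  then have "cmod (Rep_l2 v x) \<le> 2 * d / (Im z)\<^sup>2 / cmod w ^ m" by (rule order.trans[OF Rep_le_norm])
  moreover have "Rep_l2 v x = Rep_l2 u x - c * (1 + (\<Sum>k=1..m. 2 / w ^ k * cheb E d (\<lambda>y. of_bool (y = x)) k x))"
  proof -
    have Rs: "Rep_l2 (sum f S) t = (\<Sum>i\<in>S. Rep_l2 (f i) t)" if "finite S" for f :: "nat \<Rightarrow> 'v l2" and S t
      using that by (induction S rule: finite_induct) (auto simp: l2_simps)
    have Rd: "Rep_l2 (delta x) = (\<lambda>y. of_bool (y = x))" by (rule delta.rep_eq)
    show ?thesis
      unfolding v_def minus_l2.rep_eq cscale.rep_eq cheb_sum_def plus_l2.rep_eq 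
        Rs[OF finite_atLeastAtMost] Rep_chebl Rd by simp
  qed
  ultimately show ?thesis by (simp only: c_def)
qed

end

section \<open>From a bounded kernel to the resolvent set\<close>

text \<open>A bounded symmetric kernel inverting \<open>z - A\<close> entrywise shows that \<open>z\<close> is in the resolvent set.\<close>

lemma pair_norm_le:
  assumes fin: "\<And>Q. finite Q \<Longrightarrow> cmod (\<Sum>q\<in>Q. h q * g q) \<le> B" and s: "sqsum h" "sqsum g"
  shows "cmod (pair h g) \<le> B"
proof -
  have "((\<lambda>q. h q * g q) has_sum pair h g) UNIV"
    unfolding pair_def by (rule has_sum_infsum[OF sqsum_mult'[OF s]])
  then have "(sum (\<lambda>q. h q * g q) \<longlongrightarrow> pair h g) (finite_subsets_at_top UNIV)"
    by (simp add: has_sum_def)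
  from tendsto_norm[OF this] show ?thesis
    by (rule tendsto_upperbound) (auto intro!: eventually_finite_subsets_at_top_weakI fin)
qed

lemma pair_sum_left: 
  assumes "finite S" "\<And>i. i \<in> S \<Longrightarrow> sqsum (f i)" "sqsum g"
  shows "sqsum (\<lambda>x. \<Sum>i\<in>S. f i x)" "pair (\<lambda>x. \<Sum>i\<in>S. f i x) g = (\<Sum>i\<in>S. pair (f i) g)"
proof -
  have "sqsum (\<lambda>x. \<Sum>i\<in>S. f i x) \<and> pair (\<lambda>x. \<Sum>i\<in>S. f i x) g = (\<Sum>i\<in>S. pair (f i) g)"
    using assms
  proof (induction S rule: finite_induct)
    case empty
    then show ?case by (simp add: sqsum_zero pair_def)
  next
    case (insert i S)
    then show ?case by (simp add: sqsum_add pair_add_left)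
  qed
  then show "sqsum (\<lambda>x. \<Sum>i\<in>S. f i x)" "pair (\<lambda>x. \<Sum>i\<in>S. f i x) g = (\<Sum>i\<in>S. pair (f i) g)" by auto
qed

text \<open>Translates between functions that are undefined outside \<open>X\<close>, as in
  \<open>ell2\<close>, and functions on the whole type vanishing outside \<open>X\<close>, as in
  \<open>l2\<close>.\<close>

definition ext0 :: "'v set \<Rightarrow> ('v \<Rightarrow> complex) \<Rightarrow> 'v \<Rightarrow> complex" where
  "ext0 X f x = (if x \<in> X then f x else 0)"

lemma ext0_in [simp]: "x \<in> X \<Longrightarrow> ext0 X f x = f x" and ext0_out [simp]: "x \<notin> X \<Longrightarrow> ext0 X f x = 0"
  by (simp_all add: ext0_def)

lemma le_square_if_le_sqrt:
  fixes s :: real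
  assumes "s \<le> B * sqrt s" "0 \<le> s" "0 \<le> B"
  shows "s \<le> B\<^sup>2"
proof (cases "s = 0")
  case False
  then have s: "0 < sqrt s" using assms by simp
  have "sqrt s * sqrt s \<le> B * sqrt s" using assms by simp
  then have "sqrt s \<le> B" using s by (simp only: mult_le_cancel_right_pos)
  then have "(sqrt s)\<^sup>2 \<le> B\<^sup>2" using s by (intro power_mono) auto
  then show ?thesis using assms by simp
qed simp

lemma ext0_sum: "(\<Sum>\<^sub>\<infinity>x. (cmod (ext0 X f x))\<^sup>2) = (\<Sum>\<^sub>\<infinity>x\<in>X. (cmod (f x))\<^sup>2)"
  by (rule infsum_cong_neutral) (auto simp: ext0_def)

lemma ext0_sqsum: "sqsum (ext0 X f) \<longleftrightarrow> (\<lambda>x. (cmod (f x))\<^sup>2) summable_on X"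
  unfolding sqsum_def by (rule summable_on_cong_neutral) (auto simp: ext0_def)

lemma ell2_iff: "f \<in> ell2 X \<longleftrightarrow> f \<in> extensional X \<and> sqsum (ext0 X f)"
  by (simp add: ell2_def ext0_sqsum)

lemma ell2_norm_eq:
  assumes "Rep_l2 u = ext0 X f"
  shows "ell2_norm X f = norm u"
proof -
  have "(norm u)\<^sup>2 = (\<Sum>\<^sub>\<infinity>x\<in>X. (cmod (f x))\<^sup>2)"
    unfolding norm_l2_square assms by (rule ext0_sum)
  then have "ell2_norm X f = sqrt ((norm u)\<^sup>2)" by (simp only: ell2_norm_def)
  then show ?thesis by simp
qed

lemma kernel_resolvent:
  fixes T :: "'v pair_pre_digraph" and K :: "'v \<Rightarrow> 'v \<Rightarrow> complex"
  assumes bg: "bounded_graph (parcs T) d" and EX: "parcs T \<subseteq> pverts T \<times> pverts T"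
    and Ksym: "\<And>p q. p \<in> pverts T \<Longrightarrow> q \<in> pverts T \<Longrightarrow> K p q = K q p"
    and inv: "\<And>p q. p \<in> pverts T \<Longrightarrow> q \<in> pverts T \<Longrightarrow> 
        z * K p q - (\<Sum>p'\<in>parcs T `` {p}. K p' q) = of_bool (p = q)"
    and bound: "\<And>P Q f g. finite P \<Longrightarrow> finite Q \<Longrightarrow> P \<subseteq> pverts T \<Longrightarrow> Q \<subseteq> pverts T \<Longrightarrow>
        cmod (\<Sum>p\<in>P. \<Sum>q\<in>Q. f p * K p q * g q) \<le> C * L2_set (\<lambda>p. cmod (f p)) P * L2_set (\<lambda>q. cmod (g q)) Q"
    and C: "0 \<le> C"
  shows "z \<in> resolvent_set T"
proof -
  interpret bounded_graph "parcs T" d by fact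
  let ?X = "pverts T" and ?E = "parcs T"
  define K0 where "K0 p q = (if p \<in> ?X \<and> q \<in> ?X then K p q else 0)" for p q
  have EX1: "y \<in> ?X" if "y \<in> ?E `` {x}" for x y using that EX by auto
  have K0_bound: "cmod (\<Sum>p\<in>P. \<Sum>q\<in>Q. f p * K0 p q * g q) \<le> C * L2_set (\<lambda>p. cmod (f p)) P * L2_set (\<lambda>q. cmod (g q)) Q"
    if "finite P" "finite Q" for P Q f g
  proof -
    have "(\<Sum>p\<in>P. \<Sum>q\<in>Q. f p * K0 p q * g q) = (\<Sum>p\<in>P \<inter> ?X. \<Sum>q\<in>Q. f p * K0 p q * g q)"
      using that by (intro sum.mono_neutral_right) (auto simp: K0_def)
    also have "\<dots> = (\<Sum>p\<in>P \<inter> ?X. \<Sum>q\<in>Q \<inter> ?X. f p * K p q * g q)"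
    proof (rule sum.cong[OF refl])
      fix p assume p: "p \<in> P \<inter> ?X"
      have "(\<Sum>q\<in>Q. f p * K0 p q * g q) = (\<Sum>q\<in>Q \<inter> ?X. f p * K0 p q * g q)"
        using that by (intro sum.mono_neutral_right) (auto simp: K0_def)
      also have "\<dots> = (\<Sum>q\<in>Q \<inter> ?X. f p * K p q * g q)"
        using p by (intro sum.cong) (auto simp: K0_def)
      finally show "(\<Sum>q\<in>Q. f p * K0 p q * g q) = (\<Sum>q\<in>Q \<inter> ?X. f p * K p q * g q)" .
    qed
    finally have "cmod (\<Sum>p\<in>P. \<Sum>q\<in>Q. f p * K0 p q * g q) 
       \<le> C * L2_set (\<lambda>p. cmod (f p)) (P \<inter> ?X) * L2_set (\<lambda>q. cmod (g q)) (Q \<inter> ?X)"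
      using bound[of "P \<inter> ?X" "Q \<inter> ?X" f g] that by simp
    also have "\<dots> \<le> C * L2_set (\<lambda>p. cmod (f p)) P * L2_set (\<lambda>q. cmod (g q)) Q"
      unfolding L2_set_def using that C
      by (intro mult_mono mult_nonneg_nonneg real_sqrt_le_mono sum_mono2) (auto intro: sum_nonneg)
    finally show ?thesis .
  qed
  \<comment> \<open>Testing the bounded form against the conjugate of the row itself bounds the row
    in l2; \<open>T_bound\<close> below uses the same duality for the image of a vector.\<close>
  have K0_sq: "sqsum (K0 p)" for p
  proof (rule norm_l2_leI(1)[where b = C])
    fix S :: "'v set" assume S: "finite S"
    let ?s = "\<Sum>q\<in>S. (cmod (K0 p q))\<^sup>2"
    have "cmod (\<Sum>q\<in>S. K0 p q * cnj (K0 p q)) \<le> C * L2_set (\<lambda>q. cmod (K0 p q)) S"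
      using K0_bound[of "{p}" S "\<lambda>_. 1" "\<lambda>q. cnj (K0 p q)"] S by simp
    moreover have "(\<Sum>q\<in>S. K0 p q * cnj (K0 p q)) = of_real ?s"
      by (simp flip: complex_norm_square)
    moreover have s0: "0 \<le> ?s" by (simp add: sum_nonneg)
    ultimately have "?s \<le> C * sqrt ?s" by (simp only: norm_of_real abs_of_nonneg L2_set_def)
    then show "?s \<le> C\<^sup>2" using s0 C by (rule le_square_if_le_sqrt)
  qed
  have T_bound: "(\<Sum>p\<in>S. (cmod (pair (K0 p) g))\<^sup>2) \<le> (C * norm u)\<^sup>2" 
    if S: "finite S" and g: "sqsum g" "Rep_l2 u = g" for S g u
  proof -
    let ?s = "\<Sum>p\<in>S. (cmod (pair (K0 p) g))\<^sup>2"
    let ?f = "\<lambda>p. cnj (pair (K0 p) g)"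
    have sq: "sqsum (\<lambda>q. ?f p * K0 p q)" for p by (intro sqsum_cmult K0_sq)
    have "complex_of_real ?s = (\<Sum>p\<in>S. ?f p * pair (K0 p) g)"
      by (simp only: of_real_sum complex_norm_square mult.commute)
    also have "\<dots> = pair (\<lambda>q. \<Sum>p\<in>S. ?f p * K0 p q) g"
      by (subst pair_sum_left(2)[OF S sq g(1)]) (simp add: pair_cmult_left)
    finally have e: "complex_of_real ?s = pair (\<lambda>q. \<Sum>p\<in>S. ?f p * K0 p q) g" .
    have s0: "0 \<le> ?s" by (simp add: sum_nonneg)
    have "?s = cmod (complex_of_real ?s)" using s0 by (simp only: norm_of_real abs_of_nonneg)
    also have "\<dots> = cmod (pair (\<lambda>q. \<Sum>p\<in>S. ?f p * K0 p q) g)" by (simp only: e)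
    also have "\<dots> \<le> C * L2_set (\<lambda>p. cmod (?f p)) S * norm u"
    proof (rule pair_norm_le)
      fix Q :: "'v set" assume Q: "finite Q"
      have "(\<Sum>q\<in>Q. (\<Sum>p\<in>S. ?f p * K0 p q) * g q) = (\<Sum>p\<in>S. \<Sum>q\<in>Q. ?f p * K0 p q * g q)"
        by (simp add: sum_distrib_right) (rule sum.swap)
      then have "cmod (\<Sum>q\<in>Q. (\<Sum>p\<in>S. ?f p * K0 p q) * g q) 
          \<le> C * L2_set (\<lambda>p. cmod (?f p)) S * L2_set (\<lambda>q. cmod (g q)) Q"
        using K0_bound[OF S Q, of ?f g] by simp
      also have "\<dots> \<le> C * L2_set (\<lambda>p. cmod (?f p)) S * norm u"
        using L2_set_le_norm[OF Q, of u] g C by (intro mult_left_mono mult_nonneg_nonneg) (auto simp: L2_set_def sum_nonneg)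
      finally show "cmod (\<Sum>q\<in>Q. (\<Sum>p\<in>S. ?f p * K0 p q) * g q) \<le> C * L2_set (\<lambda>p. cmod (?f p)) S * norm u" .
    qed (use g pair_sum_left(1)[OF S sq g(1)] in auto)
    finally have "?s \<le> (C * norm u) * sqrt ?s" by (simp add: L2_set_def mult_ac)
    then show ?thesis using C by (intro le_square_if_le_sqrt) (auto intro: sum_nonneg)
  qed
  have inv0: "z * K0 p q - (\<Sum>p'\<in>?E `` {p}. K0 p' q) = of_bool (p = q)" if "p \<in> ?X" "q \<in> ?X" for p q
  proof -
    have "(\<Sum>p'\<in>?E `` {p}. K0 p' q) = (\<Sum>p'\<in>?E `` {p}. K p' q)"
      using that EX1 by (intro sum.cong) (auto simp: K0_def)
    then show ?thesis using inv[OF that] that by (simp add: K0_def)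
  qed
  have sym0: "K0 p q = K0 q p" for p q using Ksym by (simp add: K0_def)
  \<comment> \<open>The sign appears because the resolvent set is defined through A - z whereas the
    kernel inverts z - A.\<close>
  define G where "G g = (\<lambda>x\<in>?X. - pair (K0 x) (ext0 ?X g))" for g
  define S where "S = (\<lambda>f. \<lambda>x\<in>?X. adjacency T f x - z * f x)"
  have adjE: "adjacency T f x = nbr_sum ?E (ext0 ?X f) x" if "x \<in> ?X" for f x
  proof -
    have "{y. (x, y) \<in> ?E} = ?E `` {x}" by auto
    then show ?thesis using that EX1 by (auto simp: adjacency_def nbr_sum_def ext0_def intro!: sum.cong)
  qed
  have nbr0: "nbr_sum ?E h x = 0" if "x \<notin> ?X" for h x
  proof -
    have "?E `` {x} = {}" using that EX by auto
    then show ?thesis by (simp add: nbr_sum_def)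
  qed
  have S0: "ext0 ?X (S f) = (\<lambda>x. nbr_sum ?E (ext0 ?X f) x - z * ext0 ?X f x)" for f
  proof
    show "ext0 ?X (S f) x = nbr_sum ?E (ext0 ?X f) x - z * ext0 ?X f x" for x
      by (cases "x \<in> ?X") (simp_all add: S_def adjE nbr0)
  qed
  have S_in: "S f \<in> ell2 ?X" if "f \<in> ell2 ?X" for f
    using that unfolding ell2_iff S0 by (intro conjI sqsum_diff sqsum_cmult sqsum_adj) (auto simp: S_def)
  have G0: "ext0 ?X (G g) = (\<lambda>x. - pair (K0 x) (ext0 ?X g))" for g
  proof -
    have "K0 x = (\<lambda>_. 0)" if "x \<notin> ?X" for x using that by (simp add: K0_def fun_eq_iff)
    then have "ext0 ?X (G g) x = - pair (K0 x) (ext0 ?X g)" for x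
      by (cases "x \<in> ?X") (simp_all add: G_def pair_def)
    then show ?thesis by (rule ext)
  qed
  have G_sq: "sqsum (ext0 ?X (G g))" if "g \<in> ell2 ?X" for g
    unfolding G0
  proof (rule sqsum_uminus, rule norm_l2_leI(1))
    have sq: "sqsum (ext0 ?X g)" using that by (simp add: ell2_iff)
    show "(\<Sum>x\<in>S. (cmod (pair (K0 x) (ext0 ?X g)))\<^sup>2) \<le> (C * norm (Abs_l2 (ext0 ?X g)))\<^sup>2" if "finite S" for S
      using T_bound[OF that sq] sq by (simp add: Abs_l2_inverse)
  qed
  have G_in: "G g \<in> ell2 ?X" if "g \<in> ell2 ?X" for g
    using G_sq[OF that] by (simp add: ell2_iff) (simp add: G_def)
  have SGx: "S (G g) x = g x" if g: "g \<in> ell2 ?X" and x: "x \<in> ?X" for g x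
  proof -
    have sq: "sqsum (ext0 ?X g)" using g by (simp add: ell2_iff)
    have fE: "finite (?E `` {x})" by (rule finite_nbrs)
    have sqE: "sqsum (\<lambda>q. \<Sum>p'\<in>?E `` {x}. K0 p' q)" by (rule pair_sum_left(1)[OF fE K0_sq sq])
    have "S (G g) x = ext0 ?X (S (G g)) x" using x by (simp add: ext0_def)
    also have "\<dots> = z * pair (K0 x) (ext0 ?X g) - (\<Sum>p'\<in>?E `` {x}. pair (K0 p') (ext0 ?X g))"
      unfolding S0 G0 by (simp add: nbr_sum_def sum_negf)
    also have "\<dots> = pair (\<lambda>q. z * K0 x q - (\<Sum>p'\<in>?E `` {x}. K0 p' q)) (ext0 ?X g)"
      by (simp only: pair_diff_left[OF sqsum_cmult[OF K0_sq] sqE sq] pair_cmult_left pair_sum_left(2)[OF fE K0_sq sq])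
    also have "\<dots> = pair (\<lambda>q. of_bool (q = x)) (ext0 ?X g)"
      unfolding pair_def using inv0[OF x] by (intro infsum_cong) (auto simp: ext0_def)
    also have "\<dots> = (\<Sum>\<^sub>\<infinity>q\<in>{x}. ext0 ?X g q)"
      unfolding pair_def by (rule infsum_cong_neutral) auto
    also have "\<dots> = g x" using x by (simp add: ext0_def)
    finally show "S (G g) x = g x" .
  qed
  have ell2_ext: "g \<in> extensional ?X" if "g \<in> ell2 ?X" for g using that by (simp add: ell2_def)
  have SG: "S (G g) = g" if g: "g \<in> ell2 ?X" for g
    by (rule extensionalityI[OF ell2_ext[OF S_in[OF G_in[OF g]]] ell2_ext[OF g]]) (rule SGx[OF g])
  \<comment> \<open>The left inverse property: A is moved from the function to the row of the
    kernel, and the symmetry of the kernel turns the row equation into the assumed column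
    equation.\<close>
  have GSx: "G (S f) x = f x" if f: "f \<in> ell2 ?X" and x: "x \<in> ?X" for f x
  proof -
    have sq: "sqsum (ext0 ?X f)" using f by (simp add: ell2_iff)
    have "G (S f) x = - pair (K0 x) (\<lambda>y. adj (ext0 ?X f) y - z * ext0 ?X f y)"
      using x by (simp add: G_def S0)
    also have "\<dots> = z * pair (K0 x) (ext0 ?X f) - pair (K0 x) (adj (ext0 ?X f))"
      by (simp add: pair_diff_right[OF sqsum_adj[OF sq] sqsum_cmult[OF sq] K0_sq] pair_cmult_right)
    also have "pair (K0 x) (adj (ext0 ?X f)) = pair (adj (K0 x)) (ext0 ?X f)"
      by (rule pair_adj[symmetric, OF K0_sq sq])
    also have "z * pair (K0 x) (ext0 ?X f) - pair (adj (K0 x)) (ext0 ?X f) 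
        = pair (\<lambda>q. z * K0 x q - adj (K0 x) q) (ext0 ?X f)"
      by (simp add: pair_diff_left[OF sqsum_cmult[OF K0_sq] sqsum_adj[OF K0_sq] sq] pair_cmult_left)
    also have "\<dots> = pair (\<lambda>q. of_bool (q = x)) (ext0 ?X f)"
      unfolding pair_def
    proof (rule infsum_cong)
      fix q
      show "(z * K0 x q - adj (K0 x) q) * ext0 ?X f q = of_bool (q = x) * ext0 ?X f q"
      proof (cases "q \<in> ?X")
        case True
        have "adj (K0 x) q = (\<Sum>p'\<in>?E `` {q}. K0 p' x)" unfolding nbr_sum_def by (simp add: sym0[of x])
        then show ?thesis using inv0[OF True x] sym0[of x q] by simp
      qed (simp add: ext0_def)
    qed
    also have "\<dots> = (\<Sum>\<^sub>\<infinity>q\<in>{x}. ext0 ?X f q)"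
      unfolding pair_def by (rule infsum_cong_neutral) auto
    also have "\<dots> = f x" using x by (simp add: ext0_def)
    finally show "G (S f) x = f x" .
  qed
  have GS: "G (S f) = f" if f: "f \<in> ell2 ?X" for f
    by (rule extensionalityI[OF ell2_ext[OF G_in[OF S_in[OF f]]] ell2_ext[OF f]]) (rule GSx[OF f])
  have "bij_betw S (ell2 ?X) (ell2 ?X)"
    by (rule bij_betw_byWitness[where f' = G]) (use SG GS S_in G_in in blast)+
  moreover have "ell2_norm ?X f \<le> C * ell2_norm ?X (S f)" if f: "f \<in> ell2 ?X" for f
  proof -
    let ?g = "S f"
    have g: "?g \<in> ell2 ?X" by (rule S_in[OF f])
    have sqg: "sqsum (ext0 ?X ?g)" using g by (simp add: ell2_iff)
    have sqf: "sqsum (ext0 ?X f)" using f by (simp add: ell2_iff)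
    have Rg: "Rep_l2 (Abs_l2 (ext0 ?X ?g)) = ext0 ?X ?g" using sqg by (simp add: Abs_l2_inverse)
    have Rf: "Rep_l2 (Abs_l2 (ext0 ?X f)) = ext0 ?X f" using sqf by (simp add: Abs_l2_inverse)
    have "norm (Abs_l2 (ext0 ?X f)) \<le> C * norm (Abs_l2 (ext0 ?X ?g))"
    proof (rule norm_l2_leI(2)[OF _ _ Rf])
      fix S :: "'v set" assume "finite S"
      then have "(\<Sum>x\<in>S. (cmod (pair (K0 x) (ext0 ?X ?g)))\<^sup>2) \<le> (C * norm (Abs_l2 (ext0 ?X ?g)))\<^sup>2"
        using T_bound[OF _ sqg Rg] by blast
      moreover have "ext0 ?X f = (\<lambda>x. - pair (K0 x) (ext0 ?X ?g))" using G0[of ?g] GS[OF f] by simp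
      ultimately show "(\<Sum>x\<in>S. (cmod (ext0 ?X f x))\<^sup>2) \<le> (C * norm (Abs_l2 (ext0 ?X ?g)))\<^sup>2" by simp
    qed (use C in simp)
    then show ?thesis using ell2_norm_eq[OF Rf] ell2_norm_eq[OF Rg] by simp
  qed
  ultimately have "bij_betw S (ell2 ?X) (ell2 ?X) \<and> (\<exists>B. \<forall>f\<in>ell2 ?X. ell2_norm ?X f \<le> B * ell2_norm ?X (S f))"
    by blast
  then show ?thesis unfolding resolvent_set_def Let_def S_def by simp
qed

lemma map_poly_of_real_eq_0: "map_poly complex_of_real p = 0 \<longleftrightarrow> p = 0"
  by (simp add: poly_eq_iff coeff_map_poly)

section \<open>Polynomials of the operator and points of the spectrum\<close>

context bounded_graph
begin

definition opoly :: "complex poly \<Rightarrow> 'v l2 \<Rightarrow> 'v l2" where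
  "opoly p u = (\<Sum>i\<le>degree p. cscale (coeff p i) ((adjop ^^ i) u))"

lemma cscale_zero: "cscale 0 u = 0" by (rule l2_eqI) (simp add: cscale.rep_eq l2_simps)

lemma opoly_eq: "degree p \<le> n \<Longrightarrow> opoly p u = (\<Sum>i\<le>n. cscale (coeff p i) ((adjop ^^ i) u))"
  unfolding opoly_def by (intro sum.mono_neutral_left) (auto simp: coeff_eq_0 cscale_zero)

lemma adjop_sum: "finite S \<Longrightarrow> adjop (sum f S) = (\<Sum>i\<in>S. adjop (f i))"
proof (induction S rule: finite_induct)
  case empty
  have "adjop 0 = 0" using adjop_scaleR[of 0 0] by simp
  then show ?case by simp
qed (simp add: adjop_add)

lemma cscale_sum: "finite S \<Longrightarrow> cscale c (sum f S) = (\<Sum>i\<in>S. cscale c (f i))"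
proof (induction S rule: finite_induct)
  case empty
  show ?case by (rule l2_eqI) (simp add: cscale.rep_eq l2_simps)
qed (simp add: cscale_simps)

lemma opoly_add: "opoly (p + q) u = opoly p u + opoly q u"
proof -
  let ?n = "max (degree p) (degree q)"
  have "degree (p + q) \<le> ?n" by (rule degree_add_le_max)
  then show ?thesis
    by (simp add: opoly_eq[of _ ?n] cscale_simps sum.distrib)
qed

lemma opoly_smult: "opoly (Polynomial.smult c p) u = cscale c (opoly p u)"
  using degree_smult_le[of c p]
  by (simp add: opoly_eq[of _ "degree p"] cscale_simps cscale_sum)

lemma opoly_pCons: "opoly (pCons a p) u = cscale a u + adjop (opoly p u)"
proof -
  have "opoly (pCons a p) u = (\<Sum>i\<le>Suc (degree p). cscale (coeff (pCons a p) i) ((adjop ^^ i) u))"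
    by (rule opoly_eq) (rule degree_pCons_le)
  also have "\<dots> = cscale a u + (\<Sum>i\<le>degree p. cscale (coeff p i) (adjop ((adjop ^^ i) u)))"
    by (subst sum.atMost_Suc_shift) simp
  finally show ?thesis by (simp add: opoly_def adjop_sum adjop_cscale)
qed

lemma opoly_mult: "opoly (p * q) u = opoly p (opoly q u)"
proof (induction p)
  case 0
  show ?case by (simp add: opoly_def cscale_zero)
next
  case (pCons a p)
  have "opoly (pCons a p * q) u = cscale a (opoly q u) + opoly (pCons 0 (p * q)) u"
    by (simp add: opoly_add opoly_smult)
  then show ?case by (simp add: opoly_pCons pCons.IH cscale_zero)
qed

lemma opoly_const: "opoly [:c:] u = cscale c u"
  by (simp add: opoly_def)

lemma opoly_linear: "opoly [:- r, 1:] u = adjop u - cscale r u"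
  unfolding opoly_pCons[of "- r" "[:1:]"] opoly_const cscale_simps(6)
  by (rule l2_eqI) (simp add: cscale.rep_eq l2_simps)

lemma norm_adjop_pow: "norm ((adjop ^^ i) u) \<le> d ^ i * norm u"
proof (induction i)
  case (Suc i)
  have "norm ((adjop ^^ Suc i) u) \<le> d * norm ((adjop ^^ i) u)" using norm_adjop by simp
  also have "\<dots> \<le> d * (d ^ i * norm u)" using Suc d_pos by (intro mult_left_mono) auto
  finally show ?case by (simp add: mult_ac)
qed simp

lemma opoly_bounded: "\<exists>M\<ge>0. \<forall>u. norm (opoly p u) \<le> M * norm u"
proof (intro exI conjI allI)
  let ?M = "\<Sum>i\<le>degree p. cmod (coeff p i) * d ^ i"
  show "0 \<le> ?M" using d_pos by (intro sum_nonneg mult_nonneg_nonneg) auto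
  fix u
  have "norm (opoly p u) \<le> (\<Sum>i\<le>degree p. cmod (coeff p i) * (d ^ i * norm u))"
    unfolding opoly_def using norm_adjop_pow
    by (intro sum_norm_le) (auto simp: norm_cscale intro!: mult_left_mono)
  then show "norm (opoly p u) \<le> ?M * norm u" by (simp add: sum_distrib_right mult.assoc)
qed

lemma inner_opoly:
  "inner (opoly (map_poly of_real p) u) v = inner u (opoly (map_poly of_real p) v)"
proof -
  have a: "inner ((adjop ^^ i) u) v = inner u ((adjop ^^ i) v)" for i
  proof (induction i arbitrary: u)
    case (Suc i)
    have "inner ((adjop ^^ Suc i) u) v = inner ((adjop ^^ i) (adjop u)) v" by (simp add: funpow_swap1)
    also have "\<dots> = inner (adjop u) ((adjop ^^ i) v)" by (rule Suc)
    finally show ?case by (simp add: inner_adjop)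
  qed simp
  show ?thesis
    by (simp add: opoly_def inner_sum_left inner_sum_right coeff_map_poly cscale_of_real a)
qed

definition supp_in :: "'v set \<Rightarrow> 'v l2 \<Rightarrow> bool" where
  "supp_in X u \<longleftrightarrow> (\<forall>x. x \<notin> X \<longrightarrow> Rep_l2 u x = 0)"

context
  fixes X assumes EX: "E \<subseteq> X \<times> X"
begin

lemma supp_adjop: "supp_in X (adjop u)"
proof -
  have "E `` {x} = {}" if "x \<notin> X" for x using that EX by auto
  then show ?thesis by (simp add: supp_in_def Rep_adjop nbr_sum_def)
qed

lemma supp_cscale: "supp_in X u \<Longrightarrow> supp_in X (cscale c u)"
  by (simp add: supp_in_def cscale.rep_eq)

lemma supp_add: "supp_in X u \<Longrightarrow> supp_in X v \<Longrightarrow> supp_in X (u + v)"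
  by (simp add: supp_in_def l2_simps)

lemma supp_opoly: "supp_in X u \<Longrightarrow> supp_in X (opoly p u)"
proof (induction p)
  case 0
  show ?case by (simp add: opoly_def supp_in_def cscale_zero l2_simps)
next
  case (pCons a p)
  then show ?case by (simp add: opoly_pCons supp_add supp_cscale supp_adjop)
qed

text \<open>Restricted to vectors supported in \<open>X\<close>: the elements of the type outside
  the graph are isolated and would otherwise add the value 0 to the spectrum.\<close>

definition bdd_below_op :: "('v l2 \<Rightarrow> 'v l2) \<Rightarrow> bool" where
  "bdd_below_op A \<longleftrightarrow> (\<exists>b>0. \<forall>u. supp_in X u \<longrightarrow> b * norm u \<le> norm (A u))"

text \<open>Factor the polynomial over the complex numbers; a composition of operators that are
  bounded below is bounded below.\<close>

lemma opoly_bdd_below: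
  assumes "p \<noteq> 0" "\<And>r. poly p r = 0 \<Longrightarrow> bdd_below_op (\<lambda>u. adjop u - cscale r u)"
  shows "bdd_below_op (opoly p)"
  using assms
proof (induction "degree p" arbitrary: p)
  case 0
  then obtain c where c: "p = [:c:]" by (metis degree_eq_zeroE)
  then show ?case unfolding bdd_below_op_def using 0
    by (intro exI[of _ "cmod c"]) (auto simp: opoly_const norm_cscale)
next
  case (Suc n)
  then have "\<not> constant (poly p)" by (simp add: constant_degree)
  then obtain r where r: "poly p r = 0" using fundamental_theorem_of_algebra by blast
  then obtain q where q: "p = [:- r, 1:] * q" unfolding poly_eq_0_iff_dvd by (elim dvdE)
  have q0: "q \<noteq> 0" using Suc.prems(1) q by auto
  have "degree p = Suc (degree q)" unfolding q using q0 by (subst degree_mult_eq) auto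
  then have "n = degree q" using Suc.hyps(2) by simp
  then have "bdd_below_op (opoly q)"
    using q0 Suc.prems(2) by (intro Suc.hyps(1)) (auto simp: q)
  then obtain b where b: "0 < b" "\<And>u. supp_in X u \<Longrightarrow> b * norm u \<le> norm (opoly q u)"
    unfolding bdd_below_op_def by blast
  obtain b' where b': "0 < b'" "\<And>u. supp_in X u \<Longrightarrow> b' * norm u \<le> norm (adjop u - cscale r u)"
    using Suc.prems(2)[OF r] unfolding bdd_below_op_def by blast
  have "b' * b * norm u \<le> norm (opoly p u)" if u: "supp_in X u" for u
  proof -
    have "b' * (b * norm u) \<le> b' * norm (opoly q u)" using b(2)[OF u] b' by (intro mult_left_mono) auto
    also have "\<dots> \<le> norm (adjop (opoly q u) - cscale r (opoly q u))"
      by (rule b'(2)[OF supp_opoly[OF u]])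
    finally show ?thesis by (simp only: q opoly_mult opoly_linear mult.assoc)
  qed
  then show ?case unfolding bdd_below_op_def using b b' by (intro exI[of _ "b' * b"]) auto
qed

text \<open>\<open>\<parallel>S\<parallel>\<^sup>2\<close> is an approximate eigenvalue of \<open>S\<^sup>2\<close> for the self-adjoint operator \<open>S = q(A)\<close>.\<close>

lemma square_not_bdd_below:
  fixes q :: "real poly"
  defines "S \<equiv> opoly (map_poly of_real q)"
  assumes u0: "supp_in X u0" "S u0 \<noteq> 0"
  shows "\<exists>c>0. \<not> bdd_below_op (opoly (map_poly of_real (q * q - [:c:])))"
proof -
  obtain M0 where M0: "0 \<le> M0" "\<And>u. norm (S u) \<le> M0 * norm u"
    using opoly_bounded unfolding S_def by blast
  have Ssc: "S (c *\<^sub>R u) = c *\<^sub>R S u" for c u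
  proof -
    have aj: "(adjop ^^ i) (c *\<^sub>R u) = c *\<^sub>R (adjop ^^ i) u" for i
      by (induction i) (simp_all add: adjop_scaleR)
    have cs: "cscale a (c *\<^sub>R v) = c *\<^sub>R cscale a v" for a v
      by (rule l2_eqI) (simp add: cscale.rep_eq l2_simps)
    show ?thesis by (simp add: S_def opoly_def aj cs scaleR_sum_right)
  qed
  let ?U = "{u. supp_in X u \<and> norm u = 1}"
  have sc: "supp_in X (c *\<^sub>R u)" if "supp_in X u" for c u
    using supp_cscale[OF that, of "of_real c"] by (simp add: cscale_of_real)
  have "S 0 = 0" using Ssc[of 0 0] by simp
  then have "u0 \<noteq> 0" using u0 by auto
  define v0 where "v0 = (1 / norm u0) *\<^sub>R u0"
  have v0: "v0 \<in> ?U" "S v0 \<noteq> 0" using u0 \<open>u0 \<noteq> 0\<close> by (auto simp: v0_def Ssc sc)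
  define c where "c = (SUP u\<in>?U. (norm (S u))\<^sup>2)"
  have bdd: "bdd_above ((\<lambda>u. (norm (S u))\<^sup>2) ` ?U)"
  proof (rule bdd_aboveI2)
    fix u assume "u \<in> ?U"
    then have "norm (S u) \<le> M0" using M0(2)[of u] by simp
    then show "(norm (S u))\<^sup>2 \<le> M0\<^sup>2" by (intro power_mono) auto
  qed
  have cu: "(norm (S u))\<^sup>2 \<le> c" if "u \<in> ?U" for u
    unfolding c_def by (rule cSUP_upper[OF that bdd])
  have c: "0 < c" 
  proof -
    have "0 < (norm (S v0))\<^sup>2" using v0(2) by simp
    then show ?thesis using cu[OF v0(1)] by linarith
  qed
  have cu': "(norm (S u))\<^sup>2 \<le> c * (norm u)\<^sup>2" if u: "supp_in X u" for u
  proof (cases "u = 0")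
    case True
    then show ?thesis using \<open>S 0 = 0\<close> by simp
  next
    case False
    have "(norm (S ((1 / norm u) *\<^sub>R u)))\<^sup>2 \<le> c" using u False by (intro cu) (auto simp: sc)
    then show ?thesis using False by (simp add: Ssc power_divide pos_divide_le_eq)
  qed
  have "\<not> bdd_below_op (opoly (map_poly of_real (q * q - [:c:])))"
  proof
    assume "bdd_below_op (opoly (map_poly of_real (q * q - [:c:])))"
    then obtain b where b: "0 < b" "\<And>u. supp_in X u \<Longrightarrow> b * norm u \<le> norm (opoly (map_poly of_real (q * q - [:c:])) u)"
      unfolding bdd_below_op_def by blast
    have mp: "map_poly complex_of_real (q * q - [:c:]) = map_poly of_real q * map_poly of_real q + [:- of_real c:]"
      by (rule poly_eqI) (simp add: coeff_map_poly coeff_mult coeff_pCons split: nat.split)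
    have op: "opoly (map_poly of_real (q * q - [:c:])) u = S (S u) - c *\<^sub>R u" for u
      unfolding mp opoly_add opoly_mult opoly_const S_def
      by (rule l2_eqI) (simp add: l2_simps cscale.rep_eq)
    \<comment> \<open>Chosen so that \<open>c * e\<close> is half of the square of \<open>b\<close>:
      a vector whose image under \<open>S\<close> has squared norm above \<open>c - e\<close> then
      violates the lower bound \<open>b\<close>.\<close>
    define e where "e = b\<^sup>2 / (2 * c)"
    have e: "0 < e" using b c by (simp add: e_def)
    obtain u where u: "u \<in> ?U" "c - e < (norm (S u))\<^sup>2"
    proof -
      have "\<exists>u\<in>?U. c - e < (norm (S u))\<^sup>2"
        using e v0 unfolding c_def by (subst less_cSUP_iff[OF _ bdd, symmetric]) auto
      then show ?thesis using that by blast
    qed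
    have su: "supp_in X (S u)" using u unfolding S_def by (intro supp_opoly) auto
    have "inner (S (S u)) u = inner (S u) (S u)" unfolding S_def by (rule inner_opoly)
    then have "inner (S (S u)) u = (norm (S u))\<^sup>2" by (simp only: power2_norm_eq_inner)
    moreover have "inner u u = 1" using u by (simp flip: power2_norm_eq_inner)
    moreover have "(norm (a - c *\<^sub>R u))\<^sup>2 = (norm a)\<^sup>2 - 2 * c * inner a u + c\<^sup>2 * inner u u" for a
      unfolding power2_norm_eq_inner inner_diff_left inner_diff_right inner_scaleR_left inner_scaleR_right inner_commute[of u a]
      by (simp add: power2_eq_square algebra_simps)
    ultimately have "(norm (S (S u) - c *\<^sub>R u))\<^sup>2 = (norm (S (S u)))\<^sup>2 - 2 * c * (norm (S u))\<^sup>2 + c\<^sup>2"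
      by simp
    also have "\<dots> \<le> c * (norm (S u))\<^sup>2 - 2 * c * (norm (S u))\<^sup>2 + c\<^sup>2"
      using cu'[OF su] by simp
    also have "\<dots> = c * (c - (norm (S u))\<^sup>2)" by (simp add: algebra_simps power2_eq_square)
    also have "\<dots> < c * e" using u c by (intro mult_strict_left_mono) auto
    also have "\<dots> = b\<^sup>2 / 2" using c by (simp add: e_def)
    finally have "(norm (S (S u) - c *\<^sub>R u))\<^sup>2 < b\<^sup>2 / 2" .
    moreover have "b \<le> norm (S (S u) - c *\<^sub>R u)" using b(2)[of u] u by (simp add: op)
    then have "b\<^sup>2 \<le> (norm (S (S u) - c *\<^sub>R u))\<^sup>2" using b by (intro power_mono) auto
    ultimately show False using zero_less_power[OF b(1), of 2] by linarith
  qed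
  then show ?thesis using c by blast
qed

end

end

text \<open>Let q vanish on \<open>F\<close>. As q(A) is nonzero, some c > 0 makes q(A)^2 - c fail
  to be bounded below, hence A - r fails for some root r of q^2 - c. By self-adjointness r is real;
  it belongs to the spectrum, and q(r)^2 = c > 0 keeps it out of \<open>F\<close>.\<close>

lemma spectrum_not_subset_finite:
  fixes T :: "'v pair_pre_digraph"
  assumes bg: "bounded_graph (parcs T) d" and EX: "parcs T \<subseteq> pverts T \<times> pverts T"
    and x: "x \<in> pverts T" and ne: "\<And>p. p \<noteq> 0 \<Longrightarrow> bounded_graph.opoly (parcs T) p (delta x) \<noteq> 0"
    and F: "finite F"
  shows "\<exists>t\<in>adj_spectrum T. t \<notin> F"
proof -
  interpret bounded_graph "parcs T" d by fact
  let ?X = "pverts T" and ?R = "map_poly complex_of_real"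
  \<comment> \<open>Inserting 0 gives \<open>q\<close> positive degree even for empty
    \<open>F\<close>, so that q^2 - c cannot be the zero polynomial.\<close>
  define q :: "real poly" where "q = (\<Prod>f\<in>insert 0 F. [:- f, 1:])"
  have q0: "q \<noteq> 0" using F by (simp add: q_def)
  have "supp_in ?X (delta x)" using x by (auto simp: supp_in_def delta.rep_eq)
  moreover have "opoly (?R q) (delta x) \<noteq> 0" using ne[of "?R q"] q0 by (simp add: map_poly_of_real_eq_0)
  ultimately obtain c where c: "0 < c" "\<not> bdd_below_op ?X (opoly (?R (q * q - [:c:])))"
    using square_not_bdd_below[OF EX, of "delta x" q] by blast
  have p0: "?R (q * q - [:c:]) \<noteq> 0"
  proof
    assume "?R (q * q - [:c:]) = 0"
    then have qc: "q * q = [:c:]" unfolding map_poly_of_real_eq_0 by simp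
    then have "degree q = 0" using q0 by (metis add_is_0 degree_mult_eq degree_pCons_0)
    moreover have "degree q = (\<Sum>f\<in>insert 0 F. degree [:- f, 1:])"
      unfolding q_def by (rule degree_prod_eq_sum_degree) simp
    ultimately show False using F by (simp add: card_gt_0_iff)
  qed
  obtain r where r: "poly (?R (q * q - [:c:])) r = 0" "\<not> bdd_below_op ?X (\<lambda>u. adjop u - cscale r u)"
    using opoly_bdd_below[OF EX p0] c(2) by blast
  have "Im r = 0"
  proof (rule ccontr)
    assume "Im r \<noteq> 0"
    moreover have "\<bar>Im r\<bar> * norm u \<le> norm (adjop u - cscale r u)" for u
      using resolvent_norm_bound(1)[OF refl, of r u] by (simp add: norm_minus_commute)
    ultimately show False using r(2) unfolding bdd_below_op_def[OF EX] by (metis zero_less_abs_iff)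
  qed
  then obtain t where t: "r = of_real t" by (metis complex_is_Real_iff Reals_cases)
  have "poly (q * q - [:c:]) t = 0"
    using r(1) unfolding t eval_rpoly_def[symmetric] eval_rpoly_of_real of_real_eq_0_iff .
  then have "poly q t * poly q t = c" by simp
  moreover have "poly q f = 0" if "f \<in> F" for f using F that by (auto simp: q_def poly_prod)
  ultimately have "t \<notin> F" using c(1) by force
  moreover have "t \<in> adj_spectrum T"
  proof (rule ccontr)
    assume "t \<notin> adj_spectrum T"
    then obtain B where B: "\<And>f. f \<in> ell2 ?X \<Longrightarrow> ell2_norm ?X f 
        \<le> B * ell2_norm ?X (\<lambda>x\<in>?X. adjacency T f x - of_real t * f x)"
      unfolding adj_spectrum_def resolvent_set_def Let_def by blast
    have "norm u \<le> \<bar>B\<bar> * norm (adjop u - cscale r u)" if u: "supp_in ?X u" for u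
    proof -
      let ?f = "restrict (Rep_l2 u) ?X" and ?g = "\<lambda>x\<in>?X. adjacency T (restrict (Rep_l2 u) ?X) x - of_real t * restrict (Rep_l2 u) ?X x"
      have f: "ext0 ?X ?f = Rep_l2 u" using u by (auto simp: fun_eq_iff ext0_def supp_in_def)
      have "?f \<in> ell2 ?X" by (simp add: ell2_iff f sqsum_Rep)
      have "ext0 ?X ?g x = Rep_l2 (adjop u - cscale r u) x" for x
      proof (cases "x \<in> ?X")
        case True
        have "{y. (x, y) \<in> parcs T} = parcs T `` {x}" by auto
        then show ?thesis using True EX
          by (auto simp: adjacency_def l2_simps cscale.rep_eq Rep_adjop nbr_sum_def t intro!: sum.cong)
      next
        case False
        then show ?thesis using supp_adjop[OF EX, of u] u by (simp add: supp_in_def l2_simps cscale.rep_eq)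
      qed
      then have g: "Rep_l2 (adjop u - cscale r u) = ext0 ?X ?g" by auto
      have "norm u \<le> B * norm (adjop u - cscale r u)"
        using B[OF \<open>?f \<in> ell2 ?X\<close>] ell2_norm_eq[OF f[symmetric]] ell2_norm_eq[OF g] by simp
      also have "\<dots> \<le> \<bar>B\<bar> * norm (adjop u - cscale r u)" by (intro mult_right_mono) auto
      finally show ?thesis .
    qed
    moreover have "\<bar>B\<bar> * n \<le> (\<bar>B\<bar> + 1) * n" if "0 \<le> n" for n
      using that by (intro mult_right_mono) auto
    ultimately have "norm u \<le> (\<bar>B\<bar> + 1) * norm (adjop u - cscale r u)" if "supp_in ?X u" for u
      using that by (meson norm_ge_zero order.trans)
    then have "1 / (\<bar>B\<bar> + 1) * norm u \<le> norm (adjop u - cscale r u)" if "supp_in ?X u" for u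
      using that by (simp add: pos_divide_le_eq mult.commute)
    moreover have "0 < 1 / (\<bar>B\<bar> + 1)" by simp
    ultimately have "bdd_below_op ?X (\<lambda>u. adjop u - cscale r u)" 
      unfolding bdd_below_op_def[OF EX] by blast
    then show False using r(2) by simp
  qed
  ultimately show ?thesis by blast
qed

section \<open>The universal cover and its Green kernel\<close>

lemma vwalk_arcs_snoc: "p \<noteq> [] \<Longrightarrow> vwalk_arcs (p @ [w]) = vwalk_arcs p @ [(last p, w)]"
  by (induction p rule: vwalk_arcs.induct) auto

lemma vwalk_snoc:
  assumes "p \<noteq> []" 
  shows "vwalk (p @ [w]) (with_proj G) \<longleftrightarrow> vwalk p (with_proj G) \<and> w \<in> pverts G \<and> (last p, w) \<in> parcs G"
  using assms by (auto simp: vwalk_def vwalk_arcs_snoc)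

lemma nonbacktracking_snoc:
  "nonbacktracking (p @ [w]) \<longleftrightarrow> nonbacktracking p \<and> (2 \<le> length p \<longrightarrow> w \<noteq> p ! (length p - 2))"
proof
  assume L: "nonbacktracking (p @ [w])"
  have "nonbacktracking p"
    unfolding nonbacktracking_def
  proof (intro allI impI)
    fix i assume "i + 2 < length p"
    then show "p ! (i + 2) \<noteq> p ! i"
      using L[unfolded nonbacktracking_def, rule_format, of i] by (simp add: nth_append)
  qed
  moreover have "w \<noteq> p ! (length p - 2)" if "2 \<le> length p"
  proof -
    have "Suc (Suc (length p - 2)) = length p" using that by simp
    then show ?thesis
      using L[unfolded nonbacktracking_def, rule_format, of "length p - 2"] that by (simp add: nth_append)
  qed
  ultimately show "nonbacktracking p \<and> (2 \<le> length p \<longrightarrow> w \<noteq> p ! (length p - 2))" by blast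
next
  assume R: "nonbacktracking p \<and> (2 \<le> length p \<longrightarrow> w \<noteq> p ! (length p - 2))"
  show "nonbacktracking (p @ [w])"
    unfolding nonbacktracking_def
  proof (intro allI impI)
    fix i assume i: "i + 2 < length (p @ [w])"
    show "(p @ [w]) ! (i + 2) \<noteq> (p @ [w]) ! i"
    proof (cases "i + 2 < length p")
      case True
      then show ?thesis using R unfolding nonbacktracking_def by (auto simp: nth_append)
    next
      case False
      then have "i + 2 = length p" "length p - 2 = i" using i by auto
      then show ?thesis using R by (auto simp: nth_append)
    qed
  qed
qed

locale base_graph =
  fixes G :: "'a pair_pre_digraph" and r :: 'a
  assumes graph: "pair_graph G" and root: "r \<in> pverts G"
begin

sublocale pair_graph G by (rule graph)

text \<open>The cone types of the tree. \<open>(Some u, v)\<close> stands for the branch at v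
  entered from u, \<open>(None, v)\<close> for the whole tree seen from a vertex above v. These
  finitely many indices close up under \<open>succs\<close>, which lists the branches leaving v away
  from u.\<close>

definition dirs :: "('a option \<times> 'a) set" where
  "dirs = {(None, v) | v. v \<in> pverts G} \<union> {(Some u, v) | u v. (u, v) \<in> parcs G}"

definition succs :: "'a option \<times> 'a \<Rightarrow> ('a option \<times> 'a) set" where
  "succs i = {(Some (snd i), w) | w. (snd i, w) \<in> parcs G \<and> fst i \<noteq> Some w}"

lemma cf: "cf_system dirs succs"
proof
  have "dirs \<subseteq> (insert None (Some ` pverts G)) \<times> pverts G"
    unfolding dirs_def using arc_fst_in_verts arc_snd_in_verts by fastforce
  then show "finite dirs" using pair_finite_verts finite_subset by fastforce
  show "succs i \<subseteq> dirs" for i by (auto simp: succs_def dirs_def)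
qed

sublocale cf_system dirs succs by (rule cf)

definition cover :: "'a list pair_pre_digraph" where "cover = universal_cover G r"

abbreviation X :: "'a list set" where "X \<equiv> pverts cover"
abbreviation ET :: "('a list \<times> 'a list) set" where "ET \<equiv> parcs cover"

text \<open>The cone type of the branch that begins at the walk \<open>p\<close>, seen from the
  root; for the root walk there is no vertex of arrival.\<close>

definition idx :: "'a list \<Rightarrow> 'a option \<times> 'a" where
  "idx p = (if 2 \<le> length p then Some (p ! (length p - 2)) else None, last p)"

lemma X_iff: "p \<in> X \<longleftrightarrow> vwalk p (with_proj G) \<and> hd p = r \<and> nonbacktracking p"
  by (simp add: cover_def universal_cover_def Let_def)

lemma X_nonempty: "p \<in> X \<Longrightarrow> p \<noteq> []" by (auto simp: X_iff vwalk_def)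

lemma root_in_X: "[r] \<in> X"
  using root by (simp add: X_iff vwalk_def nonbacktracking_def)

lemma X_snoc: "p \<noteq> [] \<Longrightarrow> p @ [w] \<in> X \<longleftrightarrow> p \<in> X \<and> (Some (last p), w) \<in> succs (idx p)"
  by (auto simp: X_iff vwalk_snoc nonbacktracking_snoc succs_def idx_def dest: arc_snd_in_verts)

lemma X_cases: 
  assumes "p \<in> X" obtains "p = [r]" | q w where "p = q @ [w]" "q \<in> X" "(Some (last q), w) \<in> succs (idx q)"
proof (cases p rule: rev_cases)
  case Nil
  then show ?thesis using X_nonempty assms by blast
next
  case (snoc q w)
  show ?thesis
  proof (cases "q = []")
    case True
    then show ?thesis using that(1) snoc assms by (simp add: X_iff)
  next
    case False
    then show ?thesis using that(2) snoc assms X_snoc by blast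
  qed
qed

lemma X_induct [consumes 1, case_names root snoc]:
  assumes "p \<in> X" "P [r]" "\<And>q w. q \<in> X \<Longrightarrow> (Some (last q), w) \<in> succs (idx q) \<Longrightarrow> P q \<Longrightarrow> P (q @ [w])"
  shows "P p"
  using assms(1)
proof (induction "length p" arbitrary: p rule: less_induct)
  case less
  from less.prems show ?case
  proof (cases rule: X_cases)
    case (2 q w)
    then show ?thesis using less.hyps[of q] assms(3) by simp
  qed (use assms(2) in simp)
qed

lemma idx_snoc: "p \<noteq> [] \<Longrightarrow> idx (p @ [w]) = (Some (last p), w)"
proof -
  assume "p \<noteq> []"
  then have "(p @ [w]) ! (length p - 1) = last p" by (simp add: nth_append last_conv_nth)
  then show ?thesis using \<open>p \<noteq> []\<close> by (cases p) (simp_all add: idx_def)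
qed

lemma idx_root: "idx [v] = (None, v)" by (simp add: idx_def)

lemma idx_in: "p \<in> X \<Longrightarrow> idx p \<in> dirs"
  by (erule X_cases) (use N X_nonempty in \<open>auto simp: idx_root idx_snoc dirs_def root succs_def\<close>)

lemma last_in: "p \<in> X \<Longrightarrow> last p \<in> pverts G"
  unfolding X_iff vwalk_def by auto

lemma vertex_dir: "p \<in> X \<Longrightarrow> (None, last p) \<in> dirs"
  using last_in by (simp add: dirs_def)

lemma ET_iff: "(p, q) \<in> ET \<longleftrightarrow> p \<in> X \<and> q \<in> X \<and> ((\<exists>v. q = p @ [v]) \<or> (\<exists>v. p = q @ [v]))"
  by (simp add: cover_def universal_cover_def Let_def)

lemma ET_sub: "ET \<subseteq> X \<times> X" using ET_iff by auto

definition ch :: "'a list \<Rightarrow> 'a set" where "ch p = {w. (Some (last p), w) \<in> succs (idx p)}"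

lemma finite_ch: "finite (ch p)"
proof (rule finite_subset)
  show "ch p \<subseteq> pverts G" by (auto simp: ch_def succs_def dest: arc_snd_in_verts)
qed (rule pair_finite_verts)

lemma ch_succs: "succs (idx p) = Pair (Some (last p)) ` ch p"
  by (auto simp: ch_def succs_def idx_def)

lemma nbrs: 
  assumes "p \<in> X"
  shows "ET `` {p} = (\<lambda>w. p @ [w]) ` ch p \<union> (if 2 \<le> length p then {butlast p} else {})"
proof -
  have "q \<in> X \<and> (\<exists>v. p = q @ [v]) \<longleftrightarrow> 2 \<le> length p \<and> q = butlast p" for q
  proof
    assume "q \<in> X \<and> (\<exists>v. p = q @ [v])"
    then show "2 \<le> length p \<and> q = butlast p" using X_nonempty[of q] by (cases q) auto
  next
    assume h: "2 \<le> length p \<and> q = butlast p"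
    have "p = q @ [last p]" using X_nonempty[OF assms] h by simp
    moreover have "0 < length q" using h by simp
    then have "q \<noteq> []" by simp
    moreover note calculation
    ultimately show "q \<in> X \<and> (\<exists>v. p = q @ [v])" using assms X_snoc by metis
  qed
  note A = this
  have B: "p @ [w] \<in> X \<longleftrightarrow> w \<in> ch p" for w 
    using X_snoc[OF X_nonempty[OF assms]] assms by (simp add: ch_def)
  show ?thesis
  proof (rule Set.set_eqI)
    fix q
    have "q \<in> ET `` {p} \<longleftrightarrow> (q \<in> X \<and> (\<exists>v. q = p @ [v])) \<or> (q \<in> X \<and> (\<exists>v. p = q @ [v]))"
      using assms by (auto simp: ET_iff)
    also have "q \<in> X \<and> (\<exists>v. q = p @ [v]) \<longleftrightarrow> q \<in> (\<lambda>w. p @ [w]) ` ch p" using B by auto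
    finally show "q \<in> ET `` {p} \<longleftrightarrow> q \<in> (\<lambda>w. p @ [w]) ` ch p \<union> (if 2 \<le> length p then {butlast p} else {})"
      unfolding A by auto
  qed
qed

lemma sum_nbrs:
  fixes F :: "'a list \<Rightarrow> 'b :: comm_monoid_add"
  assumes "p \<in> X"
  shows "(\<Sum>q\<in>ET `` {p}. F q) = (\<Sum>w\<in>ch p. F (p @ [w])) + (if 2 \<le> length p then F (butlast p) else 0)"
proof -
  have "butlast p \<notin> (\<lambda>w. p @ [w]) ` ch p" 
  proof
    assume "butlast p \<in> (\<lambda>w. p @ [w]) ` ch p"
    then obtain w where w: "butlast p = p @ [w]" by auto
    have "length (butlast p) = Suc (length p)" unfolding w by simp
    then show False by simp
  qed
  moreover have "(\<Sum>q\<in>(\<lambda>w. p @ [w]) ` ch p. F q) = (\<Sum>w\<in>ch p. F (p @ [w]))"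
    by (subst sum.reindex) (auto simp: inj_on_def)
  ultimately show ?thesis using finite_ch[of p] by (simp add: nbrs[OF assms] add.commute)
qed

lemma sum_ch: "(\<Sum>w\<in>ch p. F (Some (last p), w)) = sum F (succs (idx p))"
  unfolding ch_succs by (subst sum.reindex) (auto simp: inj_on_def)

text \<open>\<open>kern x p q\<close> is the candidate for the Green function, given a solution \<open>x\<close> of the recursive equations:
  it is multiplied by \<open>x\<close> of each edge crossed on the way from \<open>q\<close> to \<open>p\<close>.\<close>

definition cone :: "('a option \<times> 'a \<Rightarrow> complex) \<Rightarrow> 'a list \<Rightarrow> 'a list \<Rightarrow> complex" where
  "cone x q p = x (None, last q) * (\<Prod>k\<in>{length q..<length p}. x (idx (take (Suc k) p)))"

function kern :: "('a option \<times> 'a \<Rightarrow> complex) \<Rightarrow> 'a list \<Rightarrow> 'a list \<Rightarrow> complex" where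
  "kern x p q = (if length q \<le> 1 \<or> prefix q p then cone x q p else kern x p (butlast q) * x (idx q))"
  by auto
termination by (relation "Wellfounded.measure (\<lambda>(x, p, q). length q)") auto

declare kern.simps [simp del]

lemma kern_root: "kern x p [r] = cone x [r] p" by (simp add: kern.simps)

lemma kern_snoc: "q \<noteq> [] \<Longrightarrow> kern x p (q @ [w]) = 
   (if prefix (q @ [w]) p then cone x (q @ [w]) p else kern x p q * x (Some (last q), w))"
  by (subst kern.simps) (auto simp: idx_snoc)

lemma prefix_root: "p \<in> X \<Longrightarrow> prefix [r] p"
  by (cases p) (auto simp: X_iff vwalk_def)

lemma cone_self: "cone x q q = x (None, last q)" by (simp add: cone_def)

lemma cone_snoc: 
  assumes "length q \<le> length p" 
  shows "cone x q (p @ [w]) = cone x q p * x (idx (p @ [w]))"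
proof -
  have "(\<Prod>k\<in>{length q..<Suc (length p)}. x (idx (take (Suc k) (p @ [w])))) 
     = (\<Prod>k\<in>{length q..<length p}. x (idx (take (Suc k) (p @ [w])))) * x (idx (p @ [w]))"
    using assms by (subst prod.atLeastLessThan_Suc) auto
  moreover have "(\<Prod>k\<in>{length q..<length p}. x (idx (take (Suc k) (p @ [w]))))
     = (\<Prod>k\<in>{length q..<length p}. x (idx (take (Suc k) p)))"
    by (rule prod.cong) auto
  ultimately show ?thesis by (simp add: cone_def mult.assoc)
qed

lemma kern_prefix: "q \<in> X \<Longrightarrow> prefix q p \<Longrightarrow> kern x p q = cone x q p"
  by (subst kern.simps) simp

definition solves :: "complex \<Rightarrow> ('a option \<times> 'a \<Rightarrow> complex) \<Rightarrow> bool" where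
  "solves z x \<longleftrightarrow> (\<forall>i\<in>dirs. x i * (z - sum x (succs i)) = 1)"

text \<open>The equations for \<open>(None, v)\<close> and \<open>(Some u, v)\<close> differ only by
  the successor \<open>(Some v, u)\<close>; eliminating the common sum gives the first identity.
  Used for both orientations of the edge, it gives the second, which is the symmetry of the Green
  function across one edge.\<close>

lemma reverse_identity:
  assumes x: "solves z x" and uv: "(u, v) \<in> parcs G"
  shows "x (None, v) * (1 - x (Some u, v) * x (Some v, u)) = x (Some u, v)"
    "x (None, u) * x (Some u, v) = x (None, v) * x (Some v, u)"
proof -
  have key: "x (None, v) * (1 - x (Some u, v) * x (Some v, u)) = x (Some u, v)" 
    if uv: "(u, v) \<in> parcs G" for u v
  proof -
    have vu: "(v, u) \<in> parcs G" using uv by (rule arcs_symmetric)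
    have i: "(Some u, v) \<in> dirs" "(None, v) \<in> dirs" using uv arc_snd_in_verts by (force simp: dirs_def)+
    have ns: "succs (None, v) = insert (Some v, u) (succs (Some u, v))" using vu by (auto simp: succs_def)
    have "(Some v, u) \<notin> succs (Some u, v)" by (simp add: succs_def)
    then have s: "sum x (succs (None, v)) = x (Some v, u) + sum x (succs (Some u, v))"
      unfolding ns using finN[OF i(1)] by simp
    define e where "e = x (Some u, v)"
    define W where "W = z - sum x (succs (Some u, v))"
    have e: "e * W = 1" using x i(1) by (simp add: solves_def e_def W_def)
    have "x (None, v) * (W - x (Some v, u)) = 1" using x i(2) s by (simp add: solves_def W_def algebra_simps)
    then have a1: "x (None, v) * (W - x (Some v, u)) * e = e" by simp
    have a2: "x (None, v) * (W - x (Some v, u)) * e = x (None, v) * (e * W - e * x (Some v, u))"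
      by (simp add: algebra_simps)
    show ?thesis using a1 unfolding a2 e unfolding e_def .
  qed
  show "x (None, v) * (1 - x (Some u, v) * x (Some v, u)) = x (Some u, v)" by (rule key[OF uv])
  have vu: "(v, u) \<in> parcs G" using uv by (rule arcs_symmetric)
  have i: "(Some u, v) \<in> dirs" using uv by (force simp: dirs_def)
  have "x (Some u, v) \<noteq> 0" using x i by (auto simp: solves_def)
  then have ne: "1 - x (Some u, v) * x (Some v, u) \<noteq> 0" using key[OF uv] by auto
  have "x (None, u) * x (Some u, v) * (1 - x (Some u, v) * x (Some v, u)) = x (Some u, v) * x (Some v, u)"
    using key[OF vu] by (simp add: mult_ac)
  also have "\<dots> = x (None, v) * x (Some v, u) * (1 - x (Some u, v) * x (Some v, u))"
    using key[OF uv] by (simp add: mult_ac)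
  finally show "x (None, u) * x (Some u, v) = x (None, v) * x (Some v, u)" using ne by simp
qed

lemma solves_idx: "solves z x \<Longrightarrow> p \<in> X \<Longrightarrow> x (idx p) * (z - (\<Sum>w\<in>ch p. x (Some (last p), w))) = 1"
  unfolding sum_ch solves_def using idx_in by blast

text \<open>Strictly beyond \<open>q\<close>, the equation at \<open>p\<close> is that of the cone
  type of \<open>p\<close> multiplied by the value at the parent.\<close>

lemma cone_eq_above:
  assumes x: "solves z x" and p: "p \<in> X" and q: "q \<in> X" "prefix q p" "q \<noteq> p"
  shows "z * cone x q p - (\<Sum>p'\<in>ET `` {p}. cone x q p') = 0"
proof -
  have lt: "length q < length p" using q(2,3) by (metis prefix_length_less prefix_order.less_le)
  have p0: "p \<noteq> []" "q \<noteq> []" using X_nonempty p q by auto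
  then have l2: "2 \<le> length p" using lt by (cases q) auto
  have cw: "cone x q (p @ [w]) = cone x q p * x (Some (last p), w)" for w
    using cone_snoc[of q p] lt p0 by (simp add: idx_snoc)
  have cp: "cone x q p = cone x q (butlast p) * x (idx p)"
    using cone_snoc[of q "butlast p" x "last p"] lt p0 by simp
  let ?S = "\<Sum>w\<in>ch p. x (Some (last p), w)"
  have "z * cone x q p - (\<Sum>w\<in>ch p. cone x q (p @ [w])) = z * cone x q p - cone x q p * ?S"
    by (simp add: cw sum_distrib_left)
  also have "\<dots> = cone x q (butlast p) * (x (idx p) * (z - ?S))" unfolding cp by (simp add: algebra_simps)
  also have "\<dots> = cone x q (butlast p)" unfolding solves_idx[OF x p] by simp
  finally have "z * cone x q p - (\<Sum>w\<in>ch p. cone x q (p @ [w])) = cone x q (butlast p)" .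
  moreover have "(\<Sum>p'\<in>ET `` {p}. cone x q p') = (\<Sum>w\<in>ch p. cone x q (p @ [w])) + cone x q (butlast p)"
    using sum_nbrs[OF p, of "cone x q"] l2 by simp
  ultimately show ?thesis by (simp add: algebra_simps)
qed

text \<open>Induction on the source, which is moved by one edge from \<open>q\<close> to
  \<open>q @ [w]\<close>. Only beyond the edge and at its two ends does the equation change.\<close>

lemma kern_inverse:
  assumes x: "solves z x" and q: "q \<in> X"
  shows "p \<in> X \<Longrightarrow> z * kern x p q - (\<Sum>p'\<in>ET `` {p}. kern x p' q) = of_bool (p = q)"
  using q
proof (induction q arbitrary: p rule: X_induct)
  case root
  have K: "kern x p' [r] = cone x [r] p'" for p' by (rule kern_root)
  show ?case
  proof (cases "p = [r]")
    case True
    have "x (None, r) * (z - (\<Sum>w\<in>ch [r]. x (Some r, w))) = 1"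
      using solves_idx[OF x root_in_X] by (simp add: idx_root)
    moreover have "cone x [r] ([r] @ [w]) = x (None, r) * x (Some r, w)" for w
      by (subst cone_snoc) (simp_all add: cone_self idx_snoc[of "[r]", simplified])
    ultimately show ?thesis
      unfolding K True sum_nbrs[OF root_in_X] by (simp add: cone_self sum_distrib_left[symmetric] algebra_simps)
  next
    case False
    then show ?thesis using cone_eq_above[OF x root.prems root_in_X prefix_root[OF root.prems]] by (simp add: K)
  qed
next
  case (snoc q w)
  note p = snoc.prems
  let ?q' = "q @ [w]" and ?e = "(Some (last q), w)"
  have q0: "q \<noteq> []" using X_nonempty snoc by auto
  have q': "?q' \<in> X" using snoc X_snoc[OF q0] by blast
  have uv: "(last q, w) \<in> parcs G" using snoc.hyps(2) by (auto simp: succs_def idx_def)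
  have K: "kern x p' ?q' = (if prefix ?q' p' then cone x ?q' p' else kern x p' q * x ?e)" for p'
    by (rule kern_snoc[OF q0])
  have Kqq: "kern x q q = x (None, last q)" using kern_prefix[OF snoc.hyps(1)] by (simp add: cone_self)
  have Kq'q: "kern x ?q' q = x (None, last q) * x ?e"
    using kern_prefix[OF snoc.hyps(1), of ?q'] cone_snoc[of q q x w] q0 by (simp add: cone_self idx_snoc)
  note R = reverse_identity[OF x uv]
  \<comment> \<open>Beyond the new source \<open>cone_eq_above\<close> applies; at the new and at
    the old source the edge identities \<open>R\<close> are needed; elsewhere every term of the
    induction hypothesis is multiplied by the same factor.\<close>
  consider "prefix ?q' p" "p \<noteq> ?q'" | "p = ?q'" | "\<not> prefix ?q' p" "p = q" | "\<not> prefix ?q' p" "p \<noteq> q" by blast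
  then show ?case
  proof cases
    case 1
    have len: "length ?q' < length p" using 1 by (metis prefix_length_less prefix_order.less_le)
    have nb: "prefix ?q' p'" if "p' \<in> ET `` {p}" for p'
    proof -
      from that have "(\<exists>v. p' = p @ [v]) \<or> (\<exists>v. p = p' @ [v])" by (auto simp: ET_iff)
      then show ?thesis
      proof
        assume "\<exists>v. p = p' @ [v]"
        then show ?thesis using 1 by (auto simp: prefix_snoc)
      qed (use 1 in \<open>auto simp: prefix_snoc\<close>)
    qed
    have "(\<Sum>p'\<in>ET `` {p}. kern x p' ?q') = (\<Sum>p'\<in>ET `` {p}. cone x ?q' p')"
      by (rule sum.cong) (use nb K in auto)
    then show ?thesis using cone_eq_above[OF x p q' 1(1)] 1 K by auto
  next
    case 2
    have c: "kern x (?q' @ [u]) ?q' = x (None, w) * x (Some w, u)" for u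
    proof -
      have "kern x (?q' @ [u]) ?q' = cone x ?q' (?q' @ [u])"
        by (rule kern_prefix[OF q']) (rule prefixI, rule refl)
      also have "\<dots> = cone x ?q' ?q' * x (idx (?q' @ [u]))" by (rule cone_snoc) simp
      finally show ?thesis using idx_snoc[of ?q' u] by (simp add: cone_self)
    qed
    have kq: "kern x q ?q' = x (None, last q) * x ?e"
      using K[of q] Kqq by simp
    have k': "kern x ?q' ?q' = x (None, w)" using K[of ?q'] by (simp add: cone_self)
    have "2 \<le> length ?q'" using q0 by (cases q) auto
    then have "(\<Sum>p'\<in>ET `` {?q'}. kern x p' ?q') = (\<Sum>u\<in>ch ?q'. x (None, w) * x (Some w, u)) + x (None, last q) * x ?e"
      by (simp only: sum_nbrs[OF q'] c) (simp add: kq)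
    also have "(\<Sum>u\<in>ch ?q'. x (None, w) * x (Some w, u)) = x (None, w) * (\<Sum>u\<in>ch ?q'. x (Some w, u))"
      by (simp add: sum_distrib_left)
    finally have s: "(\<Sum>p'\<in>ET `` {?q'}. kern x p' ?q') 
        = x (None, w) * (\<Sum>u\<in>ch ?q'. x (Some w, u)) + x (None, w) * x (Some w, last q)"
      using R(2) by simp
    define S where "S = (\<Sum>u\<in>ch ?q'. x (Some w, u))"
    have e: "x ?e * (z - S) = 1" using solves_idx[OF x q'] q0 by (simp add: idx_snoc S_def)
    then have e0: "x ?e \<noteq> 0" by auto
    have "x ?e * (z * x (None, w) - (x (None, w) * S + x (None, w) * x (Some w, last q))) 
        = x (None, w) * (x ?e * (z - S) - x ?e * x (Some w, last q))" by (simp add: algebra_simps)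
    also have "\<dots> = x ?e" using R(1) e by simp
    finally have "z * x (None, w) - (x (None, w) * S + x (None, w) * x (Some w, last q)) = 1" using e0 by simp
    then show ?thesis using 2 s k' by (simp add: S_def)
  next
    case 3
    have wch: "w \<in> ch q" using snoc.hyps(2) by (simp add: ch_def)
    have q'n: "?q' \<in> ET `` {q}" using wch nbrs[OF snoc.hyps(1)] by auto
    have fE: "finite (ET `` {q})" using finite_ch nbrs[OF snoc.hyps(1)] by auto
    have np: "\<not> prefix ?q' p'" if "p' \<in> ET `` {q} - {?q'}" for p'
    proof -
      from that have "(\<exists>v. p' = q @ [v]) \<or> (\<exists>v. q = p' @ [v])" by (auto simp: ET_iff)
      then show ?thesis
      proof
        assume "\<exists>v. q = p' @ [v]"
        then have "length p' < length ?q'" by auto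
        then show ?thesis using prefix_length_le by fastforce
      qed (use that in \<open>auto simp: prefix_snoc\<close>)
    qed
    have "(\<Sum>p'\<in>ET `` {q}. kern x p' ?q') = kern x ?q' ?q' + (\<Sum>p'\<in>ET `` {q} - {?q'}. kern x p' ?q')"
      by (rule sum.remove[OF fE q'n])
    also have "(\<Sum>p'\<in>ET `` {q} - {?q'}. kern x p' ?q') = (\<Sum>p'\<in>ET `` {q} - {?q'}. kern x p' q) * x ?e"
      using np K by (simp add: sum_distrib_right)
    also have "(\<Sum>p'\<in>ET `` {q} - {?q'}. kern x p' q) = (\<Sum>p'\<in>ET `` {q}. kern x p' q) - kern x ?q' q"
      using sum.remove[OF fE q'n, of "\<lambda>p'. kern x p' q"] by simp
    also have "(\<Sum>p'\<in>ET `` {q}. kern x p' q) = z * kern x q q - 1"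
      using snoc.IH[OF snoc.hyps(1)] by (simp add: algebra_simps)
    finally have s: "(\<Sum>p'\<in>ET `` {q}. kern x p' ?q') 
        = x (None, w) + (z * x (None, last q) - 1 - x (None, last q) * x ?e) * x ?e"
      using K[of ?q'] by (simp add: cone_self Kqq Kq'q)
    have "kern x q ?q' = x (None, last q) * x ?e" using K[of q] Kqq by simp
    then have "z * kern x q ?q' - (\<Sum>p'\<in>ET `` {q}. kern x p' ?q') 
       = x ?e + (x (None, last q) * x ?e) * x ?e - x (None, w)"
      unfolding s by (simp add: algebra_simps)
    also have "\<dots> = x ?e - x (None, w) * (1 - x ?e * x (Some w, last q))"
      unfolding R(2) by (simp add: algebra_simps)
    also have "\<dots> = 0" using R(1) by simp
    finally show ?thesis using 3 by simp
  next
    case 4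
    have np: "\<not> prefix ?q' p'" if "p' \<in> ET `` {p}" for p'
    proof -
      from that have "(\<exists>v. p' = p @ [v]) \<or> (\<exists>v. p = p' @ [v])" by (auto simp: ET_iff)
      then show ?thesis
      proof
        assume "\<exists>v. p = p' @ [v]"
        then show ?thesis using 4 by (auto simp: prefix_snoc)
      qed (use 4 in \<open>auto simp: prefix_snoc\<close>)
    qed
    have "(\<Sum>p'\<in>ET `` {p}. kern x p' ?q') = (\<Sum>p'\<in>ET `` {p}. kern x p' q) * x ?e"
      using np K by (simp add: sum_distrib_right)
    also have "\<dots> = z * kern x p q * x ?e" using snoc.IH[OF p] 4 by simp
    finally show ?thesis using 4 K[of p] by auto
  qed
qed

end

section \<open>Square summability, symmetry and bounds of the Green kernel\<close>

context base_graph
begin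

definition D0 :: real where "D0 = real (card (pverts G)) + 1"

lemma D0_pos: "0 < D0" by (simp add: D0_def add_nonneg_pos)

lemma bounded_cover: "bounded_graph ET D0"
proof
  show "sym ET" by (auto simp: sym_def ET_iff)
  fix p
  have fin: "finite (ET `` {p}) \<and> card (ET `` {p}) \<le> card (pverts G) + 1"
  proof (cases "p \<in> X")
    case True
    have c: "card (ch p) \<le> card (pverts G)"
      using pair_finite_verts by (intro card_mono) (auto simp: ch_def succs_def dest: arc_snd_in_verts)
    have "card ((\<lambda>w. p @ [w]) ` ch p) \<le> card (pverts G)"
      using card_image_le[OF finite_ch, of "\<lambda>w. p @ [w]" p] c by simp
    moreover have "card (if 2 \<le> length p then {butlast p} else {}) \<le> 1" by simp
    ultimately have "card (ET `` {p}) \<le> card (pverts G) + 1"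
      unfolding nbrs[OF True] using card_Un_le[of "(\<lambda>w. p @ [w]) ` ch p" "if 2 \<le> length p then {butlast p} else {}"]
      by linarith
    moreover have "finite (ET `` {p})" unfolding nbrs[OF True] using finite_ch by simp
    ultimately show ?thesis by blast
  next
    case False
    then have "ET `` {p} = {}" using ET_sub by auto
    then show ?thesis by simp
  qed
  then show "finite (ET `` {p})" by blast
  show "real (card (ET `` {p})) \<le> D0" using fin by (simp add: D0_def)
qed (rule D0_pos)

sublocale T: bounded_graph ET D0 by (rule bounded_cover)

lemma X_take: "p \<in> X \<Longrightarrow> 0 < n \<Longrightarrow> take n p \<in> X"
proof (induction p arbitrary: n rule: X_induct)
  case root
  then show ?case using root_in_X by simp
next
  case (snoc q w)
  show ?case
  proof (cases "n \<le> length q")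
    case True
    then show ?thesis using snoc by simp
  next
    case False
    then show ?thesis using snoc X_snoc[OF X_nonempty[OF snoc.hyps(1)]] by simp
  qed
qed

lemma prefix_in_X: "p \<in> X \<Longrightarrow> prefix q p \<Longrightarrow> q \<noteq> [] \<Longrightarrow> q \<in> X"
  using X_take[of p "length q"] by (auto simp: prefix_def)

lemma cone_holomorphic:
  assumes f: "\<And>i. i \<in> dirs \<Longrightarrow> (\<lambda>z. f z i) holomorphic_on S" and pq: "p \<in> X" "q \<in> X"
  shows "(\<lambda>z. cone (f z) q p) holomorphic_on S"
  unfolding cone_def
  using pq vertex_dir idx_in[OF X_take[OF pq(1)]] 
  by (intro holomorphic_on_mult holomorphic_on_prod f) auto

lemma kern_holomorphic:
  assumes f: "\<And>i. i \<in> dirs \<Longrightarrow> (\<lambda>z. f z i) holomorphic_on S" and p: "p \<in> X" and q: "q \<in> X"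
  shows "(\<lambda>z. kern (f z) p q) holomorphic_on S"
  using q
proof (induction q rule: X_induct)
  case root
  show ?case unfolding kern_root by (rule cone_holomorphic[OF f p root_in_X])
next
  case (snoc q w)
  have q0: "q \<noteq> []" using X_nonempty snoc by auto
  have q': "q @ [w] \<in> X" using snoc X_snoc[OF q0] by blast
  show ?case
  proof (cases "prefix (q @ [w]) p")
    case True
    then show ?thesis using cone_holomorphic[OF f p q'] by (simp add: kern_snoc[OF q0])
  next
    case False
    have "(Some (last q), w) \<in> dirs" using idx_in[OF q'] q0 by (simp add: idx_snoc)
    then show ?thesis using False snoc.IH f by (simp add: kern_snoc[OF q0] holomorphic_on_mult)
  qed
qed

lemma kern_cnj: "kern (\<lambda>i. cnj (x i)) p q = cnj (kern x p q)"
proof (induction q rule: rev_induct)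
  case Nil
  show ?case by (simp add: kern.simps cone_def)
next
  case (snoc w q)
  have c: "cone (\<lambda>i. cnj (x i)) s p = cnj (cone x s p)" for s by (simp add: cone_def)
  show ?case
    by (cases "q = []") (simp_all add: kern_snoc snoc c kern.simps[of _ _ "[w]"])
qed

lemma green_solves: "z \<in> uhp \<Longrightarrow> solves z (green z)"
  using green_eq by (simp add: solves_def)

text \<open>The imaginary part normalised by Im z; it dominates the sum of squared Green function
  values over the branch \<open>i\<close>.\<close>

definition herg :: "complex \<Rightarrow> 'a option \<times> 'a \<Rightarrow> real" where
  "herg z i = - Im (green z i) / Im z"

lemma herg_pos: "z \<in> uhp \<Longrightarrow> i \<in> dirs \<Longrightarrow> 0 < herg z i"
  using green_props(1)[of z i] by (simp add: herg_def divide_neg_pos)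

text \<open>The imaginary part of the recursive equation, known as the Ward identity.\<close>

lemma ward:
  assumes z: "z \<in> uhp" and i: "i \<in> dirs"
  shows "herg z i = (cmod (green z i))\<^sup>2 * (1 + sum (herg z) (succs i))"
proof -
  define W where "W = z - sum (green z) (succs i)"
  have e: "green z i * W = 1" using green_eq[of z i] z i by (simp add: W_def)
  then have W0: "W \<noteq> 0" by auto
  then have gW: "green z i = 1 / W" using e by (simp add: field_simps)
  have "Im (1 / W) = - Im W / (cmod W)\<^sup>2" by (simp add: Im_divide cmod_power2)
  moreover have "Im W = Im z * (1 + sum (herg z) (succs i))"
    using z by (simp add: W_def herg_def sum_divide_distrib[symmetric] sum_negf field_simps)
  ultimately have "herg z i = (1 + sum (herg z) (succs i)) / (cmod W)\<^sup>2"
    using z by (simp add: herg_def gW)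
  then show ?thesis using W0 by (simp add: gW norm_divide power_divide)
qed

definition wt :: "('a option \<times> 'a \<Rightarrow> complex) \<Rightarrow> 'a list \<Rightarrow> 'a list \<Rightarrow> real" where
  "wt x p s = (\<Prod>k\<in>{length p..<length s}. (cmod (x (idx (take (Suc k) s))))\<^sup>2)"

primrec desc :: "nat \<Rightarrow> 'a list \<Rightarrow> 'a list set" where
  "desc 0 p = {p}"
| "desc (Suc n) p = insert p (\<Union>w\<in>ch p. desc n (p @ [w]))"

lemma finite_desc: "finite (desc n p)"
  by (induction n arbitrary: p) (simp_all add: finite_ch)

lemma desc_prefix: "s \<in> desc n p \<Longrightarrow> prefix p s"
proof (induction n arbitrary: p)
  case (Suc n)
  then show ?case by (auto dest!: Suc.IH append_prefixD)
qed simp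

lemma in_desc: "s \<in> X \<Longrightarrow> p \<in> X \<Longrightarrow> prefix p s \<Longrightarrow> length s \<le> length p + n \<Longrightarrow> s \<in> desc n p"
proof (induction n arbitrary: p)
  case 0
  then have "p = s" by (metis add_0_right le_antisym prefix_length_le prefix_length_prefix prefix_order.antisym prefix_order.refl)
  then show ?case by simp
next
  case (Suc n)
  show ?case
  proof (cases "s = p")
    case False
    then obtain w t where s: "s = p @ w # t" using Suc.prems(3) by (metis append_Nil2 neq_Nil_conv prefixE)
    have "prefix (p @ [w]) s" by (simp add: s)
    then have pw: "p @ [w] \<in> X" using prefix_in_X Suc.prems(1) by blast
    then have "w \<in> ch p" using X_snoc[OF X_nonempty[OF Suc.prems(2)]] by (simp add: ch_def)
    moreover have "s \<in> desc n (p @ [w])"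
      using Suc.prems pw s by (intro Suc.IH) auto
    ultimately show ?thesis by auto
  qed simp
qed

lemma wt_nonneg: "0 \<le> wt x p s" by (simp add: wt_def prod_nonneg)

text \<open>Iterating the Ward identity over \<open>n\<close> generations bounds the squared values
  on all of them by \<open>herg\<close>, independently of \<open>n\<close>; this yields summability
  over the infinite branch.\<close>

lemma desc_sum:
  assumes z: "z \<in> uhp"
  shows "p \<in> X \<Longrightarrow> (cmod (green z (idx p)))\<^sup>2 * (\<Sum>s\<in>desc n p. wt (green z) p s) \<le> herg z (idx p)"
proof (induction n arbitrary: p)
  case 0
  have "0 \<le> sum (herg z) (succs (idx p))"
    using herg_pos[OF z] N[OF idx_in[OF 0]] by (intro sum_nonneg) (auto intro: less_imp_le)
  then have "(cmod (green z (idx p)))\<^sup>2 * 1 \<le> (cmod (green z (idx p)))\<^sup>2 * (1 + sum (herg z) (succs (idx p)))"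
    by (intro mult_left_mono) auto
  then show ?case using ward[OF z idx_in[OF 0]] by (simp add: wt_def)
next
  case (Suc n)
  have p0: "p \<noteq> []" by (rule X_nonempty[OF Suc.prems])
  have chX: "p @ [w] \<in> X" if "w \<in> ch p" for w using that X_snoc[OF p0] Suc.prems by (simp add: ch_def)
  have np: "p \<notin> (\<Union>w\<in>ch p. desc n (p @ [w]))"
  proof
    assume "p \<in> (\<Union>w\<in>ch p. desc n (p @ [w]))"
    then obtain w where "prefix (p @ [w]) p" using desc_prefix by blast
    then show False using prefix_length_le by fastforce
  qed
  have disj: "desc n (p @ [v]) \<inter> desc n (p @ [w]) = {}" if "v \<noteq> w" for v w
  proof (rule ccontr)
    assume "desc n (p @ [v]) \<inter> desc n (p @ [w]) \<noteq> {}"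
    then obtain s where "prefix (p @ [v]) s" "prefix (p @ [w]) s" using desc_prefix by blast
    then show False using that by (auto simp: prefix_def)
  qed
  have wtc: "wt (green z) p s = (cmod (green z (idx (p @ [w]))))\<^sup>2 * wt (green z) (p @ [w]) s"
    if sd: "s \<in> desc n (p @ [w])" for s w
  proof -
    obtain t where s: "s = p @ w # t" using desc_prefix[OF sd] by (auto simp: prefix_def)
    have "{length p..<length s} = insert (length p) {Suc (length p)..<length s}" using s by auto
    then show ?thesis unfolding wt_def using s by simp
  qed
  have "(\<Sum>s\<in>desc (Suc n) p. wt (green z) p s) = wt (green z) p p + (\<Sum>s\<in>(\<Union>w\<in>ch p. desc n (p @ [w])). wt (green z) p s)"
    using np finite_ch finite_desc by simp
  also have "(\<Sum>s\<in>(\<Union>w\<in>ch p. desc n (p @ [w])). wt (green z) p s) = (\<Sum>w\<in>ch p. \<Sum>s\<in>desc n (p @ [w]). wt (green z) p s)"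
    by (rule sum.UNION_disjoint) (use finite_ch finite_desc disj in auto)
  also have "\<dots> = (\<Sum>w\<in>ch p. (cmod (green z (idx (p @ [w]))))\<^sup>2 * (\<Sum>s\<in>desc n (p @ [w]). wt (green z) (p @ [w]) s))"
    by (intro sum.cong refl) (simp add: wtc sum_distrib_left)
  also have "\<dots> \<le> (\<Sum>w\<in>ch p. herg z (idx (p @ [w])))" by (intro sum_mono Suc.IH chX)
  also have "\<dots> = sum (herg z) (succs (idx p))" using sum_ch[where F = "herg z", of p] by (simp add: idx_snoc[OF p0])
  also have "wt (green z) p p = 1" by (simp add: wt_def)
  finally have "(cmod (green z (idx p)))\<^sup>2 * (\<Sum>s\<in>desc (Suc n) p. wt (green z) p s) 
      \<le> (cmod (green z (idx p)))\<^sup>2 * (1 + sum (herg z) (succs (idx p)))"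
    by (intro mult_left_mono) auto
  then show ?case using ward[OF z idx_in[OF Suc.prems]] by simp
qed

lemma green_nonzero: "z \<in> uhp \<Longrightarrow> i \<in> dirs \<Longrightarrow> green z i \<noteq> 0"
  using green_props(1)[of z i] by auto

lemma cone_norm: "(cmod (cone x q p))\<^sup>2 = (cmod (x (None, last q)))\<^sup>2 * wt x q p"
  unfolding cone_def wt_def norm_mult power_mult_distrib prod_norm[symmetric] prod_power_distrib ..

lemma cone_square_sum:
  assumes z: "z \<in> uhp" and q: "q \<in> X" and S: "finite S" "S \<subseteq> X"
  shows "(\<Sum>p\<in>{p\<in>S. prefix q p}. (cmod (cone (green z) q p))\<^sup>2) 
    \<le> (cmod (green z (None, last q)))\<^sup>2 * (herg z (idx q) / (cmod (green z (idx q)))\<^sup>2)"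
proof -
  let ?S = "{p\<in>S. prefix q p}" and ?n = "Max (insert 0 (length ` S))"
  have "length p \<le> ?n" if "p \<in> S" for p using that S by (intro Max_ge) auto
  then have sub: "?S \<subseteq> desc ?n q" using S(2) q by (auto intro!: in_desc intro: trans_le_add2)
  have "(\<Sum>p\<in>?S. (cmod (cone (green z) q p))\<^sup>2) = (cmod (green z (None, last q)))\<^sup>2 * (\<Sum>p\<in>?S. wt (green z) q p)"
    by (simp add: cone_norm sum_distrib_left)
  also have "(\<Sum>p\<in>?S. wt (green z) q p) \<le> (\<Sum>p\<in>desc ?n q. wt (green z) q p)"
    by (rule sum_mono2[OF finite_desc sub]) (rule wt_nonneg)
  also have "\<dots> \<le> herg z (idx q) / (cmod (green z (idx q)))\<^sup>2"
    using desc_sum[OF z q, of ?n] green_nonzero[OF z idx_in[OF q]] by (simp add: pos_le_divide_eq mult.commute)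
  finally show ?thesis by (simp add: mult_left_mono)
qed

text \<open>Again the source moves along one edge: beyond the new source the cone estimate holds,
  and the remaining values are those for the old source times a constant factor.\<close>

lemma column_square_sum:
  assumes z: "z \<in> uhp" and q: "q \<in> X"
  shows "\<exists>B. \<forall>S. finite S \<longrightarrow> S \<subseteq> X \<longrightarrow> (\<Sum>p\<in>S. (cmod (kern (green z) p q))\<^sup>2) \<le> B"
  using q
proof (induction q rule: X_induct)
  case root
  have "(\<Sum>p\<in>S. (cmod (kern (green z) p [r]))\<^sup>2) 
     \<le> (cmod (green z (None, last [r])))\<^sup>2 * (herg z (idx [r]) / (cmod (green z (idx [r])))\<^sup>2)"
    if S: "finite S" "S \<subseteq> X" for S
  proof -
    have "{p\<in>S. prefix [r] p} = S" using S prefix_root by auto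
    then show ?thesis using cone_square_sum[OF z root_in_X S] by (simp only: kern_root)
  qed
  then show ?case by blast
next
  case (snoc q w)
  have q0: "q \<noteq> []" using X_nonempty snoc by auto
  have q': "q @ [w] \<in> X" using snoc X_snoc[OF q0] by blast
  obtain B where B: "\<And>S. finite S \<Longrightarrow> S \<subseteq> X \<Longrightarrow> (\<Sum>p\<in>S. (cmod (kern (green z) p q))\<^sup>2) \<le> B"
    using snoc.IH by blast
  let ?B1 = "(cmod (green z (None, last (q @ [w]))))\<^sup>2 * (herg z (idx (q @ [w])) / (cmod (green z (idx (q @ [w]))))\<^sup>2)"
  let ?e = "green z (Some (last q), w)"
  have "(\<Sum>p\<in>S. (cmod (kern (green z) p (q @ [w])))\<^sup>2) \<le> ?B1 + (cmod ?e)\<^sup>2 * B"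
    if S: "finite S" "S \<subseteq> X" for S
  proof -
    let ?P = "{p\<in>S. prefix (q @ [w]) p}" and ?Q = "{p\<in>S. \<not> prefix (q @ [w]) p}"
    have "(\<Sum>p\<in>S. (cmod (kern (green z) p (q @ [w])))\<^sup>2) 
      = (\<Sum>p\<in>?P. (cmod (kern (green z) p (q @ [w])))\<^sup>2) + (\<Sum>p\<in>?Q. (cmod (kern (green z) p (q @ [w])))\<^sup>2)"
      using S by (subst sum.union_disjoint[symmetric]) (auto intro: sum.cong)
    also have "(\<Sum>p\<in>?P. (cmod (kern (green z) p (q @ [w])))\<^sup>2) = (\<Sum>p\<in>?P. (cmod (cone (green z) (q @ [w]) p))\<^sup>2)"
      by (rule sum.cong) (auto simp: kern_snoc[OF q0])
    also have "(\<Sum>p\<in>?Q. (cmod (kern (green z) p (q @ [w])))\<^sup>2) = (cmod ?e)\<^sup>2 * (\<Sum>p\<in>?Q. (cmod (kern (green z) p q))\<^sup>2)"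
      unfolding sum_distrib_left by (rule sum.cong) (auto simp: kern_snoc[OF q0] norm_mult power_mult_distrib)
    also have "(\<Sum>p\<in>?P. (cmod (cone (green z) (q @ [w]) p))\<^sup>2) \<le> ?B1" by (rule cone_square_sum[OF z q' S])
    also have "(\<Sum>p\<in>?Q. (cmod (kern (green z) p q))\<^sup>2) \<le> B" using S by (intro B) auto
    finally show ?thesis by (simp add: mult_left_mono)
  qed
  then show ?case by blast
qed

definition kcol :: "complex \<Rightarrow> 'a list \<Rightarrow> 'a list \<Rightarrow> complex" where
  "kcol z q p = (if p \<in> X then kern (green z) p q else 0)"

lemma kcol_sqsum:
  assumes z: "z \<in> uhp" and q: "q \<in> X" shows "sqsum (kcol z q)"
proof -
  obtain B where B: "\<And>S. finite S \<Longrightarrow> S \<subseteq> X \<Longrightarrow> (\<Sum>p\<in>S. (cmod (kern (green z) p q))\<^sup>2) \<le> B"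
    using column_square_sum[OF z q] by blast
  have "0 \<le> B" using B[of "{}"] by simp
  show ?thesis
  proof (rule norm_l2_leI(1)[where b = "sqrt B"])
    fix S :: "'a list set" assume S: "finite S"
    have "(\<Sum>p\<in>S. (cmod (kcol z q p))\<^sup>2) = (\<Sum>p\<in>S \<inter> X. (cmod (kern (green z) p q))\<^sup>2)"
      using S by (subst sum.mono_neutral_cong_right[of S "S \<inter> X"]) (auto simp: kcol_def)
    also have "\<dots> \<le> B" using S by (intro B) auto
    finally show "(\<Sum>p\<in>S. (cmod (kcol z q p))\<^sup>2) \<le> (sqrt B)\<^sup>2" using \<open>0 \<le> B\<close> by simp
  qed
qed

definition col :: "complex \<Rightarrow> 'a list \<Rightarrow> 'a list l2" where "col z q = Abs_l2 (kcol z q)"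

lemma Rep_col: "z \<in> uhp \<Longrightarrow> q \<in> X \<Longrightarrow> Rep_l2 (col z q) = kcol z q"
  unfolding col_def by (rule Abs_l2_inverse) (simp add: kcol_sqsum)

lemma col_eq:
  assumes z: "z \<in> uhp" and q: "q \<in> X" shows "cscale z (col z q) - T.adjop (col z q) = delta q"
proof (rule l2_eqI)
  fix p
  show "Rep_l2 (cscale z (col z q) - T.adjop (col z q)) p = Rep_l2 (delta q) p"
  proof (cases "p \<in> X")
    case True
    have "nbr_sum ET (kcol z q) p = (\<Sum>p'\<in>ET `` {p}. kern (green z) p' q)"
      unfolding nbr_sum_def using ET_sub by (intro sum.cong) (auto simp: kcol_def)
    then show ?thesis using kern_inverse[OF green_solves[OF z] q True] True
      by (simp add: l2_simps cscale.rep_eq T.Rep_adjop Rep_col[OF z q] delta.rep_eq kcol_def)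
  next
    case False
    then have "ET `` {p} = {}" "p \<noteq> q" using ET_sub q by auto
    then show ?thesis using False
      by (simp add: l2_simps cscale.rep_eq T.Rep_adjop Rep_col[OF z q] delta.rep_eq kcol_def nbr_sum_def)
  qed
qed

lemma pair_delta: "pair (Rep_l2 (delta q)) f = f q"
proof -
  have "pair (Rep_l2 (delta q)) f = (\<Sum>\<^sub>\<infinity>p\<in>{q}. f p)"
    unfolding pair_def delta.rep_eq by (rule infsum_cong_neutral) auto
  then show ?thesis by simp
qed

text \<open>The columns are square-summable solutions of the resolvent equation. Pairing the
  equation of one with the other and moving A across gives both values.\<close>

lemma kern_symmetric:
  assumes z: "z \<in> uhp" and p: "p \<in> X" and q: "q \<in> X"
  shows "kern (green z) p q = kern (green z) q p"
proof -
  define u where "u = kcol z p"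
  define v where "v = kcol z q"
  have s: "sqsum u" "sqsum v" using kcol_sqsum[OF z] p q by (auto simp: u_def v_def)
  have eq: "Rep_l2 (delta p') = (\<lambda>s. z * kcol z p' s - nbr_sum ET (kcol z p') s)" if "p' \<in> X" for p'
    unfolding col_eq[OF z that, symmetric]
    by (rule ext) (simp add: l2_simps cscale.rep_eq T.Rep_adjop Rep_col[OF z that])
  have "v p = pair (\<lambda>s. z * u s - nbr_sum ET u s) v"
    using pair_delta[of p v] unfolding eq[OF p] u_def by simp
  also have "\<dots> = z * pair u v - pair (nbr_sum ET u) v"
    by (simp add: pair_diff_left[OF sqsum_cmult[OF s(1)] T.sqsum_adj[OF s(1)] s(2)] pair_cmult_left)
  also have "pair (nbr_sum ET u) v = pair u (nbr_sum ET v)" by (rule T.pair_adj[OF s])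
  also have "z * pair u v - pair u (nbr_sum ET v) = pair u (\<lambda>s. z * v s - nbr_sum ET v s)"
    by (simp add: pair_diff_right[OF sqsum_cmult[OF s(2)] T.sqsum_adj[OF s(2)] s(1)] pair_cmult_right)
  also have "\<dots> = u q" using pair_delta[of q u] unfolding eq[OF q] v_def by (simp add: pair_commute)
  finally show ?thesis using p q by (simp add: u_def v_def kcol_def)
qed

text \<open>A combination of columns solves the resolvent equation with a finitely supported right
  side, so its norm is at most 1 / Im z times that of the right side.\<close>

lemma kern_form_bound:
  assumes z: "z \<in> uhp" and P: "finite P" "P \<subseteq> X" and Q: "finite Q" "Q \<subseteq> X"
  shows "cmod (\<Sum>p\<in>P. \<Sum>q\<in>Q. f p * kern (green z) p q * g q) 
    \<le> 1 / Im z * (L2_set (\<lambda>p. cmod (f p)) P * L2_set (\<lambda>q. cmod (g q)) Q)"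
proof -
  define u where "u = (\<Sum>q\<in>Q. cscale (g q) (col z q))"
  define w where "w = (\<Sum>q\<in>Q. cscale (g q) (delta q :: 'a list l2))"
  have Rs: "Rep_l2 (sum h S) t = (\<Sum>i\<in>S. Rep_l2 (h i) t)" if "finite S" for h :: "'a list \<Rightarrow> 'a list l2" and S t
    using that by (induction S rule: finite_induct) (auto simp: l2_simps)
  have Ru: "Rep_l2 u p = (\<Sum>q\<in>Q. kern (green z) p q * g q)" if "p \<in> X" for p
    unfolding u_def Rs[OF Q(1)] by (rule sum.cong) (use that Q(2) Rep_col[OF z] in \<open>auto simp: cscale.rep_eq kcol_def\<close>)
  have cw: "cscale c (sum h S) = (\<Sum>i\<in>S. cscale c (h i))" if "finite S" for c and h :: "'a list \<Rightarrow> 'a list l2" and S :: "'a list set"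
    by (rule l2_eqI) (simp add: cscale.rep_eq Rs[OF that] sum_distrib_left)
  have aw: "T.adjop (sum h S) = (\<Sum>i\<in>S. T.adjop (h i))" if "finite S" for h and S :: "'a list set"
    using that
  proof (induction S rule: finite_induct)
    case empty
    have "T.adjop 0 = 0" using T.adjop_scaleR[of 0 0] by simp
    then show ?case by simp
  qed (simp add: T.adjop_add)
  have "cscale z u - T.adjop u = (\<Sum>q\<in>Q. cscale (g q) (cscale z (col z q) - T.adjop (col z q)))"
    unfolding u_def cw[OF Q(1)] aw[OF Q(1)] T.adjop_cscale sum_subtractf[symmetric]
    by (intro sum.cong refl l2_eqI) (simp add: l2_simps cscale.rep_eq algebra_simps)
  also have "\<dots> = w" unfolding w_def using col_eq[OF z] Q(2) by (intro sum.cong) auto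
  finally have "\<bar>Im z\<bar> * norm u \<le> norm w" by (rule T.resolvent_norm_bound(1))
  moreover have "norm w = L2_set (\<lambda>q. cmod (g q)) Q"
  proof -
    have R: "Rep_l2 w x = (if x \<in> Q then g x else 0)" for x
    proof -
      have "Rep_l2 w x = (\<Sum>q\<in>Q. if q = x then g q else 0)"
        unfolding w_def Rs[OF Q(1)] by (rule sum.cong) (auto simp: cscale.rep_eq delta.rep_eq)
      then show ?thesis using Q(1) by simp
    qed
    have "norm w = L2_set (\<lambda>x. cmod (Rep_l2 w x)) Q" by (rule norm_finite_support[OF Q(1)]) (simp add: R)
    also have "\<dots> = L2_set (\<lambda>q. cmod (g q)) Q" by (rule L2_set_cong) (simp_all add: R)
    finally show ?thesis .
  qed
  ultimately have nu: "norm u \<le> 1 / Im z * L2_set (\<lambda>q. cmod (g q)) Q"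
    using z by (simp add: field_simps)
  have "(\<Sum>p\<in>P. \<Sum>q\<in>Q. f p * kern (green z) p q * g q) = (\<Sum>p\<in>P. f p * Rep_l2 u p)"
    using P(2) Ru by (intro sum.cong) (auto simp: sum_distrib_left mult.assoc)
  also have "cmod \<dots> \<le> (\<Sum>p\<in>P. \<bar>cmod (f p)\<bar> * \<bar>cmod (Rep_l2 u p)\<bar>)"
    by (rule order.trans[OF norm_sum]) (simp add: norm_mult)
  also have "\<dots> \<le> L2_set (\<lambda>p. cmod (f p)) P * L2_set (\<lambda>p. cmod (Rep_l2 u p)) P" by (rule L2_set_mult_ineq)
  also have "\<dots> \<le> L2_set (\<lambda>p. cmod (f p)) P * (1 / Im z * L2_set (\<lambda>q. cmod (g q)) Q)"
    using L2_set_le_norm[OF P(1), of u] nu by (intro mult_left_mono) (auto intro: L2_set_nonneg)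
  finally show ?thesis by (simp add: mult_ac)
qed

end

section \<open>Crossing the real axis: the spectral dichotomy\<close>

lemma half_ball_continuation:
  assumes h: "h holomorphic_on ball (complex_of_real t) r" 
    and 0: "\<And>z. z \<in> ball (of_real t) r \<Longrightarrow> z \<in> uhp \<Longrightarrow> h z = 0" and z: "z \<in> ball (of_real t) r"
  shows "h z = 0"
proof -
  have r: "0 < r" using z by (metis ball_eq_empty empty_iff not_le)
  have "Complex t (r / 2) \<in> ball (of_real t) r \<inter> uhp"
    using r by (simp add: dist_norm cmod_def)
  then have ne: "ball (of_real t) r \<inter> uhp \<noteq> {}" by blast
  show ?thesis
    by (rule analytic_continuation_open[OF _ open_ball ne connected_ball _ h holomorphic_on_const _ z])
      (use 0 open_uhp in \<open>auto intro!: open_Int\<close>)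
qed

text \<open>Schwarz reflection: both sides agree on the real points of the ball, which accumulate at
  its centre.\<close>

lemma reflection_on_ball:
  assumes h: "h holomorphic_on ball (complex_of_real t) r" 
    and real: "\<And>z. z \<in> ball (of_real t) r \<Longrightarrow> z \<in> \<real> \<Longrightarrow> h z \<in> \<real>" and z: "z \<in> ball (of_real t) r"
  shows "h (cnj z) = cnj (h z)"
proof -
  let ?B = "ball (complex_of_real t) r"
  have r: "0 < r" using z by (metis ball_eq_empty empty_iff not_le)
  have cB: "cnj ` ?B = ?B"
  proof -
    have "cnj w \<in> ?B" if "w \<in> ?B" for w
    proof -
      have "cmod (of_real t - cnj w) = cmod (cnj (of_real t - w))" by simp
      also have "\<dots> = cmod (of_real t - w)" by (rule complex_mod_cnj)
      finally show ?thesis using that by (simp add: dist_norm)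
    qed
    then show ?thesis by (metis (no_types, lifting) complex_cnj_cnj image_iff subsetI subset_antisym image_subsetI)
  qed
  have "(cnj \<circ> h \<circ> cnj) holomorphic_on ?B"
    by (rule holomorphic_on_compose_cnj_cnj) (use h cB in auto)
  then have hol: "(\<lambda>z. h z - (cnj \<circ> h \<circ> cnj) z) holomorphic_on ?B" using h by (rule holomorphic_on_diff[rotated])
  have lim: "of_real t islimpt (?B \<inter> \<real>)"
    unfolding islimpt_approachable
  proof (intro allI impI)
    fix e :: real assume e: "0 < e"
    let ?y = "complex_of_real (t + min e r / 2)"
    have "dist ?y (of_real t) = min e r / 2" using e r by (simp add: dist_norm del: of_real_divide)
    then show "\<exists>x'\<in>?B \<inter> \<real>. x' \<noteq> of_real t \<and> dist x' (of_real t) < e"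
      using e r by (intro bexI[of _ ?y]) (auto simp: dist_commute simp del: of_real_add)
  qed
  have "h z - (cnj \<circ> h \<circ> cnj) z = 0"
    by (rule analytic_continuation[OF hol open_ball connected_ball _ _ lim])
      (use real z r in \<open>auto simp: Reals_cnj_iff\<close>)
  then show ?thesis by simp
qed

text \<open>The maximum principle for \<open>((z - t)\<^sup>2 - s\<^sup>2) h z\<close> turns a bound by \<open>1 / Im z\<close> off the real axis 
  into a bound on it.\<close>

lemma bound_across_real_axis:
  assumes h: "h holomorphic_on ball (complex_of_real t) r" and s: "0 < s" "s < r" and M: "0 \<le> M"
    and le: "\<And>z. z \<in> ball (of_real t) r \<Longrightarrow> \<bar>Im z\<bar> * cmod (h z) \<le> M"
  shows "cmod (h (of_real t)) \<le> 2 * M / s"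
proof -
  let ?k = "\<lambda>z. ((z - of_real t)\<^sup>2 - of_real (s\<^sup>2)) * h z"
  have sub: "cball (complex_of_real t) s \<subseteq> ball (of_real t) r" using s by auto
  have k: "?k holomorphic_on ball (of_real t) r" by (intro holomorphic_intros h)
  have "cmod (?k (of_real t)) \<le> 2 * s * M"
  proof (rule maximum_modulus_frontier[of ?k "ball (of_real t) s"])
    show "?k holomorphic_on interior (ball (of_real t) s)"
      using k sub by (auto elim!: holomorphic_on_subset)
    show "continuous_on (closure (ball (of_real t) s)) ?k"
      using holomorphic_on_imp_continuous_on[OF k] sub s by (auto elim: continuous_on_subset)
    show "bounded (ball (complex_of_real t) s)" by (rule bounded_ball)
    show "of_real t \<in> ball (complex_of_real t) s" using s by simp
  next
    fix z assume "z \<in> frontier (ball (complex_of_real t) s)"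
    then have z: "cmod (z - of_real t) = s" using s by (simp add: frontier_ball dist_norm norm_minus_commute)
    define w where "w = z - of_real t"
    have w: "cmod w = s" "Im w = Im z" using z by (simp_all add: w_def)
    \<comment> \<open>On the circle |w| = s the constant s^2 equals w times its conjugate; the
      resulting factor Im z cancels the blow-up of \<open>h\<close> at the axis.\<close>
    have "w\<^sup>2 - of_real (s\<^sup>2) = w * (w - cnj w)"
      using complex_norm_square[of w] w(1) by (simp add: power2_eq_square algebra_simps)
    also have "w - cnj w = 2 * \<i> * of_real (Im z)" using w by (simp add: complex_eq_iff)
    finally have "cmod (w\<^sup>2 - of_real (s\<^sup>2)) = s * (2 * \<bar>Im z\<bar>)" by (simp add: norm_mult w)
    moreover have "z \<in> ball (of_real t) r" using z s by (simp add: dist_norm norm_minus_commute)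
    then have "\<bar>Im z\<bar> * cmod (h z) \<le> M" by (rule le)
    then have "2 * s * (\<bar>Im z\<bar> * cmod (h z)) \<le> 2 * s * M" using s by (intro mult_left_mono) auto
    ultimately show "cmod (?k z) \<le> 2 * s * M" by (simp add: norm_mult w_def mult_ac)
  qed
  then have "s * (s * cmod (h (of_real t))) \<le> s * (2 * M)" by (simp add: norm_mult norm_power power2_eq_square mult_ac)
  then have "s * cmod (h (of_real t)) \<le> 2 * M" using s by (simp only: mult_le_cancel_left_pos)
  then show ?thesis using s by (simp add: field_simps)
qed

context base_graph
begin

lemma kern_cong:
  assumes xy: "\<And>i. i \<in> dirs \<Longrightarrow> x i = y i" and p: "p \<in> X" and q: "q \<in> X"
  shows "kern x p q = kern y p q"
proof -
  have c: "cone x q p = cone y q p" if "q \<in> X" for q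
    unfolding cone_def using xy vertex_dir[OF that] idx_in[OF X_take[OF p]] by (simp cong: prod.cong)
  show ?thesis
    using q
  proof (induction q rule: X_induct)
    case root
    show ?case unfolding kern_root by (rule c[OF root_in_X])
  next
    case (snoc q w)
    have q0: "q \<noteq> []" using X_nonempty snoc by auto
    have q': "q @ [w] \<in> X" using snoc X_snoc[OF q0] by blast
    have "(Some (last q), w) \<in> dirs" using idx_in[OF q'] q0 by (simp add: idx_snoc)
    then show ?case using snoc.IH xy c[OF q'] by (simp add: kern_snoc[OF q0])
  qed
qed

text \<open>The recursive equations continue to the real point t, so the continued kernel formally
  inverts t - A. By reflection the bound 1 / |Im z| holds on both sides of the axis, and
  \<open>bound_across_real_axis\<close> turns it into a bound at t itself, as
  \<open>kernel_resolvent\<close> requires.\<close>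

lemma real_type_resolvent:
  assumes hol: "\<And>i. i \<in> dirs \<Longrightarrow> \<phi> i holomorphic_on ball (of_real t) \<rho>" and \<rho>: "0 < \<rho>"
    and ext: "\<And>i z. i \<in> dirs \<Longrightarrow> z \<in> ball (of_real t) \<rho> \<Longrightarrow> z \<in> uhp \<Longrightarrow> \<phi> i z = green z i"
    and real: "\<And>i z. i \<in> dirs \<Longrightarrow> z \<in> ball (of_real t) \<rho> \<Longrightarrow> z \<in> \<real> \<Longrightarrow> \<phi> i z \<in> \<real>"
  shows "of_real t \<in> resolvent_set cover"
proof -
  let ?B = "ball (complex_of_real t) \<rho>"
  define K where "K z = kern (\<lambda>i. \<phi> i z)" for z
  have Khol: "(\<lambda>z. K z p q) holomorphic_on ?B" if "p \<in> X" "q \<in> X" for p q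
    unfolding K_def by (rule kern_holomorphic[OF _ that]) (rule hol)
  have Kgreen: "K z p q = kern (green z) p q" if "z \<in> ?B" "z \<in> uhp" "p \<in> X" "q \<in> X" for z p q
    unfolding K_def by (rule kern_cong) (use ext that in auto)
  have t: "of_real t \<in> ?B" using \<rho> by simp
  have solves: "solves (of_real t) (\<lambda>i. \<phi> i (of_real t))"
    unfolding solves_def
  proof
    fix i assume i: "i \<in> dirs"
    have "\<phi> i (of_real t) * (of_real t - (\<Sum>j\<in>succs i. \<phi> j (of_real t))) - 1 = 0"
    proof (rule half_ball_continuation[OF _ _ t])
      show "(\<lambda>z. \<phi> i z * (z - (\<Sum>j\<in>succs i. \<phi> j z)) - 1) holomorphic_on ?B"
        using hol i N[OF i] by (intro holomorphic_intros holomorphic_on_sum) auto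
      show "\<phi> i z * (z - (\<Sum>j\<in>succs i. \<phi> j z)) - 1 = 0" if z: "z \<in> ?B" "z \<in> uhp" for z
      proof -
        have "(\<Sum>j\<in>succs i. \<phi> j z) = sum (green z) (succs i)" 
          using ext z N[OF i] by (intro sum.cong) auto
        then show ?thesis using green_solves[OF z(2)] i ext[OF i z] by (simp add: solves_def)
      qed
    qed
    then show "\<phi> i (of_real t) * (of_real t - (\<Sum>j\<in>succs i. \<phi> j (of_real t))) = 1" by simp
  qed
  have cnj: "K (cnj z) p q = cnj (K z p q)" if z: "z \<in> ?B" and pq: "p \<in> X" "q \<in> X" for z p q
  proof -
    have "K (cnj z) p q = kern (\<lambda>i. cnj (\<phi> i z)) p q"
      unfolding K_def by (rule kern_cong[OF _ pq]) (rule reflection_on_ball[OF hol real z])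
    then show ?thesis by (simp add: kern_cnj K_def)
  qed
  show ?thesis
  proof (rule kernel_resolvent[OF bounded_cover ET_sub, where K = "K (of_real t)" and C = "2 / (\<rho> / 2)"])
    fix p q assume pq: "p \<in> X" "q \<in> X"
    have "K (of_real t) p q - K (of_real t) q p = 0"
      by (rule half_ball_continuation[OF _ _ t])
        (use pq Khol Kgreen kern_symmetric in \<open>auto intro!: holomorphic_on_diff\<close>)
    then show "K (of_real t) p q = K (of_real t) q p" by simp
    show "of_real t * K (of_real t) p q - (\<Sum>p'\<in>ET `` {p}. K (of_real t) p' q) = of_bool (p = q)"
      unfolding K_def by (rule kern_inverse[OF solves pq(2) pq(1)])
  next
    fix P Q f g assume P: "finite P" "P \<subseteq> X" and Q: "finite Q" "Q \<subseteq> X"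
    define h where "h z = (\<Sum>p\<in>P. \<Sum>q\<in>Q. f p * K z p q * g q)" for z
    define M where "M = L2_set (\<lambda>p. cmod (f p)) P * L2_set (\<lambda>q. cmod (g q)) Q"
    have up: "Im z * cmod (\<Sum>p\<in>P. \<Sum>q\<in>Q. f' p * K z p q * g' q) \<le> 
        L2_set (\<lambda>p. cmod (f' p)) P * L2_set (\<lambda>q. cmod (g' q)) Q"
      if z: "z \<in> ?B" "z \<in> uhp" for z f' g'
    proof -
      have "(\<Sum>p\<in>P. \<Sum>q\<in>Q. f' p * K z p q * g' q) = (\<Sum>p\<in>P. \<Sum>q\<in>Q. f' p * kern (green z) p q * g' q)"
        by (intro sum.cong refl) (use Kgreen[OF z] P Q in auto)
      then show ?thesis using kern_form_bound[OF z(2) P Q, of f' g'] z(2) by (simp add: field_simps)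
    qed
    have "cmod (h (of_real t)) \<le> 2 * M / (\<rho> / 2)"
    proof (rule bound_across_real_axis)
      show "h holomorphic_on ball (of_real t) \<rho>"
        unfolding h_def using P Q Khol by (intro holomorphic_on_sum holomorphic_on_mult holomorphic_on_const) auto
      show "0 \<le> M" by (simp add: M_def L2_set_nonneg)
      fix z assume z: "z \<in> ?B"
      consider "Im z = 0" | "0 < Im z" | "Im z < 0" by linarith
      then show "\<bar>Im z\<bar> * cmod (h z) \<le> M"
      proof cases
        case 1
        then show ?thesis using \<open>0 \<le> M\<close> by simp
      next
        case 2
        then show ?thesis using up[OF z, of f g] by (simp add: h_def M_def)
      next
        case 3
        have "cmod (of_real t - cnj z) = cmod (cnj (of_real t - z))" by simp
        also have "\<dots> = cmod (of_real t - z)" by (rule complex_mod_cnj)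
        finally have z': "cnj z \<in> ?B" using z by (simp add: dist_norm)
        \<comment> \<open>Below the axis the form is the conjugate of the form at the conjugate
          point with conjugated test vectors, whose norms are the same.\<close>
        have "h z = (\<Sum>p\<in>P. \<Sum>q\<in>Q. f p * cnj (K (cnj z) p q) * g q)"
          unfolding h_def by (intro sum.cong refl) (use cnj[OF z'] P Q in auto)
        also have "\<dots> = cnj (\<Sum>p\<in>P. \<Sum>q\<in>Q. cnj (f p) * K (cnj z) p q * cnj (g q))" by simp
        finally have "cmod (h z) = cmod (\<Sum>p\<in>P. \<Sum>q\<in>Q. cnj (f p) * K (cnj z) p q * cnj (g q))"
          by (simp only: complex_mod_cnj)
        then show ?thesis using up[OF z', of "\<lambda>p. cnj (f p)" "\<lambda>q. cnj (g q)"] 3 by (simp add: M_def)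
      qed
    qed (use \<rho> in auto)
    then show "cmod (\<Sum>p\<in>P. \<Sum>q\<in>Q. f p * K (of_real t) p q * g q) 
        \<le> 2 / (\<rho> / 2) * L2_set (\<lambda>p. cmod (f p)) P * L2_set (\<lambda>q. cmod (g q)) Q"
      by (simp add: h_def M_def)
  qed (use \<rho> in auto)
qed

text \<open>The Stieltjes transform of the density of states of the cover: the average of the
  diagonal Green function over the vertices of G.\<close>

definition trace :: "complex \<Rightarrow> complex" where
  "trace z = (\<Sum>v\<in>pverts G. green z (None, v)) / of_nat (card (pverts G))"

lemma card_verts_pos: "0 < card (pverts G)"
  using root pair_finite_verts by (auto simp: card_gt_0_iff)

lemma Im_trace: "Im (trace z) = (\<Sum>v\<in>pverts G. Im (green z (None, v))) / card (pverts G)"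
  unfolding trace_def by (simp add: Im_divide_of_nat)

lemma vertex_in_dirs: "v \<in> pverts G \<Longrightarrow> (None, v) \<in> dirs" by (simp add: dirs_def)

text \<open>If all branches are real on the axis, a whole neighbourhood of t lies in the resolvent
  set. Otherwise some vertex carries a branch with imaginary part bounded away from 0, and no other
  vertex can cancel it because all imaginary parts have the same sign.\<close>

lemma spectral_dichotomy:
  assumes \<rho>: "0 < \<rho>" and ex: "\<forall>i\<in>dirs. \<exists>\<phi>. extends_locally (\<lambda>z. green z i) t \<rho> \<phi>"
  shows "(\<forall>s. \<bar>s - t\<bar> < \<rho> \<longrightarrow> s \<notin> adj_spectrum cover) \<or>
    (\<exists>c>0. \<exists>B. \<forall>z\<in>ball (of_real t) \<rho>. z \<in> uhp \<longrightarrow> c \<le> - Im (trace z) \<and> cmod (trace z) \<le> B)"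
proof -
  let ?B = "ball (complex_of_real t) \<rho>"
  have "\<exists>\<phi>. \<forall>i\<in>dirs. extends_locally (\<lambda>z. green z i) t \<rho> (\<phi> i)" using ex by (rule bchoice)
  then obtain \<phi> where \<phi>: "\<And>i. i \<in> dirs \<Longrightarrow> extends_locally (\<lambda>z. green z i) t \<rho> (\<phi> i)" by blast
  have hol: "\<phi> i holomorphic_on ?B" if "i \<in> dirs" for i using \<phi>[OF that] by (simp add: extends_locally_def)
  have ext: "\<phi> i z = green z i" if "i \<in> dirs" "z \<in> ?B" "z \<in> uhp" for i z
    using \<phi>[OF that(1)] that by (simp add: extends_locally_def)
  have t: "of_real t \<in> ?B" using \<rho> by simp
  define rt where "rt i \<longleftrightarrow> (\<forall>z\<in>?B. z \<in> \<real> \<longrightarrow> \<phi> i z \<in> \<real>)" for i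
  have nrt: "\<exists>c>0. \<forall>z\<in>?B. Im (\<phi> i z) \<le> - c" if "i \<in> dirs" "\<not> rt i" for i
    using \<phi>[OF that(1)] that(2) unfolding extends_locally_def rt_def by blast
  show ?thesis
  proof (cases "\<forall>i\<in>dirs. rt i")
    case True
    have "of_real s \<in> resolvent_set cover" if s: "\<bar>s - t\<bar> < \<rho>" for s
    proof (rule real_type_resolvent)
      have sub: "ball (complex_of_real s) (\<rho> - \<bar>s - t\<bar>) \<subseteq> ?B"
      proof
        fix z assume "z \<in> ball (complex_of_real s) (\<rho> - \<bar>s - t\<bar>)"
        moreover have "dist (complex_of_real t) z \<le> dist (complex_of_real t) (of_real s) + dist (of_real s) z" 
          by (rule dist_triangle)
        moreover have "dist (complex_of_real t) (of_real s) = \<bar>s - t\<bar>" by (simp add: dist_of_real dist_real_def)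
        ultimately show "z \<in> ?B" by simp
      qed
      show "\<phi> i holomorphic_on ball (of_real s) (\<rho> - \<bar>s - t\<bar>)" if "i \<in> dirs" for i
        using hol[OF that] sub by (rule holomorphic_on_subset)
      show "0 < \<rho> - \<bar>s - t\<bar>" using s by simp
      show "\<phi> i z = green z i" if "i \<in> dirs" "z \<in> ball (of_real s) (\<rho> - \<bar>s - t\<bar>)" "z \<in> uhp" for i z
        using ext that sub by blast
      show "\<phi> i z \<in> \<real>" if "i \<in> dirs" "z \<in> ball (of_real s) (\<rho> - \<bar>s - t\<bar>)" "z \<in> \<real>" for i z
        using True that sub unfolding rt_def by blast
    qed
    then show ?thesis by (simp add: adj_spectrum_def)
  next
    case False
    then obtain i where i: "i \<in> dirs" "\<not> rt i" by blast
    have le0: "Im (\<phi> j (of_real t)) \<le> 0" if "j \<in> dirs" for j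
    proof (cases "rt j")
      case True
      then have "\<phi> j (of_real t) \<in> \<real>" using t unfolding rt_def by auto
      then show ?thesis by (simp add: complex_is_Real_iff)
    next
      case False
      then show ?thesis using nrt[OF that False] t by (meson le_minus_iff less_imp_le neg_0_le_iff_le order_trans)
    qed
    \<comment> \<open>A nonreal branch of an edge out of u forces the branch of the vertex u to be
      nonreal: otherwise the imaginary parts of its successors would sum to 0, although all are
      nonpositive and one is negative.\<close>
    have "\<exists>v\<in>pverts G. \<not> rt (None, v)"
    proof (cases "fst i")
      case None
      then show ?thesis using i by (auto simp: dirs_def)
    next
      case (Some u)
      obtain v where iv: "i = (Some u, v)" using Some by (cases i) auto
      have uv: "(u, v) \<in> parcs G" using i(1) unfolding iv by (auto simp: dirs_def)
      have u: "u \<in> pverts G" using uv arc_fst_in_verts by fastforce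
      then have ud: "(None, u) \<in> dirs" by (rule vertex_in_dirs)
      have "\<not> rt (None, u)"
      proof
        assume "rt (None, u)"
        then have re: "\<phi> (None, u) (of_real t) \<in> \<real>" using t unfolding rt_def by auto
        let ?S = "\<Sum>j\<in>succs (None, u). \<phi> j (of_real t)"
        have "\<phi> (None, u) (of_real t) * (of_real t - ?S) - 1 = 0"
        proof (rule half_ball_continuation[OF _ _ t])
          show "(\<lambda>z. \<phi> (None, u) z * (z - (\<Sum>j\<in>succs (None, u). \<phi> j z)) - 1) holomorphic_on ?B"
            using hol ud N[OF ud] by (intro holomorphic_intros holomorphic_on_sum) auto
          show "\<phi> (None, u) z * (z - (\<Sum>j\<in>succs (None, u). \<phi> j z)) - 1 = 0" if z: "z \<in> ?B" "z \<in> uhp" for z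
          proof -
            have "(\<Sum>j\<in>succs (None, u). \<phi> j z) = sum (green z) (succs (None, u))" 
              using ext z N[OF ud] by (intro sum.cong) auto
            then show ?thesis using green_solves[OF z(2)] ud ext[OF ud z] by (simp add: solves_def)
          qed
        qed
        then have e: "of_real t - ?S = inverse (\<phi> (None, u) (of_real t))"
          by (metis eq_iff_diff_eq_0 inverse_unique mult.commute)
        have "of_real t - ?S \<in> \<real>" unfolding e using re by (rule Reals_inverse)
        then have S0: "Im ?S = 0" by (simp add: complex_is_Real_iff)
        have iS: "i \<in> succs (None, u)" using uv by (simp add: iv succs_def)
        obtain c where c: "0 < c" "\<And>z. z \<in> ?B \<Longrightarrow> Im (\<phi> i z) \<le> - c" using nrt[OF i] by blast
        have "(\<Sum>j\<in>succs (None, u). Im (\<phi> j (of_real t))) \<le> (\<Sum>j\<in>{i}. Im (\<phi> j (of_real t)))"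
        proof -
          have "(\<Sum>j\<in>succs (None, u). Im (\<phi> j (of_real t))) = 
              (\<Sum>j\<in>{i}. Im (\<phi> j (of_real t))) + (\<Sum>j\<in>succs (None, u) - {i}. Im (\<phi> j (of_real t)))"
            using sum.subset_diff[of "{i}" "succs (None, u)"] iS finN[OF ud] by (simp add: add.commute)
          moreover have "(\<Sum>j\<in>succs (None, u) - {i}. Im (\<phi> j (of_real t))) \<le> 0"
            using le0 N[OF ud] by (intro sum_nonpos) auto
          ultimately show ?thesis by linarith
        qed
        then show False using c(1) c(2)[OF t] S0 by simp
      qed
      then show ?thesis using u by blast
    qed
    then obtain v where v: "v \<in> pverts G" "\<not> rt (None, v)" by blast
    obtain c where c: "0 < c" "\<And>z. z \<in> ?B \<Longrightarrow> Im (\<phi> (None, v) z) \<le> - c" 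
      using nrt[OF vertex_in_dirs[OF v(1)] v(2)] by blast
    have "\<exists>b. \<forall>z\<in>?B. cmod (\<phi> (None, w) z) \<le> b" if "w \<in> pverts G" for w
      using \<phi>[OF vertex_in_dirs[OF that]] by (simp add: extends_locally_def)
    then have "\<exists>b. \<forall>w\<in>pverts G. \<forall>z\<in>?B. cmod (\<phi> (None, w) z) \<le> b w" by (intro bchoice) blast
    then obtain b where b: "\<And>w z. w \<in> pverts G \<Longrightarrow> z \<in> ?B \<Longrightarrow> cmod (\<phi> (None, w) z) \<le> b w" by blast
    let ?n = "real (card (pverts G))"
    have n: "0 < ?n" using card_verts_pos by simp
    have "c / ?n \<le> - Im (trace z) \<and> cmod (trace z) \<le> sum b (pverts G) / ?n" if z: "z \<in> ?B" "z \<in> uhp" for z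
    proof
      have "(\<Sum>w\<in>pverts G. Im (green z (None, w))) \<le> (\<Sum>w\<in>pverts G. if w = v then - c else 0)"
      proof (rule sum_mono)
        fix w assume w: "w \<in> pverts G"
        show "Im (green z (None, w)) \<le> (if w = v then - c else 0)"
          using c(2)[OF z(1)] ext[OF vertex_in_dirs[OF v(1)] z] green_props(1)[of z "(None, w)"] z(2) vertex_in_dirs[OF w] 
          by simp
      qed
      also have "\<dots> = - c" using v(1) pair_finite_verts by simp
      finally show "c / ?n \<le> - Im (trace z)" using n by (simp add: Im_trace field_simps)
      have "cmod (\<Sum>w\<in>pverts G. green z (None, w)) \<le> sum b (pverts G)"
        by (rule sum_norm_le) (use b z ext vertex_in_dirs in metis)
      then show "cmod (trace z) \<le> sum b (pverts G) / ?n" using n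
        by (simp add: trace_def norm_divide divide_right_mono)
    qed
    moreover have "0 < c / ?n" using c(1) n by (rule divide_pos_pos)
    ultimately show ?thesis by blast
  qed
qed

text \<open>The imaginary part of a diagonal entry is -Im z times the squared norm of a column, and
  columns are bounded by 1 / (|z| - D0). So above real points beyond \<open>D0\<close> it tends to 0
  with Im z.\<close>

lemma trace_far:
  assumes z: "z \<in> uhp" "D0 < cmod z" and onto: "last ` X = pverts G"
  shows "- Im (trace z) \<le> Im z / (cmod z - D0)\<^sup>2"
proof -
  have b: "- Im (green z (None, v)) \<le> Im z / (cmod z - D0)\<^sup>2" if v: "v \<in> pverts G" for v
  proof -
    obtain p where p: "p \<in> X" "last p = v" using v unfolding onto[symmetric] by blast
    note e = col_eq[OF z(1) p(1)]
    have "inner (cscale \<i> (col z p)) (delta p) = Re (pair (Rep_l2 (delta p)) (\<lambda>x. \<i> * Rep_l2 (col z p) x))"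
    proof -
      have "(\<lambda>x. cnj (Rep_l2 (delta p) x)) = Rep_l2 (delta p)" by (simp add: delta.rep_eq fun_eq_iff)
      then show ?thesis unfolding inner_l2.rep_eq cscale.rep_eq by (simp only: pair_commute)
    qed
    also have "\<dots> = - Im (kern (green z) p p)" 
      unfolding pair_delta by (simp add: Rep_col[OF z(1) p(1)] kcol_def p(1))
    also have "kern (green z) p p = green z (None, v)" 
      using kern_prefix[OF p(1), of p] p(2) by (simp add: cone_self)
    finally have I: "- Im (green z (None, v)) = Im z * (norm (col z p))\<^sup>2"
      using T.inner_resolvent[OF e] by simp
    have "(cmod z - D0) * norm (col z p) \<le> 1" using T.resolvent_norm_bound(2)[OF e] by (simp add: norm_delta)
    then have "norm (col z p) \<le> 1 / (cmod z - D0)" using z(2) by (simp add: field_simps)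
    then have "(norm (col z p))\<^sup>2 \<le> (1 / (cmod z - D0))\<^sup>2" by (intro power_mono) auto
    then have "Im z * (norm (col z p))\<^sup>2 \<le> Im z * (1 / (cmod z - D0))\<^sup>2" using z(1) by (intro mult_left_mono) auto
    then show ?thesis unfolding I by (simp add: power_divide)
  qed
  have "- Im (trace z) = (\<Sum>v\<in>pverts G. - Im (green z (None, v))) / card (pverts G)"
    by (simp add: Im_trace sum_negf)
  also have "\<dots> \<le> (\<Sum>v\<in>pverts G. Im z / (cmod z - D0)\<^sup>2) / card (pverts G)"
    by (intro divide_right_mono sum_mono b) auto
  also have "\<dots> = Im z / (cmod z - D0)\<^sup>2" using card_verts_pos by (simp add: card_gt_0_iff)
  finally show ?thesis .
qed

end

section \<open>Connected graphs of minimal degree 2: infinite spectrum and uniform bounds\<close>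

lemma out_degree_pair:
  "out_degree (with_proj G) v = card {w. (v, w) \<in> parcs G}"
proof -
  have "out_arcs (with_proj G) v = Pair v ` {w. (v, w) \<in> parcs G}" by (auto simp: out_arcs_def)
  then show ?thesis by (simp add: out_degree_def card_image inj_on_def)
qed

locale core_graph = base_graph +
  assumes conn: "Digraph_Component.connected (with_proj G)"
    and min_degree: "\<And>v. v \<in> pverts G \<Longrightarrow> 2 \<le> card {w. (v, w) \<in> parcs G}"
begin

lemma arc_closed_set:
  assumes v: "v \<in> S" "v \<in> pverts G" and S: "\<And>u w. u \<in> S \<Longrightarrow> (u, w) \<in> parcs G \<Longrightarrow> w \<in> S"
  shows "pverts G \<subseteq> S"
proof
  fix w assume w: "w \<in> pverts G"
  have "strongly_connected (mk_symmetric (with_proj G))"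
    using conn by (simp add: Digraph_Component.connected_def)
  then have "v \<rightarrow>\<^sup>*\<^bsub>with_proj (mk_symmetric (with_proj G))\<^esub> w"
    using v w by (auto simp: strongly_connected_def)
  then have "v \<rightarrow>\<^sup>*\<^bsub>with_proj G\<^esub> w" using sym_arcs by (simp add: reachable_mk_symmetric_eq)
  then show "w \<in> S"
  proof (induction rule: reachable_induct)
    case base
    show ?case by (rule v)
  next
    case (step x y)
    then show ?case using S by simp
  qed
qed

lemma cover_onto: "last ` X = pverts G"
proof
  show "last ` X \<subseteq> pverts G" using last_in by auto
  show "pverts G \<subseteq> last ` X"
  proof (rule arc_closed_set[OF _ root])
    show "r \<in> last ` X" using root_in_X by force
  next
    fix u w assume "u \<in> last ` X" and uw: "(u, w) \<in> parcs G"
    then obtain p where p: "p \<in> X" "last p = u" by auto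
    \<comment> \<open>If \<open>w\<close> is the vertex from which the walk arrived, extending would
      backtrack; the walk without its last step already ends at \<open>w\<close>.\<close>
    show "w \<in> last ` X"
    proof (cases "fst (idx p) = Some w")
      case False
      then have "p @ [w] \<in> X" using uw p X_snoc[OF X_nonempty[OF p(1)]] by (simp add: succs_def idx_def)
      then show ?thesis by force
    next
      case True
      then have l: "2 \<le> length p" "w = p ! (length p - 2)" by (auto simp: idx_def split: if_splits)
      have b: "butlast p \<in> X" using X_take[OF p(1), of "length p - 1"] l(1) by (simp add: butlast_conv_take)
      have "last (butlast p) = w" using l X_nonempty[OF b] by (simp add: last_conv_nth nth_butlast numeral_2_eq_2)
      then show ?thesis using b by force
    qed
  qed
qed

lemma ch_nonempty: assumes "p \<in> X" shows "ch p \<noteq> {}"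
proof
  assume "ch p = {}"
  then have "fst (idx p) = Some w" if "(last p, w) \<in> parcs G" for w
    using that by (auto simp: ch_def succs_def idx_def split: if_splits)
  then have "{w. (last p, w) \<in> parcs G} \<subseteq> {the (fst (idx p))}" by auto
  then have "card {w. (last p, w) \<in> parcs G} \<le> 1" using card_mono[of "{the (fst (idx p))}"] by force
  then show False using min_degree[OF last_in[OF assms]] by simp
qed

lemma long_path: "\<exists>p\<in>X. length p = Suc n"
proof (induction n)
  case 0
  show ?case using root_in_X by force
next
  case (Suc n)
  then obtain p where p: "p \<in> X" "length p = Suc n" by blast
  then obtain w where "w \<in> ch p" using ch_nonempty by blast
  then have "p @ [w] \<in> X" using p X_snoc[OF X_nonempty[OF p(1)]] by (simp add: ch_def)
  then show ?case using p by (intro bexI[of _ "p @ [w]"]) auto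
qed

text \<open>In a tree there is exactly one walk of length i to a vertex at distance i, and none to a
  vertex farther away.\<close>

lemma adjop_pow_root:
  "p \<in> X \<Longrightarrow> Suc i \<le> length p \<Longrightarrow> Rep_l2 ((T.adjop ^^ i) (delta [r])) p = of_bool (length p = Suc i)"
proof (induction i arbitrary: p)
  case 0
  have "p = [r] \<longleftrightarrow> length p = Suc 0" using 0(1) by (auto simp: X_iff length_Suc_conv)
  then show ?case by (simp add: delta.rep_eq)
next
  case (Suc i)
  let ?u = "Rep_l2 ((T.adjop ^^ i) (delta [r]))"
  have l: "2 \<le> length p" using Suc.prems by simp
  have b: "butlast p \<in> X" using X_take[OF Suc.prems(1), of "length p - 1"] l by (simp add: butlast_conv_take)
  have "?u (p @ [w]) = 0" if "w \<in> ch p" for w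
    using Suc.IH[of "p @ [w]"] that Suc.prems X_snoc[OF X_nonempty[OF Suc.prems(1)]] by (simp add: ch_def)
  then have "Rep_l2 ((T.adjop ^^ Suc i) (delta [r])) p = ?u (butlast p)"
    using l sum_nbrs[OF Suc.prems(1), of ?u] by (simp add: T.Rep_adjop nbr_sum_def)
  also have "\<dots> = of_bool (length p = Suc (Suc i))" using Suc.IH[OF b] Suc.prems l by (auto simp: of_bool_def)
  finally show ?case .
qed

text \<open>At a vertex at distance \<open>degree p\<close> from the root only the leading term
  contributes; minimal degree 2 provides such a vertex.\<close>

lemma opoly_root_nonzero:
  assumes "p \<noteq> 0" shows "T.opoly p (delta [r]) \<noteq> 0"
proof
  assume 0: "T.opoly p (delta [r]) = 0"
  obtain s where s: "s \<in> X" "length s = Suc (degree p)" using long_path by blast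
  have Rs: "Rep_l2 (sum h S) t = (\<Sum>i\<in>S. Rep_l2 (h i) t)" if "finite S" for h :: "nat \<Rightarrow> 'a list l2" and S t
    using that by (induction S rule: finite_induct) (auto simp: l2_simps)
  have "Rep_l2 (T.opoly p (delta [r])) s 
      = (\<Sum>i\<le>degree p. coeff p i * of_bool (length s = Suc i))"
    unfolding T.opoly_def Rs[OF finite_atMost] by (rule sum.cong) (use adjop_pow_root s in \<open>auto simp: cscale.rep_eq\<close>)
  also have "\<dots> = (\<Sum>i\<le>degree p. if i = degree p then coeff p i else 0)" by (rule sum.cong) (auto simp: s)
  also have "\<dots> = lead_coeff p" by simp
  finally show False using 0 assms by (simp add: l2_simps)
qed

lemma spectrum_infinite: "finite F \<Longrightarrow> \<exists>t\<in>adj_spectrum cover. t \<notin> F"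
  by (rule spectrum_not_subset_finite[OF bounded_cover ET_sub root_in_X opoly_root_nonzero])

text \<open>Off \<open>F\<close> the dichotomy holds around each point. A spectral point beyond
  \<open>D0\<close> would have -Im \<open>trace\<close> bounded below, against
  \<open>trace_far\<close>, so only a compact set remains after removing the neighbourhood of
  \<open>F\<close>, and a finite cover gives uniform constants.\<close>

lemma spectrum_local_law:
  "\<exists>F. finite F \<and> (\<forall>t\<in>adj_spectrum cover. t \<in> F \<or> \<bar>t\<bar> \<le> D0) \<and>
    (\<forall>c1>0. \<exists>c>0. \<exists>B>0. \<exists>\<delta>>0. \<forall>t\<in>adj_spectrum cover - (\<Union>x\<in>F. ball x c1). \<forall>y. 0 < y \<and> y < \<delta> \<longrightarrow>
       c \<le> - Im (trace (Complex t y)) \<and> cmod (trace (Complex t y)) \<le> B)"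
proof -
  let ?sp = "adj_spectrum cover"
  obtain F where F: "finite F" 
    and Fr: "\<And>t. t \<notin> F \<Longrightarrow> \<exists>\<rho>>0. \<forall>i\<in>dirs. \<exists>\<phi>. extends_locally (\<lambda>z. green z i) t \<rho> \<phi>"
    using exceptional_set by blast
  \<comment> \<open>The dichotomy at one point; at a point near a spectral value the first
    alternative is excluded and the bounds hold.\<close>
  define good where "good t \<rho> c B \<longleftrightarrow> 0 < \<rho> \<and> 0 < c \<and> ((\<forall>s. \<bar>s - t\<bar> < \<rho> \<longrightarrow> s \<notin> ?sp) \<or>
    (\<forall>z\<in>ball (complex_of_real t) \<rho>. z \<in> uhp \<longrightarrow> c \<le> - Im (trace z) \<and> cmod (trace z) \<le> B))" for t \<rho> c B
  have good: "\<exists>\<rho> c B. good t \<rho> c B" if tF: "t \<notin> F" for t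
  proof -
    obtain \<rho> where \<rho>: "0 < \<rho>" "\<forall>i\<in>dirs. \<exists>\<phi>. extends_locally (\<lambda>z. green z i) t \<rho> \<phi>" using Fr[OF tF] by blast
    from spectral_dichotomy[OF \<rho>] show ?thesis
    proof
      assume "\<forall>s. \<bar>s - t\<bar> < \<rho> \<longrightarrow> s \<notin> ?sp"
      then have "good t \<rho> 1 0" using \<rho>(1) by (simp add: good_def)
      then show ?thesis by blast
    next
      assume "\<exists>c>0. \<exists>B. \<forall>z\<in>ball (complex_of_real t) \<rho>. z \<in> uhp \<longrightarrow> c \<le> - Im (trace z) \<and> cmod (trace z) \<le> B"
      then obtain c B where "0 < c" 
        "\<forall>z\<in>ball (complex_of_real t) \<rho>. z \<in> uhp \<longrightarrow> c \<le> - Im (trace z) \<and> cmod (trace z) \<le> B" by blast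
      then have "good t \<rho> c B" using \<rho>(1) by (simp add: good_def)
      then show ?thesis by blast
    qed
  qed
  have far: "t \<in> F \<or> \<bar>t\<bar> \<le> D0" if t: "t \<in> ?sp" for t
  proof (rule ccontr)
    assume n: "\<not> (t \<in> F \<or> \<bar>t\<bar> \<le> D0)"
    then obtain \<rho> c B where g: "good t \<rho> c B" using good by blast
    have rc: "0 < \<rho>" "0 < c" using g by (auto simp: good_def)
    have "\<not> (\<forall>s. \<bar>s - t\<bar> < \<rho> \<longrightarrow> s \<notin> ?sp)" using t rc by (metis abs_zero diff_self)
    then have b: "c \<le> - Im (trace z)" if "z \<in> ball (complex_of_real t) \<rho>" "z \<in> uhp" for z
      using g that unfolding good_def by blast
    define e where "e = \<bar>t\<bar> - D0"
    have e: "0 < e" using n by (simp add: e_def)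
    \<comment> \<open>Small enough to stay in the ball around t and to make y / e^2 smaller than the
      lower bound \<open>c\<close>.\<close>
    define y where "y = min (\<rho> / 2) (c * e\<^sup>2 / 2)"
    have y: "0 < y" "y < \<rho>" "y < c * e\<^sup>2" using rc e by (auto simp: y_def min_less_iff_disj)
    have zb: "Complex t y \<in> ball (complex_of_real t) \<rho>" "Complex t y \<in> uhp" using y by (simp_all add: dist_norm cmod_def)
    have ge: "\<bar>t\<bar> \<le> cmod (Complex t y)" using abs_Re_le_cmod[of "Complex t y"] by simp
    have "c \<le> - Im (trace (Complex t y))" by (rule b[OF zb])
    also have "\<dots> \<le> y / (cmod (Complex t y) - D0)\<^sup>2"
      using trace_far[OF zb(2) _ cover_onto] ge e by (simp add: e_def)
    also have "\<dots> \<le> y / e\<^sup>2"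
      using ge e y by (intro divide_left_mono power_mono mult_pos_pos) (auto simp: e_def)
    finally show False using y(3) e by (simp add: field_simps)
  qed
  have law: "\<exists>c>0. \<exists>B>0. \<exists>\<delta>>0. \<forall>t\<in>?sp - (\<Union>x\<in>F. ball x c1). \<forall>y. 0 < y \<and> y < \<delta> \<longrightarrow>
       c \<le> - Im (trace (Complex t y)) \<and> cmod (trace (Complex t y)) \<le> B" if c1: "0 < c1" for c1
  proof -
    define K where "K = {- D0..D0} - (\<Union>x\<in>F. ball x c1)"
    have "compact K" unfolding K_def by (intro compact_diff compact_Icc open_UN ballI open_ball)
    have KF: "t \<notin> F" if "t \<in> K" for t using that c1 by (auto simp: K_def)
    have "\<exists>\<rho> c B. good t \<rho> c B" if "t \<in> K" for t by (rule good[OF KF[OF that]])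
    then have "\<exists>R. \<forall>t\<in>K. \<exists>c B. good t (R t) c B" by (intro bchoice) blast
    then obtain R where R: "\<And>t. t \<in> K \<Longrightarrow> \<exists>c B. good t (R t) c B" by blast
    then have "\<exists>C. \<forall>t\<in>K. \<exists>B. good t (R t) (C t) B" by (intro bchoice) blast
    then obtain C where C: "\<And>t. t \<in> K \<Longrightarrow> \<exists>B. good t (R t) (C t) B" by blast
    then have "\<exists>B. \<forall>t\<in>K. good t (R t) (C t) (B t)" by (intro bchoice) blast
    then obtain B where B: "\<And>t. t \<in> K \<Longrightarrow> good t (R t) (C t) (B t)" by blast
    have pos: "0 < R t" "0 < C t" if "t \<in> K" for t using B[OF that] by (auto simp: good_def)
    \<comment> \<open>Half radii in the cover leave the other half for the height: with
      \<open>y < \<delta>\<close> the point \<open>Complex t y\<close> still lies in the full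
      ball.\<close>
    have "K \<subseteq> (\<Union>t\<in>K. ball t (R t / 2))"
    proof
      fix t assume "t \<in> K"
      then show "t \<in> (\<Union>t\<in>K. ball t (R t / 2))" using pos by (intro UN_I[of t]) auto
    qed
    then obtain D where D: "D \<subseteq> K" "finite D" "K \<subseteq> (\<Union>t\<in>D. ball t (R t / 2))"
      using compactE_image[OF \<open>compact K\<close>, of K "\<lambda>t. ball t (R t / 2)"] by blast
    define c where "c = Min (insert 1 (C ` D))"
    define b where "b = Max (insert 1 (B ` D))"
    define \<delta> where "\<delta> = Min (insert 1 ((\<lambda>t. R t / 2) ` D))"
    have "0 < c" unfolding c_def using D pos by (subst Min_gr_iff) auto
    moreover have "1 \<le> b" unfolding b_def using D(2) by (intro Max_ge) auto
    then have "0 < b" by simp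
    moreover have "0 < \<delta>" unfolding \<delta>_def using D pos by (subst Min_gr_iff) auto
    moreover have "c \<le> - Im (trace (Complex t y)) \<and> cmod (trace (Complex t y)) \<le> b"
      if t: "t \<in> ?sp - (\<Union>x\<in>F. ball x c1)" and y: "0 < y" "y < \<delta>" for t y
    proof -
      have "t \<notin> F" using t c1 by auto
      then have "t \<in> K" using t far[of t] by (auto simp: K_def)
      then obtain s where s: "s \<in> D" "dist s t < R s / 2" using D(3) by auto
      then have sK: "s \<in> K" using D by blast
      have "\<not> (\<forall>u. \<bar>u - s\<bar> < R s \<longrightarrow> u \<notin> ?sp)"
      proof
        assume "\<forall>u. \<bar>u - s\<bar> < R s \<longrightarrow> u \<notin> ?sp"
        moreover have "\<bar>t - s\<bar> < R s" using s(2) pos(1)[OF sK] by (simp add: dist_real_def abs_minus_commute)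
        ultimately show False using t by blast
      qed
      then have b': "\<forall>z\<in>ball (complex_of_real s) (R s). z \<in> uhp \<longrightarrow> C s \<le> - Im (trace z) \<and> cmod (trace z) \<le> B s"
        using B[OF sK] unfolding good_def by blast
      have "\<delta> \<le> R s / 2" unfolding \<delta>_def using s D(2) by (intro Min_le) auto
      then have "cmod (of_real s - Complex t y) < R s"
        using cmod_le[of "of_real s - Complex t y"] s(2) y by (simp add: dist_real_def)
      then have "C s \<le> - Im (trace (Complex t y)) \<and> cmod (trace (Complex t y)) \<le> B s"
        using b' y by (simp add: dist_norm)
      moreover have "c \<le> C s" unfolding c_def using s D(2) by (intro Min_le) auto
      moreover have "B s \<le> b" unfolding b_def using s D(2) by (intro Max_ge) auto
      ultimately show ?thesis by linarith
    qed
    ultimately show ?thesis by blast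
  qed
  show ?thesis using F far law by blast
qed

end

section \<open>Finite orthonormal systems and the spectral theorem for symmetric matrices\<close>

definition dot :: "'v set \<Rightarrow> ('v \<Rightarrow> real) \<Rightarrow> ('v \<Rightarrow> real) \<Rightarrow> real" where
  "dot X f g = (\<Sum>x\<in>X. f x * g x)"

definition orthonormal_on :: "'v set \<Rightarrow> 'j set \<Rightarrow> ('j \<Rightarrow> 'v \<Rightarrow> real) \<Rightarrow> bool" where
  "orthonormal_on X J e \<longleftrightarrow> finite J \<and> (\<forall>i\<in>J. \<forall>j\<in>J. dot X (e i) (e j) = of_bool (i = j))"

lemma dot_commute: "dot X f g = dot X g f" by (simp add: dot_def mult.commute)

lemma dot_self_nonneg: "0 \<le> dot X f f" by (simp add: dot_def sum_nonneg)

lemma dot_cong: "(\<And>x. x \<in> X \<Longrightarrow> f x = f' x) \<Longrightarrow> (\<And>x. x \<in> X \<Longrightarrow> g x = g' x) \<Longrightarrow> dot X f g = dot X f' g'"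
  by (simp add: dot_def)

lemma dot_combination:
  "dot X (\<lambda>y. f y - (\<Sum>j\<in>J. c j * e j y)) g = dot X f g - (\<Sum>j\<in>J. c j * dot X (e j) g)"
proof -
  have "(\<Sum>x\<in>X. (\<Sum>j\<in>J. c j * e j x) * g x) = (\<Sum>j\<in>J. c j * (\<Sum>x\<in>X. e j x * g x))"
    unfolding sum_distrib_right sum_distrib_left mult.assoc by (rule sum.swap)
  then show ?thesis by (simp add: dot_def left_diff_distrib sum_subtractf)
qed

lemma dot_linear:
  "dot X (\<lambda>y. f y + t * g y) h = dot X f h + t * dot X g h"
  "dot X h (\<lambda>y. f y + t * g y) = dot X h f + t * dot X h g"
  by (simp_all add: dot_def algebra_simps sum.distrib sum_distrib_left)

lemma dot_sum_left: "dot X (\<lambda>y. \<Sum>j\<in>J. c j * e j y) g = (\<Sum>j\<in>J. c j * dot X (e j) g)"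
  using dot_combination[where f = "\<lambda>_. 0" and X = X and J = J and c = c and e = e and g = g] 
  by (simp add: dot_def sum_negf)

lemma residual:
  fixes f :: "'v \<Rightarrow> real"
  assumes e: "orthonormal_on X J e"
  defines "h \<equiv> \<lambda>y. f y - (\<Sum>j\<in>J. dot X f (e j) * e j y)"
  shows "i \<in> J \<Longrightarrow> dot X h (e i) = 0" "dot X h h = dot X f f - (\<Sum>j\<in>J. (dot X f (e j))\<^sup>2)"
proof -
  have J: "finite J" using e by (simp add: orthonormal_on_def)
  show 1: "dot X h (e i) = 0" if i: "i \<in> J" for i
  proof -
    have "dot X h (e i) = dot X f (e i) - (\<Sum>j\<in>J. dot X f (e j) * dot X (e j) (e i))"
      unfolding h_def by (rule dot_combination)
    also have "(\<Sum>j\<in>J. dot X f (e j) * dot X (e j) (e i)) = (\<Sum>j\<in>J. if j = i then dot X f (e j) else 0)"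
      by (rule sum.cong) (use e i in \<open>auto simp: orthonormal_on_def\<close>)
    also have "\<dots> = dot X f (e i)" using J i by simp
    finally show ?thesis by simp
  qed
  have "dot X h h = dot X f h - (\<Sum>j\<in>J. dot X f (e j) * dot X (e j) h)"
    by (subst (1) h_def) (rule dot_combination)
  also have "(\<Sum>j\<in>J. dot X f (e j) * dot X (e j) h) = 0"
    by (intro sum.neutral ballI) (simp add: dot_commute[of X _ h] 1)
  also have "dot X f h = dot X f f - (\<Sum>j\<in>J. dot X f (e j) * dot X (e j) f)"
    by (subst dot_commute, subst h_def, rule dot_combination)
  also have "(\<Sum>j\<in>J. dot X f (e j) * dot X (e j) f) = (\<Sum>j\<in>J. (dot X f (e j))\<^sup>2)"
    unfolding power2_eq_square by (rule sum.cong) (auto intro: dot_commute)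
  finally show "dot X h h = dot X f f - (\<Sum>j\<in>J. (dot X f (e j))\<^sup>2)" by simp
qed

lemma bessel: "orthonormal_on X J e \<Longrightarrow> (\<Sum>j\<in>J. (dot X f (e j))\<^sup>2) \<le> dot X f f"
  using residual(2)[of X J e f] 
    dot_self_nonneg[of X "\<lambda>y. f y - (\<Sum>j\<in>J. dot X f (e j) * e j y)"] by simp

lemma dot_indicator: "finite X \<Longrightarrow> x \<in> X \<Longrightarrow> dot X (\<lambda>y. of_bool (y = x)) g = g x"
  by (simp add: dot_def of_bool_def if_distrib[of "\<lambda>c. c * _"] cong: if_cong)

lemma bessel_point: "finite X \<Longrightarrow> x \<in> X \<Longrightarrow> orthonormal_on X J e \<Longrightarrow> (\<Sum>j\<in>J. (e j x)\<^sup>2) \<le> 1"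
  using bessel[of X J e "\<lambda>y. of_bool (y = x)"] by (simp add: dot_indicator)

lemma orthonormal_square_sum: 
  assumes "orthonormal_on X J e" shows "(\<Sum>x\<in>X. \<Sum>j\<in>J. (e j x)\<^sup>2) = card J"
proof -
  have "(\<Sum>x\<in>X. \<Sum>j\<in>J. (e j x)\<^sup>2) = (\<Sum>j\<in>J. dot X (e j) (e j))"
    by (subst sum.swap) (simp add: dot_def power2_eq_square)
  also have "\<dots> = (\<Sum>j\<in>J. 1)" using assms by (intro sum.cong) (auto simp: orthonormal_on_def)
  finally show ?thesis by simp
qed

text \<open>Rayleigh's principle on the orthogonal complement of the eigenvectors found so far.\<close>

lemma next_eigenvector:
  fixes a :: "'v \<Rightarrow> 'v \<Rightarrow> real" and e :: "nat \<Rightarrow> 'v \<Rightarrow> real" and X :: "'v set"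
  defines "L \<equiv> \<lambda>f x. \<Sum>y\<in>X. a x y * f y"
  assumes X: "finite X" and a_sym: "\<And>x y. x \<in> X \<Longrightarrow> y \<in> X \<Longrightarrow> a x y = a y x"
    and e: "orthonormal_on X {..<k} e" and eig: "\<And>j x. j < k \<Longrightarrow> x \<in> X \<Longrightarrow> L (e j) x = l j * e j x" and k: "k < card X"
  shows "\<exists>f \<mu>. dot X f f = 1 \<and> (\<forall>j<k. dot X f (e j) = 0) \<and> (\<forall>x\<in>X. L f x = \<mu> * f x)"
proof -
  define q where "q f = dot X (L f) f" for f
  have Lsym: "dot X (L f) g = dot X f (L g)" for f g
  proof -
    have "dot X (L f) g = (\<Sum>x\<in>X. \<Sum>y\<in>X. a x y * f y * g x)" by (simp add: dot_def L_def sum_distrib_right)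
    also have "\<dots> = (\<Sum>y\<in>X. \<Sum>x\<in>X. a x y * f y * g x)" by (rule sum.swap)
    also have "\<dots> = (\<Sum>y\<in>X. \<Sum>x\<in>X. f y * (a y x * g x))" by (intro sum.cong refl) (simp add: a_sym)
    finally show ?thesis by (simp add: dot_def L_def sum_distrib_left)
  qed
  have Llin: "L (\<lambda>y. f y + t * g y) = (\<lambda>x. L f x + t * L g x)" for f g t
    by (simp add: L_def fun_eq_iff algebra_simps sum.distrib sum_distrib_left)
  define S where "S = {f. (\<forall>x. x \<notin> X \<longrightarrow> f x = 0) \<and> dot X f f = 1 \<and> (\<forall>j<k. dot X f (e j) = 0)}"
  have scale: "\<exists>s>0. (\<lambda>y. if y \<in> X then s * h y else 0) \<in> S \<and> s\<^sup>2 * dot X h h = 1" 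
    if h: "\<And>j. j < k \<Longrightarrow> dot X h (e j) = 0" "0 < dot X h h" for h
  proof -
    define s where "s = 1 / sqrt (dot X h h)"
    have s: "0 < s" "s\<^sup>2 * dot X h h = 1" using h(2) by (simp_all add: s_def power_divide)
    have "dot X (\<lambda>y. if y \<in> X then s * h y else 0) g = s * dot X h g" for g
      by (simp add: dot_def sum_distrib_left mult.assoc)
    moreover have "dot X (\<lambda>y. if y \<in> X then s * h y else 0) (\<lambda>y. if y \<in> X then s * h y else 0) = s\<^sup>2 * dot X h h"
      by (simp add: dot_def sum_distrib_left power2_eq_square algebra_simps)
    ultimately show ?thesis using s h(1) by (intro exI[of _ s]) (simp add: S_def)
  qed
  have "S \<noteq> {}"
  proof -
    \<comment> \<open>The squares of the \<open>k\<close> vectors add up to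
      \<open>k < card X\<close> over all points, so some coordinate vector is not in their span and
      has a nonzero residual.\<close>
    have "\<exists>x\<in>X. (\<Sum>j<k. (e j x)\<^sup>2) < 1"
    proof (rule ccontr)
      assume "\<not> (\<exists>x\<in>X. (\<Sum>j<k. (e j x)\<^sup>2) < 1)"
      then have "(\<Sum>x\<in>X. 1) \<le> (\<Sum>x\<in>X. \<Sum>j<k. (e j x)\<^sup>2)" by (intro sum_mono) auto
      then show False using orthonormal_square_sum[OF e] k by simp
    qed
    then obtain x where x: "x \<in> X" "(\<Sum>j<k. (e j x)\<^sup>2) < 1" by blast
    let ?h = "\<lambda>y. of_bool (y = x) - (\<Sum>j<k. dot X (\<lambda>y. of_bool (y = x)) (e j) * e j y)"
    have "0 < dot X ?h ?h"
      using residual(2)[OF e, of "\<lambda>y. of_bool (y = x)"] x X by (simp add: dot_indicator)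
    then show ?thesis using scale[of ?h] residual(1)[OF e, of _ "\<lambda>y. of_bool (y = x)"] by blast
  qed
  have "compact S"
  proof -
    \<comment> \<open>Unit vectors supported in \<open>X\<close> lie in a product of compact
      intervals, constant 0 outside \<open>X\<close>; this makes the constraint set compact in the
      function topology.\<close>
    let ?P = "PiE UNIV (\<lambda>x. if x \<in> X then {- 1..1::real} else {0})"
    have "compactin (product_topology (\<lambda>_. euclidean) UNIV) ?P"
      unfolding compactin_PiE by auto
    then have "compact ?P" by (simp add: euclidean_product_topology)
    moreover have "closed S"
      unfolding S_def Collect_conj_eq dot_def
      by (intro closed_Int closed_Collect_all closed_Collect_imp closed_Collect_eq continuous_intros open_Collect_const)
        (auto intro!: continuous_on_sum continuous_on_mult)
    moreover have "S \<subseteq> ?P"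
    proof
      fix f assume f: "f \<in> S"
      have "\<bar>f x\<bar> \<le> 1" if "x \<in> X" for x
      proof -
        have "(f x)\<^sup>2 \<le> dot X f f" unfolding dot_def power2_eq_square
          using X that by (intro member_le_sum) auto
        then show ?thesis using f by (simp add: S_def abs_square_le_1)
      qed
      then show "f \<in> ?P" using f by (auto simp: S_def abs_le_iff)
    qed
    ultimately show ?thesis using compact_Int_closed[of ?P S] by (simp add: Int_absorb1)
  qed
  moreover have "continuous_on S q"
    unfolding q_def[abs_def] dot_def L_def
    by (rule continuous_on_subset[OF _ subset_UNIV]) (intro continuous_on_sum continuous_on_mult continuous_on_const continuous_on_product_coordinates)
  ultimately obtain f where f: "f \<in> S" "\<And>g. g \<in> S \<Longrightarrow> q g \<le> q f"
    using continuous_attains_sup[of S q] \<open>S \<noteq> {}\<close> by blast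
  define \<mu> where "\<mu> = q f"
  have qle: "q h \<le> \<mu> * dot X h h" if h: "\<And>j. j < k \<Longrightarrow> dot X h (e j) = 0" for h
  proof (cases "dot X h h = 0")
    case True
    then have "\<forall>x\<in>X. h x = 0" using X unfolding dot_def by (subst (asm) sum_nonneg_eq_0_iff) auto
    then have "q h = 0" by (simp add: q_def dot_def)
    then show ?thesis using True by simp
  next
    case False
    then have p: "0 < dot X h h" using dot_self_nonneg[of X h] by simp
    obtain s where s: "0 < s" "(\<lambda>y. if y \<in> X then s * h y else 0) \<in> S" "s\<^sup>2 * dot X h h = 1" 
      using scale[OF h p] by blast
    have "q (\<lambda>y. if y \<in> X then s * h y else 0) = s\<^sup>2 * q h"
    proof -
      have "L (\<lambda>y. if y \<in> X then s * h y else 0) = (\<lambda>x. s * L h x)"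
        by (simp add: L_def fun_eq_iff sum_distrib_left mult_ac)
      then show ?thesis by (simp add: q_def dot_def sum_distrib_left power2_eq_square mult_ac)
    qed
    then have "s\<^sup>2 * q h \<le> \<mu> * (s\<^sup>2 * dot X h h)" using f(2)[OF s(2)] s(3) by (simp add: \<mu>_def)
    then have "s\<^sup>2 * q h \<le> s\<^sup>2 * (\<mu> * dot X h h)" by (simp add: mult_ac)
    then show ?thesis using s(1) by (simp only: mult_le_cancel_left_pos zero_less_power)
  qed
  define h where "h y = L f y + (- \<mu>) * f y" for y
  have fe: "dot X f (e j) = 0" if "j < k" for j using f(1) that by (simp add: S_def)
  have Lfe: "dot X (L f) (e j) = 0" if "j < k" for j
  proof -
    have "dot X f (L (e j)) = l j * dot X f (e j)"
      unfolding dot_def sum_distrib_left by (intro sum.cong refl) (simp add: eig[OF that])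
    then show ?thesis using fe[OF that] by (simp add: Lsym)
  qed
  have he: "dot X h (e j) = 0" if "j < k" for j
    unfolding h_def[abs_def] dot_linear by (simp add: fe Lfe that)
  define A where "A = dot X h h"
  define B where "B = \<mu> * dot X h h - q h"
  \<comment> \<open>The Rayleigh quotient at \<open>f + t * h\<close>, with \<open>h\<close> the
    defect of the eigenvalue equation: the first-order gain \<open>2 * t * A\<close> cannot exceed a
    quadratic term for any t, which forces \<open>A = 0\<close>.\<close>
  have main: "2 * t * A \<le> t\<^sup>2 * B" for t :: real
  proof -
    have ff: "dot X f f = 1" using f(1) by (simp add: S_def)
    have Af: "A = dot X (L f) h - \<mu> * dot X f h"
      unfolding A_def by (subst (1) h_def[abs_def], unfold dot_linear) simp
    have "q (\<lambda>y. f y + t * h y) = q f + 2 * t * dot X (L f) h + t\<^sup>2 * q h"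
    proof -
      have "dot X (L h) f = dot X (L f) h" using Lsym[of h f] by (simp add: dot_commute)
      then show ?thesis unfolding q_def Llin dot_linear by (simp add: algebra_simps power2_eq_square)
    qed
    moreover have "dot X (\<lambda>y. f y + t * h y) (\<lambda>y. f y + t * h y) = 1 + 2 * t * dot X f h + t\<^sup>2 * dot X h h"
      unfolding dot_linear using ff by (simp add: dot_commute[of X h f] algebra_simps power2_eq_square)
    moreover have "q (\<lambda>y. f y + t * h y) \<le> \<mu> * dot X (\<lambda>y. f y + t * h y) (\<lambda>y. f y + t * h y)"
      by (rule qle) (simp add: dot_linear fe he)
    ultimately show ?thesis unfolding B_def Af \<mu>_def[symmetric] by (simp add: algebra_simps)
  qed
  have "A = 0"
  proof (rule ccontr)
    assume "A \<noteq> 0"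
    then have A: "0 < A" using dot_self_nonneg[of X h] by (simp add: A_def)
    define t where "t = A / (1 + \<bar>B\<bar>)"
    have t: "0 < t" "t * (1 + \<bar>B\<bar>) = A" using A by (simp_all add: t_def)
    have "2 * t * A \<le> t * (t * \<bar>B\<bar>)" using main[of t] mult_left_mono[of B "\<bar>B\<bar>" "t\<^sup>2", OF abs_ge_self zero_le_power2]
      unfolding power2_eq_square mult.assoc by linarith
    also have "\<dots> \<le> t * A" using t by (intro mult_left_mono) (auto simp: algebra_simps)
    finally show False using t(1) A by simp
  qed
  then have "\<forall>x\<in>X. h x = 0" using X unfolding A_def dot_def by (subst (asm) sum_nonneg_eq_0_iff) auto
  then have "\<forall>x\<in>X. L f x = \<mu> * f x" by (simp add: h_def)
  moreover have "dot X f f = 1" using f(1) by (simp add: S_def)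
  ultimately show ?thesis using fe by blast
qed

text \<open>The induction runs until there are \<open>card X\<close> vectors. Completeness then
  follows by counting: the pointwise sums of squares are at most 1 and add up to
  \<open>card X\<close>.\<close>

lemma symmetric_spectral_theorem:
  fixes a :: "'v \<Rightarrow> 'v \<Rightarrow> real"
  assumes X: "finite X" and a_sym: "\<And>x y. x \<in> X \<Longrightarrow> y \<in> X \<Longrightarrow> a x y = a y x"
  shows "\<exists>e l. orthonormal_on X {..<card X} e \<and> 
      (\<forall>j<card X. \<forall>x\<in>X. (\<Sum>y\<in>X. a x y * e j y) = l j * e j x) \<and>
      (\<forall>x\<in>X. \<forall>y\<in>X. (\<Sum>j<card X. e j x * e j y) = of_bool (x = y))"
proof -
  have "\<exists>e l. orthonormal_on X {..<k} e \<and> (\<forall>j<k. \<forall>x\<in>X. (\<Sum>y\<in>X. a x y * e j y) = l j * e j x)"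
    if "k \<le> card X" for k
    using that
  proof (induction k)
    case 0
    show ?case by (simp add: orthonormal_on_def)
  next
    case (Suc k)
    then obtain e l where e: "orthonormal_on X {..<k} e" 
      and l: "\<And>j x. j < k \<Longrightarrow> x \<in> X \<Longrightarrow> (\<Sum>y\<in>X. a x y * e j y) = l j * e j x" by force
    have kX: "k < card X" using Suc.prems by simp
    obtain f \<mu> where f: "dot X f f = 1" "\<And>j. j < k \<Longrightarrow> dot X f (e j) = 0" 
      "\<And>x. x \<in> X \<Longrightarrow> (\<Sum>y\<in>X. a x y * f y) = \<mu> * f x"
      using next_eigenvector[OF X a_sym e l kX] by blast
    have f': "dot X (e j) f = 0" if "j < k" for j using f(2)[OF that] by (subst dot_commute)
    have "orthonormal_on X {..<Suc k} (e(k := f))"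
      using e f(1,2) f' unfolding orthonormal_on_def by (auto simp: less_Suc_eq)
    moreover have "(\<Sum>y\<in>X. a x y * (e(k := f)) j y) = (l(k := \<mu>)) j * (e(k := f)) j x" if "j < Suc k" "x \<in> X" for j x
      using that l f by (cases "j = k") auto
    ultimately show ?case by blast
  qed
  from this[OF order_refl] obtain e l where e: "orthonormal_on X {..<card X} e" 
    and l: "\<forall>j<card X. \<forall>x\<in>X. (\<Sum>y\<in>X. a x y * e j y) = l j * e j x" by blast
  \<comment> \<open>Equality in Bessel's inequality at every point; the residual of each coordinate
    vector therefore vanishes.\<close>
  have one: "(\<Sum>j<card X. (e j x)\<^sup>2) = 1" if x: "x \<in> X" for x
  proof (rule ccontr)
    assume "(\<Sum>j<card X. (e j x)\<^sup>2) \<noteq> 1"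
    then have "(\<Sum>j<card X. (e j x)\<^sup>2) < 1" using bessel_point[OF X x e] by simp
    then have "(\<Sum>x\<in>X. \<Sum>j<card X. (e j x)\<^sup>2) < (\<Sum>x\<in>X. 1)"
      using X x bessel_point[OF X _ e] by (intro sum_strict_mono_ex1) auto
    then show False using orthonormal_square_sum[OF e] by simp
  qed
  have "(\<Sum>j<card X. e j x * e j y) = of_bool (x = y)" if x: "x \<in> X" and y: "y \<in> X" for x y
  proof -
    let ?h = "\<lambda>z. of_bool (z = x) - (\<Sum>j<card X. e j x * e j z)"
    have d: "dot X (\<lambda>y. of_bool (y = x)) g = g x" for g by (rule dot_indicator[OF X x])
    have "dot X ?h ?h = 0" using residual(2)[OF e, of "\<lambda>y. of_bool (y = x)"] one[OF x] unfolding d by simp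
    then have "?h y = 0" using X y unfolding dot_def by (subst (asm) sum_nonneg_eq_0_iff) auto
    then show ?thesis unfolding eq_commute[of x y] by simp
  qed
  then show ?thesis using e l by blast
qed

text \<open>\<open>uniform_sphere\<close> uses a basis picked by choice; this bounds its length
  below by the number of orthonormal vectors known to lie in the space. Parseval for the basis and
  Bessel for the system give the comparison.\<close>

lemma orthonormal_basis_card_ge:
  assumes X: "finite X" and J: "orthonormal_on X J e" "\<And>j. j \<in> J \<Longrightarrow> e j \<in> E" and b: "is_orthonormal_basis X E N b"
  shows "card J \<le> N"
proof -
  have bo: "orthonormal_on X {..<N} b" using b by (simp add: is_orthonormal_basis_def orthonormal_on_def dot_def)
  have parseval: "dot X f f = (\<Sum>i<N. (dot X f (b i))\<^sup>2)" if fE: "f \<in> E" for f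
  proof -
    obtain a where a: "f = (\<lambda>x\<in>X. \<Sum>i<N. a i * b i x)" using b fE unfolding is_orthonormal_basis_def by blast
    have fx: "f x = (\<Sum>i<N. a i * b i x)" if "x \<in> X" for x using that by (simp add: a)
    have "dot X f (b i) = a i" if i: "i < N" for i
    proof -
      have "dot X f (b i) = dot X (\<lambda>x. \<Sum>i<N. a i * b i x) (b i)" by (rule dot_cong) (simp_all add: fx)
      also have "\<dots> = (\<Sum>j<N. a j * dot X (b j) (b i))" by (rule dot_sum_left)
      also have "\<dots> = (\<Sum>j<N. if j = i then a j else 0)" 
        by (rule sum.cong) (use bo i in \<open>auto simp: orthonormal_on_def\<close>)
      finally show ?thesis using i by simp
    qed
    then have "dot X (\<lambda>y. f y - (\<Sum>j<N. dot X f (b j) * b j y)) (\<lambda>y. f y - (\<Sum>j<N. dot X f (b j) * b j y)) = 0"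
      by (simp add: dot_def fx)
    then show ?thesis using residual(2)[OF bo, of f] by simp
  qed
  have "real (card J) = (\<Sum>j\<in>J. dot X (e j) (e j))" using J(1) by (simp add: orthonormal_on_def)
  also have "\<dots> = (\<Sum>j\<in>J. \<Sum>i<N. (dot X (b i) (e j))\<^sup>2)" 
    by (rule sum.cong) (use J(2) in \<open>simp_all add: parseval dot_commute\<close>)
  also have "\<dots> = (\<Sum>i<N. \<Sum>j\<in>J. (dot X (b i) (e j))\<^sup>2)" by (rule sum.swap)
  also have "\<dots> \<le> (\<Sum>i<N. dot X (b i) (b i))" by (intro sum_mono bessel[OF J(1)])
  also have "\<dots> = N" using bo by (simp add: orthonormal_on_def)
  finally show ?thesis by simp
qed

section \<open>Measure of spherical caps and sup norms of random vectors\<close>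

abbreviation leb :: "nat \<Rightarrow> (nat \<Rightarrow> real) measure" where
  "leb N \<equiv> PiM {..<N} (\<lambda>_. lborel)"

lemma space_leb: "space (leb N) = {..<N} \<rightarrow>\<^sub>E UNIV"
  by (simp add: space_PiM)

lemma leb_translate: "distr (leb N) (leb N) (\<lambda>z. \<lambda>i\<in>{..<N}. c i + z i) = leb N"
proof -
  interpret product_sigma_finite "\<lambda>_::nat. lborel :: real measure" ..
  have meas: "(\<lambda>z. \<lambda>i\<in>{..<N}. c i + z i) \<in> measurable (leb N) (leb N)"
    by (intro measurable_restrict) (simp add: measurable_lborel1)
  show ?thesis
  proof (rule PiM_eqI)
    fix A :: "nat \<Rightarrow> real set" assume A: "\<And>i. i \<in> {..<N} \<Longrightarrow> A i \<in> sets lborel"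
    have eq: "(\<lambda>z. \<lambda>i\<in>{..<N}. c i + z i) -` PiE {..<N} A \<inter> space (leb N) = PiE {..<N} (\<lambda>i. (+) (c i) -` A i)"
      by (auto simp: space_leb PiE_def Pi_def)
    have m: "(+) (c i) -` A i \<in> sets lborel" if "i \<in> {..<N}" for i
      using measurable_sets[of "(+) (c i)" lborel lborel "A i"] A[OF that] by simp
    have "emeasure lborel ((+) (c i) -` A i) = emeasure lborel (A i)" if "i \<in> {..<N}" for i
    proof -
      have "emeasure lborel (A i) = emeasure (distr lborel borel ((+) (c i))) (A i)" by (simp add: lborel_distr_plus)
      also have "\<dots> = emeasure lborel ((+) (c i) -` A i)" using A[OF that] by (subst emeasure_distr) auto
      finally show ?thesis by simp
    qed
    then have "(\<Prod>i<N. emeasure lborel ((+) (c i) -` A i)) = (\<Prod>i<N. emeasure lborel (A i))" by simp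
    moreover have "emeasure (leb N) (PiE {..<N} (\<lambda>i. (+) (c i) -` A i)) = (\<Prod>i<N. emeasure lborel ((+) (c i) -` A i))"
      by (rule emeasure_PiM) (use m in auto)
    moreover have "PiE {..<N} A \<in> sets (leb N)" using A by (intro sets_PiM_I_finite) auto
    ultimately show "emeasure (distr (leb N) (leb N) (\<lambda>z. \<lambda>i\<in>{..<N}. c i + z i)) (PiE {..<N} A) 
        = (\<Prod>i<N. emeasure lborel (A i))"
      using emeasure_distr[OF meas, of "PiE {..<N} A"] by (simp add: eq)
  qed auto
qed

definition leb_ball :: "nat \<Rightarrow> (nat \<Rightarrow> real) \<Rightarrow> real \<Rightarrow> (nat \<Rightarrow> real) set" where
  "leb_ball N c \<rho> = {z \<in> space (leb N). L2_set (\<lambda>i. z i - c i) {..<N} \<le> \<rho>}"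

lemma sets_leb_ball: "leb_ball N c \<rho> \<in> sets (leb N)"
  unfolding leb_ball_def L2_set_def by measurable

lemma emeasure_leb_ball:
  assumes "0 < \<rho>" shows "emeasure (leb N) (leb_ball N c \<rho>) = ennreal (unit_ball_vol (real N) * \<rho> ^ N)"
proof -
  have meas: "(\<lambda>z. \<lambda>i\<in>{..<N}. c i + z i) \<in> measurable (leb N) (leb N)"
    by (intro measurable_restrict) (simp add: measurable_lborel1)
  have "emeasure (leb N) (leb_ball N c \<rho>) = emeasure (distr (leb N) (leb N) (\<lambda>z. \<lambda>i\<in>{..<N}. c i + z i)) (leb_ball N c \<rho>)"
    by (simp add: leb_translate)
  also have "\<dots> = emeasure (leb N) ((\<lambda>z. \<lambda>i\<in>{..<N}. c i + z i) -` leb_ball N c \<rho> \<inter> space (leb N))"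
    by (rule emeasure_distr[OF meas sets_leb_ball])
  also have "(\<lambda>z. \<lambda>i\<in>{..<N}. c i + z i) -` leb_ball N c \<rho> \<inter> space (leb N) 
      = {f. sqrt (\<Sum>i<N. (f i)\<^sup>2) \<le> \<rho>} \<inter> space (leb N)"
    by (auto simp: leb_ball_def space_leb L2_set_def)
  also have "emeasure (leb N) \<dots> = ennreal (unit_ball_vol (real N) * \<rho> ^ N)"
    using emeasure_cball_aux[of "{..<N}" \<rho>] assms by simp
  finally show ?thesis .
qed

text \<open>The cap cut out of the unit ball by a cone lies in a smaller ball (Ball's argument).\<close>

lemma cone_in_ball:
  assumes t: "0 \<le> t" "t\<^sup>2 \<le> 1 / 2" and \<beta>: "(\<Sum>i<N. (\<beta> i)\<^sup>2) \<le> 1"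
    and z: "L2_set z {..<N} \<le> 1" "t * L2_set z {..<N} \<le> (\<Sum>i<N. z i * \<beta> i)"
  shows "L2_set (\<lambda>i. z i - t * \<beta> i) {..<N} \<le> sqrt (1 - t\<^sup>2)"
proof -
  define s where "s = L2_set z {..<N}"
  have s: "0 \<le> s" "s \<le> 1" "s\<^sup>2 = (\<Sum>i<N. (z i)\<^sup>2)" using z(1) by (simp_all add: s_def L2_set_nonneg, simp add: L2_set_def sum_nonneg)
  have "(\<Sum>i<N. (z i - t * \<beta> i)\<^sup>2) = (\<Sum>i<N. (z i)\<^sup>2) - 2 * t * (\<Sum>i<N. z i * \<beta> i) + t\<^sup>2 * (\<Sum>i<N. (\<beta> i)\<^sup>2)"
    by (simp add: power2_diff sum.distrib sum_subtractf sum_distrib_left power_mult_distrib algebra_simps)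
  also have "\<dots> \<le> s\<^sup>2 - 2 * t * (t * s) + t\<^sup>2 * 1"
    using z(2) \<beta> t(1) unfolding s(3)[symmetric] s_def[symmetric] 
    by (intro add_mono diff_mono mult_left_mono) auto
  \<comment> \<open>The factorisation uses \<open>s \<le> 1\<close> and the restriction of the
    square of \<open>t\<close> to at most 1/2.\<close>
  also have "\<dots> \<le> 1 - t\<^sup>2"
  proof -
    have "0 \<le> (1 - s) * (1 + s - 2 * t\<^sup>2)" using s t by (intro mult_nonneg_nonneg) auto
    then show ?thesis by (simp add: algebra_simps power2_eq_square)
  qed
  finally show ?thesis unfolding L2_set_def by (rule real_sqrt_le_mono)
qed

text \<open>The volume ratio of the smaller ball to the unit ball is (1 - t^2)^(N/2), at most exp
  (-t^2 N / 2).\<close>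

lemma cap_measure:
  fixes N :: nat
  defines "D \<equiv> {z \<in> {..<N} \<rightarrow>\<^sub>E UNIV. L2_set z {..<N} \<le> 1}"
  assumes t: "0 \<le> t" "t\<^sup>2 \<le> 1 / 2" and \<beta>: "(\<Sum>i<N. (\<beta> i)\<^sup>2) \<le> 1"
  shows "measure (uniform_measure (leb N) D) {z \<in> space (leb N). t * L2_set z {..<N} \<le> (\<Sum>i<N. z i * \<beta> i)} 
    \<le> exp (- (t\<^sup>2) * N / 2)" (is "measure _ ?A \<le> _")
proof -
  have D: "D = leb_ball N (\<lambda>_. 0) 1" by (simp add: D_def leb_ball_def space_leb)
  define V where "V = unit_ball_vol (real N)"
  have V: "0 < V" by (simp add: V_def)
  have eD: "emeasure (leb N) D = ennreal V" using emeasure_leb_ball[of 1 N] by (simp add: D V_def)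
  have sD: "D \<in> sets (leb N)" unfolding D by (rule sets_leb_ball)
  have sA: "?A \<in> sets (leb N)" unfolding L2_set_def by measurable
  let ?q = "sqrt (1 - t\<^sup>2)"
  have q: "0 < ?q" using t by simp
  have eB: "emeasure (leb N) (leb_ball N (\<lambda>i. t * \<beta> i) ?q) = ennreal (V * ?q ^ N)"
    using emeasure_leb_ball[OF q] by (simp add: V_def)
  have "D \<inter> ?A \<subseteq> leb_ball N (\<lambda>i. t * \<beta> i) ?q"
    using cone_in_ball[OF t \<beta>] by (auto simp: D_def leb_ball_def)
  then have "emeasure (leb N) (D \<inter> ?A) \<le> ennreal (V * ?q ^ N)"
    unfolding eB[symmetric] by (rule emeasure_mono[OF _ sets_leb_ball])
  then have "measure (leb N) (D \<inter> ?A) \<le> V * ?q ^ N"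
    unfolding measure_def using V q by (intro enn2real_leI) auto
  moreover have "measure (leb N) D = V" using eD V by (simp add: measure_def)
  moreover have "measure (uniform_measure (leb N) D) ?A = measure (leb N) (D \<inter> ?A) / measure (leb N) D"
    by (rule measure_uniform_measure) (use eD V sA in auto)
  ultimately have "measure (uniform_measure (leb N) D) ?A \<le> ?q ^ N" using V by (simp add: pos_divide_le_eq mult.commute)
  also have "?q \<le> exp (- (t\<^sup>2) / 2)"
  proof (rule real_le_lsqrt)
    show "1 - t\<^sup>2 \<le> (exp (- (t\<^sup>2) / 2))\<^sup>2"
      using exp_ge_add_one_self[of "- (t\<^sup>2)"] by (simp flip: exp_double)
  qed auto
  then have "?q ^ N \<le> exp (- (t\<^sup>2) / 2) ^ N" using q by (intro power_mono) auto
  also have "\<dots> = exp (- (t\<^sup>2) * N / 2)" by (simp flip: exp_of_nat_mult)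
  finally show ?thesis .
qed

text \<open>The value at x of a random vector is an inner product with the coordinates
  \<open>b i x\<close>, of norm at most 1 by Bessel, divided by the norm of z. A union bound over
  the points and the two signs reduces the claim to caps.\<close>

lemma sphere_tail:
  assumes X: "finite X" "X \<noteq> {}" and basis: "is_orthonormal_basis X E N0 b0" "0 < N0" and s: "0 \<le> s"
  shows "prob_space (uniform_sphere X E)"
    "measure (uniform_sphere X E) {u \<in> space (uniform_sphere X E). s \<le> sup_norm X u} 
      \<le> 2 * real (card X) * exp (- (s\<^sup>2 * N0 / 4))"
proof -
  obtain N b where Nb: "(SOME (N, b). is_orthonormal_basis X E N b) = (N, b)" by (cases "SOME (N, b). is_orthonormal_basis X E N b")
  have "case (N, b) of (N, b) \<Rightarrow> is_orthonormal_basis X E N b"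
    unfolding Nb[symmetric] by (rule someI[of _ "(N0, b0)"]) (use basis in simp)
  then have b: "is_orthonormal_basis X E N b" by simp
  have bo: "orthonormal_on X {..<N} b" using b by (simp add: is_orthonormal_basis_def orthonormal_on_def dot_def)
  have "card {..<N0} \<le> N"
    by (rule orthonormal_basis_card_ge[OF X(1) _ _ b, of _ b0])
      (use basis in \<open>auto simp: is_orthonormal_basis_def orthonormal_on_def dot_def\<close>)
  then have N: "N0 \<le> N" by simp
  define D where "D = {z \<in> {..<N} \<rightarrow>\<^sub>E UNIV. L2_set z {..<N} \<le> 1}"
  define P where "P = uniform_measure (leb N) D"
  define f where "f z = (\<lambda>x\<in>X. (\<Sum>i<N. z i * b i x) / L2_set z {..<N})" for z
  have U: "uniform_sphere X E = distr P (PiM X (\<lambda>_. borel)) f"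
    unfolding uniform_sphere_def Nb Let_def P_def D_def f_def by simp
  have sP: "sets P = sets (leb N)" "space P = space (leb N)" by (simp_all add: P_def)
  have D: "D = leb_ball N (\<lambda>_. 0) 1" by (simp add: D_def leb_ball_def space_leb)
  have "emeasure (leb N) D = ennreal (unit_ball_vol (real N))" using emeasure_leb_ball[of 1 N] by (simp add: D)
  then interpret P: prob_space P
    unfolding P_def using unit_ball_vol_pos[of "real N"] by (intro prob_space_uniform_measure) (auto simp del: unit_ball_vol_pos)
  have f: "f \<in> measurable P (PiM X (\<lambda>_. borel))"
    unfolding f_def L2_set_def measurable_cong_sets[OF sP(1) refl]
    by (intro measurable_restrict) measurable
  show "prob_space (uniform_sphere X E)" unfolding U by (rule P.prob_space_distr[OF f])
  define R where "R = {u \<in> space (PiM X (\<lambda>_. borel)). s \<le> sup_norm X u}"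
  have supn: "s \<le> sup_norm X u \<longleftrightarrow> (\<exists>x\<in>X. s \<le> \<bar>u x\<bar>)" for u
    unfolding sup_norm_def using X by (subst Max_ge_iff) auto
  have "R = (\<Union>x\<in>X. {u \<in> space (PiM X (\<lambda>_. borel)). s \<le> \<bar>u x\<bar>})" by (auto simp: R_def supn)
  moreover have "{u \<in> space (PiM X (\<lambda>_. borel)). s \<le> \<bar>u x\<bar>} \<in> sets (PiM X (\<lambda>_. borel))" if "x \<in> X" for x :: 'a
    using that by measurable
  ultimately have Rs: "R \<in> sets (PiM X (\<lambda>_. borel))" using X by auto
  have m: "measure (uniform_sphere X E) {u \<in> space (uniform_sphere X E). s \<le> sup_norm X u} = measure P (f -` R \<inter> space P)"
    unfolding U using measure_distr[OF f Rs] by (simp add: R_def)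
  have sq: "(\<Sum>i<N. (b i x)\<^sup>2) \<le> 1" if "x \<in> X" for x by (rule bessel_point[OF X(1) that bo])
  consider "s = 0" | "1 < s" | "0 < s" "s \<le> 1" using s by linarith
  then show "measure (uniform_sphere X E) {u \<in> space (uniform_sphere X E). s \<le> sup_norm X u} 
      \<le> 2 * real (card X) * exp (- (s\<^sup>2 * N0 / 4))"
  proof cases
    case 1
    have "1 \<le> real (card X)" using X by (simp add: Suc_le_eq card_gt_0_iff)
    then show ?thesis unfolding m using 1 by (intro order.trans[OF P.prob_le_1]) simp
  next
    case 2
    have "\<bar>f z x\<bar> \<le> 1" if x: "x \<in> X" for z x
    proof -
      have "\<bar>\<Sum>i<N. z i * b i x\<bar> \<le> (\<Sum>i<N. \<bar>z i\<bar> * \<bar>b i x\<bar>)"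
        by (rule order.trans[OF sum_abs]) (simp add: abs_mult)
      also have "\<dots> \<le> L2_set z {..<N} * L2_set (\<lambda>i. b i x) {..<N}" by (rule L2_set_mult_ineq)
      also have "\<dots> \<le> L2_set z {..<N} * 1"
        using sq[OF x] by (intro mult_left_mono L2_set_nonneg) (simp add: L2_set_def)
      finally have "\<bar>\<Sum>i<N. z i * b i x\<bar> / L2_set z {..<N} \<le> 1" 
        using L2_set_nonneg[of z "{..<N}"] by (cases "L2_set z {..<N} = 0") (simp_all add: divide_le_eq)
      then show ?thesis using x L2_set_nonneg[of z "{..<N}"] by (simp add: f_def abs_divide)
    qed
    then have "\<not> s \<le> \<bar>f z x\<bar>" if "x \<in> X" for z x using that 2 by (metis not_le order_le_less_trans)
    then have "f -` R \<inter> space P = {}" by (auto simp: R_def supn)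
    then show ?thesis unfolding m by simp
  next
    case 3
    \<comment> \<open>Shrinking s by sqrt 2 meets the restriction on caps for all s up to 1; this
      turns the exponent 1/2 into 1/4.\<close>
    define t where "t = s / sqrt 2"
    have t: "0 \<le> t" "t\<^sup>2 \<le> 1 / 2" "t \<le> s" "t\<^sup>2 = s\<^sup>2 / 2"
      using 3 by (simp_all add: t_def power_divide divide_le_eq mult_le_cancel_left1 power_le_one)
    define A where "A \<epsilon> x = {z \<in> space (leb N). t * L2_set z {..<N} \<le> (\<Sum>i<N. z i * (\<epsilon> * b i x))}" for \<epsilon> :: real and x
    have As: "A \<epsilon> x \<in> sets P" for \<epsilon> x unfolding A_def sP L2_set_def by measurable
    have Am: "measure P (A \<epsilon> x) \<le> exp (- (s\<^sup>2 * N0 / 4))" if "x \<in> X" "\<epsilon>\<^sup>2 = 1" for \<epsilon> x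
    proof -
      have "measure P (A \<epsilon> x) \<le> exp (- (t\<^sup>2) * N / 2)"
        unfolding P_def A_def D_def using sq[OF that(1)] that(2) 
        by (intro cap_measure t) (simp add: power_mult_distrib)
      also have "\<dots> \<le> exp (- (s\<^sup>2 * N0 / 4))" using N by (simp add: t(4) mult_left_mono)
      finally show ?thesis .
    qed
    have "f -` R \<inter> space P \<subseteq> (\<Union>x\<in>X. A 1 x \<union> A (- 1) x)"
    proof
      fix z assume z: "z \<in> f -` R \<inter> space P"
      then obtain x where x: "x \<in> X" "s \<le> \<bar>f z x\<bar>" by (auto simp: R_def supn)
      have fz: "f z x = (\<Sum>i<N. z i * b i x) / L2_set z {..<N}" using x by (simp add: f_def)
      \<comment> \<open>At z = 0 the quotient has the default value 0, below the positive threshold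
        s.\<close>
      then have "L2_set z {..<N} \<noteq> 0" using x 3 by auto
      then have L0: "0 < L2_set z {..<N}" using L2_set_nonneg[of z "{..<N}"] by linarith
      have "s * L2_set z {..<N} \<le> \<bar>\<Sum>i<N. z i * b i x\<bar>" using x(2) L0 by (simp add: fz abs_divide field_simps)
      then have "t * L2_set z {..<N} \<le> \<bar>\<Sum>i<N. z i * b i x\<bar>" 
        using mult_right_mono[OF t(3), of "L2_set z {..<N}"] L0 by linarith
      then have "z \<in> A 1 x \<or> z \<in> A (- 1) x" using z by (auto simp: A_def sP sum_negf)
      then show "z \<in> (\<Union>x\<in>X. A 1 x \<union> A (- 1) x)" using x by blast
    qed
    then have "measure P (f -` R \<inter> space P) \<le> measure P (\<Union>x\<in>X. A 1 x \<union> A (- 1) x)"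
      using X As by (intro P.finite_measure_mono) auto
    also have "\<dots> \<le> (\<Sum>x\<in>X. measure P (A 1 x \<union> A (- 1) x))"
      using X As by (intro P.finite_measure_subadditive_finite) auto
    also have "\<dots> \<le> (\<Sum>x\<in>X. 2 * exp (- (s\<^sup>2 * N0 / 4)))"
    proof (rule sum_mono)
      fix x assume x: "x \<in> X"
      have "measure P (A 1 x \<union> A (- 1) x) \<le> measure P (A 1 x) + measure P (A (- 1) x)"
        by (rule measure_Un_le[OF As As])
      then show "measure P (A 1 x \<union> A (- 1) x) \<le> 2 * exp (- (s\<^sup>2 * N0 / 4))" 
        using Am[OF x, of 1] Am[OF x, of "- 1"] by simp
    qed
    finally show ?thesis unfolding m by (simp add: mult_ac)
  qed
qed

section \<open>Locality: comparing averaged resolvents of the lift and of the cover\<close>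

lemma expectation_pmf_of_set:
  fixes f :: "'b \<Rightarrow> complex"
  assumes "finite S" "S \<noteq> {}"
  shows "measure_pmf.expectation (pmf_of_set S) f = sum f S / of_nat (card S)"
proof -
  have "measure_pmf.expectation (pmf_of_set S) f = (\<Sum>a\<in>S. pmf (pmf_of_set S) a *\<^sub>R f a)"
    by (rule integral_measure_pmf) (use assms in auto)
  also have "\<dots> = (\<Sum>a\<in>S. f a / of_nat (card S))"
    by (rule sum.cong) (use assms in \<open>auto simp: scaleR_conv_of_real\<close>)
  finally show ?thesis by (simp add: sum_divide_distrib)
qed

text \<open>Split the support by the sign of the difference of the two mass functions; each part
  contributes at most the total variation distance.\<close>

lemma expectation_diff_le_tv:
  fixes f :: "'b \<Rightarrow> complex"
  assumes fin: "finite (set_pmf p)" "finite (set_pmf q)" and B: "\<And>a. a \<in> set_pmf p \<union> set_pmf q \<Longrightarrow> cmod (f a) \<le> B"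
  shows "cmod (measure_pmf.expectation p f - measure_pmf.expectation q f) \<le> 2 * B * tv_dist p q"
proof -
  define S where "S = set_pmf p \<union> set_pmf q"
  have S: "finite S" using fin by (simp add: S_def)
  have B0: "0 \<le> B" 
  proof -
    obtain a where "a \<in> set_pmf p" using set_pmf_not_empty[of p] by blast
    then have "cmod (f a) \<le> B" by (intro B) simp
    then show ?thesis by (rule order.trans[OF norm_ge_zero])
  qed
  have bdd: "bdd_above (range (\<lambda>A. \<bar>measure_pmf.prob p A - measure_pmf.prob q A\<bar>))"
  proof (rule bdd_aboveI2)
    fix A show "\<bar>measure_pmf.prob p A - measure_pmf.prob q A\<bar> \<le> 1"
      using measure_pmf.prob_le_1[of p A] measure_pmf.prob_le_1[of q A] measure_nonneg[of p A] measure_nonneg[of q A]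
      unfolding abs_le_iff by linarith
  qed
  have le: "\<bar>\<Sum>a\<in>A. pmf p a - pmf q a\<bar> \<le> tv_dist p q" if "finite A" for A
    unfolding tv_dist_def sum_subtractf measure_measure_pmf_finite[OF that, symmetric]
    by (rule cSUP_upper[OF UNIV_I bdd])
  have "measure_pmf.expectation p f - measure_pmf.expectation q f = (\<Sum>a\<in>S. (pmf p a - pmf q a) *\<^sub>R f a)"
  proof -
    have "measure_pmf.expectation p f = (\<Sum>a\<in>S. pmf p a *\<^sub>R f a)" "measure_pmf.expectation q f = (\<Sum>a\<in>S. pmf q a *\<^sub>R f a)"
      by (rule integral_measure_pmf[OF S]; simp add: S_def)+
    then show ?thesis by (simp add: scaleR_diff_left sum_subtractf)
  qed
  also have "cmod \<dots> \<le> (\<Sum>a\<in>S. \<bar>pmf p a - pmf q a\<bar> * B)"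
    by (rule sum_norm_le) (use B in \<open>auto simp: S_def intro!: mult_left_mono\<close>)
  also have "\<dots> = (\<Sum>a\<in>S. \<bar>pmf p a - pmf q a\<bar>) * B" by (simp add: sum_distrib_right)
  also have "(\<Sum>a\<in>S. \<bar>pmf p a - pmf q a\<bar>) = (\<Sum>a\<in>S \<inter> {a. pmf q a \<le> pmf p a}. pmf p a - pmf q a) 
      - (\<Sum>a\<in>S - {a. pmf q a \<le> pmf p a}. pmf p a - pmf q a)"
  proof -
    have "(\<Sum>a\<in>S. \<bar>pmf p a - pmf q a\<bar>) = (\<Sum>a\<in>S \<inter> {a. pmf q a \<le> pmf p a}. \<bar>pmf p a - pmf q a\<bar>) 
        + (\<Sum>a\<in>S - {a. pmf q a \<le> pmf p a}. \<bar>pmf p a - pmf q a\<bar>)"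
      by (rule sum.Int_Diff[OF S])
    also have "(\<Sum>a\<in>S - {a. pmf q a \<le> pmf p a}. \<bar>pmf p a - pmf q a\<bar>) = (\<Sum>a\<in>S - {a. pmf q a \<le> pmf p a}. - (pmf p a - pmf q a))"
      by (rule sum.cong) auto
    also have "(\<Sum>a\<in>S \<inter> {a. pmf q a \<le> pmf p a}. \<bar>pmf p a - pmf q a\<bar>) = (\<Sum>a\<in>S \<inter> {a. pmf q a \<le> pmf p a}. pmf p a - pmf q a)"
      by (rule sum.cong) auto
    finally show ?thesis by (simp only: sum_negf)
  qed
  also have "\<dots> \<le> 2 * tv_dist p q"
    using le[of "S \<inter> {a. pmf q a \<le> pmf p a}"] le[of "S - {a. pmf q a \<le> pmf p a}"] S by simp
  finally show ?thesis using B0 by (simp add: mult_right_mono mult_ac)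
qed

text \<open>The diagonal resolvent entry at x with its Chebyshev series cut after \<open>m\<close>
  terms: a function of the m-ball around x only.\<close>

definition local_res :: "real \<Rightarrow> complex \<Rightarrow> nat \<Rightarrow> ('v \<times> 'v) set \<Rightarrow> 'v \<Rightarrow> complex" where
  "local_res d w m E x = 2 / (of_real d * (w - 1 / w)) * 
     (1 + (\<Sum>k=1..m. 2 / w ^ k * cheb E d (\<lambda>y. of_bool (y = x)) k x))"

lemma ball_at_simps: 
  "pverts (ball_at G x h) = {y. \<exists>k\<le>h. (x, y) \<in> parcs G ^^ k}"
  "parcs (ball_at G x h) = parcs G \<inter> pverts (ball_at G x h) \<times> pverts (ball_at G x h)"
  by (simp_all add: ball_at_def Let_def)

text \<open>Finite propagation speed: each application of the adjacency operator reaches one step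
  farther.\<close>

lemma cheb_support:
  assumes "sym E" "cheb E d (\<lambda>y. of_bool (y = x)) k u \<noteq> 0"
  shows "\<exists>j\<le>k. (x, u) \<in> E ^^ j"
proof -
  have step: "\<exists>j\<le>Suc k. (x, u) \<in> E ^^ j" 
    if f: "nbr_sum E f u \<noteq> 0" and fs: "\<And>y. f y \<noteq> 0 \<Longrightarrow> \<exists>j\<le>k. (x, y) \<in> E ^^ j" for f :: "'a \<Rightarrow> complex" and k u
  proof -
    obtain y where y: "(u, y) \<in> E" "f y \<noteq> 0" using f unfolding nbr_sum_def by (auto dest: sum.not_neutral_contains_not_neutral)
    obtain j where j: "j \<le> k" "(x, y) \<in> E ^^ j" using fs[OF y(2)] by blast
    have "(x, u) \<in> E ^^ Suc j" using j(2) symD[OF assms(1) y(1)] by auto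
    then show ?thesis using j(1) by (intro exI[of _ "Suc j"]) auto
  qed
  show ?thesis
    using assms(2)
  proof (induction k arbitrary: u rule: induct_nat_012)
    case 0
    then show ?case by (auto split: if_splits)
  next
    case 1
    then have "nbr_sum E (\<lambda>y. of_bool (y = x)) u \<noteq> 0" by auto
    then show ?case by (rule step) (auto split: if_splits)
  next
    case (ge2 k)
    then consider "nbr_sum E (cheb E d (\<lambda>y. of_bool (y = x)) (Suc k)) u \<noteq> 0" | "cheb E d (\<lambda>y. of_bool (y = x)) k u \<noteq> 0"
      by fastforce
    then show ?case
    proof cases
      case 1
      then show ?thesis using step[of "cheb E d (\<lambda>y. of_bool (y = x)) (Suc k)" u "Suc k"] ge2.IH(2) by blast
    next
      case 2
      then show ?thesis using ge2.IH(1) by (meson le_SucI)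
    qed
  qed
qed

text \<open>Up to order \<open>h\<close> the functions vanish outside the ball, so the edges leaving
  it carry only zeros.\<close>

lemma cheb_ball:
  assumes sym: "sym (parcs G)" and fin: "\<And>u. finite (parcs G `` {u})"
  shows "u \<in> pverts (ball_at G x h) \<Longrightarrow> k \<le> h \<Longrightarrow> 
    cheb (parcs (ball_at G x h)) d (\<lambda>y. of_bool (y = x)) k u = cheb (parcs G) d (\<lambda>y. of_bool (y = x)) k u"
proof -
  let ?B = "pverts (ball_at G x h)" and ?c = "cheb (parcs G) d (\<lambda>y. of_bool (y = x))"
  have nb: "nbr_sum (parcs (ball_at G x h)) f u = nbr_sum (parcs G) (?c k) u" 
    if u: "u \<in> ?B" and f: "\<And>y. y \<in> ?B \<Longrightarrow> f y = ?c k y" and k: "k \<le> h" for f u k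
  proof -
    have "?c k y = 0" if "y \<notin> ?B" for y
    proof (rule ccontr)
      assume "?c k y \<noteq> 0"
      from cheb_support[OF sym this] obtain j where "j \<le> k" "(x, y) \<in> parcs G ^^ j" by blast
      then have "y \<in> ?B" using k by (auto simp: ball_at_simps(1) intro!: exI[of _ j])
      then show False using that by simp
    qed
    then have "nbr_sum (parcs G) (?c k) u = (\<Sum>y\<in>parcs G `` {u} \<inter> ?B. ?c k y)"
      unfolding nbr_sum_def using fin[of u] by (intro sum.mono_neutral_right) auto
    also have "\<dots> = (\<Sum>y\<in>parcs (ball_at G x h) `` {u}. f y)"
      using u f by (intro sum.cong) (auto simp: ball_at_simps(2))
    finally show ?thesis by (simp add: nbr_sum_def)
  qed
  show "u \<in> ?B \<Longrightarrow> k \<le> h \<Longrightarrow> cheb (parcs (ball_at G x h)) d (\<lambda>y. of_bool (y = x)) k u = ?c k u"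
  proof (induction k arbitrary: u rule: induct_nat_012)
    case 1
    then show ?case using nb[of u _ 0] by simp
  next
    case (ge2 k)
    have "nbr_sum (parcs (ball_at G x h)) (cheb (parcs (ball_at G x h)) d (\<lambda>y. of_bool (y = x)) (Suc k)) u
      = nbr_sum (parcs G) (?c (Suc k)) u"
      by (rule nb) (use ge2 in auto)
    then show ?case using ge2 by simp
  qed simp
qed

lemma cheb_iso:
  assumes f: "bij_betw f (pverts H) (pverts K)" "\<And>u v. u \<in> pverts H \<Longrightarrow> v \<in> pverts H \<Longrightarrow> (u, v) \<in> parcs H \<longleftrightarrow> (f u, f v) \<in> parcs K"
    and H: "parcs H \<subseteq> pverts H \<times> pverts H" and K: "parcs K \<subseteq> pverts K \<times> pverts K" and x: "x \<in> pverts H"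
  shows "u \<in> pverts H \<Longrightarrow> cheb (parcs K) d (\<lambda>y. of_bool (y = f x)) k (f u) = cheb (parcs H) d (\<lambda>y. of_bool (y = x)) k u"
proof -
  have inj: "inj_on f (pverts H)" using f(1) by (simp add: bij_betw_def)
  have nb: "nbr_sum (parcs K) g (f u) = nbr_sum (parcs H) g' u"
    if u: "u \<in> pverts H" and g: "\<And>y. y \<in> pverts H \<Longrightarrow> g (f y) = g' y" for g g' u
  proof -
    have "parcs K `` {f u} = f ` (parcs H `` {u})"
    proof (intro equalityI subsetI)
      fix y assume y: "y \<in> parcs K `` {f u}"
      then have "y \<in> pverts K" using K by auto
      then obtain v where v: "v \<in> pverts H" "y = f v" using f(1) by (auto simp: bij_betw_def)
      then show "y \<in> f ` (parcs H `` {u})" using f(2)[OF u v(1)] y by auto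
    next
      fix y assume "y \<in> f ` (parcs H `` {u})"
      then obtain v where v: "(u, v) \<in> parcs H" "y = f v" by auto
      then have "v \<in> pverts H" using H by auto
      then show "y \<in> parcs K `` {f u}" using f(2)[OF u] v by auto
    qed
    moreover have "parcs H `` {u} \<subseteq> pverts H" using H by auto
    ultimately show ?thesis unfolding nbr_sum_def using g inj
      by (simp add: sum.reindex[OF inj_on_subset[OF inj]] subset_iff)
  qed
  show "u \<in> pverts H \<Longrightarrow> cheb (parcs K) d (\<lambda>y. of_bool (y = f x)) k (f u) = cheb (parcs H) d (\<lambda>y. of_bool (y = x)) k u"
  proof (induction k arbitrary: u rule: induct_nat_012)
    case 0
    then show ?case using inj x by (auto dest: inj_onD)
  next
    case 1
    have "nbr_sum (parcs K) (\<lambda>y. of_bool (y = f x)) (f u) = nbr_sum (parcs H) (\<lambda>y. of_bool (y = x) :: complex) u"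
      by (rule nb[OF 1]) (use inj x in \<open>auto dest: inj_onD\<close>)
    then show ?case by simp
  next
    case (ge2 k)
    have "nbr_sum (parcs K) (cheb (parcs K) d (\<lambda>y. of_bool (y = f x)) (Suc k)) (f u) 
        = nbr_sum (parcs H) (cheb (parcs H) d (\<lambda>y. of_bool (y = x)) (Suc k)) u"
      by (rule nb[OF ge2.prems]) (rule ge2.IH(2))
    then show ?case using ge2.IH(1)[OF ge2.prems] by simp
  qed
qed

text \<open>Evaluates the truncated entry on an arbitrary representative of an isomorphism class,
  which gives one function to integrate against both local laws; \<open>cheb_iso\<close> makes it
  independent of the representative.\<close>

definition class_res :: "real \<Rightarrow> complex \<Rightarrow> nat \<Rightarrow> (nat pair_pre_digraph \<times> nat) set \<Rightarrow> complex" where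
  "class_res d w m C = (let (K, y) = (SOME R. R \<in> C) in local_res d w m (parcs K) y)"

lemma class_res_ball:
  assumes sym: "sym (parcs G)" and fin: "\<And>u. finite (parcs G `` {u})"
  shows "class_res d w m (iso_class (ball_at G x m) x) = local_res d w m (parcs G) x"
proof -
  let ?H = "ball_at G x m"
  have x: "x \<in> pverts ?H" by (auto simp: ball_at_simps(1) intro!: exI[of _ 0])
  have HH: "parcs ?H \<subseteq> pverts ?H \<times> pverts ?H" by (auto simp: ball_at_simps(2))
  have "finite {y. (x, y) \<in> parcs G ^^ k}" for k
  proof (induction k)
    case (Suc k)
    have "{y. (x, y) \<in> parcs G ^^ Suc k} = (\<Union>u\<in>{y. (x, y) \<in> parcs G ^^ k}. parcs G `` {u})" by auto
    then show ?case using Suc fin by simp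
  qed simp
  moreover have "pverts ?H = (\<Union>k\<le>m. {y. (x, y) \<in> parcs G ^^ k})" by (auto simp: ball_at_simps(1))
  ultimately have finH: "finite (pverts ?H)" by simp
  \<comment> \<open>The ball is finite and has a copy on natural numbers, so its class is nonempty
    and the choice in \<open>class_res\<close> is a genuine representative.\<close>
  obtain g :: "'a \<Rightarrow> nat" where g: "inj_on g (pverts ?H)" 
    using finite_imp_inj_to_nat_seg[OF finH] by blast
  have "(\<lparr>pverts = g ` pverts ?H, parcs = (\<lambda>(u, v). (g u, g v)) ` parcs ?H\<rparr>, g x) \<in> iso_class ?H x"
  proof -
    have "(u, v) \<in> parcs ?H \<longleftrightarrow> (g u, g v) \<in> (\<lambda>(u, v). (g u, g v)) ` parcs ?H" if "u \<in> pverts ?H" "v \<in> pverts ?H" for u v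
    proof
      assume "(g u, g v) \<in> (\<lambda>(u, v). (g u, g v)) ` parcs ?H"
      then obtain u' v' where uv: "(u', v') \<in> parcs ?H" "g u = g u'" "g v = g v'" by auto
      then have "u = u'" "v = v'" using HH that by (auto intro!: inj_onD[OF g])
      then show "(u, v) \<in> parcs ?H" using uv by simp
    qed force
    then have "rooted_iso ?H x \<lparr>pverts = g ` pverts ?H, parcs = (\<lambda>(u, v). (g u, g v)) ` parcs ?H\<rparr> (g x)"
      unfolding rooted_iso_def using g by (intro exI[of _ g]) (simp add: bij_betw_def)
    moreover have "pair_wf_digraph \<lparr>pverts = g ` pverts ?H, parcs = (\<lambda>(u, v). (g u, g v)) ` parcs ?H\<rparr>"
      by unfold_locales (use HH in auto)
    ultimately show ?thesis using x by (simp add: iso_class_def)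
  qed
  then have "(SOME R. R \<in> iso_class ?H x) \<in> iso_class ?H x" by (rule someI)
  moreover obtain K y where Ky: "(SOME R. R \<in> iso_class ?H x) = (K, y)" by (cases "SOME R. R \<in> iso_class ?H x")
  ultimately have K: "pair_wf_digraph K" "rooted_iso ?H x K y" by (auto simp: iso_class_def)
  interpret K: pair_wf_digraph K by (rule K(1))
  obtain f where f: "bij_betw f (pverts ?H) (pverts K)" "f x = y" 
    "\<And>u v. u \<in> pverts ?H \<Longrightarrow> v \<in> pverts ?H \<Longrightarrow> (u, v) \<in> parcs ?H \<longleftrightarrow> (f u, f v) \<in> parcs K"
    using K(2) unfolding rooted_iso_def by blast
  have KK: "parcs K \<subseteq> pverts K \<times> pverts K" using K.arc_fst_in_verts K.arc_snd_in_verts by fastforce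
  have "cheb (parcs K) d (\<lambda>u. of_bool (u = y)) k y = cheb (parcs G) d (\<lambda>y. of_bool (y = x)) k x" if "k \<le> m" for k
    using cheb_iso[OF f(1,3) HH KK x x, of d k] cheb_ball[OF sym fin x that, of d] f(2) by simp
  then show ?thesis by (simp add: class_res_def Ky local_res_def)
qed

lemma (in bounded_graph) local_res_close:
  assumes u: "cscale z u - adjop u = delta x" and y: "0 < Im z"
    and w: "w \<noteq> 0" "z = of_real d * (w + 1 / w) / 2" "2 * Im z / d \<le> cmod w - 1 / cmod w" "1 + Im z / d \<le> cmod w"
  shows "cmod (Rep_l2 u x - local_res d w m E x) \<le> 2 * d / (Im z)\<^sup>2 / (1 + Im z / d) ^ m"
    "cmod (local_res d w m E x) \<le> 1 / Im z + 2 * d / (Im z)\<^sup>2"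
proof -
  have yd: "0 < Im z / d" using y d_pos by simp
  have y1: "0 < 1 + Im z / d" using yd by linarith
  have "1 \<le> cmod w" using w(4) yd by simp
  then have "cmod (Rep_l2 u x - local_res d w m E x) \<le> 2 * d / (Im z)\<^sup>2 / cmod w ^ m"
    unfolding local_res_def by (rule resolvent_cheb[OF u y w(1-3)])
  also have "\<dots> \<le> 2 * d / (Im z)\<^sup>2 / (1 + Im z / d) ^ m"
    using w(4) yd y1 d_pos w(1) y by (intro divide_left_mono power_mono mult_pos_pos zero_less_power) (auto simp del: zero_less_divide_iff)
  finally show 1: "cmod (Rep_l2 u x - local_res d w m E x) \<le> 2 * d / (Im z)\<^sup>2 / (1 + Im z / d) ^ m" .
  also have "\<dots> \<le> 2 * d / (Im z)\<^sup>2 / 1"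
    using yd y1 d_pos y by (intro divide_left_mono one_le_power mult_pos_pos zero_less_power) (auto simp del: zero_less_divide_iff)
  finally have 2: "cmod (Rep_l2 u x - local_res d w m E x) \<le> 2 * d / (Im z)\<^sup>2" by simp
  have "norm u \<le> 1 / Im z" using resolvent_norm_bound(1)[OF u] y by (simp add: norm_delta field_simps)
  then have "cmod (Rep_l2 u x) \<le> 1 / Im z" using Rep_le_norm[of u x] by simp
  moreover have "cmod (local_res d w m E x) \<le> cmod (Rep_l2 u x) + cmod (Rep_l2 u x - local_res d w m E x)"
    using norm_triangle_sub[of "local_res d w m E x" "Rep_l2 u x"] by (simp add: norm_minus_commute)
  ultimately show "cmod (local_res d w m E x) \<le> 1 / Im z + 2 * d / (Im z)\<^sup>2" using 2 by simp
qed

definition spectral_data :: "'v pair_pre_digraph \<Rightarrow> (nat \<Rightarrow> 'v \<Rightarrow> real) \<Rightarrow> (nat \<Rightarrow> real) \<Rightarrow> bool" where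
  "spectral_data H e l \<longleftrightarrow> orthonormal_on (pverts H) {..<card (pverts H)} e \<and> 
     (\<forall>j<card (pverts H). \<forall>x\<in>pverts H. (\<Sum>y | (x, y) \<in> parcs H. e j y) = l j * e j x) \<and>
     (\<forall>x\<in>pverts H. \<forall>y\<in>pverts H. (\<Sum>j<card (pverts H). e j x * e j y) = of_bool (x = y))"

lemma spectral_data_exists:
  assumes "finite (pverts H)" and H: "parcs H \<subseteq> pverts H \<times> pverts H" and "sym (parcs H)"
  shows "\<exists>e l. spectral_data H e l"
proof -
  have s: "(\<Sum>y\<in>pverts H. of_bool ((x, y) \<in> parcs H) * f y) = (\<Sum>y | (x, y) \<in> parcs H. f y)" for x and f :: "'a \<Rightarrow> real"
    using assms(1) H by (intro sum.mono_neutral_cong_right) auto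
  have "of_bool ((x, y) \<in> parcs H) = (of_bool ((y, x) \<in> parcs H) :: real)" for x y
    using assms(3) by (auto dest: symD)
  from symmetric_spectral_theorem[where a = "\<lambda>x y. of_bool ((x, y) \<in> parcs H)", OF assms(1) this] show ?thesis
    unfolding s spectral_data_def .
qed

lemma finite_resolvent:
  assumes bg: "bounded_graph (parcs H) d" and fin: "finite (pverts H)" and H: "parcs H \<subseteq> pverts H \<times> pverts H"
    and sd: "spectral_data H e l" and z: "0 < Im z" and x: "x \<in> pverts H"
  shows "\<exists>u. cscale z u - bounded_graph.adjop (parcs H) u = delta x \<and> 
    Rep_l2 u x = (\<Sum>j<card (pverts H). of_real ((e j x)\<^sup>2) / (z - of_real (l j)))"
proof -
  interpret bounded_graph "parcs H" d by fact
  let ?n = "card (pverts H)"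
  define g where "g y = (if y \<in> pverts H then \<Sum>j<?n. of_real (e j x * e j y) / (z - of_real (l j)) else 0)" for y
  have "sqsum g" by (rule sqsum_finite[OF fin]) (simp add: g_def)
  then have R: "Rep_l2 (Abs_l2 g) = g" by (simp add: Abs_l2_inverse)
  have zl: "z - of_real (l j) \<noteq> 0" for j using z by (metis Im_complex_of_real eq_iff_diff_eq_0 less_irrefl)
  have "cscale z (Abs_l2 g) - adjop (Abs_l2 g) = delta x"
  proof (rule l2_eqI)
    fix y
    show "Rep_l2 (cscale z (Abs_l2 g) - adjop (Abs_l2 g)) y = Rep_l2 (delta x) y"
    proof (cases "y \<in> pverts H")
      case False
      then have "parcs H `` {y} = {}" "y \<noteq> x" using H x by auto
      then show ?thesis using False by (simp add: l2_simps cscale.rep_eq Rep_adjop R delta.rep_eq g_def nbr_sum_def)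
    next
      case True
      have im: "parcs H `` {y} = {v. (y, v) \<in> parcs H}" by auto
      have "nbr_sum (parcs H) g y = (\<Sum>v | (y, v) \<in> parcs H. \<Sum>j<?n. of_real (e j x * e j v) / (z - of_real (l j)))"
        unfolding nbr_sum_def im by (rule sum.cong) (use H in \<open>auto simp: g_def\<close>)
      also have "\<dots> = (\<Sum>j<?n. of_real (e j x * (\<Sum>v | (y, v) \<in> parcs H. e j v)) / (z - of_real (l j)))"
        by (subst sum.swap) (simp add: sum_divide_distrib sum_distrib_left)
      also have "\<dots> = (\<Sum>j<?n. of_real (e j x * (l j * e j y)) / (z - of_real (l j)))"
        by (rule sum.cong) (use sd True in \<open>auto simp: spectral_data_def\<close>)
      finally have "z * g y - nbr_sum (parcs H) g y = (\<Sum>j<?n. z * (of_real (e j x * e j y) / (z - of_real (l j))) 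
            - of_real (e j x * (l j * e j y)) / (z - of_real (l j)))"
        using True by (simp add: g_def sum_distrib_left sum_subtractf)
      also have "\<dots> = (\<Sum>j<?n. of_real (e j x * e j y))"
      proof (rule sum.cong)
        fix j
        have "of_real (e j x * (l j * e j y)) = of_real (l j) * complex_of_real (e j x * e j y)" by simp
        then have "z * (of_real (e j x * e j y) / (z - of_real (l j))) - of_real (e j x * (l j * e j y)) / (z - of_real (l j)) 
            = (z - of_real (l j)) * of_real (e j x * e j y) / (z - of_real (l j))"
          by (simp only: times_divide_eq_right left_diff_distrib diff_divide_distrib)
        also have "\<dots> = of_real (e j x * e j y)" using zl[of j] by (rule nonzero_mult_div_cancel_left)
        finally show "z * (of_real (e j x * e j y) / (z - of_real (l j))) - of_real (e j x * (l j * e j y)) / (z - of_real (l j)) 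
            = of_real (e j x * e j y)" .
      qed simp
      also have "\<dots> = of_real (\<Sum>j<?n. e j x * e j y)" by simp
      also have "\<dots> = of_bool (y = x)" using sd x True by (auto simp: spectral_data_def of_bool_def)
      finally show ?thesis by (simp add: l2_simps cscale.rep_eq Rep_adjop R delta.rep_eq)
    qed
  qed
  moreover have "Rep_l2 (Abs_l2 g) x = (\<Sum>j<?n. of_real ((e j x)\<^sup>2) / (z - of_real (l j)))"
    using x by (simp add: R g_def power2_eq_square)
  ultimately show ?thesis by blast
qed

context base_graph
begin

lemma lift_simps:
  assumes "is_lift n G H" "0 < n"
  shows "pverts H = pverts G \<times> {1..n}" "finite (pverts H)" "card (pverts H) = card (pverts G) * n" "pverts H \<noteq> {}"
    "parcs H \<subseteq> pverts H \<times> pverts H" "bounded_graph (parcs H) D0"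
proof -
  from assms(1)[unfolded is_lift_def Let_def] obtain R \<sigma> where 
    RS: "is_orientation G R \<and> (\<forall>e\<in>R. \<sigma> e permutes {1..n}) \<and> pverts H = pverts G \<times> {1..n} \<and>
      parcs H = {((u, i), (v, \<sigma> (u, v) i)) | u v i. (u, v) \<in> R \<and> i \<in> {1..n}} \<union> 
        {((u, i), (v, \<sigma> (u, v) i)) | u v i. (u, v) \<in> R \<and> i \<in> {1..n}}\<inverse>"
    by (elim exE) (rule that)
  have R: "is_orientation G R" and \<sigma>: "\<And>e. e \<in> R \<Longrightarrow> \<sigma> e permutes {1..n}"
    and V: "pverts H = pverts G \<times> {1..n}" using RS by simp_all
  have E: "parcs H = {((u, i), (v, \<sigma> (u, v) i)) | u v i. (u, v) \<in> R \<and> i \<in> {1..n}} \<union> 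
        {((u, i), (v, \<sigma> (u, v) i)) | u v i. (u, v) \<in> R \<and> i \<in> {1..n}}\<inverse>"
    using RS by (elim conjE)
  show "pverts H = pverts G \<times> {1..n}" by (rule V)
  show "finite (pverts H)" using V pair_finite_verts by simp
  show "card (pverts H) = card (pverts G) * n" by (simp add: V card_cartesian_product)
  show "pverts H \<noteq> {}" using V assms(2) root by auto
  have RG: "(u, v) \<in> parcs G" if "(u, v) \<in> R" for u v using R that by (auto simp: is_orientation_def)
  have Rv: "u \<in> pverts G" "v \<in> pverts G" if "(u, v) \<in> R" for u v
    using arc_fst_in_verts[OF RG[OF that]] arc_snd_in_verts[OF RG[OF that]] by auto
  have \<sigma>in: "\<sigma> (u, v) i \<in> {1..n}" if "(u, v) \<in> R" "i \<in> {1..n}" for u v i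
    using permutes_in_image[OF \<sigma>[OF that(1)]] that(2) by blast
  show sub: "parcs H \<subseteq> pverts H \<times> pverts H"
    unfolding E V using Rv \<sigma>in by fastforce
  have excl: "\<not> ((u, v) \<in> R \<and> (v, u) \<in> R)" for u v
    using R RG[of u v] by (auto simp: is_orientation_def)
  show "bounded_graph (parcs H) D0"
  proof
    show "sym (parcs H)" unfolding E by (rule sym_Un_converse)
    fix p
    \<comment> \<open>The covering projection separates neighbours: each edge carries a permutation
      and is oriented in only one way. Hence degrees in the lift obey the same bound as in the
      base.\<close>
    have inj: "inj_on fst (parcs H `` {p})"
    proof (rule inj_onI)
      fix q q' assume q: "q \<in> parcs H `` {p}" and q': "q' \<in> parcs H `` {p}" and eq: "fst q = fst q'"
      obtain u i where p: "p = (u, i)" by (cases p)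
      obtain v j where qv: "q = (v, j)" by (cases q)
      obtain k where qk: "q' = (v, k)" using eq qv by (cases q') auto
      have c: "((u, v) \<in> R \<and> j = \<sigma> (u, v) i) \<or> ((v, u) \<in> R \<and> i = \<sigma> (v, u) j)" if "(v, j) \<in> parcs H `` {p}" for j
        using that unfolding p E by auto
      have "j = k"
      proof (cases "(u, v) \<in> R")
        case True
        then show ?thesis using c[of j] c[of k] q q' excl[of u v] by (simp add: qv qk)
      next
        case False
        then have vu: "(v, u) \<in> R" "\<sigma> (v, u) j = \<sigma> (v, u) k" using c[of j] c[of k] q q' by (auto simp: qv qk)
        then show ?thesis using permutes_inj[OF \<sigma>[OF vu(1)]] by (simp add: inj_eq)
      qed
      then show "q = q'" by (simp add: qv qk)
    qed
    have im: "fst ` (parcs H `` {p}) \<subseteq> pverts G" using sub V by auto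
    show "finite (parcs H `` {p})" using inj im pair_finite_verts by (metis finite_imageD finite_subset)
    have "card (parcs H `` {p}) \<le> card (pverts G)"
      using card_inj_on_le[OF inj im pair_finite_verts] .
    then show "real (card (parcs H `` {p})) \<le> D0" by (simp add: D0_def)
  qed (rule D0_pos)
qed

end

context core_graph
begin

text \<open>Each trace is within the truncation error of the expectation of the same function
  \<open>class_res\<close> under its local law, and the two expectations differ by at most twice its
  bound times \<tau>.\<close>

lemma trace_compare:
  assumes H: "is_lift n G H" "0 < n" and sd: "spectral_data H e l" and z: "z \<in> uhp"
    and tv: "tv_dist (empirical_law H m) (cover_law G r m) \<le> \<tau>"
  shows "cmod ((\<Sum>j<card (pverts H). 1 / (z - of_real (l j))) / of_nat (card (pverts H)) - trace z)
    \<le> 4 * D0 / (Im z)\<^sup>2 / (1 + Im z / D0) ^ m + 2 * (1 / Im z + 2 * D0 / (Im z)\<^sup>2) * \<tau>"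
proof -
  note Hs = lift_simps[OF H]
  interpret H: bounded_graph "parcs H" D0 by (rule Hs(6))
  let ?n = "card (pverts H)" and ?V = "pverts G"
  have y: "0 < Im z" using z by simp
  obtain w where w: "w \<noteq> 0" "z = of_real D0 * (w + 1 / w) / 2" "2 * Im z / D0 \<le> cmod w - 1 / cmod w" "1 + Im z / D0 \<le> cmod w"
    using joukowski_exists[OF D0_pos y] by blast
  define err where "err = 2 * D0 / (Im z)\<^sup>2 / (1 + Im z / D0) ^ m"
  define B where "B = 1 / Im z + 2 * D0 / (Im z)\<^sup>2"
  have B0: "0 \<le> B" using y D0_pos by (simp add: B_def)
  define Q where "Q x = (\<Sum>j<?n. of_real ((e j x)\<^sup>2) / (z - of_real (l j)))" for x
  define F where "F = class_res D0 w m"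
  have Hx: "cmod (Q x - local_res D0 w m (parcs H) x) \<le> err" "cmod (local_res D0 w m (parcs H) x) \<le> B" if xH: "x \<in> pverts H" for x
  proof -
    obtain u where u: "cscale z u - H.adjop u = delta x" "Rep_l2 u x = Q x"
      using finite_resolvent[OF Hs(6,2,5) sd y xH] unfolding Q_def by blast
    show "cmod (Q x - local_res D0 w m (parcs H) x) \<le> err" "cmod (local_res D0 w m (parcs H) x) \<le> B"
      using H.local_res_close[OF u(1) y w, of m] by (simp_all add: u(2) err_def B_def)
  qed
  define p where "p v = (SOME p. p \<in> X \<and> last p = v)" for v
  have p: "p v \<in> X \<and> last (p v) = v" if "v \<in> ?V" for v
  proof -
    have "\<exists>p. p \<in> X \<and> last p = v" using that unfolding cover_onto[symmetric] by auto
    then show ?thesis unfolding p_def by (rule someI_ex)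
  qed
  have Tx: "cmod (green z (None, v) - local_res D0 w m ET (p v)) \<le> err" "cmod (local_res D0 w m ET (p v)) \<le> B" if v: "v \<in> ?V" for v
  proof -
    have pX: "p v \<in> X" "last (p v) = v" using p[OF v] by auto
    have "Rep_l2 (col z (p v)) (p v) = kern (green z) (p v) (p v)" by (simp add: Rep_col[OF z pX(1)] kcol_def pX(1))
    also have "\<dots> = green z (None, v)" using kern_prefix[OF pX(1), of "p v"] pX(2) by (simp add: cone_self)
    finally have g: "Rep_l2 (col z (p v)) (p v) = green z (None, v)" .
    show "cmod (green z (None, v) - local_res D0 w m ET (p v)) \<le> err" "cmod (local_res D0 w m ET (p v)) \<le> B"
      using T.local_res_close[OF col_eq[OF z pX(1)] y w, of m] by (simp_all add: g err_def B_def)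
  qed
  have FH: "F (iso_class (ball_at H x m) x) = local_res D0 w m (parcs H) x" for x
    unfolding F_def by (rule class_res_ball[OF H.sym H.finite_nbrs])
  have FT: "F (iso_class (ball_at cover q m) q) = local_res D0 w m ET q" for q
    unfolding F_def by (rule class_res_ball[OF T.sym T.finite_nbrs])
  have Vne: "?V \<noteq> {}" using root by auto
  have elaw: "empirical_law H m = map_pmf (\<lambda>x. iso_class (ball_at H x m) x) (pmf_of_set (pverts H))"
    by (simp add: empirical_law_def)
  have claw: "cover_law G r m = map_pmf (\<lambda>v. iso_class (ball_at cover (p v) m) (p v)) (pmf_of_set ?V)"
    by (simp add: cover_law_def Let_def p_def cover_def)
  have E1: "measure_pmf.expectation (empirical_law H m) F = (\<Sum>x\<in>pverts H. local_res D0 w m (parcs H) x) / of_nat ?n"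
    unfolding elaw integral_map_pmf FH by (rule expectation_pmf_of_set[OF Hs(2,4)])
  have E2: "measure_pmf.expectation (cover_law G r m) F = (\<Sum>v\<in>?V. local_res D0 w m ET (p v)) / of_nat (card ?V)"
    unfolding claw integral_map_pmf FT by (rule expectation_pmf_of_set[OF pair_finite_verts Vne])
  have D: "cmod (measure_pmf.expectation (empirical_law H m) F - measure_pmf.expectation (cover_law G r m) F) \<le> 2 * B * \<tau>"
  proof -
    have "cmod (F a) \<le> B" if "a \<in> set_pmf (empirical_law H m) \<union> set_pmf (cover_law G r m)" for a
      using that Hx(2) Tx(2) Hs(2,4) Vne pair_finite_verts unfolding elaw claw by (auto simp: FH FT)
    then have "cmod (measure_pmf.expectation (empirical_law H m) F - measure_pmf.expectation (cover_law G r m) F) 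
        \<le> 2 * B * tv_dist (empirical_law H m) (cover_law G r m)"
      using Hs(2,4) Vne pair_finite_verts by (intro expectation_diff_le_tv) (auto simp: elaw claw)
    also have "\<dots> \<le> 2 * B * \<tau>" using tv B0 by (intro mult_left_mono) auto
    finally show ?thesis .
  qed
  have avg: "cmod ((\<Sum>x\<in>S. f x) / of_nat (card S) - (\<Sum>x\<in>S. g x) / of_nat (card S)) \<le> err"
    if "finite S" "S \<noteq> {}" "\<And>x. x \<in> S \<Longrightarrow> cmod (f x - g x) \<le> err" for S :: "'s set" and f g
  proof -
    have c: "0 < real (card S)" using that by (simp add: card_gt_0_iff)
    have "cmod (\<Sum>x\<in>S. f x - g x) \<le> (\<Sum>x\<in>S. err)" by (rule sum_norm_le) (rule that(3))
    then have "cmod ((\<Sum>x\<in>S. f x - g x) / of_nat (card S)) \<le> err" using c by (simp add: norm_divide field_simps)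
    then show ?thesis by (simp add: sum_subtractf diff_divide_distrib)
  qed
  have "(\<Sum>j<?n. 1 / (z - of_real (l j))) = (\<Sum>j<?n. of_real (dot (pverts H) (e j) (e j)) / (z - of_real (l j)))"
    by (rule sum.cong) (use sd in \<open>auto simp: spectral_data_def orthonormal_on_def\<close>)
  also have "\<dots> = (\<Sum>x\<in>pverts H. Q x)"
    unfolding Q_def by (subst sum.swap) (simp add: dot_def sum_divide_distrib power2_eq_square)
  finally have Qs: "(\<Sum>j<?n. 1 / (z - of_real (l j))) = (\<Sum>x\<in>pverts H. Q x)" .
  have 1: "cmod ((\<Sum>x\<in>pverts H. Q x) / of_nat ?n - measure_pmf.expectation (empirical_law H m) F) \<le> err"
    unfolding E1 by (rule avg[OF Hs(2,4) Hx(1)])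
  have 2: "cmod (trace z - measure_pmf.expectation (cover_law G r m) F) \<le> err"
    unfolding E2 trace_def by (rule avg[OF pair_finite_verts Vne Tx(1)])
  have tri: "cmod (a - d) \<le> cmod (a - b) + cmod (b - c) + cmod (d - c)" for a b c d :: complex
    using norm_triangle_ineq[of "a - b" "b - c"] norm_triangle_ineq4[of "a - c" "d - c"] by simp
  have "cmod ((\<Sum>x\<in>pverts H. Q x) / of_nat ?n - trace z) \<le> err + 2 * B * \<tau> + err"
    using tri[of "(\<Sum>x\<in>pverts H. Q x) / of_nat ?n" "trace z" "measure_pmf.expectation (empirical_law H m) F" 
        "measure_pmf.expectation (cover_law G r m) F"] 1 2 D by linarith
  then show ?thesis unfolding Qs by (simp add: err_def B_def)
qed

end

section \<open>From traces to eigenvalue counts\<close>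

text \<open>The dimension of the span is the number of eigenvalues in \<open>J\<close>, counted with
  multiplicity: an eigenvector with eigenvalue in \<open>J\<close> is orthogonal to every e_j whose
  eigenvalue is different.\<close>

lemma eigen_span_basis:
  assumes fin: "finite (pverts H)" and H: "parcs H \<subseteq> pverts H \<times> pverts H" and sym: "sym (parcs H)" and sd: "spectral_data H e l"
  shows "\<exists>b. is_orthonormal_basis (pverts H) (eigen_span H J) (card {j. j < card (pverts H) \<and> l j \<in> J}) b"
proof -
  let ?X = "pverts H" and ?n = "card (pverts H)"
  define S where "S = {j. j < ?n \<and> l j \<in> J}"
  have S: "finite S" by (simp add: S_def)
  obtain h where h: "bij_betw h {0..<card S} S" using ex_bij_betw_nat_finite[OF S] by blast
  have hS: "h i \<in> S" if "i < card S" for i using h that by (auto simp: bij_betw_def)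
  have orth: "dot ?X (e i) (e j) = of_bool (i = j)" if "i < ?n" "j < ?n" for i j
    using sd that by (auto simp: spectral_data_def orthonormal_on_def)
  have eig: "(\<Sum>y | (x, y) \<in> parcs H. e j y) = l j * e j x" if "j < ?n" "x \<in> ?X" for j x
    using sd that by (simp add: spectral_data_def)
  define b where "b i = (\<lambda>x\<in>?X. e (h i) x)" for i
  have dotb: "dot ?X (b i) (b j) = dot ?X (e (h i)) (e (h j))" for i j
    by (rule dot_cong) (simp_all add: b_def)
  have 1: "b i \<in> eigen_span H J" if i: "i < card S" for i
  proof -
    have hi: "h i < ?n" "l (h i) \<in> J" using hS[OF i] by (auto simp: S_def)
    have "adjacency H (b i) x = l (h i) * b i x" if x: "x \<in> ?X" for x
    proof -
      have "(\<Sum>y | (x, y) \<in> parcs H. b i y) = (\<Sum>y | (x, y) \<in> parcs H. e (h i) y)"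
        by (rule sum.cong) (use H in \<open>auto simp: b_def\<close>)
      then show ?thesis using eig[OF hi(1) x] x by (simp add: adjacency_def b_def)
    qed
    moreover have "\<exists>x\<in>?X. b i x \<noteq> 0"
    proof (rule ccontr)
      assume "\<not> (\<exists>x\<in>?X. b i x \<noteq> 0)"
      then have "dot ?X (b i) (b i) = 0" by (simp add: dot_def)
      then show False using orth[OF hi(1) hi(1)] by (simp add: dotb)
    qed
    ultimately have "is_eigenvector H (l (h i)) (b i)" by (simp add: is_eigenvector_def b_def)
    then have "{b i} \<subseteq> {f. \<exists>l\<in>J. is_eigenvector H l f}" using hi(2) by blast
    moreover have "b i = (\<lambda>x\<in>?X. \<Sum>f\<in>{b i}. (\<lambda>_. 1) f * f x)" by (auto simp: b_def)
    ultimately show ?thesis unfolding eigen_span_def mem_Collect_eq 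
      by (intro exI[of _ "{b i}"] exI[of _ "\<lambda>_. 1"] conjI) auto
  qed
  have 2: "dot ?X (b i) (b j) = of_bool (i = j)" if "i < card S" "j < card S" for i j
  proof -
    have "h i = h j \<longleftrightarrow> i = j" using h that by (auto simp: bij_betw_def dest: inj_onD)
    then show ?thesis using orth[of "h i" "h j"] hS that by (auto simp: dotb S_def)
  qed
  have 3: "\<exists>a. f = (\<lambda>x\<in>?X. \<Sum>i<card S. a i * b i x)" if fE: "f \<in> eigen_span H J" for f
  proof -
    from fE[unfolded eigen_span_def mem_Collect_eq] obtain S' a where 
      Sa: "f = (\<lambda>x\<in>?X. \<Sum>g\<in>S'. a g * g x) \<and> finite S' \<and> S' \<subseteq> {f. \<exists>l\<in>J. is_eigenvector H l f}"
      by (elim exE) (rule that)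
    have S': "S' \<subseteq> {f. \<exists>l\<in>J. is_eigenvector H l f}" and f: "f = (\<lambda>x\<in>?X. \<Sum>g\<in>S'. a g * g x)"
      using Sa by simp_all
    have ex: "g x = (\<Sum>j\<in>S. dot ?X g (e j) * e j x)" if g: "g \<in> S'" and x: "x \<in> ?X" for g x
    proof -
      obtain \<mu> where "\<mu> \<in> J" "is_eigenvector H \<mu> g" using S' g by blast
      then have \<mu>: "\<mu> \<in> J" "\<And>x. x \<in> ?X \<Longrightarrow> adjacency H g x = \<mu> * g x" 
        by (simp_all add: is_eigenvector_def)
      \<comment> \<open>Symmetry of the adjacency matrix, by exchanging the double sum over
        arcs.\<close>
      have z: "dot ?X g (e j) = 0" if j: "j < ?n" "l j \<noteq> \<mu>" for j
      proof -
        have im: "{y. (x, y) \<in> parcs H} = {y \<in> ?X. (x, y) \<in> parcs H}" for x using H by auto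
        have "\<mu> * dot ?X g (e j) = (\<Sum>x\<in>?X. \<Sum>y | (x, y) \<in> parcs H. g y * e j x)"
          unfolding dot_def sum_distrib_left sum_distrib_right[symmetric]
          using \<mu>(2) by (intro sum.cong refl) (simp add: adjacency_def mult.assoc[symmetric])
        also have "\<dots> = (\<Sum>x\<in>?X. \<Sum>y\<in>?X. if (x, y) \<in> parcs H then g y * e j x else 0)"
          unfolding im using fin by (intro sum.cong refl sum.inter_filter)
        also have "\<dots> = (\<Sum>y\<in>?X. \<Sum>x\<in>?X. if (x, y) \<in> parcs H then g y * e j x else 0)" by (rule sum.swap)
        also have "\<dots> = (\<Sum>y\<in>?X. \<Sum>x\<in>?X. if (y, x) \<in> parcs H then g y * e j x else 0)"
          using symD[OF sym] by (intro sum.cong refl if_cong) blast+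
        also have "\<dots> = (\<Sum>y\<in>?X. \<Sum>x | (y, x) \<in> parcs H. g y * e j x)"
          unfolding im using fin by (intro sum.cong refl sum.inter_filter[symmetric])
        also have "\<dots> = (\<Sum>y\<in>?X. l j * (g y * e j y))"
          by (rule sum.cong) (simp_all add: sum_distrib_left[symmetric] eig[OF j(1)])
        also have "\<dots> = l j * dot ?X g (e j)" by (simp only: dot_def sum_distrib_left)
        finally show ?thesis using j(2) by simp
      qed
      have "g x = (\<Sum>y\<in>?X. g y * of_bool (y = x))" using x fin by (simp add: of_bool_def if_distrib[of "\<lambda>c. _ * c"] cong: if_cong)
      also have "\<dots> = (\<Sum>y\<in>?X. g y * (\<Sum>j<?n. e j y * e j x))"
        using sd x by (intro sum.cong refl) (auto simp: spectral_data_def)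
      also have "\<dots> = (\<Sum>y\<in>?X. \<Sum>j<?n. g y * e j y * e j x)" by (simp add: sum_distrib_left mult.assoc)
      also have "\<dots> = (\<Sum>j<?n. dot ?X g (e j) * e j x)"
        by (subst sum.swap) (simp add: dot_def sum_distrib_right)
      also have "\<dots> = (\<Sum>j\<in>S. dot ?X g (e j) * e j x)"
        using z \<mu>(1) by (intro sum.mono_neutral_right) (auto simp: S_def)
      finally show ?thesis .
    qed
    define a' where "a' i = (\<Sum>g\<in>S'. a g * dot ?X g (e (h i)))" for i
    have "f x = (\<lambda>x\<in>?X. \<Sum>i<card S. a' i * b i x) x" for x
    proof (cases "x \<in> ?X")
      case True
      have "f x = (\<Sum>g\<in>S'. a g * (\<Sum>j\<in>S. dot ?X g (e j) * e j x))" using True ex by (simp add: f)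
      also have "\<dots> = (\<Sum>j\<in>S. (\<Sum>g\<in>S'. a g * dot ?X g (e j)) * e j x)"
        unfolding sum_distrib_left sum_distrib_right by (subst sum.swap) (simp add: mult.assoc)
      also have "\<dots> = (\<Sum>i\<in>{0..<card S}. a' i * e (h i) x)"
        unfolding a'_def by (rule sum.reindex_bij_betw[OF h, symmetric])
      finally show ?thesis using True by (simp add: b_def atLeast0LessThan)
    qed (simp add: f)
    then show ?thesis by blast
  qed
  have "is_orthonormal_basis ?X (eigen_span H J) (card S) b"
    unfolding is_orthonormal_basis_def using 1 2 3 by (simp add: dot_def)
  then show ?thesis unfolding S_def by blast
qed

text \<open>An eigenvalue within \<open>w\<close> of t contributes at most 1 / \<eta>; for one
  farther away, lowering the height from \<open>w\<close> to \<open>\<eta>\<close> multiplies the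
  Poisson kernel by at most 2 \<eta> / w.\<close>

lemma poisson_count:
  fixes l :: "nat \<Rightarrow> real"
  assumes \<eta>: "0 < \<eta>" "\<eta> \<le> w"
  shows "(\<Sum>j<n. \<eta> / ((t - l j)\<^sup>2 + \<eta>\<^sup>2)) 
    \<le> card {j. j < n \<and> \<bar>l j - t\<bar> \<le> w} / \<eta> + 2 * \<eta> / w * (\<Sum>j<n. w / ((t - l j)\<^sup>2 + w\<^sup>2))"
proof -
  have w: "0 < w" using \<eta> by simp
  have "\<eta> / ((t - l j)\<^sup>2 + \<eta>\<^sup>2) \<le> of_bool (\<bar>l j - t\<bar> \<le> w) / \<eta> + 2 * \<eta> / w * (w / ((t - l j)\<^sup>2 + w\<^sup>2))" for j
  proof (cases "\<bar>l j - t\<bar> \<le> w")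
    case True
    have "\<eta> / ((t - l j)\<^sup>2 + \<eta>\<^sup>2) \<le> \<eta> / \<eta>\<^sup>2" using \<eta> by (intro divide_left_mono) (auto intro!: mult_pos_pos add_nonneg_pos)
    also have "\<dots> = 1 / \<eta>" by (simp add: power2_eq_square)
    also have "0 \<le> 2 * \<eta> / w * (w / ((t - l j)\<^sup>2 + w\<^sup>2))" using \<eta> w by simp
    ultimately show ?thesis using True by simp
  next
    case False
    then have "w \<le> \<bar>t - l j\<bar>" by (simp add: abs_minus_commute)
    then have "w\<^sup>2 \<le> \<bar>t - l j\<bar>\<^sup>2" using w by (intro power_mono) auto
    then have q: "w\<^sup>2 \<le> (t - l j)\<^sup>2" by simp
    have pw: "0 < w\<^sup>2" using w by simp
    have "((t - l j)\<^sup>2 + w\<^sup>2) / 2 \<le> (t - l j)\<^sup>2 + \<eta>\<^sup>2" 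
    proof -
      have "(a + b) / 2 \<le> a + c" if "b \<le> a" "0 \<le> c" for a b c :: real using that by simp
      from this[OF q zero_le_power2] show ?thesis .
    qed
    then have "\<eta> / ((t - l j)\<^sup>2 + \<eta>\<^sup>2) \<le> \<eta> / (((t - l j)\<^sup>2 + w\<^sup>2) / 2)"
      using \<eta> pw by (intro divide_left_mono) (auto intro!: mult_pos_pos add_nonneg_pos)
    also have "\<dots> = 2 * \<eta> / w * (w / ((t - l j)\<^sup>2 + w\<^sup>2))" using w by (simp add: field_simps)
    finally show ?thesis using False by simp
  qed
  then have "(\<Sum>j<n. \<eta> / ((t - l j)\<^sup>2 + \<eta>\<^sup>2)) \<le> (\<Sum>j<n. of_bool (\<bar>l j - t\<bar> \<le> w) / \<eta> + 2 * \<eta> / w * (w / ((t - l j)\<^sup>2 + w\<^sup>2)))"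
    by (intro sum_mono)
  also have "\<dots> = (\<Sum>j<n. of_bool (\<bar>l j - t\<bar> \<le> w)) / \<eta> + 2 * \<eta> / w * (\<Sum>j<n. w / ((t - l j)\<^sup>2 + w\<^sup>2))"
    by (simp only: sum.distrib sum_divide_distrib sum_distrib_left)
  also have "(\<Sum>j<n. of_bool (\<bar>l j - t\<bar> \<le> w)) = real (card {j. j < n \<and> \<bar>l j - t\<bar> \<le> w})"
  proof -
    have "(\<Sum>j<n. of_bool (\<bar>l j - t\<bar> \<le> w)) = real (card ({..<n} \<inter> {j. \<bar>l j - t\<bar> \<le> w}))"
      by (subst sum_of_bool_eq) auto
    also have "{..<n} \<inter> {j. \<bar>l j - t\<bar> \<le> w} = {j. j < n \<and> \<bar>l j - t\<bar> \<le> w}" by auto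
    finally show ?thesis .
  qed
  finally show ?thesis .
qed

lemma Im_resolvent_term: "Im (1 / (Complex t y - of_real l)) = - (y / ((t - l)\<^sup>2 + y\<^sup>2))"
  by (simp add: Im_divide)

lemma exp_half_le: "0 \<le> x \<Longrightarrow> x \<le> 1 \<Longrightarrow> exp (x / 2) \<le> 1 + (x::real)"
proof -
  assume x: "0 \<le> x" "x \<le> 1"
  have "exp (x / 2) \<le> 1 + x / 2 + (x / 2)\<^sup>2" using x by (intro exp_bound) auto
  also have "(x / 2)\<^sup>2 \<le> x / 2" using x mult_left_mono[of x 1 x] by (simp add: power2_eq_square)
  finally show ?thesis by simp
qed

context core_graph
begin

text \<open>Comparing the Poisson kernels at heights \<open>\<theta> w\<close> and \<open>w\<close> detects eigenvalues at distance at most \<open>w\<close>.\<close>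

lemma count_near:
  assumes H: "is_lift n G H" "0 < n" and sd: "spectral_data H e l" 
    and tv: "tv_dist (empirical_law H m) (cover_law G r m) \<le> \<tau>" and \<tau>: "0 \<le> \<tau>"
    and k: "0 < k" "k \<le> B" and w: "0 < w" and \<theta>: "\<theta> = k / (8 * (B + 1))"
    and law: "\<And>y. 0 < y \<Longrightarrow> y \<le> w \<Longrightarrow> k \<le> - Im (trace (Complex t y)) \<and> cmod (trace (Complex t y)) \<le> B"
    and err: "4 * D0 / (\<theta> * w)\<^sup>2 / (1 + \<theta> * w / D0) ^ m + 2 * (1 / (\<theta> * w) + 2 * D0 / (\<theta> * w)\<^sup>2) * \<tau> \<le> min 1 (k / 2)"
  shows "k * \<theta> * w / 4 * real n \<le> card {j. j < card (pverts H) \<and> \<bar>l j - t\<bar> \<le> w}"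
proof -
  note Hs = lift_simps[OF H]
  let ?n = "card (pverts H)"
  define f where "f y = (\<Sum>j<?n. y / ((t - l j)\<^sup>2 + y\<^sup>2)) / ?n" for y
  define \<epsilon> where "\<epsilon> y = 4 * D0 / y\<^sup>2 / (1 + y / D0) ^ m + 2 * (1 / y + 2 * D0 / y\<^sup>2) * \<tau>" for y
  have n: "0 < real ?n" using Hs(2,4) by (simp add: card_gt_0_iff)
  have B: "0 < B + 1" using k by simp
  have \<theta>1: "0 < \<theta>" "\<theta> \<le> 1" using k B by (simp_all add: \<theta> divide_le_eq)
  define \<eta> where "\<eta> = \<theta> * w"
  have \<eta>: "0 < \<eta>" "\<eta> \<le> w" using \<theta>1 w by (simp_all add: \<eta>_def mult_left_le_one_le)
  have cmp: "\<bar>f y + Im (trace (Complex t y))\<bar> \<le> \<epsilon> y" if "0 < y" for y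
  proof -
    have "Im ((\<Sum>j<?n. 1 / (Complex t y - of_real (l j))) / of_nat ?n) = - f y"
      unfolding Im_divide_of_nat Im_sum Im_resolvent_term by (simp add: f_def sum_negf)
    then have "\<bar>f y + Im (trace (Complex t y))\<bar> 
        = \<bar>Im ((\<Sum>j<?n. 1 / (Complex t y - of_real (l j))) / of_nat ?n - trace (Complex t y))\<bar>"
      by simp
    also have "\<dots> \<le> \<epsilon> y"
      using trace_compare[OF H sd _ tv, of "Complex t y"] that unfolding \<epsilon>_def
      by (intro order.trans[OF abs_Im_le_cmod]) simp
    finally show ?thesis .
  qed
  have mono: "\<epsilon> w \<le> \<epsilon> \<eta>"
  proof -
    have "0 < 1 + \<eta> / D0" using \<eta> D0_pos by (simp add: add_pos_pos)
    then have "1 / (1 + w / D0) ^ m \<le> 1 / (1 + \<eta> / D0) ^ m"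
      using \<eta> D0_pos by (intro divide_left_mono power_mono mult_pos_pos zero_less_power) (auto simp: divide_right_mono add_pos_pos)
    moreover have q: "1 / w\<^sup>2 \<le> 1 / \<eta>\<^sup>2" using \<eta> by (intro divide_left_mono power_mono) auto
    ultimately have "4 * D0 * (1 / w\<^sup>2 * (1 / (1 + w / D0) ^ m)) \<le> 4 * D0 * (1 / \<eta>\<^sup>2 * (1 / (1 + \<eta> / D0) ^ m))"
      using D0_pos \<eta> by (intro mult_left_mono mult_mono) (auto simp: add_nonneg_nonneg)
    moreover have "1 / w + 2 * D0 * (1 / w\<^sup>2) \<le> 1 / \<eta> + 2 * D0 * (1 / \<eta>\<^sup>2)"
      using \<eta> D0_pos q by (intro add_mono mult_left_mono divide_left_mono) auto
    then have "2 * (1 / w + 2 * D0 * (1 / w\<^sup>2)) * \<tau> \<le> 2 * (1 / \<eta> + 2 * D0 * (1 / \<eta>\<^sup>2)) * \<tau>"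
      using \<tau> by (intro mult_right_mono mult_left_mono) auto
    ultimately show ?thesis unfolding \<epsilon>_def by simp
  qed
  have e: "\<epsilon> \<eta> \<le> 1" "\<epsilon> \<eta> \<le> k / 2" using err by (simp_all add: \<epsilon>_def \<eta>_def)
  let ?N = "real (card {j. j < ?n \<and> \<bar>l j - t\<bar> \<le> w})"
  have "f \<eta> \<le> (?N / \<eta> + 2 * \<eta> / w * (\<Sum>j<?n. w / ((t - l j)\<^sup>2 + w\<^sup>2))) / ?n"
    unfolding f_def using poisson_count[OF \<eta>] n by (intro divide_right_mono) auto
  also have "\<dots> = ?N / \<eta> / ?n + 2 * \<theta> * f w" using w by (simp add: add_divide_distrib f_def \<eta>_def)
  finally have 1: "f \<eta> \<le> ?N / \<eta> / ?n + 2 * \<theta> * f w" .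
  have "k - k / 2 \<le> f \<eta>" using cmp[OF \<eta>(1)] law[OF \<eta>] e(2) by linarith
  moreover have "f w \<le> B + 1"
    using cmp[OF w] law[OF w order_refl] mono e(1) abs_Im_le_cmod[of "trace (Complex t w)"] by linarith
  then have "2 * \<theta> * f w \<le> 2 * \<theta> * (B + 1)" using \<theta>1 by (intro mult_left_mono) auto
  \<comment> \<open>This fixes \<open>\<theta>\<close>: the far eigenvalues contribute at most k /
    4, while the kernel at the lower height is at least k / 2, so the near ones account for k /
    4.\<close>
  moreover have "\<theta> * (8 * (B + 1)) = k" using \<theta> B by (subst (asm) nonzero_eq_divide_eq) auto
  then have "2 * \<theta> * (B + 1) = k / 4" by (simp add: algebra_simps)
  ultimately have "k / 4 \<le> ?N / \<eta> / ?n" using 1 by linarith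
  then have "k / 4 * \<eta> * ?n \<le> ?N" using \<eta>(1) n by (simp add: field_simps)
  moreover have "real n \<le> ?n" using card_verts_pos mult_right_mono[of 1 "real (card (pverts G))" "real n"] unfolding Hs(3) by simp
  then have "k / 4 * \<eta> * n \<le> k / 4 * \<eta> * ?n" using k \<eta>(1) by (intro mult_left_mono) auto
  ultimately show ?thesis by (simp add: \<eta>_def mult_ac)
qed

end

section \<open>A connected graph of minimal degree 2 that is not a cycle has larger maximal
  degree\<close>

context core_graph
begin

text \<open>A longest path in a graph with all degrees 2 closes up to a cycle, which is a component.\<close>

lemma cycle_if_two_regular:
  assumes two: "\<And>v. v \<in> pverts G \<Longrightarrow> card {w. (v, w) \<in> parcs G} \<le> 2"
  shows "is_cycle_graph G"
proof -
  let ?N = "\<lambda>v. {w. (v, w) \<in> parcs G}"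
  have arc: "u \<in> pverts G" "v \<in> pverts G" if "(u, v) \<in> parcs G" for u v 
    using arc_fst_in_verts[OF that] arc_snd_in_verts[OF that] by auto
  have finN: "finite (?N v)" for v
    by (rule finite_subset[OF _ pair_finite_verts]) (use arc in auto)
  have only: "c = a \<or> c = b" if "(v, a) \<in> parcs G" "(v, b) \<in> parcs G" "(v, c) \<in> parcs G" "a \<noteq> b" for v a b c
  proof (rule ccontr)
    assume "\<not> (c = a \<or> c = b)"
    then have "card {a, b, c} = 3" using that(4) by auto
    moreover have "card {a, b, c} \<le> card (?N v)" using that by (intro card_mono finN) auto
    ultimately show False using two[OF arc(1)[OF that(1)]] by simp
  qed
  define path where "path vs \<longleftrightarrow> vs \<noteq> [] \<and> distinct vs \<and> set vs \<subseteq> pverts G \<and> 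
    (\<forall>i. Suc i < length vs \<longrightarrow> (vs ! i, vs ! Suc i) \<in> parcs G)" for vs
  have len: "length vs \<le> card (pverts G)" if "path vs" for vs
    using that card_mono[OF pair_finite_verts, of "set vs"] by (simp add: path_def distinct_card)
  have "path [r]" using root by (simp add: path_def)
  then obtain vs where vs: "path vs" and max: "\<And>us. path us \<Longrightarrow> length us \<le> length vs"
    using ex_has_greatest_nat[of path "[r]" length "Suc (card (pverts G))"] len by (metis less_Suc_eq_le)
  define n where "n = length vs"
  have dist: "distinct vs" and sub: "set vs \<subseteq> pverts G" and n0: "0 < n" using vs by (auto simp: path_def n_def)
  have step: "(vs ! i, vs ! Suc i) \<in> parcs G" if "Suc i < n" for i using vs that by (simp add: path_def n_def)
  have ne: "vs ! i \<noteq> vs ! j" if "i < n" "j < n" "i \<noteq> j" for i j 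
    using that dist by (simp add: n_def nth_eq_iff_index_eq)
  \<comment> \<open>By maximality the path cannot be prolonged at its start, so all neighbours of
    its first vertex lie on it.\<close>
  have start: "w \<in> set vs" if w: "(vs ! 0, w) \<in> parcs G" for w
  proof (rule ccontr)
    assume "w \<notin> set vs"
    moreover have "((w # vs) ! i, (w # vs) ! Suc i) \<in> parcs G" if "Suc i < Suc n" for i
      using that step[of "i - 1"] arcs_symmetric[OF w] by (cases i) auto
    ultimately have "path (w # vs)" using vs arc(2)[OF w] by (simp add: path_def n_def)
    then show False using max[of "w # vs"] by simp
  qed
  have deg0: "2 \<le> card (?N (vs ! 0))" using min_degree sub n0 by (simp add: n_def subset_iff)
  have n2: "2 \<le> n"
  proof (rule ccontr)
    assume "\<not> 2 \<le> n"
    then have "n = 1" using n0 by simp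
    then have "set vs = {vs ! 0}" by (cases vs) (auto simp: n_def)
    then have "?N (vs ! 0) \<subseteq> {vs ! 0}" using start by auto
    then have "card (?N (vs ! 0)) \<le> 1" using card_mono[of "{vs ! 0}"] by force
    then show False using deg0 by simp
  qed
  have "\<not> ?N (vs ! 0) \<subseteq> {vs ! 1}" using deg0 card_mono[of "{vs ! 1}" "?N (vs ! 0)"] by auto
  then obtain w where w: "(vs ! 0, w) \<in> parcs G" "w \<noteq> vs ! 1" by auto
  obtain k where k: "k < n" "w = vs ! k" using start[OF w(1)] by (auto simp: in_set_conv_nth n_def)
  have "k \<noteq> 0" using no_loops[OF w(1)] k(2) by (intro notI) simp
  moreover have "k \<noteq> 1" using w(2) k(2) by auto
  ultimately have k2: "2 \<le> k" by simp
  \<comment> \<open>An interior vertex already has its two path neighbours, so the second neighbour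
    of the first vertex must be the last vertex, and the path closes up.\<close>
  have "\<not> Suc k < n"
  proof
    assume kn: "Suc k < n"
    have "(vs ! k, vs ! (k - 1)) \<in> parcs G" using step[of "k - 1"] k k2 by (auto intro: arcs_symmetric)
    then have "vs ! 0 = vs ! (k - 1) \<or> vs ! 0 = vs ! Suc k"
      using step[OF kn] arcs_symmetric[OF w(1)] ne[of "k - 1" "Suc k"] kn unfolding k(2) by (intro only[of "vs ! k"]) auto
    moreover have "vs ! 0 \<noteq> vs ! (k - 1)" by (rule ne) (use k2 kn n0 in auto)
    moreover have "vs ! 0 \<noteq> vs ! Suc k" by (rule ne) (use kn n0 in auto)
    ultimately show False by simp
  qed
  then have kn: "k = n - 1" using k(1) by simp
  have n3: "3 \<le> n" using kn k2 by simp
  have nxt: "(vs ! i, vs ! (Suc i mod n)) \<in> parcs G" if "i < n" for i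
  proof (cases "Suc i < n")
    case False
    then have "i = k" "Suc i = n" using that kn by auto
    then show ?thesis using arcs_symmetric[OF w(1)] k(2) by simp
  qed (use step in simp)
  define A where "A = {(vs ! i, vs ! (Suc i mod n)) | i. i < n}"
  have AG: "A \<union> A\<inverse> \<subseteq> parcs G" unfolding A_def using nxt arcs_symmetric by auto
  have out: "(u, v) \<in> A \<union> A\<inverse>" if u: "u \<in> set vs" and uv: "(u, v) \<in> parcs G" for u v
  proof -
    obtain i where i: "i < n" "u = vs ! i" using u by (auto simp: in_set_conv_nth n_def)
    define j where "j = (if i = 0 then n - 1 else i - 1)"
    have j: "j < n" "Suc j mod n = i" using i n3 by (auto simp: j_def)
    have "j \<noteq> Suc i mod n" using i n3 by (auto simp: j_def mod_Suc split: if_splits)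
    then have "vs ! j \<noteq> vs ! (Suc i mod n)" using ne[of j "Suc i mod n"] j n0 by simp
    moreover have "(vs ! i, vs ! j) \<in> parcs G" using arcs_symmetric[OF nxt[OF j(1)]] j(2) by simp
    ultimately have "v = vs ! j \<or> v = vs ! (Suc i mod n)" using only[OF _ nxt[OF i(1)]] uv i(2) by blast
    then show ?thesis
    proof
      assume "v = vs ! j"
      then have "(v, u) \<in> A" unfolding A_def using i(2) j by (intro CollectI exI[of _ j]) simp
      then show ?thesis by simp
    next
      assume "v = vs ! (Suc i mod n)"
      then have "(u, v) \<in> A" unfolding A_def using i by (intro CollectI exI[of _ i]) simp
      then show ?thesis by simp
    qed
  qed
  have Avs: "A \<subseteq> set vs \<times> set vs" using n0 unfolding A_def n_def by auto
  have "pverts G \<subseteq> set vs"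
  proof (rule arc_closed_set)
    show "vs ! 0 \<in> set vs" "vs ! 0 \<in> pverts G" using n0 sub by (auto simp: n_def)
    show "v \<in> set vs" if "u \<in> set vs" "(u, v) \<in> parcs G" for u v using out[OF that] Avs by auto
  qed
  then have V: "pverts G = set vs" using sub by auto
  have "parcs G \<subseteq> A \<union> A\<inverse>"
  proof
    fix e assume e: "e \<in> parcs G"
    obtain u v where uv: "e = (u, v)" by (cases e)
    have "u \<in> set vs" using arc(1)[of u v] e uv V by simp
    then show "e \<in> A \<union> A\<inverse>" using out[of u v] e uv by simp
  qed
  then have "parcs G = A \<union> A\<inverse>" using AG by auto
  then show ?thesis
    unfolding is_cycle_graph_def Let_def using dist n3 V by (intro exI[of _ vs]) (simp add: A_def n_def)
qed

text \<open>Ensures ln (d - 1) > 0, hence that the radius constant c is positive.\<close>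

lemma max_degree_ge_3:
  assumes "\<not> is_cycle_graph G"
  shows "3 \<le> max_degree G"
proof (rule ccontr)
  assume "\<not> 3 \<le> max_degree G"
  then have le: "max_degree G \<le> 2" by simp
  have "card {w. (v, w) \<in> parcs G} \<le> 2" if v: "v \<in> pverts G" for v
  proof -
    have "out_degree (with_proj G) v \<le> max_degree G"
      unfolding max_degree_def using v pair_finite_verts by (intro Max_ge) auto
    then show ?thesis using le by (simp add: out_degree_pair)
  qed
  then show False using cycle_if_two_regular assms by blast
qed

end

section \<open>Choice of scales and conclusion\<close>

text \<open>The error of \<open>trace_compare\<close> at height a log log n / log n once the
  truncation factor has reached (log n)^3, one power more than the inverse square of the height
  costs; the total variation part carries 1 / sqrt n.\<close>

lemma error_tendsto:
  fixes a D :: real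
  assumes "0 < a" "0 < D"
  shows "((\<lambda>n. 4 * D / (a * (ln (ln n) / ln n))\<^sup>2 / (ln n) ^ 3 + 
      2 * (1 / (a * (ln (ln n) / ln n)) + 2 * D / (a * (ln (ln n) / ln n))\<^sup>2) * (2 / sqrt n)) \<longlongrightarrow> 0) at_top"
  using assms by real_asymp

context core_graph
begin

text \<open>\<open>count_near\<close> at the scale w = A log log n / log n, with A large enough, in
  terms of c, for the Chebyshev truncation at order c log n to be accurate. The count k \<theta> w n
  / 4 is then at least a multiple of n / log n.\<close>

lemma eigenvalue_count:
  assumes c: "0 < c"
  shows "\<exists>F. finite F \<and> (\<forall>t\<in>adj_spectrum cover. t \<in> F \<or> \<bar>t\<bar> \<le> D0) \<and>
    (\<forall>c1>0. \<exists>A>0. \<exists>\<kappa>>0. \<exists>n0. \<forall>n\<ge>n0. \<forall>H e l. \<forall>t\<in>adj_spectrum cover - (\<Union>x\<in>F. ball x c1). 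
      3 \<le> n \<longrightarrow> is_lift n G H \<longrightarrow> spectral_data H e l \<longrightarrow>
      tv_dist (empirical_law H (nat \<lfloor>c * ln (real n)\<rfloor>)) (cover_law G r (nat \<lfloor>c * ln (real n)\<rfloor>)) \<le> 2 / sqrt (real n) \<longrightarrow>
      \<kappa> * (n / ln n) \<le> card {j. j < card (pverts H) \<and> \<bar>l j - t\<bar> \<le> A * (ln (ln (real n)) / ln (real n))})"
proof -
  obtain F where F: "finite F" "\<forall>t\<in>adj_spectrum cover. t \<in> F \<or> \<bar>t\<bar> \<le> D0"
    and law: "\<forall>c1>0. \<exists>k>0. \<exists>B>0. \<exists>\<delta>>0. \<forall>t\<in>adj_spectrum cover - (\<Union>x\<in>F. ball x c1). \<forall>y. 0 < y \<and> y < \<delta> \<longrightarrow>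
       k \<le> - Im (trace (Complex t y)) \<and> cmod (trace (Complex t y)) \<le> B"
    using spectrum_local_law by blast
  have "\<exists>A>0. \<exists>\<kappa>>0. \<exists>n0. \<forall>n\<ge>n0. \<forall>H e l. \<forall>t\<in>adj_spectrum cover - (\<Union>x\<in>F. ball x c1). 
      3 \<le> n \<longrightarrow> is_lift n G H \<longrightarrow> spectral_data H e l \<longrightarrow>
      tv_dist (empirical_law H (nat \<lfloor>c * ln (real n)\<rfloor>)) (cover_law G r (nat \<lfloor>c * ln (real n)\<rfloor>)) \<le> 2 / sqrt (real n) \<longrightarrow>
      \<kappa> * (n / ln n) \<le> card {j. j < card (pverts H) \<and> \<bar>l j - t\<bar> \<le> A * (ln (ln (real n)) / ln (real n))}"
    if c1: "0 < c1" for c1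
  proof -
    from law[rule_format, OF c1] obtain k B0 \<delta> where k: "0 < k" and B0: "0 < B0" and \<delta>: "0 < \<delta>" 
      and lw: "\<forall>t\<in>adj_spectrum cover - (\<Union>x\<in>F. ball x c1). \<forall>y. 0 < y \<and> y < \<delta> \<longrightarrow>
       k \<le> - Im (trace (Complex t y)) \<and> cmod (trace (Complex t y)) \<le> B0"
      by (elim exE conjE) (rule that)
    define B where "B = max k B0"
    have kB: "k \<le> B" by (simp add: B_def)
    define \<theta> where "\<theta> = k / (8 * (B + 1))"
    have \<theta>: "0 < \<theta>" using k kB by (simp add: \<theta>_def)
    \<comment> \<open>From \<open>a * c = 12 * D0\<close>, a truncation order at least c \<xi> / 2
      and 1 + x at least exp (x / 2), the factor (1 + x)^m is at least exp (3 ln \<xi>), the cube of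
      \<xi> = ln n.\<close>
    define A where "A = 12 * D0 / (c * \<theta>)"
    have A: "0 < A" using D0_pos c \<theta> by (simp add: A_def)
    define a where "a = \<theta> * A"
    have a: "0 < a" using \<theta> A by (simp add: a_def)
    have ac: "a * c = 12 * D0" using c \<theta> by (simp add: a_def A_def field_simps)
    define w where "w n = A * (ln (ln (real n)) / ln (real n))" for n :: nat
    define err where "err n = 4 * D0 / (a * (ln (ln (real n)) / ln (real n)))\<^sup>2 / (ln (real n)) ^ 3 + 
      2 * (1 / (a * (ln (ln (real n)) / ln (real n))) + 2 * D0 / (a * (ln (ln (real n)) / ln (real n)))\<^sup>2) * (2 / sqrt (real n))" for n :: nat
    have "err \<longlonglongrightarrow> 0"
      unfolding err_def by (rule filterlim_compose[OF error_tendsto[OF a D0_pos] filterlim_real_sequentially])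
    then have e1: "\<forall>\<^sub>F n in sequentially. err n < min 1 (k / 2)" using k by (intro order_tendstoD(2)) auto
    have "w \<longlonglongrightarrow> 0" unfolding w_def using A by real_asymp
    then have e2: "\<forall>\<^sub>F n in sequentially. w n < \<delta>" using \<delta> by (intro order_tendstoD(2)) auto
    have "(\<lambda>n::nat. a * (ln (ln (real n)) / ln (real n)) / D0) \<longlonglongrightarrow> 0" using a D0_pos by real_asymp
    then have e3: "\<forall>\<^sub>F n in sequentially. a * (ln (ln (real n)) / ln (real n)) / D0 < 1" by (intro order_tendstoD(2)) auto
    have e4: "\<forall>\<^sub>F n::nat in sequentially. 2 \<le> c * ln (real n)" using c by real_asymp
    from eventually_conj[OF e1 eventually_conj[OF e2 eventually_conj[OF e3 e4]]]
    obtain n0 where n0: "\<And>n. n0 \<le> n \<Longrightarrow> err n < min 1 (k / 2) \<and> w n < \<delta> \<and> 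
        a * (ln (ln (real n)) / ln (real n)) / D0 < 1 \<and> 2 \<le> c * ln (real n)"
      unfolding eventually_sequentially by blast
    \<comment> \<open>The count is proportional to n ln (ln n) / ln n; replacing ln (ln n) by its
      least value, at n = 3, leaves n / ln n.\<close>
    define \<kappa> where "\<kappa> = k * \<theta> * A * ln (ln 3) / 4"
    have l3: "1 < ln (3::real)" using ln3_gt_1 .
    have \<kappa>: "0 < \<kappa>" using k \<theta> A l3 by (simp add: \<kappa>_def)
    have main: "\<kappa> * (n / ln n) \<le> card {j. j < card (pverts H) \<and> \<bar>l j - t\<bar> \<le> w n}"
      if n: "n0 \<le> n" "3 \<le> n" and H: "is_lift n G H" and sd: "spectral_data H e l" 
        and t: "t \<in> adj_spectrum cover - (\<Union>x\<in>F. ball x c1)"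
        and tv: "tv_dist (empirical_law H (nat \<lfloor>c * ln (real n)\<rfloor>)) (cover_law G r (nat \<lfloor>c * ln (real n)\<rfloor>)) \<le> 2 / sqrt (real n)"
      for n H e l t
    proof -
      define \<xi> where "\<xi> = ln (real n)"
      define L where "L = ln \<xi>"
      have \<xi>3: "ln 3 \<le> \<xi>" unfolding \<xi>_def using n by simp
      then have \<xi>: "1 < \<xi>" using l3 by simp
      have L3: "ln (ln 3) \<le> L" unfolding L_def using \<xi>3 l3 by simp
      have "0 < ln (ln (3::real))" using l3 by simp
      then have L: "0 < L" using L3 by linarith
      define m where "m = nat \<lfloor>c * \<xi>\<rfloor>"
      have wn: "w n = A * (L / \<xi>)" by (simp add: w_def L_def \<xi>_def)
      have w0: "0 < w n" using A L \<xi> by (simp add: wn)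
      have tw: "\<theta> * w n = a * (L / \<xi>)" by (simp add: wn a_def)
      note n0' = n0[OF n(1), folded \<xi>_def, folded L_def]
      define x where "x = a * (L / \<xi>) / D0"
      have x: "0 \<le> x" "x \<le> 1" using n0' a L \<xi> D0_pos by (simp_all add: x_def)
      have m: "c * \<xi> / 2 \<le> real m" using n0' unfolding m_def by linarith
      have "\<xi> ^ 3 = exp (3 * L)" using \<xi> exp_of_nat_mult[of 3 L] by (simp add: L_def)
      also have "3 * L = c * \<xi> / 2 * (x / 2)"
      proof -
        have "c * \<xi> / 2 * (x / 2) = (a * c) * L * (\<xi> / \<xi>) / (4 * D0)" by (simp add: x_def field_simps)
        also have "\<dots> = 3 * L" using \<xi> D0_pos by (simp add: ac)
        finally show ?thesis by simp
      qed
      also have "exp (c * \<xi> / 2 * (x / 2)) \<le> exp (real m * (x / 2))"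
        unfolding exp_le_cancel_iff by (rule mult_right_mono[OF m]) (use x in simp)
      also have "\<dots> = exp (x / 2) ^ m" by (rule exp_of_nat_mult)
      also have "\<dots> \<le> (1 + x) ^ m" using exp_half_le[OF x] by (intro power_mono) auto
      finally have pw: "\<xi> ^ 3 \<le> (1 + x) ^ m" .
      have "4 * D0 / (\<theta> * w n)\<^sup>2 / (1 + \<theta> * w n / D0) ^ m + 2 * (1 / (\<theta> * w n) + 2 * D0 / (\<theta> * w n)\<^sup>2) * (2 / sqrt (real n)) \<le> err n"
      proof -
        have "4 * D0 / (a * (L / \<xi>))\<^sup>2 / (1 + x) ^ m \<le> 4 * D0 / (a * (L / \<xi>))\<^sup>2 / \<xi> ^ 3"
          using pw \<xi> D0_pos x by (intro divide_left_mono mult_pos_pos zero_less_power) auto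
        then show ?thesis unfolding err_def tw x_def L_def \<xi>_def by simp
      qed
      then have er: "4 * D0 / (\<theta> * w n)\<^sup>2 / (1 + \<theta> * w n / D0) ^ m + 2 * (1 / (\<theta> * w n) + 2 * D0 / (\<theta> * w n)\<^sup>2) * (2 / sqrt (real n)) \<le> min 1 (k / 2)"
        using n0' by linarith
      have lw': "k \<le> - Im (trace (Complex t y)) \<and> cmod (trace (Complex t y)) \<le> B" if "0 < y" "y \<le> w n" for y
      proof -
        have "y < \<delta>" using that n0' by simp
        then have "k \<le> - Im (trace (Complex t y)) \<and> cmod (trace (Complex t y)) \<le> B0" using lw t that(1) by blast
        then show ?thesis by (simp add: B_def le_max_iff_disj)
      qed
      have "k * \<theta> * w n / 4 * real n \<le> card {j. j < card (pverts H) \<and> \<bar>l j - t\<bar> \<le> w n}"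
        by (rule count_near[OF H _ sd tv[folded \<xi>_def, folded m_def] _ k kB w0 \<theta>_def lw' er]) (use n in auto)
      moreover have "\<kappa> * (n / \<xi>) \<le> k * \<theta> * w n / 4 * real n"
      proof -
        have "k * \<theta> * A * ln (ln 3) / 4 * (n / \<xi>) \<le> k * \<theta> * A * L / 4 * (n / \<xi>)"
          using L3 k \<theta> A \<xi> by (intro mult_right_mono divide_right_mono mult_left_mono) auto
        then show ?thesis by (simp add: \<kappa>_def wn field_simps)
      qed
      ultimately show ?thesis unfolding \<xi>_def by linarith
    qed
    show ?thesis
      by (rule exI[of _ A], rule conjI[OF A], rule exI[of _ \<kappa>], rule conjI[OF \<kappa>], rule exI[of _ n0])
        (intro allI ballI impI, rule main[unfolded w_def])
  qed
  then show ?thesis using F by blast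
qed

end

text \<open>With \<xi> = ln n, the exponent s^2 N / 4 is at least \<Lambda>^2 \<xi>^3 times C'^2
  \<kappa> / 4. The three summands in the condition on C' absorb ln (2 v), the union bound term
  \<xi>, and ln \<Lambda> times \<xi> / (2 ln \<xi>), where ln \<xi> is at least ln (ln 3) and ln
  \<Lambda> at most \<Lambda>^2.\<close>

lemma tail_estimate:
  fixes n :: nat and \<Lambda> \<kappa> v N C' s :: real
  assumes n: "3 \<le> n" and \<Lambda>: "1 \<le> \<Lambda>" and \<kappa>: "0 < \<kappa>" and v: "1 \<le> v" and N: "\<kappa> * (n / ln n) \<le> N" 
    and C': "ln (2 * v) + 1 + 1 / (2 * ln (ln 3)) \<le> C'\<^sup>2 * \<kappa> / 4"
    and s: "s = \<Lambda> * C' * (ln (real n))\<^sup>2 * real n powr (- 1 / 2)"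
  shows "2 * (v * n) * exp (- (s\<^sup>2 * N / 4)) \<le> \<Lambda> powr (- (ln (real n) / (2 * ln (ln (real n)))))"
proof -
  define \<xi> where "\<xi> = ln (real n)"
  define K where "K = 1 / (2 * ln (ln (3::real)))"
  have l3: "1 < ln (3::real)" by (rule ln3_gt_1)
  have n0: "0 < real n" using n by simp
  have \<xi>3: "ln 3 \<le> \<xi>" unfolding \<xi>_def using n by simp
  then have \<xi>: "1 < \<xi>" using l3 by simp
  have L3: "ln (ln 3) \<le> ln \<xi>" using \<xi>3 l3 by simp
  have ll: "0 < ln (ln (3::real))" using l3 by simp
  have K: "0 < K" using ll by (simp add: K_def)
  have "1 / (2 * ln \<xi>) \<le> K" unfolding K_def by (intro divide_left_mono mult_pos_pos; (use L3 ll in linarith))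
  then have "\<xi> * (1 / (2 * ln \<xi>)) \<le> \<xi> * K" using \<xi> by (intro mult_left_mono) auto
  then have lK: "\<xi> / (2 * ln \<xi>) \<le> \<xi> * K" by simp
  have ln\<Lambda>: "0 \<le> ln \<Lambda>" "ln \<Lambda> \<le> \<Lambda>\<^sup>2" "1 \<le> \<Lambda>\<^sup>2"
  proof -
    show "0 \<le> ln \<Lambda>" using \<Lambda> by (rule ln_ge_zero)
    show "1 \<le> \<Lambda>\<^sup>2" using \<Lambda> by (rule one_le_power)
    have "\<Lambda> ^ 1 \<le> \<Lambda>\<^sup>2" using \<Lambda> by (intro power_increasing) auto
    then show "ln \<Lambda> \<le> \<Lambda>\<^sup>2" using ln_le_minus_one[of \<Lambda>] \<Lambda> by simp
  qed
  have lv: "0 \<le> ln (2 * v)" using v by simp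
  have "(real n powr (- 1 / 2))\<^sup>2 = 1 / n" 
    using n0 by (simp add: powr_minus_divide powr_half_sqrt power_divide)
  then have s2: "s\<^sup>2 = \<Lambda>\<^sup>2 * C'\<^sup>2 * \<xi> ^ 4 / n" by (simp add: s \<xi>_def power_mult_distrib flip: power_mult)
  have "\<Lambda>\<^sup>2 * C'\<^sup>2 * \<xi> ^ 3 * \<kappa> / 4 = s\<^sup>2 * (\<kappa> * (n / \<xi>)) / 4"
    using n0 \<xi> by (simp add: s2 field_simps power4_eq_xxxx power3_eq_cube)
  also have "\<dots> \<le> s\<^sup>2 * N / 4" using N by (intro divide_right_mono mult_left_mono) (auto simp: \<xi>_def)
  finally have 1: "\<Lambda>\<^sup>2 * \<xi> ^ 3 * (C'\<^sup>2 * \<kappa> / 4) \<le> s\<^sup>2 * N / 4" by (simp add: mult_ac)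
  have "\<xi> ^ 1 \<le> \<xi> ^ 3" using \<xi> by (intro power_increasing) auto
  then have q: "\<Lambda>\<^sup>2 * \<xi> \<le> \<Lambda>\<^sup>2 * \<xi> ^ 3" by (intro mult_left_mono) auto
  have "\<Lambda>\<^sup>2 * \<xi> * (ln (2 * v) + 1 + K) \<le> \<Lambda>\<^sup>2 * \<xi> ^ 3 * (C'\<^sup>2 * \<kappa> / 4)"
    by (rule mult_mono[OF q C'[folded K_def]]) (use lv K \<xi> in simp_all)
  moreover have "ln (2 * v) + \<xi> + ln \<Lambda> * (\<xi> * K) \<le> \<Lambda>\<^sup>2 * \<xi> * (ln (2 * v) + 1 + K)"
  proof -
    have q: "1 \<le> \<Lambda>\<^sup>2 * \<xi>" "\<xi> \<le> \<Lambda>\<^sup>2 * \<xi>" using mult_mono[of 1 "\<Lambda>\<^sup>2" 1 \<xi>] mult_mono[of 1 "\<Lambda>\<^sup>2" \<xi> \<xi>] ln\<Lambda>(3) \<xi> by auto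
    have "1 * ln (2 * v) \<le> \<Lambda>\<^sup>2 * \<xi> * ln (2 * v)" using q lv by (intro mult_right_mono) auto
    moreover have "ln \<Lambda> * (\<xi> * K) \<le> \<Lambda>\<^sup>2 * (\<xi> * K)" using ln\<Lambda> \<xi> K by (intro mult_right_mono) auto
    ultimately show ?thesis using q(2) by (simp add: algebra_simps)
  qed
  moreover have "ln \<Lambda> * (\<xi> / (2 * ln \<xi>)) \<le> ln \<Lambda> * (\<xi> * K)" using lK ln\<Lambda> by (intro mult_left_mono) auto
  ultimately have "ln (2 * v) + \<xi> - s\<^sup>2 * N / 4 \<le> - (\<xi> / (2 * ln \<xi>)) * ln \<Lambda>"
    using 1 by (simp add: mult.commute)
  then have "exp (ln (2 * v) + \<xi> - s\<^sup>2 * N / 4) \<le> exp (- (\<xi> / (2 * ln \<xi>)) * ln \<Lambda>)" by simp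
  moreover have "exp (ln (2 * v) + \<xi> - s\<^sup>2 * N / 4) = 2 * (v * n) * exp (- (s\<^sup>2 * N / 4))"
  proof -
    have "exp (ln (2 * v) + \<xi> - s\<^sup>2 * N / 4) = exp (ln (2 * v)) * exp \<xi> * exp (- (s\<^sup>2 * N / 4))"
      by (simp only: diff_conv_add_uminus exp_add)
    then show ?thesis using v n0 by (simp add: \<xi>_def)
  qed
  moreover have "exp (- (\<xi> / (2 * ln \<xi>)) * ln \<Lambda>) = \<Lambda> powr (- (\<xi> / (2 * ln \<xi>)))"
    using \<Lambda> by (simp add: powr_def)
  ultimately show ?thesis unfolding \<xi>_def by (simp only:)
qed

text \<open>The window around the midpoint takes only half of the length, so it avoids the end
  points whether or not they belong to \<open>J\<close>.\<close>

lemma interval_middle: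
  fixes J :: "real set"
  assumes J: "is_interval J" "J \<subseteq> {- M..M}" and w: "0 < w" "4 * w \<le> measure lborel J"
  shows "\<exists>t. \<forall>s. \<bar>s - t\<bar> \<le> w \<longrightarrow> s \<in> J"
proof -
  have pos: "0 < measure lborel J" using w by simp
  then have ne: "J \<noteq> {}" by auto
  \<comment> \<open>A set that is not measurable has measure 0 by convention, so positive measure
    gives measurability.\<close>
  have Js: "J \<in> sets lborel" using pos measure_notin_sets[of J lborel] by force
  have bd: "bdd_below J" "bdd_above J" using bdd_below_mono[OF bdd_below_Icc J(2)] bdd_above_mono[OF bdd_above_Icc J(2)] by auto
  define a where "a = Inf J"
  define b where "b = Sup J"
  have Jab: "J \<subseteq> {a..b}" using bd by (auto simp: a_def b_def cInf_lower cSup_upper)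
  then have ab: "a \<le> b" using ne by fastforce
  have "measure lborel J \<le> measure lborel {a..b}" by (rule measure_mono_fmeasurable[OF Jab Js], intro fmeasurableI) (auto simp: emeasure_lborel_Icc_eq)
  then have W: "4 * w \<le> b - a" using w(2) ab by simp
  have "s \<in> J" if "\<bar>s - (a + b) / 2\<bar> \<le> w" for s
  proof -
    have "s - (a + b) / 2 \<le> w" "(a + b) / 2 - s \<le> w" using that by (simp_all add: abs_le_iff)
    then have "a < s" "s < b" using W w(1) by (simp_all add: field_simps)
    obtain u where u: "u \<in> J" "u < s" using cInf_lessD[OF ne] \<open>a < s\<close> unfolding a_def by blast
    obtain v where v: "v \<in> J" "s < v" using less_cSupD[OF ne] \<open>s < b\<close> unfolding b_def by blast
    show ?thesis using J(1) u v unfolding is_interval_1 by (meson less_imp_le)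
  qed
  then show ?thesis by blast
qed

theorem theorem5p7:
  fixes G :: "'a pair_pre_digraph" and r :: 'a and T :: "'a list pair_pre_digraph"
    and d :: nat and c :: real
  assumes graph: "pair_graph G"
    and conn: "Digraph_Component.connected (with_proj G)"
    and min_degree: "\<forall>v\<in>pverts G. 2 \<le> out_degree (with_proj G) v"
    and not_cycle: "\<not> is_cycle_graph G"
    and base: "r \<in> pverts G"
    and T: "T = universal_cover G r"
    and d: "d = max_degree G"
    and c: "c = 1 / (8 * ln (real d - 1))"
  shows "\<exists>II :: real \<Rightarrow> real \<Rightarrow> real set.
    (\<forall>c1 c2. 0 < c1 \<and> c1 < c2 \<longrightarrow>
      (\<exists>C>0. \<exists>C'>0. \<forall>n::nat. \<forall>\<Lambda>::real. \<forall>J::real set. \<forall>Gn :: ('a \<times> nat) pair_pre_digraph.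
         3 \<le> n \<and> 0 < \<Lambda> \<and>
         is_interval J \<and> J \<subseteq> adj_spectrum T - II c1 c2 \<and>
         C * (ln (ln (real n)) / ln (real n)) \<le> measure lborel J \<and>
         is_lift n G Gn \<and>
         (let h = nat \<lfloor>c * ln (real n)\<rfloor>
          in tv_dist (empirical_law Gn h) (cover_law G r h) \<le> 2 / sqrt (real n))
         \<longrightarrow>
         (\<exists>u\<in>eigen_span Gn J. \<exists>x\<in>pverts Gn. u x \<noteq> 0) \<and>
         measure (random_eigenvector Gn J)
           {u \<in> space (random_eigenvector Gn J).
              \<Lambda> * C' * (ln (real n))\<^sup>2 * real n powr (- 1 / 2) \<le> sup_norm (pverts Gn) u}
         \<le> \<Lambda> powr (- (ln (real n) / (2 * ln (ln (real n)))))))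
    \<and> (\<forall>c1 c2. 0 < c1 \<and> c1 \<le> c2 \<longrightarrow>
        (\<exists>\<J>. finite \<J> \<and> (\<forall>J\<in>\<J>. open J \<and> is_interval J) \<and> II c1 c2 = \<Union>\<J>))
    \<and> (\<exists>F. finite F \<and>
        (\<forall>\<epsilon>>0. \<exists>\<delta>>0. \<exists>K>0. \<forall>c1 c2. 0 < c1 \<and> c1 \<le> c2 \<and> c1 < \<delta> \<and> K < c2 \<longrightarrow>
           II c1 c2 \<subseteq> (\<Union>x\<in>F. ball x \<epsilon>)))
    \<and> (\<exists>\<delta>>0. \<exists>K>0. \<forall>c1 c2. 0 < c1 \<and> c1 \<le> c2 \<and> c1 < \<delta> \<and> K < c2 \<longrightarrow>
        adj_spectrum T - II c1 c2 \<noteq> {})"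
proof -
  interpret core_graph G r
    by (intro core_graph.intro base_graph.intro core_graph_axioms.intro graph base conn)
      (use min_degree in \<open>simp add: out_degree_pair\<close>)
  have Tc: "T = cover" by (simp add: T cover_def)
  have "3 \<le> d" unfolding d by (rule max_degree_ge_3[OF not_cycle])
  then have c0: "0 < c" by (simp add: c)
  obtain F where F: "finite F" "\<forall>t\<in>adj_spectrum cover. t \<in> F \<or> \<bar>t\<bar> \<le> D0"
    and count: "\<forall>c1>0. \<exists>A>0. \<exists>\<kappa>>0. \<exists>n0. \<forall>n\<ge>n0. \<forall>H e l. \<forall>t\<in>adj_spectrum cover - (\<Union>x\<in>F. ball x c1). 
      3 \<le> n \<longrightarrow> is_lift n G H \<longrightarrow> spectral_data H e l \<longrightarrow>
      tv_dist (empirical_law H (nat \<lfloor>c * ln (real n)\<rfloor>)) (cover_law G r (nat \<lfloor>c * ln (real n)\<rfloor>)) \<le> 2 / sqrt (real n) \<longrightarrow>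
      \<kappa> * (n / ln n) \<le> card {j. j < card (pverts H) \<and> \<bar>l j - t\<bar> \<le> A * (ln (ln (real n)) / ln (real n))}"
    using eigenvalue_count[OF c0] by blast
  \<comment> \<open>The open c1-neighbourhood of the finite set on which continuation may fail; it
    shrinks to that set as c1 tends to 0.\<close>
  define II :: "real \<Rightarrow> real \<Rightarrow> real set" where "II c1 c2 = (\<Union>x\<in>F. ball x c1)" for c1 c2
  \<comment> \<open>Bounds the whole spectrum, including its points in \<open>F\<close>, and hence
    the length of any admissible interval by 2 M.\<close>
  define M where "M = Max (insert D0 (abs ` F))"
  have spM: "\<bar>t\<bar> \<le> M" if "t \<in> adj_spectrum cover" for t
    unfolding M_def using F that by (cases "t \<in> F") (auto simp: Max_ge_iff)
  have D0M: "D0 \<le> M" unfolding M_def using F(1) by (intro Max_ge) auto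
  have l3: "1 < ln (3::real)" by (rule ln3_gt_1)
  have ll3: "0 < ln (ln (3::real))" using l3 by simp
  have part1: "\<exists>C>0. \<exists>C'>0. \<forall>n::nat. \<forall>\<Lambda>::real. \<forall>J::real set. \<forall>Gn :: ('a \<times> nat) pair_pre_digraph.
         3 \<le> n \<and> 0 < \<Lambda> \<and>
         is_interval J \<and> J \<subseteq> adj_spectrum T - II c1 c2 \<and>
         C * (ln (ln (real n)) / ln (real n)) \<le> measure lborel J \<and>
         is_lift n G Gn \<and>
         (let h = nat \<lfloor>c * ln (real n)\<rfloor>
          in tv_dist (empirical_law Gn h) (cover_law G r h) \<le> 2 / sqrt (real n))
         \<longrightarrow>
         (\<exists>u\<in>eigen_span Gn J. \<exists>x\<in>pverts Gn. u x \<noteq> 0) \<and>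
         measure (random_eigenvector Gn J)
           {u \<in> space (random_eigenvector Gn J).
              \<Lambda> * C' * (ln (real n))\<^sup>2 * real n powr (- 1 / 2) \<le> sup_norm (pverts Gn) u}
         \<le> \<Lambda> powr (- (ln (real n) / (2 * ln (ln (real n)))))" if c1: "0 < c1" for c1 c2
  proof -
    from count[rule_format, OF c1] obtain A \<kappa> n0 where A: "0 < A" and \<kappa>: "0 < \<kappa>" 
      and cnt: "\<forall>n\<ge>n0. \<forall>H e l. \<forall>t\<in>adj_spectrum cover - (\<Union>x\<in>F. ball x c1). 
      3 \<le> n \<longrightarrow> is_lift n G H \<longrightarrow> spectral_data H e l \<longrightarrow>
      tv_dist (empirical_law H (nat \<lfloor>c * ln (real n)\<rfloor>)) (cover_law G r (nat \<lfloor>c * ln (real n)\<rfloor>)) \<le> 2 / sqrt (real n) \<longrightarrow>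
      \<kappa> * (n / ln n) \<le> card {j. j < card (pverts H) \<and> \<bar>l j - t\<bar> \<le> A * (ln (ln (real n)) / ln (real n))}"
      by (elim exE conjE) (rule that)
    define v where "v = real (card (pverts G))"
    have v: "1 \<le> v" using card_verts_pos by (simp add: v_def)
    \<comment> \<open>The first summand makes the interval contain a window of half-width A log log
      n / log n. The second makes the required length exceed 2 M whenever n is below
      \<open>n0\<close>, so that no admissible interval exists there.\<close>
    define C where "C = 4 * A + (2 * M + 1) * (ln (real n0 + 3) / ln (ln 3))"
    \<comment> \<open>At least 1, so that C' is at most its square and the linear bound suffices for
      \<open>tail_estimate\<close>.\<close>
    define C' where "C' = 1 + 4 / \<kappa> * (ln (2 * v) + 1 + 1 / (2 * ln (ln 3)))"
    have M0: "0 < M" using D0M D0_pos by simp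
    have n03: "0 \<le> ln (real n0 + 3) / ln (ln 3)" using ll3 by simp
    have C: "0 < C" "4 * A \<le> C" "(2 * M + 1) * (ln (real n0 + 3) / ln (ln 3)) \<le> C"
      using A M0 mult_nonneg_nonneg[of "2 * M + 1", OF _ n03] by (simp_all add: C_def add_pos_nonneg)
    have Kp: "0 < ln (2 * v) + 1 + 1 / (2 * ln (ln 3))" using v ll3 by (simp add: add_nonneg_pos)
    have C1: "1 \<le> C'" using Kp \<kappa> by (simp add: C'_def)
    then have C2: "C' \<le> C'\<^sup>2" by (simp add: self_le_power)
    have C': "ln (2 * v) + 1 + 1 / (2 * ln (ln 3)) \<le> C'\<^sup>2 * \<kappa> / 4"
    proof -
      have "ln (2 * v) + 1 + 1 / (2 * ln (ln 3)) \<le> C' * \<kappa> / 4" using \<kappa> by (simp add: C'_def field_simps)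
      also have "\<dots> \<le> C'\<^sup>2 * \<kappa> / 4" using C2 \<kappa> by (intro divide_right_mono mult_right_mono) auto
      finally show ?thesis .
    qed
    have main: "(\<exists>u\<in>eigen_span Gn J. \<exists>x\<in>pverts Gn. u x \<noteq> 0) \<and>
         measure (random_eigenvector Gn J)
           {u \<in> space (random_eigenvector Gn J).
              \<Lambda> * C' * (ln (real n))\<^sup>2 * real n powr (- 1 / 2) \<le> sup_norm (pverts Gn) u}
         \<le> \<Lambda> powr (- (ln (real n) / (2 * ln (ln (real n)))))"
      if n: "3 \<le> n" and \<Lambda>: "0 < \<Lambda>" and J: "is_interval J" "J \<subseteq> adj_spectrum T - II c1 c2"
        and len: "C * (ln (ln (real n)) / ln (real n)) \<le> measure lborel J" and lift: "is_lift n G Gn"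
        and tv: "tv_dist (empirical_law Gn (nat \<lfloor>c * ln (real n)\<rfloor>)) (cover_law G r (nat \<lfloor>c * ln (real n)\<rfloor>)) \<le> 2 / sqrt (real n)"
      for n :: nat and \<Lambda> :: real and J :: "real set" and Gn :: "('a \<times> nat) pair_pre_digraph"
    proof -
      have npos: "0 < n" using n by simp
      note Hs = lift_simps[OF lift npos]
      interpret Gn: bounded_graph "parcs Gn" D0 by (rule Hs(6))
      define \<xi> where "\<xi> = ln (real n)"
      have \<xi>3: "ln 3 \<le> \<xi>" unfolding \<xi>_def using n by simp
      then have \<xi>: "1 < \<xi>" using l3 by simp
      have L3: "ln (ln 3) \<le> ln \<xi>" using \<xi>3 l3 by simp
      then have L: "0 < ln \<xi>" using ll3 by linarith
      have JM: "J \<subseteq> {- M..M}" using J(2) spM unfolding Tc by (fastforce simp: abs_le_iff)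
      \<comment> \<open>For smaller n the length condition would force \<open>J\<close> to be longer
        than the interval [-M, M] that contains it.\<close>
      have n0: "n0 \<le> n"
      proof (rule ccontr)
        assume "\<not> n0 \<le> n"
        then have "\<xi> \<le> ln (real n0 + 3)" unfolding \<xi>_def using npos by simp
        then have "ln (ln 3) / ln (real n0 + 3) \<le> ln \<xi> / \<xi>" using L3 ll3 \<xi> by (intro frac_le) auto
        then have "ln (real n0 + 3) / ln (ln 3) * (ln (ln 3) / ln (real n0 + 3)) 
            \<le> ln (real n0 + 3) / ln (ln 3) * (ln \<xi> / \<xi>)" using n03 by (rule mult_left_mono)
        moreover have "0 < ln (real n0 + 3)" by simp
        then have "ln (real n0 + 3) / ln (ln 3) * (ln (ln 3) / ln (real n0 + 3)) = 1" using ll3 by simp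
        ultimately have "(2 * M + 1) * 1 \<le> (2 * M + 1) * (ln (real n0 + 3) / ln (ln 3) * (ln \<xi> / \<xi>))"
          using M0 by (intro mult_left_mono) auto
        then have "2 * M + 1 \<le> (2 * M + 1) * (ln (real n0 + 3) / ln (ln 3)) * (ln \<xi> / \<xi>)"
          by (simp only: mult.assoc mult_1_right)
        also have "\<dots> \<le> C * (ln \<xi> / \<xi>)" using C(3) L \<xi> by (intro mult_right_mono) auto
        also have "\<dots> \<le> measure lborel J" using len by (simp add: \<xi>_def)
        also have "\<dots> \<le> 2 * M"
        proof (cases "J \<in> sets lborel")
          case True
          have "measure lborel J \<le> measure lborel {- M..M}" by (rule measure_mono_fmeasurable[OF JM True], intro fmeasurableI) (auto simp: emeasure_lborel_Icc_eq)
          then show ?thesis using M0 by simp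
        next
          case False
          then show ?thesis using M0 by (simp add: measure_notin_sets)
        qed
        finally show False by simp
      qed
      define w where "w = A * (ln \<xi> / \<xi>)"
      have w: "0 < w" using A L \<xi> by (simp add: w_def)
      have "4 * w = 4 * A * (ln \<xi> / \<xi>)" by (simp add: w_def)
      also have "\<dots> \<le> C * (ln \<xi> / \<xi>)" using C(2) L \<xi> by (intro mult_right_mono) auto
      also have "\<dots> \<le> measure lborel J" using len by (simp add: \<xi>_def)
      finally have w4: "4 * w \<le> measure lborel J" .
      obtain t where t: "\<And>s. \<bar>s - t\<bar> \<le> w \<Longrightarrow> s \<in> J" using interval_middle[OF J(1) JM w w4] by blast
      have tJ: "t \<in> adj_spectrum cover - (\<Union>x\<in>F. ball x c1)" using t[of t] w J(2) unfolding Tc II_def by auto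
      obtain e l where sd: "spectral_data Gn e l" using spectral_data_exists[OF Hs(2,5) Gn.sym] by blast
      \<comment> \<open>The eigenvalues in \<open>J\<close>; their number is the dimension of the
        space in which the random vector lives.\<close>
      define S where "S = {j. j < card (pverts Gn) \<and> l j \<in> J}"
      have "\<kappa> * (n / ln n) \<le> card {j. j < card (pverts Gn) \<and> \<bar>l j - t\<bar> \<le> A * (ln (ln (real n)) / ln (real n))}"
        using cnt[rule_format, OF n0 tJ n lift sd tv] .
      also have "\<dots> \<le> card S" using t unfolding S_def w_def \<xi>_def by (intro of_nat_mono card_mono) auto
      finally have N: "\<kappa> * (n / ln n) \<le> card S" .
      have "0 < ln (real n)" using \<xi> unfolding \<xi>_def by linarith
      then have "0 < \<kappa> * (n / ln n)" using \<kappa> npos by (intro mult_pos_pos divide_pos_pos) auto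
      then have S0: "0 < card S" using N by linarith
      obtain b where b: "is_orthonormal_basis (pverts Gn) (eigen_span Gn J) (card S) b"
        using eigen_span_basis[OF Hs(2,5) Gn.sym sd, of J] unfolding S_def by blast
      have "b 0 \<in> eigen_span Gn J" "(\<Sum>x\<in>pverts Gn. b 0 x * b 0 x) = 1"
        using b S0 by (auto simp: is_orthonormal_basis_def)
      moreover have "\<exists>x\<in>pverts Gn. b 0 x \<noteq> 0"
      proof (rule ccontr)
        assume "\<not> (\<exists>x\<in>pverts Gn. b 0 x \<noteq> 0)"
        then have "(\<Sum>x\<in>pverts Gn. b 0 x * b 0 x) = 0" by simp
        then show False using calculation(2) by simp
      qed
      ultimately have 1: "\<exists>u\<in>eigen_span Gn J. \<exists>x\<in>pverts Gn. u x \<noteq> 0" by blast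
      define s where "s = \<Lambda> * C' * (ln (real n))\<^sup>2 * real n powr (- 1 / 2)"
      have s0: "0 \<le> s" using \<Lambda> C1 by (simp add: s_def)
      note tail = sphere_tail[OF Hs(2,4) b S0 s0, folded random_eigenvector_def]
      interpret P: prob_space "random_eigenvector Gn J" by (rule tail(1))
      have "measure (random_eigenvector Gn J) {u \<in> space (random_eigenvector Gn J). s \<le> sup_norm (pverts Gn) u}
         \<le> \<Lambda> powr (- (ln (real n) / (2 * ln (ln (real n)))))"
      proof (cases "1 \<le> \<Lambda>")
        case True
        have "real (card (pverts Gn)) = v * n" by (simp add: Hs(3) v_def)
        then show ?thesis
          using order.trans[OF tail(2)] tail_estimate[OF n True \<kappa> v N C' s_def] by (simp add: mult.assoc)
      next
        \<comment> \<open>For \<Lambda> < 1 the right-hand side is at least 1, and any probability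
          satisfies the bound.\<close>
        case False
        have "1 \<le> \<Lambda> powr (- (\<xi> / (2 * ln \<xi>)))"
        proof -
          have "\<xi> / (2 * ln \<xi>) * ln \<Lambda> \<le> 0" using \<Lambda> False L \<xi> by (intro mult_nonneg_nonpos) auto
          then show ?thesis using \<Lambda> by (simp add: powr_def)
        qed
        then show ?thesis unfolding \<xi>_def by (rule order.trans[OF P.prob_le_1])
      qed
      then show ?thesis using 1 unfolding s_def by blast
    qed
    have "0 < C'" using C1 by simp
    show ?thesis
      unfolding Let_def
      by (rule exI[of _ C], rule conjI[OF C(1)], rule exI[of _ C'], rule conjI[OF \<open>0 < C'\<close>])
        (intro allI impI, elim conjE, rule main)
  qed
  have part2: "\<exists>\<J>. finite \<J> \<and> (\<forall>J\<in>\<J>. open J \<and> is_interval J) \<and> II c1 c2 = \<Union>\<J>" for c1 c2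
    using F(1) by (intro exI[of _ "(\<lambda>x. ball x c1) ` F"]) (auto simp: II_def is_interval_ball_real)
  have part3: "\<exists>\<delta>>0. \<exists>K>0. \<forall>c1 c2. 0 < c1 \<and> c1 \<le> c2 \<and> c1 < \<delta> \<and> K < c2 \<longrightarrow> II c1 c2 \<subseteq> (\<Union>x\<in>F. ball x \<epsilon>)"
    if "0 < \<epsilon>" for \<epsilon> :: real
    using that by (intro exI[of _ \<epsilon>] conjI exI[of _ "1::real"]) (auto simp: II_def)
  have part4: "\<exists>\<delta>>0. \<exists>K>0. \<forall>c1 c2. 0 < c1 \<and> c1 \<le> c2 \<and> c1 < \<delta> \<and> K < c2 \<longrightarrow> adj_spectrum T - II c1 c2 \<noteq> {}"
  proof -
    obtain t where t: "t \<in> adj_spectrum cover" "t \<notin> F" using spectrum_infinite[OF F(1)] by blast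
    \<comment> \<open>The distance from a spectral point outside \<open>F\<close> to
      \<open>F\<close>, capped at 1 so that the minimum is over a nonempty set.\<close>
    define \<delta> where "\<delta> = Min (insert 1 ((\<lambda>x. dist x t) ` F))"
    have "0 < \<delta>" unfolding \<delta>_def using F(1) t(2) by (subst Min_gr_iff) auto
    moreover have "t \<notin> II c1 c2" if "c1 < \<delta>" for c1 c2
    proof
      assume "t \<in> II c1 c2"
      then obtain x where x: "x \<in> F" "dist x t < c1" by (auto simp: II_def)
      have "\<delta> \<le> dist x t" unfolding \<delta>_def using F(1) x(1) by (intro Min_le) auto
      then show False using x(2) that by simp
    qed
    ultimately show ?thesis using t(1) unfolding Tc by (intro exI[of _ \<delta>] conjI exI[of _ "1::real"]) auto
  qed
  show ?thesis
    by (rule exI[of _ II], rule conjI, (intro allI impI, elim conjE, rule part1, assumption)[1],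
        rule conjI, (intro allI impI, rule part2)[1],
        rule conjI, rule exI[of _ F], rule conjI[OF F(1)], (intro allI impI, rule part3, assumption)[1], rule part4)
qed

end
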